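(* Let $k$ be a field and $H$ a numerical semigroup. Let $R$ be the numerical semigroup ring $k[[H]]$, that is, the subring $k[[t^h\mid h\in H]]$ of $S=k[[t]]$. Then $$\mathsf{D}^{\mathrm{b}}(\operatorname{mod} R)=\langle S\oplus k\rangle_{2\left\lceil\frac{c(H)}{e(R)}\right\rceil+2}$$ holds. Hence $$\dim\mathsf{D}^{\mathrm{b}}(\operatorname{mod} R)\le2\left\lceil\frac{c(H)}{e(R)}\right\rceil+1 .$$
   Context: A numerical semigroup is a subsemigroup $H$ of the additive semigroup $\mathbb{N}=\{0,1,2,\dots\}$ containing $0$ such that $\mathbb{N}\setminus H$ is finite. Its conductor is $c(H)=\max\{i\in\mathbb{N}\mid i-1\notin H\}$. For a commutative Noetherian local ring $R$ of Krull dimension $d$ with maximal ideal $\mathfrak{m}$, $e(R)=\lim_{n\to\infty}\frac{d!}{n^d}\ell_R(R/\mathfrak{m}^{n+1})$ is the multiplicity ($\ell_R$ denotes length). $\lceil\alpha\rceil=\min\{n\in\mathbb{Z}\mid n\ge\alpha\}$. $k$ is viewed as an $R$-module as the residue field of $R$. $\mathsf{D}^{\mathrm{b}}(\operatorname{mod} R)$ is the bounded derived category of finitely generated $R$-modules. Let $\mathcal{T}$ be a triangulated category with shift $\Sigma$, and $\mathcal{X},\mathcal{Y}$ (full, isomorphism-closed) subcategories. $\mathcal{X}*\mathcal{Y}$ is the subcategory of objects $M$ admitting an exact triangle $X\to M\to Y\to\Sigma X$ with $X\in\mathcal{X}$, $Y\in\mathcal{Y}$. $\langle\mathcal{X}\rangle$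 is the smallest subcategory of $\mathcal{T}$ containing $\mathcal{X}$ and closed under finite direct sums, direct summands and shifts. Set $\langle\mathcal{X}\rangle_0=\{0\}$, $\langle\mathcal{X}\rangle_1=\langle\mathcal{X}\rangle$ and $\langle\mathcal{X}\rangle_n=\langle\langle\mathcal{X}\rangle*\langle\mathcal{X}\rangle_{n-1}\rangle$ for $n\ge2$. For an object $G$, $\langle G\rangle_n$ means $\langle\{G\}\rangle_n$. The dimension $\dim\mathcal{T}$ of a triangulated category is the infimum of the integers $d$ such that $\mathcal{T}=\langle M\rangle_{d+1}$ for some object $M\in\mathcal{T}$. *)

theory Defs
  imports
    "HOL-Computational_Algebra.Formal_Power_Series"
    "HOL-Algebra.QuotRing"
    "HOL-Algebra.Ideal_Product"
    "HOL-Algebra.Module"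
    "HOL-Library.Extended_Real"
    "HOL-Library.Extended_Nat"
begin

unbundle fps_syntax

section \<open>Numerical semigroups and their rings\<close>

definition numerical_semigroup :: "nat set \<Rightarrow> bool" where
  "numerical_semigroup H \<longleftrightarrow>
     0 \<in> H \<and> (\<forall>a\<in>H. \<forall>b\<in>H. a + b \<in> H) \<and> finite (UNIV - H)"

text \<open>The predecessor is taken in the integers, so that 0 always belongs to the set below
  and the conductor of the semigroup of all natural numbers is 0.\<close>

definition conductor :: "nat set \<Rightarrow> nat" where
  "conductor H = Max {i. int i - 1 \<notin> int ` H}"

text \<open>For a numerical semigroup, the series in the powers \<open>t\<^sup>h\<close> with \<open>h \<in> H\<close> are exactly the
  power series supported in \<open>H\<close>.\<close>

definition semigroup_ring :: "nat set \<Rightarrow> 'k::field fps ring" where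
  "semigroup_ring H =
     \<lparr>carrier = {f. \<forall>n. f $ n \<noteq> 0 \<longrightarrow> n \<in> H}, mult = (*), one = 1, zero = 0, add = (+)\<rparr>"


section \<open>Multiplicity of a local ring\<close>

definition module_length :: "('r, 'a) ring_scheme \<Rightarrow> ('r, 'b) module \<Rightarrow> enat" where
  "module_length R M =
     Sup {enat n | n. \<exists>N. (\<forall>i\<le>n. submodule (N i) R M) \<and> (\<forall>i<n. N i \<subset> N (Suc i))}"

definition krull_dim :: "('r, 'a) ring_scheme \<Rightarrow> enat" where
  "krull_dim R =
     Sup {enat n | n. \<exists>P. (\<forall>i\<le>n. primeideal (P i) R) \<and> (\<forall>i<n. P i \<subset> P (Suc i))}"

definition local_ideal :: "('r, 'a) ring_scheme \<Rightarrow> 'r set" where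
  "local_ideal R = (THE m. maximalideal m R)"

primrec ideal_power :: "('r, 'a) ring_scheme \<Rightarrow> 'r set \<Rightarrow> nat \<Rightarrow> 'r set" where
  "ideal_power R I 0 = carrier R"
| "ideal_power R I (Suc n) = ideal_prod R I (ideal_power R I n)"

definition quotient_module :: "('r, 'a) ring_scheme \<Rightarrow> 'r set \<Rightarrow> ('r, 'r set) module" where
  "quotient_module R I =
     \<lparr>carrier = carrier (R Quot I), mult = mult (R Quot I), one = one (R Quot I),
      zero = zero (R Quot I), add = add (R Quot I),
      smult = (\<lambda>r A. (I +>\<^bsub>R\<^esub> r) \<otimes>\<^bsub>R Quot I\<^esub> A)\<rparr>"

definition ring_multiplicity :: "('r, 'a) ring_scheme \<Rightarrow> real" where
  "ring_multiplicity R =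
     (let d = the_enat (krull_dim R) in
      lim (\<lambda>n. fact d / real n ^ d *
        real (the_enat (module_length R (quotient_module R (ideal_power R (local_ideal R) (n + 1)))))))"


section \<open>Generation and dimension in triangulated categories\<close>

text \<open>The data of a triangulated category: objects, morphism sets, identities, composition
  (\<open>Cmp T g f\<close> is \<open>g\<close> after \<open>f\<close>), the shift on objects and on morphisms, and the exact triangles
  \<open>X \<rightarrow> Y \<rightarrow> Z \<rightarrow> \<Sigma>X\<close>, listed as \<open>(X, Y, Z, u, v, w)\<close>.  Full subcategories are sets of objects.\<close>

record ('o, 'm) tricat =
  Ob :: "'o set"
  Hom :: "'o \<Rightarrow> 'o \<Rightarrow> 'm set"
  Idm :: "'o \<Rightarrow> 'm"
  Cmp :: "'m \<Rightarrow> 'm \<Rightarrow> 'm"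
  Sh :: "'o \<Rightarrow> 'o"
  Shm :: "'m \<Rightarrow> 'm"
  Tri :: "('o \<times> 'o \<times> 'o \<times> 'm \<times> 'm \<times> 'm) set"

definition iso_mor :: "('o, 'm) tricat \<Rightarrow> 'o \<Rightarrow> 'o \<Rightarrow> 'm \<Rightarrow> bool" where
  "iso_mor T X Y f \<longleftrightarrow>
     f \<in> Hom T X Y \<and> (\<exists>g\<in>Hom T Y X. Cmp T g f = Idm T X \<and> Cmp T f g = Idm T Y)"

definition isomorphic_obj :: "('o, 'm) tricat \<Rightarrow> 'o \<Rightarrow> 'o \<Rightarrow> bool" where
  "isomorphic_obj T X Y \<longleftrightarrow> (\<exists>f. iso_mor T X Y f)"

definition zero_obj :: "('o, 'm) tricat \<Rightarrow> 'o \<Rightarrow> bool" where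
  "zero_obj T X \<longleftrightarrow>
     X \<in> Ob T \<and> (\<forall>Y\<in>Ob T. (\<exists>!f. f \<in> Hom T X Y) \<and> (\<exists>!f. f \<in> Hom T Y X))"

text \<open>Direct sums are coproducts; in an additive category these are the biproducts.\<close>

definition direct_sum_obj :: "('o, 'm) tricat \<Rightarrow> 'o \<Rightarrow> 'o \<Rightarrow> 'o \<Rightarrow> bool" where
  "direct_sum_obj T X Y P \<longleftrightarrow>
     X \<in> Ob T \<and> Y \<in> Ob T \<and> P \<in> Ob T \<and>
     (\<exists>i\<in>Hom T X P. \<exists>j\<in>Hom T Y P.
        \<forall>Z\<in>Ob T. \<forall>f\<in>Hom T X Z. \<forall>g\<in>Hom T Y Z.
          \<exists>!h. h \<in> Hom T P Z \<and> Cmp T h i = f \<and> Cmp T h j = g)"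

text \<open>The rule \<open>unshift\<close> provides, up to isomorphism, the negative shifts.\<close>

inductive_set generated :: "('o, 'm) tricat \<Rightarrow> 'o set \<Rightarrow> 'o set"
  for T :: "('o, 'm) tricat" and \<X> :: "'o set" where
  base: "X \<in> \<X> \<Longrightarrow> X \<in> Ob T \<Longrightarrow> X \<in> generated T \<X>"
| iso: "X \<in> generated T \<X> \<Longrightarrow> Y \<in> Ob T \<Longrightarrow> isomorphic_obj T X Y \<Longrightarrow> Y \<in> generated T \<X>"
| zero: "zero_obj T X \<Longrightarrow> X \<in> generated T \<X>"
| sum: "X \<in> generated T \<X> \<Longrightarrow> Y \<in> generated T \<X> \<Longrightarrow> direct_sum_obj T X Y P \<Longrightarrow>
    P \<in> generated T \<X>"
| summand: "P \<in> generated T \<X> \<Longrightarrow> direct_sum_obj T X Y P \<Longrightarrow> X \<in> generated T \<X>"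
| shift: "X \<in> generated T \<X> \<Longrightarrow> Sh T X \<in> generated T \<X>"
| unshift: "X \<in> Ob T \<Longrightarrow> Sh T X \<in> generated T \<X> \<Longrightarrow> X \<in> generated T \<X>"

definition star :: "('o, 'm) tricat \<Rightarrow> 'o set \<Rightarrow> 'o set \<Rightarrow> 'o set" where
  "star T \<X> \<Y> = {M. \<exists>X\<in>\<X>. \<exists>Y\<in>\<Y>. \<exists>u v w. (X, M, Y, u, v, w) \<in> Tri T}"

fun level :: "('o, 'm) tricat \<Rightarrow> 'o set \<Rightarrow> nat \<Rightarrow> 'o set" where
  "level T \<X> 0 = {X. zero_obj T X}"
| "level T \<X> (Suc 0) = generated T \<X>"
| "level T \<X> (Suc (Suc n)) = generated T (star T (generated T \<X>) (level T \<X> (Suc n)))"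

text \<open>The zero category has dimension -1; the infimum of the empty set is infinite.\<close>

definition tri_dim :: "('o, 'm) tricat \<Rightarrow> ereal" where
  "tri_dim T =
     Inf {ereal (real_of_int d) | d. d \<ge> -1 \<and> (\<exists>M\<in>Ob T. Ob T = level T {M} (nat (d + 1)))}"


section \<open>Modules\<close>

definition fg_module :: "('r, 'a) ring_scheme \<Rightarrow> ('r, 'u) module \<Rightarrow> bool" where
  "fg_module R M \<longleftrightarrow> module R M \<and>
     (\<exists>A. finite A \<and> A \<subseteq> carrier M \<and> (\<forall>N. submodule N R M \<and> A \<subseteq> N \<longrightarrow> N = carrier M))"

definition mod_hom ::
  "('r, 'a) ring_scheme \<Rightarrow> ('r, 'u) module \<Rightarrow> ('r, 'v) module \<Rightarrow> ('u \<Rightarrow> 'v) set" where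
  "mod_hom R M N = {f. f \<in> carrier M \<rightarrow> carrier N \<and>
     (\<forall>x\<in>carrier M. \<forall>y\<in>carrier M. f (x \<oplus>\<^bsub>M\<^esub> y) = f x \<oplus>\<^bsub>N\<^esub> f y) \<and>
     (\<forall>r\<in>carrier R. \<forall>x\<in>carrier M. f (r \<odot>\<^bsub>M\<^esub> x) = r \<odot>\<^bsub>N\<^esub> f x)}"

text \<open>All modules over a subring \<open>R\<close> of \<open>k[[t]]\<close> are taken with carrier a subset of
  \<open>k[[t]]\<close>, used merely as a set that is large enough: a finitely generated \<open>R\<close>-module has at most
  as many elements as \<open>k[[t]]\<close>, and so is isomorphic to one of these (see
  \<open>fg_module_representable\<close> below).  The operations of such a module are arbitrary.
  The fields \<open>mult\<close> and \<open>one\<close> of a module record carry no information.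

  Direct sums of such modules are formed with the bijection \<open>(f, g) \<mapsto> f(t\<^sup>2) + t g(t\<^sup>2)\<close> as
  pairing.\<close>

definition fps_pair :: "'k::zero fps \<Rightarrow> 'k fps \<Rightarrow> 'k fps" where
  "fps_pair f g = Abs_fps (\<lambda>n. if even n then f $ (n div 2) else g $ (n div 2))"

definition fps_fst :: "'k::zero fps \<Rightarrow> 'k fps" where
  "fps_fst f = Abs_fps (\<lambda>n. f $ (2 * n))"

definition fps_snd :: "'k::zero fps \<Rightarrow> 'k fps" where
  "fps_snd f = Abs_fps (\<lambda>n. f $ (2 * n + 1))"

definition mod_sum ::
  "('r, 'k::zero fps) module \<Rightarrow> ('r, 'k fps) module \<Rightarrow> ('r, 'k fps) module" where
  "mod_sum M N =
     \<lparr>carrier = {fps_pair x y | x y. x \<in> carrier M \<and> y \<in> carrier N},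
      mult = (\<lambda>_ _. undefined), one = undefined,
      zero = fps_pair \<zero>\<^bsub>M\<^esub> \<zero>\<^bsub>N\<^esub>,
      add = (\<lambda>a b. fps_pair (fps_fst a \<oplus>\<^bsub>M\<^esub> fps_fst b) (fps_snd a \<oplus>\<^bsub>N\<^esub> fps_snd b)),
      smult = (\<lambda>r a. fps_pair (r \<odot>\<^bsub>M\<^esub> fps_fst a) (r \<odot>\<^bsub>N\<^esub> fps_snd a))\<rparr>"

definition zero_mod :: "('r, 'k::zero fps) module" where
  "zero_mod = \<lparr>carrier = {0}, mult = (\<lambda>_ _. undefined), one = undefined,
      zero = 0, add = (\<lambda>_ _. 0), smult = (\<lambda>_ _. 0)\<rparr>"

definition S_mod :: "('k::field fps, 'k fps) module" where
  "S_mod = \<lparr>carrier = UNIV, mult = (*), one = 1, zero = 0, add = (+), smult = (*)\<rparr>"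

text \<open>The residue field \<open>k\<close>, realised as the set of constant series: the residue class of \<open>r\<close> is
  determined by the constant coefficient of \<open>r\<close>.\<close>

definition k_mod :: "('k::field fps, 'k fps) module" where
  "k_mod = \<lparr>carrier = range fps_const, mult = (*), one = 1, zero = 0, add = (+),
      smult = (\<lambda>r a. fps_const (r $ 0) * a)\<rparr>"


section \<open>Bounded complexes\<close>

record ('r, 'u) cpx =
  cobj :: "int \<Rightarrow> ('r, 'u) module"
  cdif :: "int \<Rightarrow> 'u \<Rightarrow> 'u"

definition bcpx :: "('r, 'a) ring_scheme \<Rightarrow> ('r, 'u) cpx \<Rightarrow> bool" where
  "bcpx R X \<longleftrightarrow>
     (\<forall>n. fg_module R (cobj X n)) \<and>
     (\<forall>n. cdif X n \<in> mod_hom R (cobj X n) (cobj X (n + 1))) \<and>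
     (\<forall>n. \<forall>x\<in>carrier (cobj X n). cdif X (n + 1) (cdif X n x) = \<zero>\<^bsub>cobj X (n + 1 + 1)\<^esub>) \<and>
     (\<exists>b. \<forall>n. b < \<bar>n\<bar> \<longrightarrow> carrier (cobj X n) = {\<zero>\<^bsub>cobj X n\<^esub>})"

definition chain_map ::
  "('r, 'a) ring_scheme \<Rightarrow> ('r, 'u) cpx \<Rightarrow> ('r, 'u) cpx \<Rightarrow> (int \<Rightarrow> 'u \<Rightarrow> 'u) \<Rightarrow> bool" where
  "chain_map R X Y f \<longleftrightarrow>
     (\<forall>n. f n \<in> mod_hom R (cobj X n) (cobj Y n)) \<and>
     (\<forall>n. \<forall>x\<in>carrier (cobj X n). f (n + 1) (cdif X n x) = cdif Y n (f n x))"

definition cmp :: "(int \<Rightarrow> 'v \<Rightarrow> 'w) \<Rightarrow> (int \<Rightarrow> 'u \<Rightarrow> 'v) \<Rightarrow> int \<Rightarrow> 'u \<Rightarrow> 'w" where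
  "cmp g f = (\<lambda>n. g n \<circ> f n)"

definition homotopic :: "('r, 'a) ring_scheme \<Rightarrow> ('r, 'u) cpx \<Rightarrow> ('r, 'u) cpx \<Rightarrow>
    (int \<Rightarrow> 'u \<Rightarrow> 'u) \<Rightarrow> (int \<Rightarrow> 'u \<Rightarrow> 'u) \<Rightarrow> bool" where
  "homotopic R X Y f g \<longleftrightarrow>
     (\<exists>h. (\<forall>n. h n \<in> mod_hom R (cobj X n) (cobj Y (n - 1))) \<and>
          (\<forall>n. \<forall>x\<in>carrier (cobj X n).
             f n x = g n x \<oplus>\<^bsub>cobj Y n\<^esub>
               (cdif Y (n - 1) (h n x) \<oplus>\<^bsub>cobj Y n\<^esub> h (n + 1) (cdif X n x))))"

definition cocycles :: "('r, 'u) cpx \<Rightarrow> int \<Rightarrow> 'u set" where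
  "cocycles X n = {x \<in> carrier (cobj X n). cdif X n x = \<zero>\<^bsub>cobj X (n + 1)\<^esub>}"

definition coboundaries :: "('r, 'u) cpx \<Rightarrow> int \<Rightarrow> 'u set" where
  "coboundaries X n = cdif X (n - 1) ` carrier (cobj X (n - 1))"

definition cohom_class :: "('r, 'u) cpx \<Rightarrow> int \<Rightarrow> 'u \<Rightarrow> 'u set" where
  "cohom_class X n z = coboundaries X n +>\<^bsub>cobj X n\<^esub> z"

definition cohomology :: "('r, 'u) cpx \<Rightarrow> int \<Rightarrow> 'u set set" where
  "cohomology X n = cohom_class X n ` cocycles X n"

definition cohom_map :: "('r, 'u) cpx \<Rightarrow> (int \<Rightarrow> 'u \<Rightarrow> 'u) \<Rightarrow> int \<Rightarrow> 'u set \<Rightarrow> 'u set" where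
  "cohom_map Y f n c = (\<Union>z\<in>c. cohom_class Y n (f n z))"

definition quasi_iso ::
  "('r, 'a) ring_scheme \<Rightarrow> ('r, 'u) cpx \<Rightarrow> ('r, 'u) cpx \<Rightarrow> (int \<Rightarrow> 'u \<Rightarrow> 'u) \<Rightarrow> bool" where
  "quasi_iso R X Y f \<longleftrightarrow> chain_map R X Y f \<and>
     (\<forall>n. bij_betw (cohom_map Y f n) (cohomology X n) (cohomology Y n))"

definition cshift :: "('r, 'u) cpx \<Rightarrow> ('r, 'u) cpx" where
  "cshift X = \<lparr>cobj = (\<lambda>n. cobj X (n + 1)),
     cdif = (\<lambda>n x. \<ominus>\<^bsub>cobj X (n + 1 + 1)\<^esub> cdif X (n + 1) x)\<rparr>"

definition cone :: "('r, 'k::zero fps) cpx \<Rightarrow> ('r, 'k fps) cpx \<Rightarrow> (int \<Rightarrow> 'k fps \<Rightarrow> 'k fps) \<Rightarrow>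
    ('r, 'k fps) cpx" where
  "cone X Y f = \<lparr>cobj = (\<lambda>n. mod_sum (cobj X (n + 1)) (cobj Y n)),
     cdif = (\<lambda>n a. fps_pair
        (\<ominus>\<^bsub>cobj X (n + 1 + 1)\<^esub> cdif X (n + 1) (fps_fst a))
        (f (n + 1) (fps_fst a) \<oplus>\<^bsub>cobj Y (n + 1)\<^esub> cdif Y n (fps_snd a)))\<rparr>"

definition cone_inc :: "('r, 'k::zero fps) cpx \<Rightarrow> int \<Rightarrow> 'k fps \<Rightarrow> 'k fps" where
  "cone_inc X n y = fps_pair \<zero>\<^bsub>cobj X (n + 1)\<^esub> y"

definition cone_prj :: "int \<Rightarrow> 'k::zero fps \<Rightarrow> 'k fps" where
  "cone_prj n a = fps_fst a"

definition stalk :: "('r, 'k::zero fps) module \<Rightarrow> ('r, 'k fps) cpx" where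
  "stalk M = \<lparr>cobj = (\<lambda>n. if n = 0 then M else zero_mod),
     cdif = (\<lambda>n x. if n = -1 then \<zero>\<^bsub>M\<^esub> else 0)\<rparr>"


section \<open>The bounded derived category\<close>

text \<open>The localisation of the homotopy category of bounded complexes at the quasi-isomorphisms,
  by calculus of fractions: a morphism \<open>X \<rightarrow> Y\<close> is an equivalence class of roofs
  \<open>X \<leftarrow> W \<rightarrow> Y\<close> whose left leg is a quasi-isomorphism.\<close>

record ('r, 'u) roof =
  rsrc :: "('r, 'u) cpx"
  rtgt :: "('r, 'u) cpx"
  rapex :: "('r, 'u) cpx"
  rleft :: "int \<Rightarrow> 'u \<Rightarrow> 'u"
  rright :: "int \<Rightarrow> 'u \<Rightarrow> 'u"

definition is_roof :: "('r, 'a) ring_scheme \<Rightarrow> ('r, 'u) roof \<Rightarrow> bool" where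
  "is_roof R \<rho> \<longleftrightarrow> bcpx R (rsrc \<rho>) \<and> bcpx R (rtgt \<rho>) \<and> bcpx R (rapex \<rho>) \<and>
     quasi_iso R (rapex \<rho>) (rsrc \<rho>) (rleft \<rho>) \<and> chain_map R (rapex \<rho>) (rtgt \<rho>) (rright \<rho>)"

definition roof_eq :: "('r, 'a) ring_scheme \<Rightarrow> ('r, 'u) roof \<Rightarrow> ('r, 'u) roof \<Rightarrow> bool" where
  "roof_eq R \<rho> \<sigma> \<longleftrightarrow> is_roof R \<rho> \<and> is_roof R \<sigma> \<and> rsrc \<rho> = rsrc \<sigma> \<and> rtgt \<rho> = rtgt \<sigma> \<and>
     (\<exists>W u v. bcpx R W \<and> chain_map R W (rapex \<rho>) u \<and> chain_map R W (rapex \<sigma>) v \<and>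
        quasi_iso R W (rsrc \<rho>) (cmp (rleft \<rho>) u) \<and>
        homotopic R W (rsrc \<rho>) (cmp (rleft \<rho>) u) (cmp (rleft \<sigma>) v) \<and>
        homotopic R W (rtgt \<rho>) (cmp (rright \<rho>) u) (cmp (rright \<sigma>) v))"

definition roof_class :: "('r, 'a) ring_scheme \<Rightarrow> ('r, 'u) roof \<Rightarrow> ('r, 'u) roof set" where
  "roof_class R \<rho> = {\<sigma>. roof_eq R \<rho> \<sigma>}"

definition dhom :: "('r, 'a) ring_scheme \<Rightarrow> ('r, 'u) cpx \<Rightarrow> ('r, 'u) cpx \<Rightarrow>
    ('r, 'u) roof set set" where
  "dhom R X Y = {roof_class R \<rho> | \<rho>. is_roof R \<rho> \<and> rsrc \<rho> = X \<and> rtgt \<rho> = Y}"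

definition dmor :: "('r, 'a) ring_scheme \<Rightarrow> ('r, 'u) cpx \<Rightarrow> ('r, 'u) cpx \<Rightarrow>
    (int \<Rightarrow> 'u \<Rightarrow> 'u) \<Rightarrow> ('r, 'u) roof set" where
  "dmor R X Y f =
     roof_class R \<lparr>rsrc = X, rtgt = Y, rapex = X, rleft = (\<lambda>_ x. x), rright = f\<rparr>"

text \<open>The composite of \<open>X \<leftarrow> V \<rightarrow> Y\<close> and \<open>Y \<leftarrow> V' \<rightarrow> Z\<close> is \<open>X \<leftarrow> V \<leftarrow> W \<rightarrow> V' \<rightarrow> Z\<close> for any
  completion \<open>V \<leftarrow> W \<rightarrow> V'\<close> to a square commuting up to homotopy, with \<open>W \<rightarrow> V\<close> a
  quasi-isomorphism.\<close>

definition dcomp :: "('r, 'a) ring_scheme \<Rightarrow> ('r, 'u) roof set \<Rightarrow> ('r, 'u) roof set \<Rightarrow>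
    ('r, 'u) roof set" where
  "dcomp R \<psi> \<phi> = {\<tau>. \<exists>\<rho>\<in>\<phi>. \<exists>\<sigma>\<in>\<psi>. \<exists>W u h. rtgt \<rho> = rsrc \<sigma> \<and> bcpx R W \<and>
     quasi_iso R W (rapex \<rho>) u \<and> chain_map R W (rapex \<sigma>) h \<and>
     homotopic R W (rtgt \<rho>) (cmp (rright \<rho>) u) (cmp (rleft \<sigma>) h) \<and>
     roof_eq R \<lparr>rsrc = rsrc \<rho>, rtgt = rtgt \<sigma>, rapex = W,
       rleft = cmp (rleft \<rho>) u, rright = cmp (rright \<sigma>) h\<rparr> \<tau>}"

definition roof_shift :: "('r, 'u) roof \<Rightarrow> ('r, 'u) roof" where
  "roof_shift \<rho> = \<lparr>rsrc = cshift (rsrc \<rho>), rtgt = cshift (rtgt \<rho>), rapex = cshift (rapex \<rho>),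
     rleft = (\<lambda>n. rleft \<rho> (n + 1)), rright = (\<lambda>n. rright \<rho> (n + 1))\<rparr>"

definition dshift :: "('r, 'a) ring_scheme \<Rightarrow> ('r, 'u) roof set \<Rightarrow> ('r, 'u) roof set" where
  "dshift R \<phi> = (\<Union>\<rho>\<in>\<phi>. roof_class R (roof_shift \<rho>))"

definition Db_cat :: "('r, 'a) ring_scheme \<Rightarrow> (('r, 'u) cpx, ('r, 'u) roof set) tricat" where
  "Db_cat R = \<lparr>Ob = {X. bcpx R X}, Hom = dhom R, Idm = (\<lambda>X. dmor R X X (\<lambda>_ x. x)),
     Cmp = dcomp R, Sh = cshift, Shm = dshift R, Tri = {}\<rparr>"

text \<open>The exact triangles are those isomorphic to the triangle \<open>A \<rightarrow> B \<rightarrow> cone f \<rightarrow> A[1]\<close> of a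
  chain map \<open>f\<close>.  This does not involve the field \<open>Tri\<close> of \<^term>\<open>Db_cat R\<close>, which is left empty
  there and filled in afterwards.\<close>

definition Db_triangles :: "'k::field fps ring \<Rightarrow>
    (('k fps, 'k fps) cpx \<times> ('k fps, 'k fps) cpx \<times> ('k fps, 'k fps) cpx \<times>
     ('k fps, 'k fps) roof set \<times> ('k fps, 'k fps) roof set \<times> ('k fps, 'k fps) roof set) set" where
  "Db_triangles R = {(X, Y, Z, u, v, w).
     bcpx R X \<and> bcpx R Y \<and> bcpx R Z \<and>
     u \<in> dhom R X Y \<and> v \<in> dhom R Y Z \<and> w \<in> dhom R Z (cshift X) \<and>
     (\<exists>A B f a b c. bcpx R A \<and> bcpx R B \<and> chain_map R A B f \<and>
        iso_mor (Db_cat R) X A a \<and> iso_mor (Db_cat R) Y B b \<and>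
        iso_mor (Db_cat R) Z (cone A B f) c \<and>
        dcomp R b u = dcomp R (dmor R A B f) a \<and>
        dcomp R c v = dcomp R (dmor R B (cone A B f) (cone_inc A)) b \<and>
        dcomp R (dshift R a) w = dcomp R (dmor R (cone A B f) (cshift A) cone_prj) c)}"

definition Db :: "'k::field fps ring \<Rightarrow>
    (('k fps, 'k fps) cpx, ('k fps, 'k fps) roof set) tricat" where
  "Db R = (Db_cat R)\<lparr>Tri := Db_triangles R\<rparr>"


section \<open>The modules and complexes are as intended\<close>

lemma fps_fst_pair [simp]: "fps_fst (fps_pair f g) = f"
  by (simp add: fps_fst_def fps_pair_def fps_eq_iff)

lemma fps_snd_pair [simp]: "fps_snd (fps_pair f g) = g"
  by (simp add: fps_snd_def fps_pair_def fps_eq_iff)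

lemma fps_pair_eq_iff [simp]: "fps_pair f g = fps_pair f' g' \<longleftrightarrow> f = f' \<and> g = g'"
  by (metis fps_fst_pair fps_snd_pair)

lemma transport_module:
  fixes M :: "('r, 'm) module" and \<phi> :: "'m \<Rightarrow> 'u"
  assumes M: "fg_module R M" and inj: "inj_on \<phi> (carrier M)"
  shows "\<exists>N::('r, 'u) module. fg_module R N \<and> \<phi> \<in> mod_hom R M N \<and>
           bij_betw \<phi> (carrier M) (carrier N)"
proof -
  interpret M: module R M using M by (simp add: fg_module_def)
  define g where "g = the_inv_into (carrier M) \<phi>"
  have g [simp]: "g (\<phi> x) = x" if "x \<in> carrier M" for x
    using the_inv_into_f_f[OF inj that] by (simp add: g_def)
  define N :: "('r, 'u) module" where "N = \<lparr>carrier = \<phi> ` carrier M, mult = (\<lambda>_ _. undefined),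
     one = undefined, zero = \<phi> \<zero>\<^bsub>M\<^esub>, add = (\<lambda>a b. \<phi> (g a \<oplus>\<^bsub>M\<^esub> g b)),
     smult = (\<lambda>r a. \<phi> (r \<odot>\<^bsub>M\<^esub> g a))\<rparr>"
  have ab: "abelian_group N"
  proof (rule abelian_groupI, goal_cases)
    case (6 x)
    then obtain y where "y \<in> carrier M" "x = \<phi> y" by (auto simp: N_def)
    then show ?case
      by (intro bexI[of _ "\<phi> (\<ominus>\<^bsub>M\<^esub> y)"]) (auto simp: N_def M.l_neg)
  qed (auto simp: N_def M.a_ac)
  have mN: "module R N"
    by (rule moduleI)
       (auto simp: N_def ab[unfolded N_def] M.is_cring M.smult_l_distr M.smult_r_distr M.smult_assoc1 
        intro: cring.intro)
  interpret N: module R N by fact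
  obtain A where A: "finite A" "A \<subseteq> carrier M"
    "\<And>K. submodule K R M \<Longrightarrow> A \<subseteq> K \<Longrightarrow> K = carrier M"
    using M unfolding fg_module_def by auto
  have "K = carrier N" if K: "submodule K R N" "\<phi> ` A \<subseteq> K" for K
  proof -
    note E = N.submoduleE[OF K(1)]
    have sub: "submodule {x \<in> carrier M. \<phi> x \<in> K} R M"
    proof (rule M.submoduleI)
      obtain k where k: "k \<in> K" using E(2) by auto
      have "\<zero>\<^bsub>N\<^esub> \<in> K" using E(3)[OF k] E(5)[OF k, of "\<ominus>\<^bsub>N\<^esub> k"] E(1) k
        by (metis N.M.r_neg subsetD)
      then show "\<zero>\<^bsub>M\<^esub> \<in> {x \<in> carrier M. \<phi> x \<in> K}" by (simp add: N_def)
    next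
      fix a assume "a \<in> {x \<in> carrier M. \<phi> x \<in> K}"
      then have a: "a \<in> carrier M" "\<phi> a \<in> K" by auto
      have "(\<ominus>\<^bsub>R\<^esub> \<one>\<^bsub>R\<^esub>) \<odot>\<^bsub>N\<^esub> \<phi> a \<in> K" using E(4)[OF _ a(2)] by simp
      moreover have "(\<ominus>\<^bsub>R\<^esub> \<one>\<^bsub>R\<^esub>) \<odot>\<^bsub>N\<^esub> \<phi> a = \<phi> (\<ominus>\<^bsub>M\<^esub> a)"
        using a(1) by (simp add: N_def M.smult_l_minus)
      ultimately show "\<ominus>\<^bsub>M\<^esub> a \<in> {x \<in> carrier M. \<phi> x \<in> K}" using a by simp
    next
      fix a b assume "a \<in> {x \<in> carrier M. \<phi> x \<in> K}" "b \<in> {x \<in> carrier M. \<phi> x \<in> K}"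
      then show "a \<oplus>\<^bsub>M\<^esub> b \<in> {x \<in> carrier M. \<phi> x \<in> K}"
        using E(5)[of "\<phi> a" "\<phi> b"] by (auto simp: N_def)
    next
      fix r x assume "r \<in> carrier R" "x \<in> {x \<in> carrier M. \<phi> x \<in> K}"
      then show "r \<odot>\<^bsub>M\<^esub> x \<in> {x \<in> carrier M. \<phi> x \<in> K}"
        using E(4)[of r "\<phi> x"] by (auto simp: N_def)
    qed auto
    have "{x \<in> carrier M. \<phi> x \<in> K} = carrier M"
      by (rule A(3)[OF sub]) (use A(2) K(2) in auto)
    then show ?thesis using E(1) by (auto simp: N_def)
  qed
  then have "fg_module R N"
    unfolding fg_module_def using mN A(1,2)
    by (intro conjI exI[of _ "\<phi> ` A"]) (auto simp: N_def)
  moreover have "\<phi> \<in> mod_hom R M N" by (auto simp: mod_hom_def N_def)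
  moreover have "bij_betw \<phi> (carrier M) (carrier N)" using inj by (simp add: bij_betw_def N_def)
  ultimately show ?thesis by blast
qed

lemma fg_module_representable:
  fixes R :: "'k::zero fps ring" and M :: "('k fps, 'm) module"
  assumes M: "fg_module R M"
  shows "\<exists>(N::('k fps, 'k fps) module) \<phi>. fg_module R N \<and> \<phi> \<in> mod_hom R M N \<and>
           bij_betw \<phi> (carrier M) (carrier N)"
proof -
  interpret M: module R M using M by (simp add: fg_module_def)
  have *: "\<exists>N (g::'m \<Rightarrow> 'k fps). submodule N R M \<and> A \<subseteq> N \<and> inj_on g N"
    if "finite A" "A \<subseteq> carrier M" for A
    using that
  proof (induction A)
    case empty
    have "submodule {\<zero>\<^bsub>M\<^esub>} R M" by (rule M.submoduleI) auto
    then show ?case by (intro exI[of _ "{\<zero>\<^bsub>M\<^esub>}"]) auto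
  next
    case (insert a A)
    then obtain N and g :: "'m \<Rightarrow> 'k fps"
      where N: "submodule N R M" "A \<subseteq> N" "inj_on g N" by auto
    have a: "a \<in> carrier M" using insert by auto
    note E = M.submoduleE[OF N(1)]
    have z: "\<zero>\<^bsub>M\<^esub> \<in> N" using E(2,3,5) E(1) by (metis M.M.r_neg all_not_in_conv subsetD)
    define N' where "N' = {r \<odot>\<^bsub>M\<^esub> a \<oplus>\<^bsub>M\<^esub> y | r y. r \<in> carrier R \<and> y \<in> N}"
    have "submodule N' R M"
    proof (rule M.submoduleI)
      show "N' \<subseteq> carrier M" using E(1) a by (auto simp: N'_def)
      show "\<zero>\<^bsub>M\<^esub> \<in> N'" unfolding N'_def using z a
        by (auto intro!: exI[of _ "\<zero>\<^bsub>R\<^esub>"] exI[of _ "\<zero>\<^bsub>M\<^esub>"])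
    next
      fix x assume "x \<in> N'"
      then obtain r y where ry: "x = r \<odot>\<^bsub>M\<^esub> a \<oplus>\<^bsub>M\<^esub> y" "r \<in> carrier R" "y \<in> N" by (auto simp: N'_def)
      have "\<ominus>\<^bsub>M\<^esub> x = (\<ominus>\<^bsub>R\<^esub> r) \<odot>\<^bsub>M\<^esub> a \<oplus>\<^bsub>M\<^esub> \<ominus>\<^bsub>M\<^esub> y"
        using ry E(1) a by (simp add: M.smult_l_minus M.minus_add subsetD)
      then show "\<ominus>\<^bsub>M\<^esub> x \<in> N'" unfolding N'_def using ry E(3) by blast
    next
      fix x x' assume "x \<in> N'" "x' \<in> N'"
      then obtain r y r' y' where ry: "x = r \<odot>\<^bsub>M\<^esub> a \<oplus>\<^bsub>M\<^esub> y" "r \<in> carrier R" "y \<in> N"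
        "x' = r' \<odot>\<^bsub>M\<^esub> a \<oplus>\<^bsub>M\<^esub> y'" "r' \<in> carrier R" "y' \<in> N" by (auto simp: N'_def)
      have yy: "y \<in> carrier M" "y' \<in> carrier M" using ry E(1) by auto
      have "x \<oplus>\<^bsub>M\<^esub> x' = (r \<oplus>\<^bsub>R\<^esub> r') \<odot>\<^bsub>M\<^esub> a \<oplus>\<^bsub>M\<^esub> (y \<oplus>\<^bsub>M\<^esub> y')"
        using ry yy a by (simp add: M.smult_l_distr M.a_ac)
      then show "x \<oplus>\<^bsub>M\<^esub> x' \<in> N'" unfolding N'_def using ry E(5) by blast
    next
      fix s x assume s: "s \<in> carrier R" and "x \<in> N'"
      then obtain r y where ry: "x = r \<odot>\<^bsub>M\<^esub> a \<oplus>\<^bsub>M\<^esub> y" "r \<in> carrier R" "y \<in> N" by (auto simp: N'_def)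
      have "s \<odot>\<^bsub>M\<^esub> x = (s \<otimes>\<^bsub>R\<^esub> r) \<odot>\<^bsub>M\<^esub> a \<oplus>\<^bsub>M\<^esub> s \<odot>\<^bsub>M\<^esub> y"
        using ry E(1) a s by (simp add: M.smult_r_distr M.smult_assoc1 subsetD)
      then show "s \<odot>\<^bsub>M\<^esub> x \<in> N'" unfolding N'_def using ry E(4)[OF s] s by blast
    qed
    moreover have "insert a A \<subseteq> N'"
    proof -
      have "a \<in> N'" unfolding N'_def using a z
        by (auto intro!: exI[of _ "\<one>\<^bsub>R\<^esub>"] exI[of _ "\<zero>\<^bsub>M\<^esub>"])
      moreover have "x \<in> N'" if "x \<in> N" for x
      proof -
        have "x = \<zero>\<^bsub>R\<^esub> \<odot>\<^bsub>M\<^esub> a \<oplus>\<^bsub>M\<^esub> x" using a that E(1) by auto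
        then show ?thesis unfolding N'_def using that by blast
      qed
      ultimately show ?thesis using N(2) by auto
    qed
    moreover have "\<exists>g'::'m \<Rightarrow> 'k fps. inj_on g' N'"
    proof -
      have "\<forall>x\<in>N'. \<exists>p. fst p \<in> carrier R \<and> snd p \<in> N \<and> x = fst p \<odot>\<^bsub>M\<^esub> a \<oplus>\<^bsub>M\<^esub> snd p"
        unfolding N'_def by fastforce
      then obtain p where p: "\<And>x. x \<in> N' \<Longrightarrow> snd (p x) \<in> N"
        "\<And>x. x \<in> N' \<Longrightarrow> x = fst (p x) \<odot>\<^bsub>M\<^esub> a \<oplus>\<^bsub>M\<^esub> snd (p x)"
        by metis
      have "inj_on (\<lambda>x. fps_pair (fst (p x)) (g (snd (p x)))) N'"
      proof (rule inj_onI)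
        fix x y assume xy: "x \<in> N'" "y \<in> N'"
          and eq: "fps_pair (fst (p x)) (g (snd (p x))) = fps_pair (fst (p y)) (g (snd (p y)))"
        then have "fst (p x) = fst (p y)" "snd (p x) = snd (p y)"
          using p(1) inj_onD[OF N(3)] by auto
        then show "x = y" using p(2)[OF xy(1)] p(2)[OF xy(2)] by simp
      qed
      then show ?thesis by blast
    qed
    ultimately show ?case by blast
  qed
  obtain A where A: "finite A" "A \<subseteq> carrier M"
    "\<And>K. submodule K R M \<Longrightarrow> A \<subseteq> K \<Longrightarrow> K = carrier M"
    using M unfolding fg_module_def by auto
  from *[OF A(1,2)] obtain g :: "'m \<Rightarrow> 'k fps" where "inj_on g (carrier M)" using A(3) by metis
  from transport_module[OF M this] show ?thesis by blast
qed


lemma fg_zero_mod: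
  fixes R :: "('r, 'a) ring_scheme"
  shows "cring R \<Longrightarrow> fg_module R (zero_mod :: ('r, 'b::zero fps) module)"
proof -
  assume R: "cring R"
  have "abelian_group (zero_mod :: ('r, 'b fps) module)"
    by (rule abelian_groupI) (auto simp: zero_mod_def)
  then have m: "module R (zero_mod :: ('r, 'b fps) module)"
    by (intro moduleI R) (auto simp: zero_mod_def)
  have "N = carrier (zero_mod :: ('r, 'b fps) module)"
    if "submodule N R (zero_mod :: ('r, 'b fps) module)" for N
    using module.submoduleE(1,2)[OF m that] by (simp add: zero_mod_def subset_singleton_iff)
  with m show ?thesis unfolding fg_module_def by (intro conjI exI[of _ "{}"]) auto
qed

lemma module_mod_sum:
  assumes "module R M" "module R N"
  shows "module R (mod_sum M N)"
proof -
  interpret M: module R M by fact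
  interpret N: module R N by fact
  have "abelian_group (mod_sum M N)"
  proof (rule abelian_groupI, goal_cases)
    case (6 x)
    then obtain y z where "y \<in> carrier M" "z \<in> carrier N" "x = fps_pair y z"
      by (auto simp: mod_sum_def)
    then show ?case
      by (intro bexI[of _ "fps_pair (\<ominus>\<^bsub>M\<^esub> y) (\<ominus>\<^bsub>N\<^esub> z)"]) (auto simp: mod_sum_def M.l_neg N.l_neg)
  qed (auto simp: mod_sum_def M.a_ac N.a_ac)
  then show ?thesis
    by (intro moduleI M.is_cring)
       (auto simp: mod_sum_def M.smult_l_distr M.smult_r_distr M.smult_assoc1
          N.smult_l_distr N.smult_r_distr N.smult_assoc1)
qed

lemma fg_mod_sum:
  assumes "fg_module R M" "fg_module R N"
  shows "fg_module R (mod_sum M N)"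
proof -
  have mm: "module R M" "module R N" using assms by (auto simp: fg_module_def)
  interpret M: module R M by fact
  interpret N: module R N by fact
  interpret P: module R "mod_sum M N" by (rule module_mod_sum) fact+
  obtain A where A: "finite A" "A \<subseteq> carrier M"
    "\<And>K. submodule K R M \<Longrightarrow> A \<subseteq> K \<Longrightarrow> K = carrier M"
    using assms(1) unfolding fg_module_def by auto
  obtain B where B: "finite B" "B \<subseteq> carrier N"
    "\<And>K. submodule K R N \<Longrightarrow> B \<subseteq> K \<Longrightarrow> K = carrier N"
    using assms(2) unfolding fg_module_def by auto
  define C where "C = (\<lambda>x. fps_pair x \<zero>\<^bsub>N\<^esub>) ` A \<union> fps_pair \<zero>\<^bsub>M\<^esub> ` B"
  have "K = carrier (mod_sum M N)" if K: "submodule K R (mod_sum M N)" "C \<subseteq> K" for K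
  proof -
    note E = P.submoduleE[OF K(1)]
    obtain k where k: "k \<in> K" using E(2) by auto
    have z: "\<zero>\<^bsub>mod_sum M N\<^esub> \<in> K" using E(3)[OF k] E(5)[OF k, of "\<ominus>\<^bsub>mod_sum M N\<^esub> k"] E(1) k
        by (metis P.M.r_neg subsetD)
    have minus: "(\<ominus>\<^bsub>R\<^esub> \<one>\<^bsub>R\<^esub>) \<odot>\<^bsub>mod_sum M N\<^esub> a \<in> K" if "a \<in> K" for a using E(4)[OF _ that] by simp
    have sub1: "submodule {x \<in> carrier M. fps_pair x \<zero>\<^bsub>N\<^esub> \<in> K} R M"
    proof (rule M.submoduleI)
      show "\<zero>\<^bsub>M\<^esub> \<in> {x \<in> carrier M. fps_pair x \<zero>\<^bsub>N\<^esub> \<in> K}" using z by (simp add: mod_sum_def)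
      show "\<ominus>\<^bsub>M\<^esub> a \<in> {x \<in> carrier M. fps_pair x \<zero>\<^bsub>N\<^esub> \<in> K}"
        if "a \<in> {x \<in> carrier M. fps_pair x \<zero>\<^bsub>N\<^esub> \<in> K}" for a
        using that minus[of "fps_pair a \<zero>\<^bsub>N\<^esub>"] by (auto simp: mod_sum_def M.smult_l_minus)
      show "a \<oplus>\<^bsub>M\<^esub> b \<in> {x \<in> carrier M. fps_pair x \<zero>\<^bsub>N\<^esub> \<in> K}"
        if "a \<in> {x \<in> carrier M. fps_pair x \<zero>\<^bsub>N\<^esub> \<in> K}" "b \<in> {x \<in> carrier M. fps_pair x \<zero>\<^bsub>N\<^esub> \<in> K}" for a b
        using that E(5)[of "fps_pair a \<zero>\<^bsub>N\<^esub>" "fps_pair b \<zero>\<^bsub>N\<^esub>"] by (auto simp: mod_sum_def)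
      show "r \<odot>\<^bsub>M\<^esub> x \<in> {x \<in> carrier M. fps_pair x \<zero>\<^bsub>N\<^esub> \<in> K}"
        if "r \<in> carrier R" "x \<in> {x \<in> carrier M. fps_pair x \<zero>\<^bsub>N\<^esub> \<in> K}" for r x
        using that E(4)[of r "fps_pair x \<zero>\<^bsub>N\<^esub>"] by (auto simp: mod_sum_def)
    qed auto
    have sub2: "submodule {x \<in> carrier N. fps_pair \<zero>\<^bsub>M\<^esub> x \<in> K} R N"
    proof (rule N.submoduleI)
      show "\<zero>\<^bsub>N\<^esub> \<in> {x \<in> carrier N. fps_pair \<zero>\<^bsub>M\<^esub> x \<in> K}" using z by (simp add: mod_sum_def)
      show "\<ominus>\<^bsub>N\<^esub> a \<in> {x \<in> carrier N. fps_pair \<zero>\<^bsub>M\<^esub> x \<in> K}"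
        if "a \<in> {x \<in> carrier N. fps_pair \<zero>\<^bsub>M\<^esub> x \<in> K}" for a
        using that minus[of "fps_pair \<zero>\<^bsub>M\<^esub> a"] by (auto simp: mod_sum_def N.smult_l_minus)
      show "a \<oplus>\<^bsub>N\<^esub> b \<in> {x \<in> carrier N. fps_pair \<zero>\<^bsub>M\<^esub> x \<in> K}"
        if "a \<in> {x \<in> carrier N. fps_pair \<zero>\<^bsub>M\<^esub> x \<in> K}" "b \<in> {x \<in> carrier N. fps_pair \<zero>\<^bsub>M\<^esub> x \<in> K}" for a b
        using that E(5)[of "fps_pair \<zero>\<^bsub>M\<^esub> a" "fps_pair \<zero>\<^bsub>M\<^esub> b"] by (auto simp: mod_sum_def)
      show "r \<odot>\<^bsub>N\<^esub> x \<in> {x \<in> carrier N. fps_pair \<zero>\<^bsub>M\<^esub> x \<in> K}"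
        if "r \<in> carrier R" "x \<in> {x \<in> carrier N. fps_pair \<zero>\<^bsub>M\<^esub> x \<in> K}" for r x
        using that E(4)[of r "fps_pair \<zero>\<^bsub>M\<^esub> x"] by (auto simp: mod_sum_def)
    qed auto
    have 1: "{x \<in> carrier M. fps_pair x \<zero>\<^bsub>N\<^esub> \<in> K} = carrier M"
      by (rule A(3)[OF sub1]) (use A(2) K(2) in \<open>auto simp: C_def\<close>)
    have 2: "{x \<in> carrier N. fps_pair \<zero>\<^bsub>M\<^esub> x \<in> K} = carrier N"
      by (rule B(3)[OF sub2]) (use B(2) K(2) in \<open>auto simp: C_def\<close>)
    have "fps_pair x y \<in> K" if "x \<in> carrier M" "y \<in> carrier N" for x y
    proof -
      have "fps_pair x \<zero>\<^bsub>N\<^esub> \<oplus>\<^bsub>mod_sum M N\<^esub> fps_pair \<zero>\<^bsub>M\<^esub> y \<in> K" using that 1 2 by (intro E(5)) auto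
      then show ?thesis using that by (simp add: mod_sum_def)
    qed
    then have "carrier (mod_sum M N) \<subseteq> K" by (auto simp: mod_sum_def)
    then show ?thesis using E(1) by auto
  qed
  moreover have "C \<subseteq> carrier (mod_sum M N)" using A(2) B(2) by (auto simp: C_def mod_sum_def)
  moreover have "finite C" using A(1) B(1) by (simp add: C_def)
  ultimately show ?thesis unfolding fg_module_def using P.module_axioms by blast
qed

lemma mod_hom_zero:
  assumes "module R M" "module R N" "f \<in> mod_hom R M N"
  shows "f \<zero>\<^bsub>M\<^esub> = \<zero>\<^bsub>N\<^esub>"
proof -
  interpret M: module R M by fact
  interpret N: module R N by fact
  have "f (\<zero>\<^bsub>R\<^esub> \<odot>\<^bsub>M\<^esub> \<zero>\<^bsub>M\<^esub>) = \<zero>\<^bsub>R\<^esub> \<odot>\<^bsub>N\<^esub> f \<zero>\<^bsub>M\<^esub>"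
    using assms(3) unfolding mod_hom_def by blast
  moreover have "f \<zero>\<^bsub>M\<^esub> \<in> carrier N" using assms(3) by (auto simp: mod_hom_def)
  ultimately show ?thesis by simp
qed

lemma bcpx_stalk:
  assumes "fg_module R M"
  shows "bcpx R (stalk M)"
proof -
  interpret M: module R M using assms by (simp add: fg_module_def)
  show ?thesis
    unfolding bcpx_def using fg_zero_mod[OF M.is_cring] assms
    by (auto simp: stalk_def mod_hom_def zero_mod_def)
qed

lemma bcpx_cone:
  assumes X: "bcpx R X" and Y: "bcpx R Y" and f: "chain_map R X Y f"
  shows "bcpx R (cone X Y f)"
proof -
  have mX: "module R (cobj X n)" and mY: "module R (cobj Y n)" for n
    using X Y by (auto simp: bcpx_def fg_module_def)
  interpret X: module R "cobj X n" for n by (rule mX)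
  interpret Y: module R "cobj Y n" for n by (rule mY)
  have dX: "cdif X n x \<in> carrier (cobj X (n + 1))" if "x \<in> carrier (cobj X n)" for n x
    using X that by (auto simp: bcpx_def mod_hom_def)
  have dY: "cdif Y n x \<in> carrier (cobj Y (n + 1))" if "x \<in> carrier (cobj Y n)" for n x
    using Y that by (auto simp: bcpx_def mod_hom_def)
  have ff: "f n x \<in> carrier (cobj Y n)" if "x \<in> carrier (cobj X n)" for n x
    using f that by (auto simp: chain_map_def mod_hom_def)
  have dX2: "cdif X (n+1) x \<in> carrier (cobj X (2 + n))" if "x \<in> carrier (cobj X (n + 1))" for n x
    using dX[OF that] by simp
  have addX: "cdif X n (x \<oplus>\<^bsub>cobj X n\<^esub> y) = cdif X n x \<oplus>\<^bsub>cobj X (n+1)\<^esub> cdif X n y"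
    if "x \<in> carrier (cobj X n)" "y \<in> carrier (cobj X n)" for n x y
    using X that by (auto simp: bcpx_def mod_hom_def)
  have addY: "cdif Y n (x \<oplus>\<^bsub>cobj Y n\<^esub> y) = cdif Y n x \<oplus>\<^bsub>cobj Y (n+1)\<^esub> cdif Y n y"
    if "x \<in> carrier (cobj Y n)" "y \<in> carrier (cobj Y n)" for n x y
    using Y that by (auto simp: bcpx_def mod_hom_def)
  have addf: "f n (x \<oplus>\<^bsub>cobj X n\<^esub> y) = f n x \<oplus>\<^bsub>cobj Y n\<^esub> f n y"
    if "x \<in> carrier (cobj X n)" "y \<in> carrier (cobj X n)" for n x y
    using f that by (auto simp: chain_map_def mod_hom_def)
  have smX: "cdif X n (r \<odot>\<^bsub>cobj X n\<^esub> x) = r \<odot>\<^bsub>cobj X (n+1)\<^esub> cdif X n x"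
    if "x \<in> carrier (cobj X n)" "r \<in> carrier R" for n x r
    using X that by (auto simp: bcpx_def mod_hom_def)
  have smY: "cdif Y n (r \<odot>\<^bsub>cobj Y n\<^esub> x) = r \<odot>\<^bsub>cobj Y (n+1)\<^esub> cdif Y n x"
    if "x \<in> carrier (cobj Y n)" "r \<in> carrier R" for n x r
    using Y that by (auto simp: bcpx_def mod_hom_def)
  have smf: "f n (r \<odot>\<^bsub>cobj X n\<^esub> x) = r \<odot>\<^bsub>cobj Y n\<^esub> f n x"
    if "x \<in> carrier (cobj X n)" "r \<in> carrier R" for n x r
    using f that by (auto simp: chain_map_def mod_hom_def)
  have ddX: "cdif X (n+1) (cdif X n x) = \<zero>\<^bsub>cobj X (n+1+1)\<^esub>" if "x \<in> carrier (cobj X n)" for n x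
    using X that by (auto simp: bcpx_def)
  have ddY: "cdif Y (n+1) (cdif Y n x) = \<zero>\<^bsub>cobj Y (n+1+1)\<^esub>" if "x \<in> carrier (cobj Y n)" for n x
    using Y that by (auto simp: bcpx_def)
  have cm: "f (n+1) (cdif X n x) = cdif Y n (f n x)" if "x \<in> carrier (cobj X n)" for n x
    using f that by (auto simp: chain_map_def)
  have minX: "\<ominus>\<^bsub>cobj X n\<^esub> x = (\<ominus>\<^bsub>R\<^esub> \<one>\<^bsub>R\<^esub>) \<odot>\<^bsub>cobj X n\<^esub> x" if "x \<in> carrier (cobj X n)" for n x
    using that by (simp add: X.smult_l_minus)
  have minY: "\<ominus>\<^bsub>cobj Y n\<^esub> x = (\<ominus>\<^bsub>R\<^esub> \<one>\<^bsub>R\<^esub>) \<odot>\<^bsub>cobj Y n\<^esub> x" if "x \<in> carrier (cobj Y n)" for n x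
    using that by (simp add: Y.smult_l_minus)
  have hom: "cdif (cone X Y f) n \<in> mod_hom R (cobj (cone X Y f) n) (cobj (cone X Y f) (n+1))" for n
    unfolding mod_hom_def
  proof (intro CollectI conjI ballI)
    show "cdif (cone X Y f) n \<in> carrier (cobj (cone X Y f) n) \<rightarrow> carrier (cobj (cone X Y f) (n+1))"
      by (auto simp: cone_def mod_sum_def dX dX2 dY ff)
  next
    fix a b assume "a \<in> carrier (cobj (cone X Y f) n)" "b \<in> carrier (cobj (cone X Y f) n)"
    then show "cdif (cone X Y f) n (a \<oplus>\<^bsub>cobj (cone X Y f) n\<^esub> b) =
      cdif (cone X Y f) n a \<oplus>\<^bsub>cobj (cone X Y f) (n+1)\<^esub> cdif (cone X Y f) n b"
      by (auto simp: cone_def mod_sum_def dX dX2 dY ff addX addY addf X.minus_add Y.a_ac)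
  next
    fix r a assume "r \<in> carrier R" "a \<in> carrier (cobj (cone X Y f) n)"
    then show "cdif (cone X Y f) n (r \<odot>\<^bsub>cobj (cone X Y f) n\<^esub> a) =
      r \<odot>\<^bsub>cobj (cone X Y f) (n+1)\<^esub> cdif (cone X Y f) n a"
      by (auto simp: cone_def mod_sum_def dX dX2 dY ff smX smY smf Y.smult_r_distr X.smult_r_minus)
  qed
  have dd: "cdif (cone X Y f) (n+1) (cdif (cone X Y f) n a) = \<zero>\<^bsub>cobj (cone X Y f) (n+1+1)\<^esub>"
    if a: "a \<in> carrier (cobj (cone X Y f) n)" for n a
  proof -
    obtain x y where xy: "x \<in> carrier (cobj X (n+1))" "y \<in> carrier (cobj Y n)" "a = fps_pair x y"
      using a by (auto simp: cone_def mod_sum_def)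
    have 1: "cdif X (m + 1) (\<ominus>\<^bsub>cobj X (m + 1)\<^esub> cdif X m x) = \<zero>\<^bsub>cobj X (m + 1 + 1)\<^esub>"
      if "x \<in> carrier (cobj X m)" for m
      by (subst minX[OF dX[OF that]], subst smX[OF dX[OF that]], simp, subst ddX[OF that], simp)
    have 2: "f (m + 1) (\<ominus>\<^bsub>cobj X (m + 1)\<^esub> cdif X m x) =
        \<ominus>\<^bsub>cobj Y (m + 1)\<^esub> cdif Y m (f m x)"
      if "x \<in> carrier (cobj X m)" for m
      by (subst minX[OF dX[OF that]], subst smf[OF dX[OF that]], simp, subst cm[OF that],
          subst minY[OF dY[OF ff[OF that]]], simp)
    have 3: "cdif Y (n + 1) (f (n + 1) x \<oplus>\<^bsub>cobj Y (n + 1)\<^esub> cdif Y n y) = cdif Y (n + 1) (f (n + 1) x)"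
      by (subst addY[OF ff[OF xy(1)] dY[OF xy(2)]], subst ddY[OF xy(2)])
         (rule Y.r_zero, rule dY, rule ff, rule xy(1))
    have 4: "\<ominus>\<^bsub>cobj Y (n + 1 + 1)\<^esub> cdif Y (n + 1) (f (n + 1) x) \<oplus>\<^bsub>cobj Y (n + 1 + 1)\<^esub>
        cdif Y (n + 1) (f (n + 1) x) = \<zero>\<^bsub>cobj Y (n + 1 + 1)\<^esub>"
      by (rule Y.l_neg, rule dY, rule ff, rule xy(1))
    have 5: "\<ominus>\<^bsub>cobj X (n + 1 + 1 + 1)\<^esub> \<zero>\<^bsub>cobj X (n + 1 + 1 + 1)\<^esub> = \<zero>\<^bsub>cobj X (n + 1 + 1 + 1)\<^esub>"
      by simp
    show ?thesis
      unfolding xy(3) cone_def mod_sum_def cpx.simps ring.simps module.simps partial_object.simps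
        fps_fst_pair fps_snd_pair 1[OF xy(1)] 2[OF xy(1)] 3 4 5 ..
  qed
  obtain b where b: "\<And>n. b < \<bar>n\<bar> \<Longrightarrow> carrier (cobj X n) = {\<zero>\<^bsub>cobj X n\<^esub>}"
    using X by (auto simp: bcpx_def)
  obtain c where c: "\<And>n. c < \<bar>n\<bar> \<Longrightarrow> carrier (cobj Y n) = {\<zero>\<^bsub>cobj Y n\<^esub>}"
    using Y by (auto simp: bcpx_def)
  have bd: "carrier (cobj (cone X Y f) n) = {\<zero>\<^bsub>cobj (cone X Y f) n\<^esub>}" if "max (b+1) c < \<bar>n\<bar>" for n
    using b[of "n+1"] c[of n] that by (auto simp: cone_def mod_sum_def)
  have fg: "fg_module R (cobj (cone X Y f) n)" for n
    using X Y by (auto simp: cone_def bcpx_def fg_mod_sum)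
  show ?thesis unfolding bcpx_def using hom dd bd fg by blast
qed

lemma cring_semigroup_ring:
  assumes H: "numerical_semigroup H"
  shows "cring (semigroup_ring H)"
proof -
  have mult: "n \<in> H"
    if "(f * g) $ n \<noteq> 0" "\<forall>n. f $ n \<noteq> 0 \<longrightarrow> n \<in> H" "\<forall>n. g $ n \<noteq> 0 \<longrightarrow> n \<in> H"
    for f g :: "'a fps" and n
  proof -
    from that(1) obtain i where "i \<le> n" "f $ i * g $ (n - i) \<noteq> 0"
      unfolding fps_mult_nth by (meson atLeastAtMost_iff sum.not_neutral_contains_not_neutral)
    then have "i \<in> H" "n - i \<in> H" "n = i + (n - i)" using that by auto
    then show ?thesis using H unfolding numerical_semigroup_def by metis
  qed
  have add: "n \<in> H"
    if "f $ n + g $ n \<noteq> 0" "\<forall>n. f $ n \<noteq> 0 \<longrightarrow> n \<in> H" "\<forall>n. g $ n \<noteq> 0 \<longrightarrow> n \<in> H"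
    for f g :: "'a fps" and n
    using that by (metis add.right_neutral)
  have z: "0 \<in> H" using H by (simp add: numerical_semigroup_def)
  show ?thesis
  proof (rule cringI)
    show "abelian_group (semigroup_ring H :: 'a fps ring)"
    proof (rule abelian_groupI, goal_cases)
      case (6 x)
      then show ?case by (intro bexI[of _ "- x"]) (auto simp: semigroup_ring_def)
    qed (auto simp: semigroup_ring_def algebra_simps intro: add)
    show "comm_monoid (semigroup_ring H :: 'a fps ring)"
    proof (rule comm_monoidI)
      show "x \<otimes>\<^bsub>semigroup_ring H\<^esub> y \<in> carrier (semigroup_ring H)"
        if "x \<in> carrier (semigroup_ring H)" "y \<in> carrier (semigroup_ring H)" for x y :: "'a fps"
        using that mult[of x y] by (auto simp: semigroup_ring_def)
    qed (use z in \<open>auto simp: semigroup_ring_def algebra_simps\<close>)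
  qed (auto simp: semigroup_ring_def algebra_simps)
qed

lemma fg_k_mod:
  assumes H: "numerical_semigroup H"
  shows "fg_module (semigroup_ring H) k_mod"
proof -
  have ag: "abelian_group (k_mod :: ('a fps, 'a fps) module)"
  proof (rule abelian_groupI, goal_cases)
    case (6 x)
    then obtain c where "x = fps_const c" by (auto simp: k_mod_def)
    then show ?case by (intro bexI[of _ "fps_const (- c)"]) (auto simp: k_mod_def)
  qed (auto simp: k_mod_def algebra_simps simp flip: fps_const_0_eq_0)
  interpret M: module "semigroup_ring H" "k_mod :: ('a fps, 'a fps) module"
    by (intro moduleI cring_semigroup_ring H ag)
       (auto simp: k_mod_def semigroup_ring_def algebra_simps)
  have "K = carrier k_mod" if K: "submodule K (semigroup_ring H) k_mod" "{1} \<subseteq> K"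
    for K :: "'a fps set"
  proof -
    note E = M.submoduleE[OF K(1)]
    have "fps_const c \<in> K" for c
    proof -
      have "fps_const c \<in> carrier (semigroup_ring H)"
        using H by (auto simp: semigroup_ring_def numerical_semigroup_def)
      from E(4)[OF this, of 1] K(2) show ?thesis by (simp add: k_mod_def)
    qed
    then show ?thesis using E(1) by (auto simp: k_mod_def)
  qed
  moreover have "1 \<in> carrier (k_mod :: ('a fps, 'a fps) module)"
    by (auto simp: k_mod_def image_iff intro!: exI[of _ 1])
  ultimately show ?thesis unfolding fg_module_def using M.module_axioms
    by (intro conjI exI[of _ "{1}"]) auto
qed

lemma fg_S_mod:
  assumes H: "numerical_semigroup H"
  shows "fg_module (semigroup_ring H) S_mod"
proof -
  have ag: "abelian_group (S_mod :: ('a fps, 'a fps) module)"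
  proof (rule abelian_groupI, goal_cases)
    case (6 x)
    then show ?case by (intro bexI[of _ "- x"]) (auto simp: S_mod_def)
  qed (auto simp: S_mod_def)
  interpret M: module "semigroup_ring H" "S_mod :: ('a fps, 'a fps) module"
    by (intro moduleI cring_semigroup_ring H ag)
       (auto simp: S_mod_def semigroup_ring_def algebra_simps)
  obtain c where c: "\<And>n. n \<ge> c \<Longrightarrow> n \<in> H"
  proof -
    have "finite (UNIV - H)" using H by (simp add: numerical_semigroup_def)
    then obtain m where "\<forall>n\<in>UNIV - H. n < m" using finite_nat_set_iff_bounded by auto
    then show ?thesis using that[of m] by (metis DiffI UNIV_I leD)
  qed
  define A where "A = insert 1 ((\<lambda>i. fps_X ^ i) ` {..<c} :: 'a fps set)"
  have "K = carrier S_mod" if K: "submodule K (semigroup_ring H) S_mod" "A \<subseteq> K"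
    for K :: "'a fps set"
  proof -
    note E = M.submoduleE[OF K(1)]
    have sm: "r * x \<in> K" if "r \<in> carrier (semigroup_ring H)" "x \<in> K" for r x
      using E(4)[OF that] by (simp add: S_mod_def)
    have ad: "x + y \<in> K" if "x \<in> K" "y \<in> K" for x y
      using E(5)[OF that] by (simp add: S_mod_def)
    have 1: "(\<Sum>i<m. fps_const (f $ i) * fps_X ^ i) \<in> K" if "m \<le> c" for f m
      using that
    proof (induction m)
      case 0
      have "0 \<in> carrier (semigroup_ring H :: 'a fps ring)" by (simp add: semigroup_ring_def)
      from sm[OF this, of 1] show ?case using K(2) by (simp add: A_def)
    next
      case (Suc m)
      have "fps_const (f $ m) \<in> carrier (semigroup_ring H)"
        using H by (auto simp: semigroup_ring_def numerical_semigroup_def)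
      from sm[OF this, of "fps_X ^ m"] have "fps_const (f $ m) * fps_X ^ m \<in> K"
        using K(2) Suc.prems by (simp add: A_def image_subset_iff)
      with Suc show ?case by (simp add: ad)
    qed
    have "f \<in> K" for f
    proof -
      define g where "g = Abs_fps (\<lambda>n. if n < c then 0 else f $ n)"
      have "g \<in> carrier (semigroup_ring H)"
        using c by (auto simp: semigroup_ring_def g_def not_less split: if_splits)
      from sm[OF this, of 1] have "g \<in> K" using K(2) by (simp add: A_def)
      with 1 have "(\<Sum>i<c. fps_const (f $ i) * fps_X ^ i) + g \<in> K" by (intro ad) auto
      moreover have "f = (\<Sum>i<c. fps_const (f $ i) * fps_X ^ i) + g"
        by (rule fps_ext) (auto simp: g_def fps_sum_nth if_distrib cong: if_cong)
      ultimately show ?thesis by (rule ssubst[rotated])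
    qed
    then show ?thesis by (auto simp: S_mod_def)
  qed
  moreover have "finite A" "A \<subseteq> carrier S_mod" by (auto simp: A_def S_mod_def)
  ultimately show ?thesis unfolding fg_module_def using M.module_axioms by blast
qed

lemma generator_in_Db:
  assumes "numerical_semigroup H"
  shows "stalk (mod_sum S_mod k_mod) \<in> Ob (Db (semigroup_ring H))"
  by (simp add: Db_def Db_cat_def bcpx_stalk fg_mod_sum fg_S_mod fg_k_mod assms)

end

theory Submission
  imports Defs
begin

text \<open>
  Let \<open>e\<close> be the least positive element of \<open>H\<close> and \<open>N = \<lceil>c/e\<rceil>\<close>. Orders of power series squeeze the
  length of \<open>R/m\<^sup>n\<close> between \<open>ne - c\<close> and \<open>ne + c\<close>, so the multiplicity of \<open>R\<close> is \<open>e\<close>.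

  A bounded complex \<open>X\<close> is covered by a contractible complex \<open>P\<close> of finite free modules; the kernel
  \<open>K\<close> is \<open>X\<close> up to a shift. Each \<open>K\<^sup>n\<close> lies in a free \<open>S\<close>-module to which the differential extends
  \<open>S\<close>-linearly. Let \<open>L\<^sub>j\<close> consist of the \<open>x\<close> in \<open>K\<close> such that \<open>s x\<close> is in \<open>K\<close> for all \<open>s\<close> in \<open>S\<close> of
  order at least \<open>je\<close>. Then \<open>L\<^sub>0\<close> is \<open>S\<close>-stable, hence degreewise free over \<open>S\<close>, the maximal ideal
  of \<open>R\<close> maps \<open>L\<^sub>j\<^sub>+\<^sub>1\<close> into \<open>L\<^sub>j\<close>, and \<open>L\<^sub>N = K\<close> because \<open>Ne \<ge> c\<close>. Inserting \<open>d\<close>-preimages refines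
  \<open>0 \<subseteq> L\<^sub>0 \<subseteq> \<dots> \<subseteq> L\<^sub>N\<close> to a filtration in \<open>2(N + 1)\<close> steps whose subquotients have zero differential
  and are sums of shifts of \<open>S\<close> or of \<open>k\<close>.
\<close>

text \<open>The modules of \<open>X\<close> may have torsion and then embed in no free
  \<open>S\<close>-module. Passing to \<open>K\<close> cures this at the price of a shift, which
  costs no level because the cover is contractible. The differential of the cover has entries 0 and
  1 only, so it makes sense over \<open>S\<close>; scalars from \<open>S\<close> then commute with
  \<open>d\<close>, and every \<open>L_j\<close> is a subcomplex.

  Each subquotient has to be absorbed by a single cone, hence to be a sum of shifted modules, hence
  to have zero differential. On \<open>L_j / L_(j-1)\<close> the differential need not vanish;
  splitting at the elements with \<open>d x\<close> in \<open>L_(j-1)\<close> makes it vanish on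
  both halves, as \<open>d d = 0\<close>. This is the factor 2. For \<open>j = 0\<close> the upper
  half is isomorphic to \<open>d (L_0)\<close>, which lies in a free module over the discrete
  valuation ring \<open>S\<close> and so is free. For \<open>j > 0\<close> the maximal ideal kills
  both halves, and they are finite dimensional over \<open>k\<close> because \<open>S\<close> is a
  Noetherian \<open>R\<close>-module.

  Morphisms in \<open>Db\<close> are classes of roofs, so isomorphisms, triangles and coproducts
  rest on Ore squares and on the cancellation of quasi-isomorphisms.\<close>

lemma carrier_mod_sum [simp]:
  "fps_pair x y \<in> carrier (mod_sum M N) \<longleftrightarrow> x \<in> carrier M \<and> y \<in> carrier N"
  by (auto simp: mod_sum_def)

lemma ball_mod_sum [simp]:
  "(\<forall>a\<in>carrier (mod_sum M N). P a) \<longleftrightarrow> (\<forall>x\<in>carrier M. \<forall>y\<in>carrier N. P (fps_pair x y))"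
  by (auto simp: mod_sum_def)

lemma mod_sum_cases:
  assumes "a \<in> carrier (mod_sum M N)"
  obtains x y where "x \<in> carrier M" "y \<in> carrier N" "a = fps_pair x y"
  using assms by (auto simp: mod_sum_def)

lemma fst_in_carrier [simp]: "a \<in> carrier (mod_sum M N) \<Longrightarrow> fps_fst a \<in> carrier M"
  by (auto simp: mod_sum_def)

lemma snd_in_carrier [simp]: "a \<in> carrier (mod_sum M N) \<Longrightarrow> fps_snd a \<in> carrier N"
  by (auto simp: mod_sum_def)

lemma add_mod_sum [simp]:
  "a \<oplus>\<^bsub>mod_sum M N\<^esub> b = fps_pair (fps_fst a \<oplus>\<^bsub>M\<^esub> fps_fst b) (fps_snd a \<oplus>\<^bsub>N\<^esub> fps_snd b)"
  by (simp add: mod_sum_def)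

lemma smult_mod_sum [simp]:
  "r \<odot>\<^bsub>mod_sum M N\<^esub> a = fps_pair (r \<odot>\<^bsub>M\<^esub> fps_fst a) (r \<odot>\<^bsub>N\<^esub> fps_snd a)"
  by (simp add: mod_sum_def)

lemma zero_mod_sum [simp]: "\<zero>\<^bsub>mod_sum M N\<^esub> = fps_pair \<zero>\<^bsub>M\<^esub> \<zero>\<^bsub>N\<^esub>"
  by (simp add: mod_sum_def)

lemma mod_homI:
  assumes "\<And>x. x \<in> carrier M \<Longrightarrow> f x \<in> carrier N"
    and "\<And>x y. x \<in> carrier M \<Longrightarrow> y \<in> carrier M \<Longrightarrow> f (x \<oplus>\<^bsub>M\<^esub> y) = f x \<oplus>\<^bsub>N\<^esub> f y"
    and "\<And>r x. r \<in> carrier R \<Longrightarrow> x \<in> carrier M \<Longrightarrow> f (r \<odot>\<^bsub>M\<^esub> x) = r \<odot>\<^bsub>N\<^esub> f x"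
  shows "f \<in> mod_hom R M N"
  using assms by (auto simp: mod_hom_def)

lemma mod_hom_closed: "f \<in> mod_hom R M N \<Longrightarrow> x \<in> carrier M \<Longrightarrow> f x \<in> carrier N"
  by (auto simp: mod_hom_def)

lemma mod_hom_add: "f \<in> mod_hom R M N \<Longrightarrow> x \<in> carrier M \<Longrightarrow> y \<in> carrier M \<Longrightarrow>
    f (x \<oplus>\<^bsub>M\<^esub> y) = f x \<oplus>\<^bsub>N\<^esub> f y"
  by (auto simp: mod_hom_def)

lemma mod_hom_smult: "f \<in> mod_hom R M N \<Longrightarrow> r \<in> carrier R \<Longrightarrow> x \<in> carrier M \<Longrightarrow>
    f (r \<odot>\<^bsub>M\<^esub> x) = r \<odot>\<^bsub>N\<^esub> f x"
  by (auto simp: mod_hom_def)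

lemma mod_hom_id: "(\<lambda>x. x) \<in> mod_hom R M M"
  by (auto simp: mod_hom_def)

lemma mod_hom_comp: "f \<in> mod_hom R M N \<Longrightarrow> g \<in> mod_hom R N P \<Longrightarrow> (\<lambda>x. g (f x)) \<in> mod_hom R M P"
  by (auto simp: mod_hom_def Pi_def)

lemma mod_hom_inverse:
  assumes "f \<in> mod_hom R M N" "bij_betw f (carrier M) (carrier N)" "module R M"
  shows "the_inv_into (carrier M) f \<in> mod_hom R N M"
proof -
  interpret M: module R M by fact
  note inj = bij_betw_imp_inj_on[OF assms(2)]
  have im: "f ` carrier M = carrier N" using assms(2) by (simp add: bij_betw_def)
  show ?thesis
  proof (rule mod_homI)
    fix x assume "x \<in> carrier N"
    then show "the_inv_into (carrier M) f x \<in> carrier M"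
      using the_inv_into_into[OF inj] im by auto
  next
    fix x y assume "x \<in> carrier N" "y \<in> carrier N"
    then obtain a b where "a \<in> carrier M" "b \<in> carrier M" "x = f a" "y = f b" using im by (metis imageE)
    then show "the_inv_into (carrier M) f (x \<oplus>\<^bsub>N\<^esub> y) =
        the_inv_into (carrier M) f x \<oplus>\<^bsub>M\<^esub> the_inv_into (carrier M) f y"
      by (simp add: the_inv_into_f_f[OF inj] flip: mod_hom_add[OF assms(1)])
  next
    fix r x assume r: "r \<in> carrier R" and "x \<in> carrier N"
    then obtain a where "a \<in> carrier M" "x = f a" using im by auto
    then show "the_inv_into (carrier M) f (r \<odot>\<^bsub>N\<^esub> x) = r \<odot>\<^bsub>M\<^esub> the_inv_into (carrier M) f x"
      using r by (simp add: the_inv_into_f_f[OF inj] flip: mod_hom_smult[OF assms(1)])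
  qed
qed

text \<open>Together with \<open>inj_H\<close> this replaces the bijection of coset sets in
  \<open>quasi_iso\<close> by statements about representatives, so that diagram chases never mention
  cosets.\<close>

definition surj_H :: "('r, 'u) cpx \<Rightarrow> ('r, 'v) cpx \<Rightarrow> (int \<Rightarrow> 'u \<Rightarrow> 'v) \<Rightarrow> bool" where
  "surj_H X Y f \<longleftrightarrow> (\<forall>n. \<forall>y\<in>cocycles Y n. \<exists>x\<in>cocycles X n. \<exists>z\<in>carrier (cobj Y (n - 1)).
     y = f n x \<oplus>\<^bsub>cobj Y n\<^esub> cdif Y (n - 1) z)"

definition inj_H :: "('r, 'u) cpx \<Rightarrow> ('r, 'v) cpx \<Rightarrow> (int \<Rightarrow> 'u \<Rightarrow> 'v) \<Rightarrow> bool" where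
  "inj_H X Y f \<longleftrightarrow> (\<forall>n. \<forall>x\<in>cocycles X n. \<forall>z\<in>carrier (cobj Y (n - 1)).
     f n x = cdif Y (n - 1) z \<longrightarrow> (\<exists>w\<in>carrier (cobj X (n - 1)). x = cdif X (n - 1) w))"

text \<open>The homological part needs of the coefficient ring only that it is commutative, so the
  locale serves for the semigroup ring and for \<open>k[[t]]\<close> itself.\<close>

locale fps_complexes =
  fixes R :: "'k::field fps ring"
  assumes cring_R: "cring R"
begin

section \<open>Arithmetic in modules, differentials and chain maps\<close>

lemma
  fixes M (structure)
  assumes "module R M"
  shows zero_closed [simp]: "\<zero> \<in> carrier M"
    and add_closed [simp]: "x \<in> carrier M \<Longrightarrow> y \<in> carrier M \<Longrightarrow> x \<oplus> y \<in> carrier M"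
    and minus_closed [simp]: "x \<in> carrier M \<Longrightarrow> \<ominus> x \<in> carrier M"
    and smult_closed [simp]: "r \<in> carrier R \<Longrightarrow> x \<in> carrier M \<Longrightarrow> r \<odot> x \<in> carrier M"
    and l_zero [simp]: "x \<in> carrier M \<Longrightarrow> \<zero> \<oplus> x = x"
    and r_zero [simp]: "x \<in> carrier M \<Longrightarrow> x \<oplus> \<zero> = x"
    and minus_zero [simp]: "\<ominus> \<zero> = \<zero>"
    and minus_minus [simp]: "x \<in> carrier M \<Longrightarrow> \<ominus> (\<ominus> x) = x"
    and r_neg [simp]: "x \<in> carrier M \<Longrightarrow> x \<oplus> (\<ominus> x) = \<zero>"
    and l_neg [simp]: "x \<in> carrier M \<Longrightarrow> \<ominus> x \<oplus> x = \<zero>"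
    and r_neg2 [simp]: "x \<in> carrier M \<Longrightarrow> y \<in> carrier M \<Longrightarrow> x \<oplus> (\<ominus> x \<oplus> y) = y"
    and r_neg1 [simp]: "x \<in> carrier M \<Longrightarrow> y \<in> carrier M \<Longrightarrow> \<ominus> x \<oplus> (x \<oplus> y) = y"
    and minus_add: "x \<in> carrier M \<Longrightarrow> y \<in> carrier M \<Longrightarrow> \<ominus> (x \<oplus> y) = \<ominus> x \<oplus> \<ominus> y"
    and a_assoc: "x \<in> carrier M \<Longrightarrow> y \<in> carrier M \<Longrightarrow> z \<in> carrier M \<Longrightarrow>
      (x \<oplus> y) \<oplus> z = x \<oplus> (y \<oplus> z)"
    and a_comm: "x \<in> carrier M \<Longrightarrow> y \<in> carrier M \<Longrightarrow> x \<oplus> y = y \<oplus> x"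
    and a_lcomm: "x \<in> carrier M \<Longrightarrow> y \<in> carrier M \<Longrightarrow> z \<in> carrier M \<Longrightarrow>
      x \<oplus> (y \<oplus> z) = y \<oplus> (x \<oplus> z)"
    and smult_r_distr: "r \<in> carrier R \<Longrightarrow> x \<in> carrier M \<Longrightarrow> y \<in> carrier M \<Longrightarrow>
      r \<odot> (x \<oplus> y) = r \<odot> x \<oplus> r \<odot> y"
    and smult_r_minus: "r \<in> carrier R \<Longrightarrow> x \<in> carrier M \<Longrightarrow> r \<odot> (\<ominus> x) = \<ominus> (r \<odot> x)"
    and smult_r_zero [simp]: "r \<in> carrier R \<Longrightarrow> r \<odot> \<zero> = \<zero>"
    and minus_smult: "x \<in> carrier M \<Longrightarrow> \<ominus> x = (\<ominus>\<^bsub>R\<^esub> \<one>\<^bsub>R\<^esub>) \<odot> x"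
proof -
  interpret M: module R M by fact
  show "\<zero> \<in> carrier M" "\<ominus> \<zero> = \<zero>"
    "x \<in> carrier M \<Longrightarrow> y \<in> carrier M \<Longrightarrow> x \<oplus> y \<in> carrier M"
    "x \<in> carrier M \<Longrightarrow> \<ominus> x \<in> carrier M"
    "x \<in> carrier M \<Longrightarrow> \<ominus> (\<ominus> x) = x"
    "r \<in> carrier R \<Longrightarrow> x \<in> carrier M \<Longrightarrow> r \<odot> x \<in> carrier M"
    "x \<in> carrier M \<Longrightarrow> \<zero> \<oplus> x = x" "x \<in> carrier M \<Longrightarrow> x \<oplus> \<zero> = x"
    "r \<in> carrier R \<Longrightarrow> r \<odot> \<zero> = \<zero>"
    by simp_all
  show "x \<in> carrier M \<Longrightarrow> x \<oplus> (\<ominus> x) = \<zero>" "x \<in> carrier M \<Longrightarrow> \<ominus> x \<oplus> x = \<zero>"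
    by (simp_all add: M.r_neg M.l_neg)
  show "x \<in> carrier M \<Longrightarrow> y \<in> carrier M \<Longrightarrow> x \<oplus> (\<ominus> x \<oplus> y) = y"
    "x \<in> carrier M \<Longrightarrow> y \<in> carrier M \<Longrightarrow> \<ominus> x \<oplus> (x \<oplus> y) = y"
    by (simp_all add: M.r_neg M.l_neg flip: M.a_assoc)
  show "x \<in> carrier M \<Longrightarrow> y \<in> carrier M \<Longrightarrow> \<ominus> (x \<oplus> y) = \<ominus> x \<oplus> \<ominus> y"
    by (rule M.minus_add)
  show "x \<in> carrier M \<Longrightarrow> y \<in> carrier M \<Longrightarrow> z \<in> carrier M \<Longrightarrow>
      (x \<oplus> y) \<oplus> z = x \<oplus> (y \<oplus> z)" by (rule M.a_assoc)
  show "x \<in> carrier M \<Longrightarrow> y \<in> carrier M \<Longrightarrow> x \<oplus> y = y \<oplus> x" by (rule M.a_comm)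
  show "x \<in> carrier M \<Longrightarrow> y \<in> carrier M \<Longrightarrow> z \<in> carrier M \<Longrightarrow>
      x \<oplus> (y \<oplus> z) = y \<oplus> (x \<oplus> z)" by (rule M.a_lcomm)
  show "r \<in> carrier R \<Longrightarrow> x \<in> carrier M \<Longrightarrow> y \<in> carrier M \<Longrightarrow>
      r \<odot> (x \<oplus> y) = r \<odot> x \<oplus> r \<odot> y" by (rule M.smult_r_distr)
  show "r \<in> carrier R \<Longrightarrow> x \<in> carrier M \<Longrightarrow> r \<odot> (\<ominus> x) = \<ominus> (r \<odot> x)"
    by (rule M.smult_r_minus)
  show "x \<in> carrier M \<Longrightarrow> \<ominus> x = (\<ominus>\<^bsub>R\<^esub> \<one>\<^bsub>R\<^esub>) \<odot> x"
    by (simp add: M.smult_l_minus)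
qed

lemmas group_ac = a_assoc a_comm a_lcomm minus_add

text \<open>
  Rewriting with \<open>group_ac\<close> separates an element from its inverse by up to three other summands.
\<close>
lemma group_cancel [simp]:
  fixes M (structure)
  assumes M: "module R M"
  shows "x \<in> carrier M \<Longrightarrow> a \<in> carrier M \<Longrightarrow>
      x \<oplus> (a \<oplus> \<ominus> x) = a"
    and "x \<in> carrier M \<Longrightarrow> a \<in> carrier M \<Longrightarrow>
      \<ominus> x \<oplus> (a \<oplus> x) = a"
    and "x \<in> carrier M \<Longrightarrow> a \<in> carrier M \<Longrightarrow> y \<in> carrier M \<Longrightarrow>
      x \<oplus> (a \<oplus> (\<ominus> x \<oplus> y)) = a \<oplus> y"
    and "x \<in> carrier M \<Longrightarrow> a \<in> carrier M \<Longrightarrow> y \<in> carrier M \<Longrightarrow>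
      \<ominus> x \<oplus> (a \<oplus> (x \<oplus> y)) = a \<oplus> y"
    and "x \<in> carrier M \<Longrightarrow> a \<in> carrier M \<Longrightarrow> b \<in> carrier M \<Longrightarrow>
      x \<oplus> (a \<oplus> (b \<oplus> \<ominus> x)) = a \<oplus> b"
    and "x \<in> carrier M \<Longrightarrow> a \<in> carrier M \<Longrightarrow> b \<in> carrier M \<Longrightarrow>
      \<ominus> x \<oplus> (a \<oplus> (b \<oplus> x)) = a \<oplus> b"
    and "x \<in> carrier M \<Longrightarrow> a \<in> carrier M \<Longrightarrow> b \<in> carrier M \<Longrightarrow> y \<in> carrier M \<Longrightarrow>
      x \<oplus> (a \<oplus> (b \<oplus> (\<ominus> x \<oplus> y))) = a \<oplus> (b \<oplus> y)"
    and "x \<in> carrier M \<Longrightarrow> a \<in> carrier M \<Longrightarrow> b \<in> carrier M \<Longrightarrow> y \<in> carrier M \<Longrightarrow>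
      \<ominus> x \<oplus> (a \<oplus> (b \<oplus> (x \<oplus> y))) = a \<oplus> (b \<oplus> y)"
    and "x \<in> carrier M \<Longrightarrow> a \<in> carrier M \<Longrightarrow> b \<in> carrier M \<Longrightarrow> c \<in> carrier M \<Longrightarrow>
      x \<oplus> (a \<oplus> (b \<oplus> (c \<oplus> \<ominus> x))) = a \<oplus> (b \<oplus> c)"
    and "x \<in> carrier M \<Longrightarrow> a \<in> carrier M \<Longrightarrow> b \<in> carrier M \<Longrightarrow> c \<in> carrier M \<Longrightarrow>
      \<ominus> x \<oplus> (a \<oplus> (b \<oplus> (c \<oplus> x))) = a \<oplus> (b \<oplus> c)"
    and "x \<in> carrier M \<Longrightarrow> a \<in> carrier M \<Longrightarrow> b \<in> carrier M \<Longrightarrow> c \<in> carrier M \<Longrightarrow> y \<in> carrier M \<Longrightarrow>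
      x \<oplus> (a \<oplus> (b \<oplus> (c \<oplus> (\<ominus> x \<oplus> y)))) = a \<oplus> (b \<oplus> (c \<oplus> y))"
    and "x \<in> carrier M \<Longrightarrow> a \<in> carrier M \<Longrightarrow> b \<in> carrier M \<Longrightarrow> c \<in> carrier M \<Longrightarrow> y \<in> carrier M \<Longrightarrow>
      \<ominus> x \<oplus> (a \<oplus> (b \<oplus> (c \<oplus> (x \<oplus> y)))) = a \<oplus> (b \<oplus> (c \<oplus> y))"
  using M by (simp_all add: a_lcomm[OF M, of x a] a_lcomm[OF M, of x b] a_lcomm[OF M, of x c]
    a_lcomm[OF M, of "\<ominus> x" a] a_lcomm[OF M, of "\<ominus> x" b] a_lcomm[OF M, of "\<ominus> x" c])

lemma minus_unique:
  assumes "module R M" "x \<in> carrier M" "y \<in> carrier M" "x \<oplus>\<^bsub>M\<^esub> y = \<zero>\<^bsub>M\<^esub>"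
  shows "y = \<ominus>\<^bsub>M\<^esub> x"
  using r_neg1[OF assms(1-3)] assms by simp

lemma eq_if_diff_zero:
  assumes "module R M" "x \<in> carrier M" "y \<in> carrier M" "x \<oplus>\<^bsub>M\<^esub> \<ominus>\<^bsub>M\<^esub> y = \<zero>\<^bsub>M\<^esub>"
  shows "x = y"
  using r_neg1[of M "\<ominus>\<^bsub>M\<^esub> y" x] assms by (simp add: a_comm)

lemma module_sum [simp]: "module R M \<Longrightarrow> module R N \<Longrightarrow> module R (mod_sum M N)"
  by (rule module_mod_sum)

lemma minus_mod_sum [simp]:
  assumes "module R M" "module R N" "x \<in> carrier M" "y \<in> carrier N"
  shows "\<ominus>\<^bsub>mod_sum M N\<^esub> (fps_pair x y) = fps_pair (\<ominus>\<^bsub>M\<^esub> x) (\<ominus>\<^bsub>N\<^esub> y)"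
  by (rule minus_unique[symmetric]) (use assms in auto)

lemma module_zero_mod [simp]: "module R (zero_mod :: ('k fps, 'k fps) module)"
  using fg_zero_mod[OF cring_R, where 'b = 'k] unfolding fg_module_def by blast

lemma hom_zero: "module R M \<Longrightarrow> module R N \<Longrightarrow> f \<in> mod_hom R M N \<Longrightarrow> f \<zero>\<^bsub>M\<^esub> = \<zero>\<^bsub>N\<^esub>"
  by (rule mod_hom_zero)

lemma hom_minus:
  assumes "module R M" "module R N" "f \<in> mod_hom R M N" "x \<in> carrier M"
  shows "f (\<ominus>\<^bsub>M\<^esub> x) = \<ominus>\<^bsub>N\<^esub> f x"
proof -
  interpret R: cring R by (rule cring_R)
  show ?thesis using assms by (simp add: minus_smult mod_hom_closed mod_hom_smult)
qed

lemma mod_hom_const: "module R N \<Longrightarrow> (\<lambda>_. \<zero>\<^bsub>N\<^esub>) \<in> mod_hom R M N"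
  by (rule mod_homI) auto

lemma mod_hom_plus: "module R N \<Longrightarrow> f \<in> mod_hom R M N \<Longrightarrow> g \<in> mod_hom R M N \<Longrightarrow>
    (\<lambda>x. f x \<oplus>\<^bsub>N\<^esub> g x) \<in> mod_hom R M N"
  by (rule mod_homI) (simp_all add: mod_hom_closed mod_hom_add mod_hom_smult smult_r_distr group_ac)

lemma mod_hom_minus: "module R N \<Longrightarrow> f \<in> mod_hom R M N \<Longrightarrow> (\<lambda>x. \<ominus>\<^bsub>N\<^esub> f x) \<in> mod_hom R M N"
  by (rule mod_homI) (simp_all add: mod_hom_closed mod_hom_add mod_hom_smult smult_r_minus group_ac)

lemma bcpx_module [simp]: "bcpx R X \<Longrightarrow> module R (cobj X n)"
  by (simp add: bcpx_def fg_module_def)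

lemma bcpx_fg: "bcpx R X \<Longrightarrow> fg_module R (cobj X n)"
  by (simp add: bcpx_def)

lemma cdif_hom: "bcpx R X \<Longrightarrow> cdif X n \<in> mod_hom R (cobj X n) (cobj X (n + 1))"
  by (simp add: bcpx_def)

lemma bcpx_bound:
  assumes "bcpx R X"
  obtains b where "\<And>n. b < \<bar>n\<bar> \<Longrightarrow> carrier (cobj X n) = {\<zero>\<^bsub>cobj X n\<^esub>}"
  using assms unfolding bcpx_def by blast

lemma
  assumes X: "bcpx R X"
  shows cdif_closed [simp]: "x \<in> carrier (cobj X n) \<Longrightarrow> m = n + 1 \<Longrightarrow> cdif X n x \<in> carrier (cobj X m)"
    and cdif_add [simp]: "x \<in> carrier (cobj X n) \<Longrightarrow> y \<in> carrier (cobj X n) \<Longrightarrow>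
      cdif X n (x \<oplus>\<^bsub>cobj X n\<^esub> y) = cdif X n x \<oplus>\<^bsub>cobj X (n + 1)\<^esub> cdif X n y"
    and cdif_smult [simp]: "r \<in> carrier R \<Longrightarrow> x \<in> carrier (cobj X n) \<Longrightarrow>
      cdif X n (r \<odot>\<^bsub>cobj X n\<^esub> x) = r \<odot>\<^bsub>cobj X (n + 1)\<^esub> cdif X n x"
    and cdif_zero [simp]: "cdif X n \<zero>\<^bsub>cobj X n\<^esub> = \<zero>\<^bsub>cobj X (n + 1)\<^esub>"
    and cdif_minus [simp]: "x \<in> carrier (cobj X n) \<Longrightarrow>
      cdif X n (\<ominus>\<^bsub>cobj X n\<^esub> x) = \<ominus>\<^bsub>cobj X (n + 1)\<^esub> cdif X n x"
    and cdif_cdif [simp]: "x \<in> carrier (cobj X n) \<Longrightarrow> m = n + 1 \<Longrightarrow>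
      cdif X m (cdif X n x) = \<zero>\<^bsub>cobj X (m + 1)\<^esub>"
  using X mod_hom_closed[OF cdif_hom[OF X]] mod_hom_add[OF cdif_hom[OF X]]
    mod_hom_smult[OF cdif_hom[OF X]] hom_zero[OF _ _ cdif_hom[OF X]] hom_minus[OF _ _ cdif_hom[OF X]]
  by (simp_all add: bcpx_def)

lemma bcpxI:
  assumes "\<And>n. fg_module R (cobj X n)" "\<And>n. cdif X n \<in> mod_hom R (cobj X n) (cobj X (n + 1))"
    "\<And>n x. x \<in> carrier (cobj X n) \<Longrightarrow> cdif X (n + 1) (cdif X n x) = \<zero>\<^bsub>cobj X (n + 1 + 1)\<^esub>"
    "\<And>n. b < \<bar>n\<bar> \<Longrightarrow> carrier (cobj X n) = {\<zero>\<^bsub>cobj X n\<^esub>}"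
  shows "bcpx R X"
  using assms unfolding bcpx_def by blast

lemma chain_map_hom: "chain_map R X Y f \<Longrightarrow> f n \<in> mod_hom R (cobj X n) (cobj Y n)"
  by (simp add: chain_map_def)

lemma chain_map_simps:
  assumes X: "bcpx R X" and Y: "bcpx R Y" and f: "chain_map R X Y f"
  shows "\<And>n x. x \<in> carrier (cobj X n) \<Longrightarrow> f n x \<in> carrier (cobj Y n)"
    and "\<And>n x y. x \<in> carrier (cobj X n) \<Longrightarrow> y \<in> carrier (cobj X n) \<Longrightarrow>
      f n (x \<oplus>\<^bsub>cobj X n\<^esub> y) = f n x \<oplus>\<^bsub>cobj Y n\<^esub> f n y"
    and "\<And>n r x. r \<in> carrier R \<Longrightarrow> x \<in> carrier (cobj X n) \<Longrightarrow>
      f n (r \<odot>\<^bsub>cobj X n\<^esub> x) = r \<odot>\<^bsub>cobj Y n\<^esub> f n x"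
    and "\<And>n. f n \<zero>\<^bsub>cobj X n\<^esub> = \<zero>\<^bsub>cobj Y n\<^esub>"
    and "\<And>n x. x \<in> carrier (cobj X n) \<Longrightarrow> f n (\<ominus>\<^bsub>cobj X n\<^esub> x) = \<ominus>\<^bsub>cobj Y n\<^esub> f n x"
    and "\<And>n m x. x \<in> carrier (cobj X n) \<Longrightarrow> m = n + 1 \<Longrightarrow> f m (cdif X n x) = cdif Y n (f n x)"
  using assms mod_hom_closed[OF chain_map_hom[OF f]] mod_hom_add[OF chain_map_hom[OF f]]
    mod_hom_smult[OF chain_map_hom[OF f]] hom_zero[OF _ _ chain_map_hom[OF f]]
    hom_minus[OF _ _ chain_map_hom[OF f]] by (simp_all add: chain_map_def)

lemma chain_mapI:
  assumes "\<And>n. f n \<in> mod_hom R (cobj X n) (cobj Y n)"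
    and "\<And>n x. x \<in> carrier (cobj X n) \<Longrightarrow> f (n + 1) (cdif X n x) = cdif Y n (f n x)"
  shows "chain_map R X Y f"
  using assms by (simp add: chain_map_def)

lemma chain_map_id: "chain_map R X X (\<lambda>_ x. x)"
  by (simp add: chain_map_def mod_hom_id)

lemma chain_map_cmp:
  assumes "chain_map R X Y f" "chain_map R Y Z g"
  shows "chain_map R X Z (cmp g f)"
proof (rule chain_mapI)
  show "cmp g f n \<in> mod_hom R (cobj X n) (cobj Z n)" for n
    unfolding cmp_def o_def by (rule mod_hom_comp[OF chain_map_hom chain_map_hom]) fact+
  show "cmp g f (n + 1) (cdif X n x) = cdif Z n (cmp g f n x)" if "x \<in> carrier (cobj X n)" for n x
    using assms that mod_hom_closed[OF chain_map_hom[OF assms(1)] that]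
    by (simp add: cmp_def chain_map_def)
qed

lemma cmp_id [simp]: "cmp f (\<lambda>_ x. x) = f" "cmp (\<lambda>_ x. x) f = f"
  by (simp_all add: cmp_def o_def)

lemma cmp_assoc: "cmp (cmp h g) f = cmp h (cmp g f)"
  by (simp add: cmp_def o_assoc)

lemma cmp_apply [simp]: "cmp g f n x = g n (f n x)"
  by (simp add: cmp_def)

section \<open>Homotopies\<close>

lemma homotopicI:
  assumes "\<And>n. h n \<in> mod_hom R (cobj X n) (cobj Y (n - 1))"
    "\<And>n x. x \<in> carrier (cobj X n) \<Longrightarrow> f n x = g n x \<oplus>\<^bsub>cobj Y n\<^esub>
               (cdif Y (n - 1) (h n x) \<oplus>\<^bsub>cobj Y n\<^esub> h (n + 1) (cdif X n x))"
  shows "homotopic R X Y f g"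
  using assms unfolding homotopic_def by blast

lemma homotopy_simps:
  assumes X: "bcpx R X" and Y: "bcpx R Y" and h: "\<And>n. h n \<in> mod_hom R (cobj X n) (cobj Y (n - 1))"
  shows "\<And>n m x. x \<in> carrier (cobj X n) \<Longrightarrow> m = n - 1 \<Longrightarrow> h n x \<in> carrier (cobj Y m)"
    and "\<And>n x y. x \<in> carrier (cobj X n) \<Longrightarrow> y \<in> carrier (cobj X n) \<Longrightarrow>
      h n (x \<oplus>\<^bsub>cobj X n\<^esub> y) = h n x \<oplus>\<^bsub>cobj Y (n - 1)\<^esub> h n y"
    and "\<And>n r x. r \<in> carrier R \<Longrightarrow> x \<in> carrier (cobj X n) \<Longrightarrow>
      h n (r \<odot>\<^bsub>cobj X n\<^esub> x) = r \<odot>\<^bsub>cobj Y (n - 1)\<^esub> h n x"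
    and "\<And>n. h n \<zero>\<^bsub>cobj X n\<^esub> = \<zero>\<^bsub>cobj Y (n - 1)\<^esub>"
    and "\<And>n x. x \<in> carrier (cobj X n) \<Longrightarrow> h n (\<ominus>\<^bsub>cobj X n\<^esub> x) = \<ominus>\<^bsub>cobj Y (n - 1)\<^esub> h n x"
  using assms mod_hom_closed[OF h] mod_hom_add[OF h] mod_hom_smult[OF h] hom_zero[OF _ _ h]
    hom_minus[OF _ _ h] by simp_all

lemma homotopic_eqI:
  assumes X: "bcpx R X" and Y: "bcpx R Y" and f: "chain_map R X Y f"
    and eq: "\<And>n x. x \<in> carrier (cobj X n) \<Longrightarrow> f n x = g n x"
  shows "homotopic R X Y f g"
proof (rule homotopicI[of "\<lambda>n _. \<zero>\<^bsub>cobj Y (n - 1)\<^esub>"])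
  show "(\<lambda>_. \<zero>\<^bsub>cobj Y (n - 1)\<^esub>) \<in> mod_hom R (cobj X n) (cobj Y (n - 1))" for n
    using Y by (intro mod_hom_const) simp
next
  fix n x assume x: "x \<in> carrier (cobj X n)"
  then have "g n x \<in> carrier (cobj Y n)" using chain_map_simps(1)[OF X Y f x] eq by simp
  with x show "f n x = g n x \<oplus>\<^bsub>cobj Y n\<^esub> (cdif Y (n - 1) \<zero>\<^bsub>cobj Y (n - 1)\<^esub> \<oplus>\<^bsub>cobj Y n\<^esub>
      \<zero>\<^bsub>cobj Y (n + 1 - 1)\<^esub>)"
    using cdif_zero[OF Y, of "n - 1"] Y by (simp add: eq)
qed

lemma homotopic_refl: "bcpx R X \<Longrightarrow> bcpx R Y \<Longrightarrow> chain_map R X Y f \<Longrightarrow> homotopic R X Y f f"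
  by (rule homotopic_eqI) auto

lemma homotopic_sym:
  assumes X [simp]: "bcpx R X" and Y [simp]: "bcpx R Y" and f: "chain_map R X Y f" and g: "chain_map R X Y g"
    and "homotopic R X Y f g"
  shows "homotopic R X Y g f"
proof -
  obtain h where h: "\<And>n. h n \<in> mod_hom R (cobj X n) (cobj Y (n - 1))"
    "\<And>n x. x \<in> carrier (cobj X n) \<Longrightarrow> f n x = g n x \<oplus>\<^bsub>cobj Y n\<^esub>
               (cdif Y (n - 1) (h n x) \<oplus>\<^bsub>cobj Y n\<^esub> h (n + 1) (cdif X n x))"
    using assms(5) unfolding homotopic_def by blast
  note [simp] = homotopy_simps[OF X Y h(1)] chain_map_simps[OF X Y g]
  note cm = cdif_minus[OF Y, of _ "n - 1" for n, simplified]
  show ?thesis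
    by (rule homotopicI[of "\<lambda>n x. \<ominus>\<^bsub>cobj Y (n - 1)\<^esub> h n x"])
       (simp_all add: h(1) mod_hom_minus h(2) group_ac cm)
qed

lemma homotopic_trans:
  assumes X [simp]: "bcpx R X" and Y [simp]: "bcpx R Y" and g: "chain_map R X Y k"
    and "homotopic R X Y f g" "homotopic R X Y g k"
  shows "homotopic R X Y f k"
proof -
  obtain h where h: "\<And>n. h n \<in> mod_hom R (cobj X n) (cobj Y (n - 1))"
    "\<And>n x. x \<in> carrier (cobj X n) \<Longrightarrow> f n x = g n x \<oplus>\<^bsub>cobj Y n\<^esub>
               (cdif Y (n - 1) (h n x) \<oplus>\<^bsub>cobj Y n\<^esub> h (n + 1) (cdif X n x))"
    using assms(4) unfolding homotopic_def by blast
  obtain l where l: "\<And>n. l n \<in> mod_hom R (cobj X n) (cobj Y (n - 1))"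
    "\<And>n x. x \<in> carrier (cobj X n) \<Longrightarrow> g n x = k n x \<oplus>\<^bsub>cobj Y n\<^esub>
               (cdif Y (n - 1) (l n x) \<oplus>\<^bsub>cobj Y n\<^esub> l (n + 1) (cdif X n x))"
    using assms(5) unfolding homotopic_def by blast
  note [simp] = homotopy_simps[OF X Y h(1)] homotopy_simps[OF X Y l(1)] chain_map_simps[OF X Y g]
  note ca = cdif_add[OF Y, of _ "n - 1" for n, simplified]
  show ?thesis
    by (rule homotopicI[of "\<lambda>n x. h n x \<oplus>\<^bsub>cobj Y (n - 1)\<^esub> l n x"])
       (simp_all add: h(1) l(1) mod_hom_plus h(2) l(2) group_ac ca)
qed

lemma homotopic_pre:
  assumes W [simp]: "bcpx R W" and X [simp]: "bcpx R X" and Y [simp]: "bcpx R Y"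
    and u: "chain_map R W X u" and "homotopic R X Y f g"
  shows "homotopic R W Y (cmp f u) (cmp g u)"
proof -
  obtain h where h: "\<And>n. h n \<in> mod_hom R (cobj X n) (cobj Y (n - 1))"
    "\<And>n x. x \<in> carrier (cobj X n) \<Longrightarrow> f n x = g n x \<oplus>\<^bsub>cobj Y n\<^esub>
               (cdif Y (n - 1) (h n x) \<oplus>\<^bsub>cobj Y n\<^esub> h (n + 1) (cdif X n x))"
    using assms(5) unfolding homotopic_def by blast
  note [simp] = chain_map_simps[OF W X u]
  show ?thesis
    by (rule homotopicI[of "\<lambda>n x. h n (u n x)"])
       (simp_all add: mod_hom_comp[OF chain_map_hom[OF u] h(1)] h(2))
qed

lemma homotopic_post:
  assumes X [simp]: "bcpx R X" and Y [simp]: "bcpx R Y" and Z [simp]: "bcpx R Z"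
    and s: "chain_map R Y Z s" and g: "chain_map R X Y g" and "homotopic R X Y f g"
  shows "homotopic R X Z (cmp s f) (cmp s g)"
proof -
  obtain h where h: "\<And>n. h n \<in> mod_hom R (cobj X n) (cobj Y (n - 1))"
    "\<And>n x. x \<in> carrier (cobj X n) \<Longrightarrow> f n x = g n x \<oplus>\<^bsub>cobj Y n\<^esub>
               (cdif Y (n - 1) (h n x) \<oplus>\<^bsub>cobj Y n\<^esub> h (n + 1) (cdif X n x))"
    using assms(6) unfolding homotopic_def by blast
  note [simp] = chain_map_simps[OF Y Z s] chain_map_simps[OF X Y g] homotopy_simps[OF X Y h(1)]
  show ?thesis
    by (rule homotopicI[of "\<lambda>n x. s (n - 1) (h n x)"])
       (simp_all add: mod_hom_comp[OF h(1) chain_map_hom[OF s]] h(2))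
qed

section \<open>Quasi-isomorphisms\<close>

lemma cocyclesD: "x \<in> cocycles X n \<Longrightarrow> x \<in> carrier (cobj X n)"
    "x \<in> cocycles X n \<Longrightarrow> cdif X n x = \<zero>\<^bsub>cobj X (n + 1)\<^esub>"
  by (simp_all add: cocycles_def)

lemma in_cohom_class:
  "a \<in> cohom_class X n z \<longleftrightarrow> (\<exists>w\<in>carrier (cobj X (n - 1)). a = cdif X (n - 1) w \<oplus>\<^bsub>cobj X n\<^esub> z)"
  by (auto simp: cohom_class_def coboundaries_def a_r_coset_def r_coset_def)

lemma cohom_class_eq:
  assumes X [simp]: "bcpx R X" and [simp]: "x \<in> carrier (cobj X n)" "y \<in> carrier (cobj X n)"
  shows "cohom_class X n x = cohom_class X n y \<longleftrightarrow>
    (\<exists>w\<in>carrier (cobj X (n - 1)). x = y \<oplus>\<^bsub>cobj X n\<^esub> cdif X (n - 1) w)"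
proof
  note cm = cdif_minus[OF X, of _ "n - 1", simplified] cdif_add[OF X, of _ "n - 1", simplified]
  have cz: "cdif X (n - 1) \<zero>\<^bsub>cobj X (n - 1)\<^esub> = \<zero>\<^bsub>cobj X n\<^esub>" using cdif_zero[OF X, of "n-1"] by simp
  have cl: "cohom_class X n z = {cdif X (n - 1) w \<oplus>\<^bsub>cobj X n\<^esub> z | w. w \<in> carrier (cobj X (n - 1))}" for z
    by (auto simp: in_cohom_class)
  {
    assume eq: "cohom_class X n x = cohom_class X n y"
    have "x \<in> cohom_class X n x" unfolding cl
      by (intro CollectI exI[of _ "\<zero>\<^bsub>cobj X (n - 1)\<^esub>"]) (simp add: cz)
    then have "x \<in> cohom_class X n y" using eq by simp
    then show "\<exists>w\<in>carrier (cobj X (n - 1)). x = y \<oplus>\<^bsub>cobj X n\<^esub> cdif X (n - 1) w"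
      unfolding cl by (auto simp: a_comm)
  }
  assume "\<exists>w\<in>carrier (cobj X (n - 1)). x = y \<oplus>\<^bsub>cobj X n\<^esub> cdif X (n - 1) w"
  then obtain w where w [simp]: "w \<in> carrier (cobj X (n - 1))" and x: "x = y \<oplus>\<^bsub>cobj X n\<^esub> cdif X (n - 1) w"
    by auto
  have c1: "\<exists>v'. cdif X (n - 1) v \<oplus>\<^bsub>cobj X n\<^esub> x = cdif X (n - 1) v' \<oplus>\<^bsub>cobj X n\<^esub> y \<and> v' \<in> carrier (cobj X (n - 1))"
    if "v \<in> carrier (cobj X (n - 1))" for v
    using that by (intro exI[of _ "v \<oplus>\<^bsub>cobj X (n - 1)\<^esub> w"]) (simp add: cm group_ac x)
  have c2: "\<exists>v'. cdif X (n - 1) v \<oplus>\<^bsub>cobj X n\<^esub> y = cdif X (n - 1) v' \<oplus>\<^bsub>cobj X n\<^esub> x \<and> v' \<in> carrier (cobj X (n - 1))"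
    if "v \<in> carrier (cobj X (n - 1))" for v
    using that by (intro exI[of _ "v \<oplus>\<^bsub>cobj X (n - 1)\<^esub> \<ominus>\<^bsub>cobj X (n - 1)\<^esub> w"]) (simp add: cm group_ac x)
  have sub: "cohom_class X n p \<subseteq> cohom_class X n q"
    if H: "\<And>v. v \<in> carrier (cobj X (n - 1)) \<Longrightarrow> \<exists>v'. cdif X (n - 1) v \<oplus>\<^bsub>cobj X n\<^esub> p = cdif X (n - 1) v' \<oplus>\<^bsub>cobj X n\<^esub> q \<and> v' \<in> carrier (cobj X (n - 1))"
    for p q
  proof
    fix a assume "a \<in> cohom_class X n p"
    then obtain v where v: "v \<in> carrier (cobj X (n - 1))" "a = cdif X (n - 1) v \<oplus>\<^bsub>cobj X n\<^esub> p"
      unfolding in_cohom_class by blast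
    obtain v' where "cdif X (n - 1) v \<oplus>\<^bsub>cobj X n\<^esub> p = cdif X (n - 1) v' \<oplus>\<^bsub>cobj X n\<^esub> q"
      "v' \<in> carrier (cobj X (n - 1))" using H[OF v(1)] by blast
    then show "a \<in> cohom_class X n q" unfolding in_cohom_class v(2) by blast
  qed
  show "cohom_class X n x = cohom_class X n y"
    using sub[OF c1] sub[OF c2] by (rule subset_antisym)
qed

lemma cohom_class_self:
  assumes X [simp]: "bcpx R X" and [simp]: "z \<in> carrier (cobj X n)"
  shows "z \<in> cohom_class X n z"
  using cdif_zero[OF X, of "n-1"]
  by (auto simp: in_cohom_class intro!: bexI[of _ "\<zero>\<^bsub>cobj X (n - 1)\<^esub>"])

text \<open>\<open>cohom_map\<close> is a union over all representatives of a class. A chain map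
  sends coboundaries to coboundaries, so all the classes in this union coincide.\<close>

lemma cohom_map_class:
  assumes X [simp]: "bcpx R X" and Y [simp]: "bcpx R Y" and f: "chain_map R X Y f"
    and z [simp]: "z \<in> carrier (cobj X n)"
  shows "cohom_map Y f n (cohom_class X n z) = cohom_class Y n (f n z)"
proof -
  note [simp] = chain_map_simps[OF X Y f]
  have "cohom_class Y n (f n x) = cohom_class Y n (f n z)" if x: "x \<in> cohom_class X n z" for x
  proof -
    obtain w where w [simp]: "w \<in> carrier (cobj X (n - 1))" "x = cdif X (n - 1) w \<oplus>\<^bsub>cobj X n\<^esub> z"
      using x unfolding in_cohom_class by blast
    show ?thesis by (subst cohom_class_eq) (auto simp: group_ac intro!: bexI[of _ "f (n - 1) w"])
  qed
  then show ?thesis using cohom_class_self[OF X z] unfolding cohom_map_def by blast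
qed

lemma surj_HD:
  assumes "surj_H X Y f" "y \<in> carrier (cobj Y n)" "cdif Y n y = \<zero>\<^bsub>cobj Y (n + 1)\<^esub>"
  obtains x z where "x \<in> carrier (cobj X n)" "cdif X n x = \<zero>\<^bsub>cobj X (n + 1)\<^esub>"
    "z \<in> carrier (cobj Y (n - 1))" "y = f n x \<oplus>\<^bsub>cobj Y n\<^esub> cdif Y (n - 1) z"
proof -
  have "y \<in> cocycles Y n" using assms by (simp add: cocycles_def)
  from assms(1)[unfolded surj_H_def, rule_format, OF this] obtain x where x: "x \<in> cocycles X n"
    and "\<exists>z\<in>carrier (cobj Y (n - 1)). y = f n x \<oplus>\<^bsub>cobj Y n\<^esub> cdif Y (n - 1) z"
    by (rule bexE)
  then obtain z where "z \<in> carrier (cobj Y (n - 1))" "y = f n x \<oplus>\<^bsub>cobj Y n\<^esub> cdif Y (n - 1) z"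
    by (elim bexE)
  with x show thesis by (intro that[of x z]) (simp_all add: cocycles_def)
qed

lemma inj_HD:
  assumes "inj_H X Y f" "x \<in> carrier (cobj X n)" "cdif X n x = \<zero>\<^bsub>cobj X (n + 1)\<^esub>"
    "z \<in> carrier (cobj Y (n - 1))" "f n x = cdif Y (n - 1) z"
  obtains w where "w \<in> carrier (cobj X (n - 1))" "x = cdif X (n - 1) w"
proof -
  have "x \<in> cocycles X n" using assms(2,3) by (simp add: cocycles_def)
  from assms(1)[unfolded inj_H_def, rule_format, OF this assms(4,5)]
  show thesis by (elim bexE that)
qed

lemma surj_HI:
  assumes "\<And>n y. y \<in> carrier (cobj Y n) \<Longrightarrow> cdif Y n y = \<zero>\<^bsub>cobj Y (n + 1)\<^esub> \<Longrightarrow>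
    \<exists>x\<in>carrier (cobj X n). cdif X n x = \<zero>\<^bsub>cobj X (n + 1)\<^esub> \<and> (\<exists>z\<in>carrier (cobj Y (n - 1)).
     y = f n x \<oplus>\<^bsub>cobj Y n\<^esub> cdif Y (n - 1) z)"
  shows "surj_H X Y f"
  unfolding surj_H_def
proof (intro allI ballI)
  fix n y assume "y \<in> cocycles Y n"
  then have "y \<in> carrier (cobj Y n)" "cdif Y n y = \<zero>\<^bsub>cobj Y (n + 1)\<^esub>" by (simp_all add: cocycles_def)
  from assms[OF this] obtain x where "x \<in> carrier (cobj X n)" "cdif X n x = \<zero>\<^bsub>cobj X (n + 1)\<^esub>"
    "\<exists>z\<in>carrier (cobj Y (n - 1)). y = f n x \<oplus>\<^bsub>cobj Y n\<^esub> cdif Y (n - 1) z"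
    by (elim bexE conjE) blast
  then show "\<exists>x\<in>cocycles X n. \<exists>z\<in>carrier (cobj Y (n - 1)). y = f n x \<oplus>\<^bsub>cobj Y n\<^esub> cdif Y (n - 1) z"
    by - (rule bexI[of _ x], simp_all add: cocycles_def)
qed

lemma inj_HI:
  assumes "\<And>n x z. x \<in> carrier (cobj X n) \<Longrightarrow> cdif X n x = \<zero>\<^bsub>cobj X (n + 1)\<^esub> \<Longrightarrow>
    z \<in> carrier (cobj Y (n - 1)) \<Longrightarrow> f n x = cdif Y (n - 1) z \<Longrightarrow>
    \<exists>w\<in>carrier (cobj X (n - 1)). x = cdif X (n - 1) w"
  shows "inj_H X Y f"
  unfolding inj_H_def
proof (intro allI ballI impI)
  fix n x z assume "x \<in> cocycles X n" and z: "z \<in> carrier (cobj Y (n - 1))" "f n x = cdif Y (n - 1) z"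
  then have "x \<in> carrier (cobj X n)" "cdif X n x = \<zero>\<^bsub>cobj X (n + 1)\<^esub>" by (simp_all add: cocycles_def)
  from assms[OF this z] show "\<exists>w\<in>carrier (cobj X (n - 1)). x = cdif X (n - 1) w" .
qed

text \<open>By \<open>cohom_map_class\<close> the map on cohomology is computed on representatives.
  Injectivity need only be tested against the zero class, since the difference of two cocycles is a
  cocycle.\<close>

lemma quasi_iso_iff:
  assumes X [simp]: "bcpx R X" and Y [simp]: "bcpx R Y"
  shows "quasi_iso R X Y f \<longleftrightarrow> chain_map R X Y f \<and> surj_H X Y f \<and> inj_H X Y f"
proof (cases "chain_map R X Y f")
  case f: True
  note [simp] = chain_map_simps[OF X Y f]
  have fz [simp]: "f n x \<in> cocycles Y n" if "x \<in> cocycles X n" for n x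
  proof -
    have "cdif Y n (f n x) = f (n + 1) (cdif X n x)"
      using chain_map_simps(6)[OF X Y f cocyclesD(1)[OF that] refl] by (rule sym)
    also have "\<dots> = \<zero>\<^bsub>cobj Y (n + 1)\<^esub>" by (simp only: cocyclesD(2)[OF that] chain_map_simps(4)[OF X Y f])
    finally show ?thesis using cocyclesD(1)[OF that] by (simp add: cocycles_def)
  qed
  have im: "cohom_map Y f n ` cohomology X n = (\<lambda>x. cohom_class Y n (f n x)) ` cocycles X n" for n
    unfolding cohomology_def image_image by (intro image_cong refl cohom_map_class[OF X Y f] cocyclesD(1))
  have "cohom_map Y f n ` cohomology X n = cohomology Y n \<longleftrightarrow>
      (\<forall>y\<in>cocycles Y n. \<exists>x\<in>cocycles X n. cohom_class Y n y = cohom_class Y n (f n x))" for n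
  proof
    assume e: "cohom_map Y f n ` cohomology X n = cohomology Y n"
    show "\<forall>y\<in>cocycles Y n. \<exists>x\<in>cocycles X n. cohom_class Y n y = cohom_class Y n (f n x)"
    proof
      fix y assume "y \<in> cocycles Y n"
      then have "cohom_class Y n y \<in> cohomology Y n" unfolding cohomology_def by (rule imageI)
      then have "cohom_class Y n y \<in> (\<lambda>x. cohom_class Y n (f n x)) ` cocycles X n"
        by (simp only: e[symmetric] im)
      then show "\<exists>x\<in>cocycles X n. cohom_class Y n y = cohom_class Y n (f n x)" by (simp add: image_iff)
    qed
  next
    assume "\<forall>y\<in>cocycles Y n. \<exists>x\<in>cocycles X n. cohom_class Y n y = cohom_class Y n (f n x)"
    then have "cohomology Y n \<subseteq> cohom_map Y f n ` cohomology X n"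
      unfolding im unfolding cohomology_def by (intro image_subsetI) (simp add: image_iff)
    moreover have "cohom_map Y f n ` cohomology X n \<subseteq> cohomology Y n"
      unfolding im unfolding cohomology_def using fz by (intro image_subsetI) (rule imageI)
    ultimately show "cohom_map Y f n ` cohomology X n = cohomology Y n" by (intro subset_antisym)
  qed
  then have s: "(\<forall>n. cohom_map Y f n ` cohomology X n = cohomology Y n) \<longleftrightarrow> surj_H X Y f"
    unfolding surj_H_def by (simp add: cohom_class_eq cocyclesD(1))
  have i: "(\<forall>n. inj_on (cohom_map Y f n) (cohomology X n)) \<longleftrightarrow> inj_H X Y f"
  proof
    assume inj: "\<forall>n. inj_on (cohom_map Y f n) (cohomology X n)"
    show "inj_H X Y f" unfolding inj_H_def
    proof (intro allI ballI impI)
      fix n x z assume x: "x \<in> cocycles X n" and z: "z \<in> carrier (cobj Y (n - 1))"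
        and eq: "f n x = cdif Y (n - 1) z"
      have z0: "\<zero>\<^bsub>cobj X n\<^esub> \<in> cocycles X n" by (simp add: cocycles_def)
      have "cohom_map Y f n (cohom_class X n x) = cohom_map Y f n (cohom_class X n \<zero>\<^bsub>cobj X n\<^esub>)"
        using z eq cocyclesD(1)[OF x] by (auto simp: cohom_map_class[OF X Y f] cohom_class_eq)
      then have "cohom_class X n x = cohom_class X n \<zero>\<^bsub>cobj X n\<^esub>"
        using inj x z0 unfolding cohomology_def inj_on_def by blast
      then show "\<exists>w\<in>carrier (cobj X (n - 1)). x = cdif X (n - 1) w"
        using cocyclesD(1)[OF x] by (simp add: cohom_class_eq)
    qed
  next
    assume inj: "inj_H X Y f"
    show "\<forall>n. inj_on (cohom_map Y f n) (cohomology X n)"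
    proof (intro allI inj_onI)
      fix n a b assume "a \<in> cohomology X n" "b \<in> cohomology X n"
        and eq: "cohom_map Y f n a = cohom_map Y f n b"
      then obtain x y where x: "x \<in> cocycles X n" and y: "y \<in> cocycles X n"
        and a: "a = cohom_class X n x" and b: "b = cohom_class X n y"
        unfolding cohomology_def by blast
      have [simp]: "x \<in> carrier (cobj X n)" "y \<in> carrier (cobj X n)" using x y by (simp_all add: cocyclesD(1))
      obtain w where w: "w \<in> carrier (cobj Y (n - 1))" "f n x = f n y \<oplus>\<^bsub>cobj Y n\<^esub> cdif Y (n - 1) w"
        using eq by (auto simp: a b cohom_map_class[OF X Y f] cohom_class_eq)
      have "f n (x \<oplus>\<^bsub>cobj X n\<^esub> \<ominus>\<^bsub>cobj X n\<^esub> y) = cdif Y (n - 1) w"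
        using w by (simp add: group_ac)
      moreover have "x \<oplus>\<^bsub>cobj X n\<^esub> \<ominus>\<^bsub>cobj X n\<^esub> y \<in> cocycles X n"
        using x y by (simp add: cocycles_def)
      ultimately obtain v where v: "v \<in> carrier (cobj X (n - 1))"
        "x \<oplus>\<^bsub>cobj X n\<^esub> \<ominus>\<^bsub>cobj X n\<^esub> y = cdif X (n - 1) v"
        using inj[unfolded inj_H_def, rule_format, OF _ w(1)] by blast
      have "x = y \<oplus>\<^bsub>cobj X n\<^esub> cdif X (n - 1) v"
        by (simp add: group_ac flip: v(2))
      then show "a = b" using v(1) by (auto simp: a b cohom_class_eq)
    qed
  qed
  show ?thesis unfolding quasi_iso_def bij_betw_def using s i f by auto
qed (simp add: quasi_iso_def)

lemma quasi_iso_chain_map: "quasi_iso R X Y f \<Longrightarrow> chain_map R X Y f"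
  by (simp add: quasi_iso_def)

text \<open>Degrees occur inside \<open>cobj X n\<close> and must match syntactically, so the
  constant is moved to the right. The guards exclude literals, on which the rewriting could
  loop.\<close>

lemma index_norm [simp]:
  fixes n :: int
  assumes "NO_MATCH (numeral v :: int) n" "NO_MATCH (1 :: int) n"
  shows "1 + n = n + 1" "2 + n = n + 2"
  by simp_all

end

text \<open>The inverse of \<open>cshift\<close> up to double negation. It turns cones into
  fibres.\<close>

definition unshift :: "('r, 'u) cpx \<Rightarrow> ('r, 'u) cpx" where
  "unshift X = \<lparr>cobj = (\<lambda>n. cobj X (n - 1)), cdif = (\<lambda>n x. \<ominus>\<^bsub>cobj X n\<^esub> cdif X (n - 1) x)\<rparr>"

definition acyclic :: "('r, 'u) cpx \<Rightarrow> bool" where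
  "acyclic X \<longleftrightarrow> (\<forall>n. \<forall>x\<in>carrier (cobj X n). cdif X n x = \<zero>\<^bsub>cobj X (n + 1)\<^esub> \<longrightarrow>
     (\<exists>w\<in>carrier (cobj X (n - 1)). x = cdif X (n - 1) w))"

text \<open>The homotopy fibre, as the cone of the desuspended map. The sign in \<open>cone\<close>
  cancels the one in \<open>unshift\<close> on the \<open>A\<close> part, so the first projection to
  \<open>A\<close> is a chain map.\<close>

definition fiber :: "('r, 'k::zero fps) cpx \<Rightarrow> ('r, 'k fps) cpx \<Rightarrow> (int \<Rightarrow> 'k fps \<Rightarrow> 'k fps) \<Rightarrow>
    ('r, 'k fps) cpx" where
  "fiber A B f = cone (unshift A) (unshift B) (\<lambda>n. f (n - 1))"

context fps_complexes
begin

lemma quasi_isoI: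
  assumes "bcpx R X" "bcpx R Y" "chain_map R X Y f"
    and "\<And>n y. y \<in> carrier (cobj Y n) \<Longrightarrow> cdif Y n y = \<zero>\<^bsub>cobj Y (n + 1)\<^esub> \<Longrightarrow>
    \<exists>x\<in>carrier (cobj X n). cdif X n x = \<zero>\<^bsub>cobj X (n + 1)\<^esub> \<and> (\<exists>z\<in>carrier (cobj Y (n - 1)).
     y = f n x \<oplus>\<^bsub>cobj Y n\<^esub> cdif Y (n - 1) z)"
    and "\<And>n x z. x \<in> carrier (cobj X n) \<Longrightarrow> cdif X n x = \<zero>\<^bsub>cobj X (n + 1)\<^esub> \<Longrightarrow>
    z \<in> carrier (cobj Y (n - 1)) \<Longrightarrow> f n x = cdif Y (n - 1) z \<Longrightarrow>
    \<exists>w\<in>carrier (cobj X (n - 1)). x = cdif X (n - 1) w"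
  shows "quasi_iso R X Y f"
  unfolding quasi_iso_iff[OF assms(1,2)]
  by (intro conjI assms(3) surj_HI[OF assms(4)] inj_HI[OF assms(5)])

lemma quasi_iso_surj: "bcpx R X \<Longrightarrow> bcpx R Y \<Longrightarrow> quasi_iso R X Y f \<Longrightarrow> surj_H X Y f"
  using quasi_iso_iff by blast

lemma quasi_iso_inj: "bcpx R X \<Longrightarrow> bcpx R Y \<Longrightarrow> quasi_iso R X Y f \<Longrightarrow> inj_H X Y f"
  using quasi_iso_iff by blast

text \<open>The rules for \<open>cdif\<close> at degree \<open>n - 1\<close> with the target degree
  simplified to \<open>n\<close>, the form in which coboundaries occur.\<close>

lemma cdif_pred:
  assumes "bcpx R X"
  shows "x \<in> carrier (cobj X (n - 1)) \<Longrightarrow> y \<in> carrier (cobj X (n - 1)) \<Longrightarrow>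
      cdif X (n - 1) (x \<oplus>\<^bsub>cobj X (n - 1)\<^esub> y) = cdif X (n - 1) x \<oplus>\<^bsub>cobj X n\<^esub> cdif X (n - 1) y"
    and "cdif X (n - 1) \<zero>\<^bsub>cobj X (n - 1)\<^esub> = \<zero>\<^bsub>cobj X n\<^esub>"
    and "x \<in> carrier (cobj X (n - 1)) \<Longrightarrow>
      cdif X (n - 1) (\<ominus>\<^bsub>cobj X (n - 1)\<^esub> x) = \<ominus>\<^bsub>cobj X n\<^esub> cdif X (n - 1) x"
    and "x \<in> carrier (cobj X (n - 1)) \<Longrightarrow> cdif X n (cdif X (n - 1) x) = \<zero>\<^bsub>cobj X (n + 1)\<^esub>"
  using cdif_add[OF assms, of x "n - 1" y] cdif_zero[OF assms, of "n - 1"]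
    cdif_minus[OF assms, of x "n - 1"] cdif_cdif[OF assms, of x "n - 1" n] by simp_all

lemma quasi_iso_cmp:
  assumes X [simp]: "bcpx R X" and Y [simp]: "bcpx R Y" and Z [simp]: "bcpx R Z"
    and f: "quasi_iso R X Y f" and g: "quasi_iso R Y Z g"
  shows "quasi_iso R X Z (cmp g f)"
proof -
  note cf = quasi_iso_chain_map[OF f] and cg = quasi_iso_chain_map[OF g]
  note [simp] = chain_map_simps[OF X Y cf] chain_map_simps[OF Y Z cg] cdif_pred[OF Z]
  show ?thesis
  proof (rule quasi_isoI[OF X Z chain_map_cmp[OF cf cg]])
    fix n z assume z: "z \<in> carrier (cobj Z n)" "cdif Z n z = \<zero>\<^bsub>cobj Z (n + 1)\<^esub>"
    obtain y a where y: "y \<in> carrier (cobj Y n)" "cdif Y n y = \<zero>\<^bsub>cobj Y (n + 1)\<^esub>"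
      "a \<in> carrier (cobj Z (n - 1))" "z = g n y \<oplus>\<^bsub>cobj Z n\<^esub> cdif Z (n - 1) a"
      using surj_HD[OF quasi_iso_surj[OF Y Z g] z] .
    obtain x b where x: "x \<in> carrier (cobj X n)" "cdif X n x = \<zero>\<^bsub>cobj X (n + 1)\<^esub>"
      "b \<in> carrier (cobj Y (n - 1))" "y = f n x \<oplus>\<^bsub>cobj Y n\<^esub> cdif Y (n - 1) b"
      using surj_HD[OF quasi_iso_surj[OF X Y f] y(1,2)] .
    have "z = cmp g f n x \<oplus>\<^bsub>cobj Z n\<^esub> cdif Z (n - 1) (g (n - 1) b \<oplus>\<^bsub>cobj Z (n - 1)\<^esub> a)"
      unfolding y(4) using x(1,3) y(3) by (simp add: x(4) group_ac)
    then show "\<exists>x\<in>carrier (cobj X n). cdif X n x = \<zero>\<^bsub>cobj X (n + 1)\<^esub> \<and>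
       (\<exists>za\<in>carrier (cobj Z (n - 1)). z = cmp g f n x \<oplus>\<^bsub>cobj Z n\<^esub> cdif Z (n - 1) za)"
      by - (rule bexI[OF _ x(1)], rule conjI[OF x(2)], rule bexI, assumption, simp add: x y)
  next
    fix n x z assume x: "x \<in> carrier (cobj X n)" "cdif X n x = \<zero>\<^bsub>cobj X (n + 1)\<^esub>"
      "z \<in> carrier (cobj Z (n - 1))" "cmp g f n x = cdif Z (n - 1) z"
    have "cdif Y n (f n x) = \<zero>\<^bsub>cobj Y (n + 1)\<^esub>"
      using chain_map_simps(6)[OF X Y cf x(1) refl] by (simp only: x(2) chain_map_simps(4)[OF X Y cf])
    then obtain w where w: "w \<in> carrier (cobj Y (n - 1))" "f n x = cdif Y (n - 1) w"
      using inj_HD[OF quasi_iso_inj[OF Y Z g], of "f n x" n z] x(1,3,4) by auto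
    show "\<exists>w\<in>carrier (cobj X (n - 1)). x = cdif X (n - 1) w"
      by (rule inj_HD[OF quasi_iso_inj[OF X Y f] x(1,2) w]) (rule bexI)
  qed
qed

text \<open>The part of two-out-of-three that is not composition: surjectivity for \<open>u\<close>
  uses injectivity of \<open>s\<close> on cohomology, since a cocycle \<open>y\<close> is compared
  with \<open>u n x\<close> after applying \<open>s\<close>.\<close>

lemma quasi_iso_cancel:
  assumes X [simp]: "bcpx R X" and Y [simp]: "bcpx R Y" and Z [simp]: "bcpx R Z"
    and u: "chain_map R X Y u" and s: "quasi_iso R Y Z s" and su: "quasi_iso R X Z (cmp s u)"
  shows "quasi_iso R X Y u"
proof -
  note cs = quasi_iso_chain_map[OF s]
  note [simp] = chain_map_simps[OF X Y u] chain_map_simps[OF Y Z cs] cdif_pred[OF Y]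
  show ?thesis
  proof (rule quasi_isoI[OF X Y u])
    fix n y assume y: "y \<in> carrier (cobj Y n)" "cdif Y n y = \<zero>\<^bsub>cobj Y (n + 1)\<^esub>"
    have sy: "cdif Z n (s n y) = \<zero>\<^bsub>cobj Z (n + 1)\<^esub>"
      using chain_map_simps(6)[OF Y Z cs y(1) refl] by (simp only: y(2) chain_map_simps(4)[OF Y Z cs])
    have s1: "s n y \<in> carrier (cobj Z n)" using y(1) by simp
    obtain x z where x: "x \<in> carrier (cobj X n)" "cdif X n x = \<zero>\<^bsub>cobj X (n + 1)\<^esub>"
      "z \<in> carrier (cobj Z (n - 1))" "s n y = cmp s u n x \<oplus>\<^bsub>cobj Z n\<^esub> cdif Z (n - 1) z"
      using surj_HD[OF quasi_iso_surj[OF X Z su] s1 sy] .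
    let ?a = "y \<oplus>\<^bsub>cobj Y n\<^esub> \<ominus>\<^bsub>cobj Y n\<^esub> u n x"
    have ux: "cdif Y n (u n x) = \<zero>\<^bsub>cobj Y (n + 1)\<^esub>"
      using chain_map_simps(6)[OF X Y u x(1) refl] by (simp only: x(2) chain_map_simps(4)[OF X Y u])
    have a: "?a \<in> carrier (cobj Y n)" "cdif Y n ?a = \<zero>\<^bsub>cobj Y (n + 1)\<^esub>" using x(1) y ux by simp_all
    have "s n ?a = cdif Z (n - 1) z" using x(1,3) y(1) by (simp add: x(4) group_ac)
    from inj_HD[OF quasi_iso_inj[OF Y Z s] a x(3) this]
    obtain w where w: "w \<in> carrier (cobj Y (n - 1))" "?a = cdif Y (n - 1) w" .
    have "y = u n x \<oplus>\<^bsub>cobj Y n\<^esub> cdif Y (n - 1) w"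
      using x(1) y(1) by (simp add: group_ac flip: w(2))
    then show "\<exists>x\<in>carrier (cobj X n). cdif X n x = \<zero>\<^bsub>cobj X (n + 1)\<^esub> \<and>
       (\<exists>z\<in>carrier (cobj Y (n - 1)). y = u n x \<oplus>\<^bsub>cobj Y n\<^esub> cdif Y (n - 1) z)"
      by - (rule bexI[OF _ x(1)], rule conjI[OF x(2)], rule bexI[OF _ w(1)])
  next
    fix n x z assume x: "x \<in> carrier (cobj X n)" "cdif X n x = \<zero>\<^bsub>cobj X (n + 1)\<^esub>"
      "z \<in> carrier (cobj Y (n - 1))" "u n x = cdif Y (n - 1) z"
    have "cmp s u n x = cdif Z (n - 1) (s (n - 1) z)"
      using chain_map_simps(6)[OF Y Z cs x(3), of n] by (simp add: x(4))
    from inj_HD[OF quasi_iso_inj[OF X Z su] x(1,2) _ this]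
    show "\<exists>w\<in>carrier (cobj X (n - 1)). x = cdif X (n - 1) w" using x(3) by auto
  qed
qed

text \<open>On a cocycle the term \<open>h (n + 1) (cdif X n x)\<close> of the homotopy vanishes, so
  there \<open>f\<close> and \<open>g\<close> differ by a coboundary.\<close>

lemma quasi_iso_homotopic:
  assumes X [simp]: "bcpx R X" and Y [simp]: "bcpx R Y"
    and f: "chain_map R X Y f" and g: "quasi_iso R X Y g" and h: "homotopic R X Y f g"
  shows "quasi_iso R X Y f"
proof -
  obtain h where h: "\<And>n. h n \<in> mod_hom R (cobj X n) (cobj Y (n - 1))"
    "\<And>n x. x \<in> carrier (cobj X n) \<Longrightarrow> f n x = g n x \<oplus>\<^bsub>cobj Y n\<^esub>
               (cdif Y (n - 1) (h n x) \<oplus>\<^bsub>cobj Y n\<^esub> h (n + 1) (cdif X n x))"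
    using h unfolding homotopic_def by blast
  note cg = quasi_iso_chain_map[OF g]
  note [simp] = chain_map_simps[OF X Y f] chain_map_simps[OF X Y cg] homotopy_simps[OF X Y h(1)] cdif_pred[OF Y]
  have fg: "f n x = g n x \<oplus>\<^bsub>cobj Y n\<^esub> cdif Y (n - 1) (h n x)"
    if x: "x \<in> carrier (cobj X n)" "cdif X n x = \<zero>\<^bsub>cobj X (n + 1)\<^esub>" for n x
    using h(2)[OF x(1)] homotopy_simps(4)[OF X Y h(1), of "n + 1"] x by simp
  show ?thesis
  proof (rule quasi_isoI[OF X Y f])
    fix n y assume y: "y \<in> carrier (cobj Y n)" "cdif Y n y = \<zero>\<^bsub>cobj Y (n + 1)\<^esub>"
    obtain x z where x: "x \<in> carrier (cobj X n)" "cdif X n x = \<zero>\<^bsub>cobj X (n + 1)\<^esub>"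
      "z \<in> carrier (cobj Y (n - 1))" "y = g n x \<oplus>\<^bsub>cobj Y n\<^esub> cdif Y (n - 1) z"
      using surj_HD[OF quasi_iso_surj[OF X Y g] y] .
    have "y = f n x \<oplus>\<^bsub>cobj Y n\<^esub> cdif Y (n - 1) (z \<oplus>\<^bsub>cobj Y (n - 1)\<^esub> \<ominus>\<^bsub>cobj Y (n - 1)\<^esub> h n x)"
      using x(1,3) by (simp add: fg[OF x(1,2)] x(4) group_ac)
    then show "\<exists>x\<in>carrier (cobj X n). cdif X n x = \<zero>\<^bsub>cobj X (n + 1)\<^esub> \<and>
       (\<exists>z\<in>carrier (cobj Y (n - 1)). y = f n x \<oplus>\<^bsub>cobj Y n\<^esub> cdif Y (n - 1) z)"
      by - (rule bexI[OF _ x(1)], rule conjI[OF x(2)], rule bexI, assumption, simp add: x)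
  next
    fix n x z assume x: "x \<in> carrier (cobj X n)" "cdif X n x = \<zero>\<^bsub>cobj X (n + 1)\<^esub>"
      "z \<in> carrier (cobj Y (n - 1))" "f n x = cdif Y (n - 1) z"
    have "g n x = f n x \<oplus>\<^bsub>cobj Y n\<^esub> \<ominus>\<^bsub>cobj Y n\<^esub> cdif Y (n - 1) (h n x)"
      using x(1) by (simp add: fg[OF x(1,2)] group_ac)
    then have "g n x = cdif Y (n - 1) (z \<oplus>\<^bsub>cobj Y (n - 1)\<^esub> \<ominus>\<^bsub>cobj Y (n - 1)\<^esub> h n x)"
      using x(1,3) by (simp add: x(4))
    from inj_HD[OF quasi_iso_inj[OF X Y g] x(1,2) _ this]
    show "\<exists>w\<in>carrier (cobj X (n - 1)). x = cdif X (n - 1) w" using x(1,3) by auto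
  qed
qed

lemma quasi_iso_bij:
  assumes X [simp]: "bcpx R X" and Y [simp]: "bcpx R Y" and f: "chain_map R X Y f"
    and bij: "\<And>n. bij_betw (f n) (carrier (cobj X n)) (carrier (cobj Y n))"
  shows "quasi_iso R X Y f"
proof -
  note [simp] = chain_map_simps[OF X Y f] cdif_pred[OF X] cdif_pred[OF Y]
  have inj: "x = y" if "x \<in> carrier (cobj X n)" "y \<in> carrier (cobj X n)" "f n x = f n y" for n x y
    using that bij[of n] by (auto simp: bij_betw_def inj_on_def)
  have surj: "\<exists>x\<in>carrier (cobj X n). y = f n x" if "y \<in> carrier (cobj Y n)" for n y
    using that bij[of n] by (auto simp: bij_betw_def)
  show ?thesis
  proof (rule quasi_isoI[OF X Y f])
    fix n y assume y: "y \<in> carrier (cobj Y n)" "cdif Y n y = \<zero>\<^bsub>cobj Y (n + 1)\<^esub>"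
    obtain x where x: "x \<in> carrier (cobj X n)" "y = f n x" using surj[OF y(1)] by (elim bexE)
    have "cdif X n x = \<zero>\<^bsub>cobj X (n + 1)\<^esub>"
      by (rule inj[of _ "n + 1"]) (use x y in simp_all)
    then show "\<exists>x\<in>carrier (cobj X n). cdif X n x = \<zero>\<^bsub>cobj X (n + 1)\<^esub> \<and>
       (\<exists>z\<in>carrier (cobj Y (n - 1)). y = f n x \<oplus>\<^bsub>cobj Y n\<^esub> cdif Y (n - 1) z)"
      by - (rule bexI[OF _ x(1)], rule conjI, assumption, rule bexI[of _ "\<zero>\<^bsub>cobj Y (n - 1)\<^esub>"], simp_all add: x)
  next
    fix n x z assume x: "x \<in> carrier (cobj X n)" "cdif X n x = \<zero>\<^bsub>cobj X (n + 1)\<^esub>"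
      "z \<in> carrier (cobj Y (n - 1))" "f n x = cdif Y (n - 1) z"
    obtain w where w: "w \<in> carrier (cobj X (n - 1))" "z = f (n - 1) w" using surj[OF x(3)] by (elim bexE)
    have "x = cdif X (n - 1) w"
      by (rule inj[of _ n]) (use x w chain_map_simps(6)[OF X Y f w(1), of n] in simp_all)
    then show "\<exists>w\<in>carrier (cobj X (n - 1)). x = cdif X (n - 1) w" using w(1) by (rule bexI)
  qed
qed

lemma quasi_iso_id: "bcpx R X \<Longrightarrow> quasi_iso R X X (\<lambda>_ x. x)"
  by (rule quasi_iso_bij) (auto simp: chain_map_id bij_betw_def)

lemma quasi_iso_id_like:
  assumes "bcpx R X" "bcpx R Y" "chain_map R X Y f" "\<And>n x. x \<in> carrier (cobj X n) \<Longrightarrow> f n x = x"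
    "\<And>n. carrier (cobj X n) = carrier (cobj Y n)"
  shows "quasi_iso R X Y f"
  using assms by (intro quasi_iso_bij) (auto simp: bij_betw_def inj_on_def)

section \<open>Shifts and cones\<close>

lemma cobj_cshift [simp]: "cobj (cshift X) n = cobj X (n + 1)"
  by (simp add: cshift_def)

lemma cdif_cshift [simp]: "cdif (cshift X) n x = \<ominus>\<^bsub>cobj X (n + 2)\<^esub> cdif X (n + 1) x"
  by (simp add: cshift_def add.assoc)

lemma bcpx_cshift [simp]: "bcpx R X \<Longrightarrow> bcpx R (cshift X)"
proof -
  assume X [simp]: "bcpx R X"
  obtain b where b: "\<And>n. b < \<bar>n\<bar> \<Longrightarrow> carrier (cobj X n) = {\<zero>\<^bsub>cobj X n\<^esub>}" by (rule bcpx_bound[OF X]) blast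
  have e: "n + 1 + 1 = n + 2" for n :: int by simp
  show ?thesis
  proof (rule bcpxI[of _ "b + 1"])
    fix n
    have "cdif X (n + 1) \<in> mod_hom R (cobj X (n + 1)) (cobj X (n + 2))"
      using cdif_hom[OF X, of "n + 1"] by (simp add: e)
    then have "(\<lambda>x. \<ominus>\<^bsub>cobj X (n + 2)\<^esub> cdif X (n + 1) x) \<in> mod_hom R (cobj X (n + 1)) (cobj X (n + 2))"
      by (rule mod_hom_minus[rotated]) simp
    then show "cdif (cshift X) n \<in> mod_hom R (cobj (cshift X) n) (cobj (cshift X) (n + 1))"
      by (simp add: cshift_def e)
  next
    fix n x assume "x \<in> carrier (cobj (cshift X) n)"
    then show "cdif (cshift X) (n + 1) (cdif (cshift X) n x) = \<zero>\<^bsub>cobj (cshift X) (n + 1 + 1)\<^esub>"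
      using cdif_minus[OF X, of "cdif X (n + 1) x" "n + 2"] by (simp add: e add.assoc)
  qed (use b in \<open>simp_all add: bcpx_fg\<close>)
qed

lemma cobj_unshift [simp]: "cobj (unshift X) n = cobj X (n - 1)"
  by (simp add: unshift_def)

lemma cdif_unshift [simp]: "cdif (unshift X) n x = \<ominus>\<^bsub>cobj X n\<^esub> cdif X (n - 1) x"
  by (simp add: unshift_def)

lemma bcpx_unshift [simp]: "bcpx R X \<Longrightarrow> bcpx R (unshift X)"
proof -
  assume X [simp]: "bcpx R X"
  obtain b where b: "\<And>n. b < \<bar>n\<bar> \<Longrightarrow> carrier (cobj X n) = {\<zero>\<^bsub>cobj X n\<^esub>}" by (rule bcpx_bound[OF X]) blast
  show ?thesis
  proof (rule bcpxI[of _ "b + 1"])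
    fix n
    have "cdif X (n - 1) \<in> mod_hom R (cobj X (n - 1)) (cobj X n)"
      using cdif_hom[OF X, of "n - 1"] by simp
    then have "(\<lambda>x. \<ominus>\<^bsub>cobj X n\<^esub> cdif X (n - 1) x) \<in> mod_hom R (cobj X (n - 1)) (cobj X n)"
      by (rule mod_hom_minus[rotated]) simp
    then show "cdif (unshift X) n \<in> mod_hom R (cobj (unshift X) n) (cobj (unshift X) (n + 1))"
      by (simp add: unshift_def)
  next
    fix n x assume "x \<in> carrier (cobj (unshift X) n)"
    then show "cdif (unshift X) (n + 1) (cdif (unshift X) n x) = \<zero>\<^bsub>cobj (unshift X) (n + 1 + 1)\<^esub>"
      using cdif_minus[OF X, of "cdif X (n - 1) x" n] by (simp add: cdif_pred)
  qed (use b in \<open>simp_all add: bcpx_fg\<close>)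
qed

lemma chain_map_unshift:
  assumes X [simp]: "bcpx R X" and Y [simp]: "bcpx R Y" and f: "chain_map R X Y f"
  shows "chain_map R (unshift X) (unshift Y) (\<lambda>n. f (n - 1))"
proof -
  note [simp] = chain_map_simps[OF X Y f]
  show ?thesis by (intro chain_mapI) (simp_all add: chain_map_hom[OF f])
qed

lemma chain_map_cshift:
  assumes X [simp]: "bcpx R X" and Y [simp]: "bcpx R Y" and f: "chain_map R X Y f"
  shows "chain_map R (cshift X) (cshift Y) (\<lambda>n. f (n + 1))"
proof -
  note [simp] = chain_map_simps[OF X Y f]
  show ?thesis by (intro chain_mapI) (simp_all add: chain_map_hom[OF f])
qed

lemma cobj_cone [simp]: "cobj (cone X Y f) n = mod_sum (cobj X (n + 1)) (cobj Y n)"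
  by (simp add: cone_def)

lemma cdif_cone [simp]: "cdif (cone X Y f) n p = fps_pair (\<ominus>\<^bsub>cobj X (n + 2)\<^esub> cdif X (n + 1) (fps_fst p))
    (f (n + 1) (fps_fst p) \<oplus>\<^bsub>cobj Y (n + 1)\<^esub> cdif Y n (fps_snd p))"
  by (simp add: cone_def add.assoc)

lemma bcpx_cone' [simp]: "bcpx R X \<Longrightarrow> bcpx R Y \<Longrightarrow> chain_map R X Y f \<Longrightarrow> bcpx R (cone X Y f)"
  by (rule bcpx_cone)

lemma mod_hom_fst: "fps_fst \<in> mod_hom R (mod_sum M N) M"
  by (rule mod_homI) auto

lemma mod_hom_snd: "fps_snd \<in> mod_hom R (mod_sum M N) N"
  by (rule mod_homI) auto

lemma mod_hom_pair: "f \<in> mod_hom R L M \<Longrightarrow> g \<in> mod_hom R L N \<Longrightarrow>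
    (\<lambda>x. fps_pair (f x) (g x)) \<in> mod_hom R L (mod_sum M N)"
  by (rule mod_homI) (auto simp: mod_hom_closed mod_hom_add mod_hom_smult)

lemma chain_map_cone_inc:
  assumes [simp]: "bcpx R X" "bcpx R Y" and f: "chain_map R X Y f"
  shows "chain_map R Y (cone X Y f) (cone_inc X)"
proof (rule chain_mapI)
  have "cone_inc X n = (\<lambda>y. fps_pair \<zero>\<^bsub>cobj X (n + 1)\<^esub> y)" for n by (simp add: cone_inc_def fun_eq_iff)
  then show "cone_inc X n \<in> mod_hom R (cobj Y n) (cobj (cone X Y f) n)" for n
    by (simp add: mod_hom_pair mod_hom_const mod_hom_id)
qed (use cdif_zero[of X] chain_map_simps(4)[OF _ _ f] in \<open>auto simp: cone_inc_def add.assoc\<close>)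

lemma chain_map_cone_prj:
  assumes [simp]: "bcpx R X" "bcpx R Y" and f: "chain_map R X Y f"
  shows "chain_map R (cone X Y f) (cshift X) cone_prj"
proof (rule chain_mapI)
  show "cone_prj n \<in> mod_hom R (cobj (cone X Y f) n) (cobj (cshift X) n)" for n
    by (simp add: cone_prj_def[abs_def] mod_hom_fst)
qed (auto simp: cone_prj_def)

lemma acyclicD:
  assumes "acyclic X" "x \<in> carrier (cobj X n)" "cdif X n x = \<zero>\<^bsub>cobj X (n + 1)\<^esub>"
  obtains w where "w \<in> carrier (cobj X (n - 1))" "x = cdif X (n - 1) w"
  using assms(1)[unfolded acyclic_def, rule_format, OF assms(2,3)] by (elim bexE)

lemma acyclic_unshift:
  assumes X [simp]: "bcpx R X" and "acyclic X"
  shows "acyclic (unshift X)"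
  unfolding acyclic_def
proof (intro allI ballI impI)
  fix n x assume x: "x \<in> carrier (cobj (unshift X) n)" "cdif (unshift X) n x = \<zero>\<^bsub>cobj (unshift X) (n + 1)\<^esub>"
  have "cdif X (n - 1) x = \<ominus>\<^bsub>cobj X n\<^esub> (\<ominus>\<^bsub>cobj X n\<^esub> cdif X (n - 1) x)" using x(1) by simp
  also have "\<dots> = \<zero>\<^bsub>cobj X (n - 1 + 1)\<^esub>" using x by simp
  finally obtain w where w: "w \<in> carrier (cobj X (n - 1 - 1))" "x = cdif X (n - 1 - 1) w"
    using acyclicD[OF assms(2), of x "n - 1"] x(1) by auto
  then show "\<exists>w\<in>carrier (cobj (unshift X) (n - 1)). x = cdif (unshift X) (n - 1) w"
    using cdif_pred(3)[OF X, of w "n - 1"]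
    by (intro bexI[of _ "\<ominus>\<^bsub>cobj X (n - 1 - 1)\<^esub> w"]) simp_all
qed

text \<open>The long exact sequence of the cone in elements: injectivity of \<open>f\<close> on
  cohomology bounds the first component of a cocycle, surjectivity then corrects the second.\<close>

lemma acyclic_cone:
  assumes X [simp]: "bcpx R X" and Y [simp]: "bcpx R Y" and f: "quasi_iso R X Y f"
  shows "acyclic (cone X Y f)"
  unfolding acyclic_def
proof (intro allI ballI impI)
  note cf = quasi_iso_chain_map[OF f]
  note [simp] = chain_map_simps[OF X Y cf]
  fix n p assume p: "p \<in> carrier (cobj (cone X Y f) n)"
    "cdif (cone X Y f) n p = \<zero>\<^bsub>cobj (cone X Y f) (n + 1)\<^esub>"
  obtain x y where x: "x \<in> carrier (cobj X (n + 1))" and y: "y \<in> carrier (cobj Y n)" and xy: "p = fps_pair x y"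
    using p(1) by (auto elim: mod_sum_cases)
  have mdx: "\<ominus>\<^bsub>cobj X (n + 2)\<^esub> cdif X (n + 1) x = \<zero>\<^bsub>cobj X (n + 2)\<^esub>"
    and fx: "f (n + 1) x \<oplus>\<^bsub>cobj Y (n + 1)\<^esub> cdif Y n y = \<zero>\<^bsub>cobj Y (n + 1)\<^esub>"
    using p(2) by (simp_all add: xy add.assoc)
  have dx: "cdif X (n + 1) x = \<zero>\<^bsub>cobj X (n + 1 + 1)\<^esub>"
    using minus_minus[of "cobj X (n + 2)" "cdif X (n + 1) x"] x by (simp add: mdx add.assoc)
  have "f (n + 1) x = cdif Y (n + 1 - 1) (\<ominus>\<^bsub>cobj Y n\<^esub> y)"
    using minus_unique[OF _ _ _ fx] x y by simp
  then obtain x0 where x0: "x0 \<in> carrier (cobj X n)" "x = cdif X n x0"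
    using inj_HD[OF quasi_iso_inj[OF X Y f] x dx, of "\<ominus>\<^bsub>cobj Y n\<^esub> y"] y by auto
  let ?c = "f n x0 \<oplus>\<^bsub>cobj Y n\<^esub> y"
  have c: "?c \<in> carrier (cobj Y n)" "cdif Y n ?c = \<zero>\<^bsub>cobj Y (n + 1)\<^esub>"
    using fx x0(1) y chain_map_simps(6)[OF X Y cf x0(1), of "n + 1"] by (simp_all add: x0(2))
  obtain x1 z where x1: "x1 \<in> carrier (cobj X n)" "cdif X n x1 = \<zero>\<^bsub>cobj X (n + 1)\<^esub>"
    "z \<in> carrier (cobj Y (n - 1))" "?c = f n x1 \<oplus>\<^bsub>cobj Y n\<^esub> cdif Y (n - 1) z"
    using surj_HD[OF quasi_iso_surj[OF X Y f] c] .
  have "y = \<ominus>\<^bsub>cobj Y n\<^esub> f n x0 \<oplus>\<^bsub>cobj Y n\<^esub> ?c" using x0(1) y by simp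
  then have y': "y = f n x1 \<oplus>\<^bsub>cobj Y n\<^esub> (\<ominus>\<^bsub>cobj Y n\<^esub> f n x0 \<oplus>\<^bsub>cobj Y n\<^esub> cdif Y (n - 1) z)"
    unfolding x1(4) using x1(1,3) x0(1) by (simp add: group_ac)
  \<comment> \<open>The cone differential negates its first component and \<open>x1\<close> is a
    cocycle, so \<open>x1 - x0\<close> is sent to \<open>cdif X n x0 = x\<close>.\<close>
  show "\<exists>w\<in>carrier (cobj (cone X Y f) (n - 1)). p = cdif (cone X Y f) (n - 1) w"
    using x0(1) x1 by (intro bexI[of _ "fps_pair (x1 \<oplus>\<^bsub>cobj X n\<^esub> \<ominus>\<^bsub>cobj X n\<^esub> x0) z"])
      (simp_all add: xy x0(2) y' group_ac cdif_pred[OF Y])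
qed

lemma bcpx_fiber [simp]: "bcpx R A \<Longrightarrow> bcpx R B \<Longrightarrow> chain_map R A B f \<Longrightarrow> bcpx R (fiber A B f)"
  by (simp add: fiber_def chain_map_unshift)

lemma cobj_fiber [simp]: "cobj (fiber A B f) n = mod_sum (cobj A n) (cobj B (n - 1))"
  by (simp add: fiber_def)

lemma cdif_fiber [simp]:
  assumes "bcpx R A" "a \<in> carrier (cobj A n)"
  shows "cdif (fiber A B f) n (fps_pair a b) =
    fps_pair (cdif A n a) (f n a \<oplus>\<^bsub>cobj B n\<^esub> \<ominus>\<^bsub>cobj B n\<^esub> cdif B (n - 1) b)"
  using assms by (simp add: fiber_def)

text \<open>The projection is surjective and its kernel is a shift of the acyclic complex
  \<open>B\<close>, so it changes no cohomology.\<close>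

lemma quasi_iso_fiber:
  assumes A [simp]: "bcpx R A" and B [simp]: "bcpx R B" and f [simp]: "chain_map R A B f" and ac: "acyclic B"
  shows "quasi_iso R (fiber A B f) A (\<lambda>_. fps_fst)"
proof (intro quasi_isoI surj_HI inj_HI)
  note [simp] = chain_map_simps[OF A B f]
  show "chain_map R (fiber A B f) A (\<lambda>_. fps_fst)"
    by (rule chain_mapI) (auto simp: mod_hom_fst elim!: mod_sum_cases)
  {
    fix n a assume a: "a \<in> carrier (cobj A n)" "cdif A n a = \<zero>\<^bsub>cobj A (n + 1)\<^esub>"
    have "cdif B n (f n a) = \<zero>\<^bsub>cobj B (n + 1)\<^esub>"
      using chain_map_simps(6)[OF A B f a(1) refl] by (simp only: a(2) chain_map_simps(4)[OF A B f])
    then obtain b where b: "b \<in> carrier (cobj B (n - 1))" "f n a = cdif B (n - 1) b"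
      using acyclicD[OF ac, of "f n a" n] a(1) by auto
    then show "\<exists>x\<in>carrier (cobj (fiber A B f) n).
            cdif (fiber A B f) n x = \<zero>\<^bsub>cobj (fiber A B f) (n + 1)\<^esub> \<and>
            (\<exists>z\<in>carrier (cobj A (n - 1)). a = fps_fst x \<oplus>\<^bsub>cobj A n\<^esub> cdif A (n - 1) z)"
      using a cdif_pred[OF A] by (intro bexI[of _ "fps_pair a b"] conjI bexI[of _ "\<zero>\<^bsub>cobj A (n - 1)\<^esub>"]) simp_all
  next
    fix n x z assume x: "x \<in> carrier (cobj (fiber A B f) n)"
        "cdif (fiber A B f) n x = \<zero>\<^bsub>cobj (fiber A B f) (n + 1)\<^esub>"
        "z \<in> carrier (cobj A (n - 1))" "fps_fst x = cdif A (n - 1) z"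
    obtain a b where a: "a \<in> carrier (cobj A n)" and b: "b \<in> carrier (cobj B (n - 1))" and ab: "x = fps_pair a b"
      using x(1) by (auto elim: mod_sum_cases)
    have az: "a = cdif A (n - 1) z" using x(4) by (simp add: ab)
    have "f n a \<oplus>\<^bsub>cobj B n\<^esub> \<ominus>\<^bsub>cobj B n\<^esub> cdif B (n - 1) b = \<zero>\<^bsub>cobj B n\<^esub>"
      using x(2) a by (simp add: ab)
    then have fa: "f n a = cdif B (n - 1) b" using eq_if_diff_zero[of "cobj B n"] a b by simp
    \<comment> \<open>For \<open>(z, c)\<close> to bound \<open>(a, b)\<close> the component
      \<open>c\<close> must have boundary \<open>f z - b\<close>, so it suffices that this element
      is a cocycle.\<close>
    let ?c = "f (n - 1) z \<oplus>\<^bsub>cobj B (n - 1)\<^esub> \<ominus>\<^bsub>cobj B (n - 1)\<^esub> b"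
    have "cdif B (n - 1) ?c = \<zero>\<^bsub>cobj B (n - 1 + 1)\<^esub>"
      using b x(3) fa chain_map_simps(6)[OF A B f x(3), of n] by (simp add: az cdif_pred[OF B])
    then obtain c where c: "c \<in> carrier (cobj B (n - 1 - 1))" "?c = cdif B (n - 1 - 1) c"
      using acyclicD[OF ac, of ?c "n - 1"] b x(3) by auto
    have "b = f (n - 1) z \<oplus>\<^bsub>cobj B (n - 1)\<^esub> \<ominus>\<^bsub>cobj B (n - 1)\<^esub> ?c"
      using b x(3) by (simp add: group_ac)
    then show "\<exists>w\<in>carrier (cobj (fiber A B f) (n - 1)). x = cdif (fiber A B f) (n - 1) w"
      unfolding c(2) using x(3) c(1) by (intro bexI[of _ "fps_pair z c"]) (simp_all add: ab az)
  }
qed simp_all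

text \<open>
  The apex \<open>W\<close> is the fibre of the composite of \<open>f\<close> with the inclusion of \<open>Y\<close> into the acyclic cone
  of \<open>s\<close>: its component in \<open>V'\<close> is \<open>h\<close>, its component in \<open>Y\<close> is the homotopy.
\<close>
lemma ore:
  fixes V :: "('k fps, 'k fps) cpx"
  assumes V [simp]: "bcpx R V" and V' [simp]: "bcpx R V'" and Y [simp]: "bcpx R Y"
    and f: "chain_map R V Y f" and s: "quasi_iso R V' Y s"
  obtains W u h where "bcpx R W" "quasi_iso R W V u" "chain_map R W V' h"
    "homotopic R W Y (cmp f u) (cmp s h)"
proof -
  note cs = quasi_iso_chain_map[OF s]
  define C where "C = cone V' Y s"
  have C [simp]: "bcpx R C" and ac: "acyclic C" by (simp_all add: C_def cs acyclic_cone s)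
  define p where "p = cmp (cone_inc V') f"
  have p [simp]: "chain_map R V C p"
    unfolding p_def C_def by (rule chain_map_cmp[OF f chain_map_cone_inc]) (simp_all add: cs)
  note [simp] = chain_map_simps[OF V Y f] chain_map_simps[OF V' Y cs]
  let ?W = "fiber V C p"
  have W [simp]: "bcpx R ?W" by simp
  note [simp del] = cobj_fiber cdif_fiber
  have Wc [simp]: "cobj ?W n = mod_sum (cobj V n) (mod_sum (cobj V' n) (cobj Y (n - 1)))" for n
    by (simp add: C_def cobj_fiber)
  have Wd: "cdif ?W n (fps_pair v (fps_pair v' y)) = fps_pair (cdif V n v)
      (fps_pair (cdif V' n v') (f n v \<oplus>\<^bsub>cobj Y n\<^esub> \<ominus>\<^bsub>cobj Y n\<^esub> (s n v' \<oplus>\<^bsub>cobj Y n\<^esub> cdif Y (n - 1) y)))"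
    if "v \<in> carrier (cobj V n)" "v' \<in> carrier (cobj V' n)" "y \<in> carrier (cobj Y (n - 1))" for n v v' y
    using that by (simp add: C_def p_def cone_inc_def cdif_fiber)
  let ?h = "\<lambda>(n::int) w. fps_fst (fps_snd w)"
  have h: "chain_map R ?W V' ?h"
    by (rule chain_mapI) (auto intro: mod_hom_comp[OF mod_hom_snd mod_hom_fst] simp: Wd elim!: mod_sum_cases)
  have "homotopic R ?W Y (cmp f (\<lambda>_. fps_fst)) (cmp s ?h)"
  proof (rule homotopicI[of "\<lambda>_ w. fps_snd (fps_snd w)"])
    show "(\<lambda>w. fps_snd (fps_snd w)) \<in> mod_hom R (cobj ?W n) (cobj Y (n - 1))" for n
      by (auto intro: mod_hom_comp[OF mod_hom_snd mod_hom_snd])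
  qed (auto simp: Wd group_ac elim!: mod_sum_cases)
  with that[OF W quasi_iso_fiber[OF V C p ac] h] show thesis .
qed

text \<open>
  A homotopy \<open>k\<close> from \<open>s f\<close> to \<open>s g\<close> makes \<open>(f - g, -k)\<close> a chain map into the desuspended cone of
  \<open>s\<close>, which is acyclic; \<open>W\<close> is its fibre.
\<close>
lemma homotopic_cancel:
  fixes V :: "('k fps, 'k fps) cpx"
  assumes V [simp]: "bcpx R V" and Y [simp]: "bcpx R Y" and Z [simp]: "bcpx R Z"
    and f: "chain_map R V Y f" and g: "chain_map R V Y g" and s: "quasi_iso R Y Z s"
    and "homotopic R V Z (cmp s f) (cmp s g)"
  obtains W u where "bcpx R W" "quasi_iso R W V u" "homotopic R W Y (cmp f u) (cmp g u)"
proof -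
  note cs = quasi_iso_chain_map[OF s]
  obtain k where k: "\<And>n. k n \<in> mod_hom R (cobj V n) (cobj Z (n - 1))"
    "\<And>n x. x \<in> carrier (cobj V n) \<Longrightarrow> cmp s f n x = cmp s g n x \<oplus>\<^bsub>cobj Z n\<^esub>
               (cdif Z (n - 1) (k n x) \<oplus>\<^bsub>cobj Z n\<^esub> k (n + 1) (cdif V n x))"
    using assms(7) unfolding homotopic_def by blast
  define C where "C = unshift (cone Y Z s)"
  have C [simp]: "bcpx R C" and ac: "acyclic C" by (simp_all add: C_def cs acyclic_cone acyclic_unshift s)
  note [simp] = chain_map_simps[OF V Y f] chain_map_simps[OF V Y g] chain_map_simps[OF Y Z cs]
    homotopy_simps[OF V Z k(1)]
  define p where "p = (\<lambda>n v. fps_pair (f n v \<oplus>\<^bsub>cobj Y n\<^esub> \<ominus>\<^bsub>cobj Y n\<^esub> g n v) (\<ominus>\<^bsub>cobj Z (n - 1)\<^esub> k n v))"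
  have p [simp]: "chain_map R V C p"
  proof (rule chain_mapI)
    fix n
    show "p n \<in> mod_hom R (cobj V n) (cobj C n)"
      using k(1) chain_map_hom[OF f] chain_map_hom[OF g]
      by (simp add: p_def C_def mod_hom_pair mod_hom_plus mod_hom_minus)
    fix x assume x: "x \<in> carrier (cobj V n)"
    show "p (n + 1) (cdif V n x) = cdif C n (p n x)"
      using x k(2)[OF x] by (simp add: p_def C_def group_ac)
  qed
  let ?W = "fiber V C p"
  have W [simp]: "bcpx R ?W" by simp
  note [simp del] = cobj_fiber cdif_fiber
  have Wc [simp]: "cobj ?W n = mod_sum (cobj V n) (mod_sum (cobj Y (n - 1)) (cobj Z (n - 2)))" for n
    by (simp add: C_def cobj_fiber)
  have Wd: "fps_fst (fps_snd (cdif ?W n (fps_pair v (fps_pair y z)))) =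
      f n v \<oplus>\<^bsub>cobj Y n\<^esub> (\<ominus>\<^bsub>cobj Y n\<^esub> g n v \<oplus>\<^bsub>cobj Y n\<^esub> \<ominus>\<^bsub>cobj Y n\<^esub> cdif Y (n - 1) y)"
    if "v \<in> carrier (cobj V n)" "y \<in> carrier (cobj Y (n - 1))" "z \<in> carrier (cobj Z (n - 2))" for n v y z
    using that by (simp add: C_def p_def group_ac cdif_fiber)
  have "homotopic R ?W Y (cmp f (\<lambda>_. fps_fst)) (cmp g (\<lambda>_. fps_fst))"
  proof (rule homotopicI[of "\<lambda>_ w. fps_fst (fps_snd w)"])
    show "(\<lambda>w. fps_fst (fps_snd w)) \<in> mod_hom R (cobj ?W n) (cobj Y (n - 1))" for n
      by (auto intro: mod_hom_comp[OF mod_hom_snd mod_hom_fst])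
  qed (auto simp: Wd group_ac elim!: mod_sum_cases)
  with that[OF W quasi_iso_fiber[OF V C p ac]] show thesis .
qed

end

definition csum :: "('r, 'k::zero fps) cpx \<Rightarrow> ('r, 'k fps) cpx \<Rightarrow> ('r, 'k fps) cpx" where
  "csum X Y = \<lparr>cobj = (\<lambda>n. mod_sum (cobj X n) (cobj Y n)),
     cdif = (\<lambda>n p. fps_pair (cdif X n (fps_fst p)) (cdif Y n (fps_snd p)))\<rparr>"

definition inl :: "('r, 'k::zero fps) cpx \<Rightarrow> int \<Rightarrow> 'k fps \<Rightarrow> 'k fps" where
  "inl Y = (\<lambda>n x. fps_pair x \<zero>\<^bsub>cobj Y n\<^esub>)"

definition inr :: "('r, 'k::zero fps) cpx \<Rightarrow> int \<Rightarrow> 'k fps \<Rightarrow> 'k fps" where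
  "inr X = (\<lambda>n y. fps_pair \<zero>\<^bsub>cobj X n\<^esub> y)"

definition copair :: "('r, 'k::zero fps) cpx \<Rightarrow> (int \<Rightarrow> 'k fps \<Rightarrow> 'k fps) \<Rightarrow> (int \<Rightarrow> 'k fps \<Rightarrow> 'k fps) \<Rightarrow>
    int \<Rightarrow> 'k fps \<Rightarrow> 'k fps" where
  "copair Z f g = (\<lambda>n p. f n (fps_fst p) \<oplus>\<^bsub>cobj Z n\<^esub> g n (fps_snd p))"

definition csum_map :: "(int \<Rightarrow> 'k::zero fps \<Rightarrow> 'k fps) \<Rightarrow> (int \<Rightarrow> 'k fps \<Rightarrow> 'k fps) \<Rightarrow>
    int \<Rightarrow> 'k fps \<Rightarrow> 'k fps" where
  "csum_map f g = (\<lambda>n p. fps_pair (f n (fps_fst p)) (g n (fps_snd p)))"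

lemma Db_simps [simp]:
  "Ob (Db R) = {X. bcpx R X}" "Hom (Db R) = dhom R" "Idm (Db R) X = dmor R X X (\<lambda>_ x. x)"
  "Cmp (Db R) = dcomp R" "Sh (Db R) = cshift" "Tri (Db R) = Db_triangles R"
  by (simp_all add: Db_def Db_cat_def)

lemma Db_cat_simps [simp]:
  "Ob (Db_cat R) = {X. bcpx R X}" "Hom (Db_cat R) = dhom R" "Idm (Db_cat R) X = dmor R X X (\<lambda>_ x. x)"
  "Cmp (Db_cat R) = dcomp R"
  by (simp_all add: Db_cat_def)

context fps_complexes
begin

section \<open>Sums of complexes\<close>

lemma cobj_csum [simp]: "cobj (csum X Y) n = mod_sum (cobj X n) (cobj Y n)"
  by (simp add: csum_def)

lemma cdif_csum [simp]: "cdif (csum X Y) n p = fps_pair (cdif X n (fps_fst p)) (cdif Y n (fps_snd p))"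
  by (simp add: csum_def)

lemma bcpx_csum [simp]:
  assumes X [simp]: "bcpx R X" and Y [simp]: "bcpx R Y"
  shows "bcpx R (csum X Y)"
proof -
  obtain b where b: "\<And>n. b < \<bar>n\<bar> \<Longrightarrow> carrier (cobj X n) = {\<zero>\<^bsub>cobj X n\<^esub>}"
    by (rule bcpx_bound[OF X]) blast
  obtain c where c: "\<And>n. c < \<bar>n\<bar> \<Longrightarrow> carrier (cobj Y n) = {\<zero>\<^bsub>cobj Y n\<^esub>}"
    by (rule bcpx_bound[OF Y]) blast
  show ?thesis
  proof (rule bcpxI[of _ "max b c"])
    show "fg_module R (cobj (csum X Y) n)" for n by (simp add: fg_mod_sum bcpx_fg)
    show "cdif (csum X Y) n \<in> mod_hom R (cobj (csum X Y) n) (cobj (csum X Y) (n + 1))" for n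
      unfolding csum_def cpx.simps
      by (intro mod_hom_pair mod_hom_comp[OF mod_hom_fst] mod_hom_comp[OF mod_hom_snd] cdif_hom X Y)
    show "carrier (cobj (csum X Y) n) = {\<zero>\<^bsub>cobj (csum X Y) n\<^esub>}" if "max b c < \<bar>n\<bar>" for n
      using b[of n] c[of n] that by (auto elim!: mod_sum_cases)
  qed (auto elim!: mod_sum_cases)
qed

lemma chain_map_inl: "bcpx R X \<Longrightarrow> bcpx R Y \<Longrightarrow> chain_map R X (csum X Y) (inl Y)"
  by (rule chain_mapI) (simp_all add: inl_def mod_hom_pair mod_hom_id mod_hom_const)

lemma chain_map_inr: "bcpx R X \<Longrightarrow> bcpx R Y \<Longrightarrow> chain_map R Y (csum X Y) (inr X)"
  by (rule chain_mapI) (simp_all add: inr_def mod_hom_pair mod_hom_id mod_hom_const)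

lemma chain_map_copair:
  assumes X [simp]: "bcpx R X" and Y [simp]: "bcpx R Y" and Z [simp]: "bcpx R Z"
    and f: "chain_map R X Z f" and g: "chain_map R Y Z g"
  shows "chain_map R (csum X Y) Z (copair Z f g)"
proof -
  note [simp] = chain_map_simps[OF X Z f] chain_map_simps[OF Y Z g]
  show ?thesis
    by (rule chain_mapI)
      (auto simp: copair_def chain_map_hom[OF f] chain_map_hom[OF g] elim!: mod_sum_cases
        intro!: mod_hom_plus mod_hom_comp[OF mod_hom_fst] mod_hom_comp[OF mod_hom_snd])
qed

lemma chain_map_csum_map:
  assumes X [simp]: "bcpx R X" and Y [simp]: "bcpx R Y" and X' [simp]: "bcpx R X'" and Y' [simp]: "bcpx R Y'"
    and f: "chain_map R X X' f" and g: "chain_map R Y Y' g"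
  shows "chain_map R (csum X Y) (csum X' Y') (csum_map f g)"
proof -
  note [simp] = chain_map_simps[OF X X' f] chain_map_simps[OF Y Y' g]
  show ?thesis
    by (rule chain_mapI)
      (auto simp: csum_map_def chain_map_hom[OF f] chain_map_hom[OF g] elim!: mod_sum_cases
        intro!: mod_hom_pair mod_hom_comp[OF mod_hom_fst] mod_hom_comp[OF mod_hom_snd])
qed

lemma quasi_iso_csum_map:
  assumes X [simp]: "bcpx R X" and Y [simp]: "bcpx R Y" and X' [simp]: "bcpx R X'" and Y' [simp]: "bcpx R Y'"
    and f: "quasi_iso R X X' f" and g: "quasi_iso R Y Y' g"
  shows "quasi_iso R (csum X Y) (csum X' Y') (csum_map f g)"
proof (rule quasi_isoI)
  note cf = quasi_iso_chain_map[OF f] and cg = quasi_iso_chain_map[OF g]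
  show "chain_map R (csum X Y) (csum X' Y') (csum_map f g)"
    by (rule chain_map_csum_map) (simp_all add: cf cg)
  {
    fix n y assume y: "y \<in> carrier (cobj (csum X' Y') n)"
      "cdif (csum X' Y') n y = \<zero>\<^bsub>cobj (csum X' Y') (n + 1)\<^esub>"
    have y1: "fps_fst y \<in> carrier (cobj X' n)" "cdif X' n (fps_fst y) = \<zero>\<^bsub>cobj X' (n + 1)\<^esub>"
      and y2: "fps_snd y \<in> carrier (cobj Y' n)" "cdif Y' n (fps_snd y) = \<zero>\<^bsub>cobj Y' (n + 1)\<^esub>"
      using y by auto
    obtain x z where x: "x \<in> carrier (cobj X n)" "cdif X n x = \<zero>\<^bsub>cobj X (n + 1)\<^esub>"
      "z \<in> carrier (cobj X' (n - 1))" "fps_fst y = f n x \<oplus>\<^bsub>cobj X' n\<^esub> cdif X' (n - 1) z"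
      using surj_HD[OF quasi_iso_surj[OF X X' f] y1] .
    obtain x' z' where x': "x' \<in> carrier (cobj Y n)" "cdif Y n x' = \<zero>\<^bsub>cobj Y (n + 1)\<^esub>"
      "z' \<in> carrier (cobj Y' (n - 1))" "fps_snd y = g n x' \<oplus>\<^bsub>cobj Y' n\<^esub> cdif Y' (n - 1) z'"
      using surj_HD[OF quasi_iso_surj[OF Y Y' g] y2] .
    have "y = fps_pair (fps_fst y) (fps_snd y)" using y(1) by (auto elim: mod_sum_cases)
    then have e: "y = fps_pair (f n x \<oplus>\<^bsub>cobj X' n\<^esub> cdif X' (n - 1) z) (g n x' \<oplus>\<^bsub>cobj Y' n\<^esub> cdif Y' (n - 1) z')"
      unfolding x(4) x'(4) .
    show "\<exists>x\<in>carrier (cobj (csum X Y) n). cdif (csum X Y) n x = \<zero>\<^bsub>cobj (csum X Y) (n + 1)\<^esub> \<and>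
            (\<exists>z\<in>carrier (cobj (csum X' Y') (n - 1)). y = csum_map f g n x \<oplus>\<^bsub>cobj (csum X' Y') n\<^esub>
               cdif (csum X' Y') (n - 1) z)"
      by (rule bexI[of _ "fps_pair x x'"], rule conjI, simp add: x x', rule bexI[of _ "fps_pair z z'"])
        (simp_all add: e x(1,3) x'(1,3) csum_map_def)
  next
    fix n x z assume x: "x \<in> carrier (cobj (csum X Y) n)"
      "cdif (csum X Y) n x = \<zero>\<^bsub>cobj (csum X Y) (n + 1)\<^esub>"
      and z: "z \<in> carrier (cobj (csum X' Y') (n - 1))" "csum_map f g n x = cdif (csum X' Y') (n - 1) z"
    have x1: "fps_fst x \<in> carrier (cobj X n)" "cdif X n (fps_fst x) = \<zero>\<^bsub>cobj X (n + 1)\<^esub>"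
      and x2: "fps_snd x \<in> carrier (cobj Y n)" "cdif Y n (fps_snd x) = \<zero>\<^bsub>cobj Y (n + 1)\<^esub>"
      and z1: "fps_fst z \<in> carrier (cobj X' (n - 1))" "f n (fps_fst x) = cdif X' (n - 1) (fps_fst z)"
      and z2: "fps_snd z \<in> carrier (cobj Y' (n - 1))" "g n (fps_snd x) = cdif Y' (n - 1) (fps_snd z)"
      using x z by (auto simp: csum_map_def)
    obtain w where w: "w \<in> carrier (cobj X (n - 1))" "fps_fst x = cdif X (n - 1) w"
      using inj_HD[OF quasi_iso_inj[OF X X' f] x1 z1] .
    obtain v where v: "v \<in> carrier (cobj Y (n - 1))" "fps_snd x = cdif Y (n - 1) v"
      using inj_HD[OF quasi_iso_inj[OF Y Y' g] x2 z2] .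
    have "x = fps_pair (fps_fst x) (fps_snd x)" using x(1) by (auto elim: mod_sum_cases)
    then have "x = fps_pair (cdif X (n - 1) w) (cdif Y (n - 1) v)" unfolding w v .
    then show "\<exists>w\<in>carrier (cobj (csum X Y) (n - 1)). x = cdif (csum X Y) (n - 1) w"
      using w(1) v(1) by (intro bexI[of _ "fps_pair w v"]) simp_all
  }
qed simp_all

lemma homotopic_copair:
  assumes X [simp]: "bcpx R X" and Y [simp]: "bcpx R Y" and Z [simp]: "bcpx R Z"
    and f': "chain_map R X Z f'" and g': "chain_map R Y Z g'"
    and "homotopic R X Z f f'" "homotopic R Y Z g g'"
  shows "homotopic R (csum X Y) Z (copair Z f g) (copair Z f' g')"
proof -
  obtain h where h: "\<And>n. h n \<in> mod_hom R (cobj X n) (cobj Z (n - 1))"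
    "\<And>n x. x \<in> carrier (cobj X n) \<Longrightarrow> f n x = f' n x \<oplus>\<^bsub>cobj Z n\<^esub>
               (cdif Z (n - 1) (h n x) \<oplus>\<^bsub>cobj Z n\<^esub> h (n + 1) (cdif X n x))"
    using assms(6) unfolding homotopic_def by blast
  obtain k where k: "\<And>n. k n \<in> mod_hom R (cobj Y n) (cobj Z (n - 1))"
    "\<And>n x. x \<in> carrier (cobj Y n) \<Longrightarrow> g n x = g' n x \<oplus>\<^bsub>cobj Z n\<^esub>
               (cdif Z (n - 1) (k n x) \<oplus>\<^bsub>cobj Z n\<^esub> k (n + 1) (cdif Y n x))"
    using assms(7) unfolding homotopic_def by blast
  note [simp] = chain_map_simps[OF X Z f'] chain_map_simps[OF Y Z g']
    homotopy_simps[OF X Z h(1)] homotopy_simps[OF Y Z k(1)] cdif_pred[OF Z]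
  show ?thesis
    \<comment> \<open>\<open>copair\<close> adds in the degree \<open>n\<close> module of its first
      argument; \<open>unshift Z\<close> puts that addition into degree \<open>n - 1\<close> of
      \<open>Z\<close>, where homotopies live.\<close>
    by (rule homotopicI[of "\<lambda>n. copair (unshift Z) h k n"])
      (auto simp: copair_def h k(1) k(2) group_ac elim!: mod_sum_cases
        intro!: mod_hom_plus mod_hom_comp[OF mod_hom_fst] mod_hom_comp[OF mod_hom_snd])
qed

section \<open>Roofs\<close>

text \<open>Homotopy bundled with the typing of both maps. Symmetry, transitivity and the
  composition rules need that typing, and the bundle lets them be chained without side conditions on
  the maps already compared.\<close>

definition htpy :: "('k fps, 'u) cpx \<Rightarrow> ('k fps, 'u) cpx \<Rightarrow> (int \<Rightarrow> 'u \<Rightarrow> 'u) \<Rightarrow>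
    (int \<Rightarrow> 'u \<Rightarrow> 'u) \<Rightarrow> bool" where
  "htpy X Y f g \<longleftrightarrow> bcpx R X \<and> bcpx R Y \<and> chain_map R X Y f \<and> chain_map R X Y g \<and> homotopic R X Y f g"

lemma htpyI: "bcpx R X \<Longrightarrow> bcpx R Y \<Longrightarrow> chain_map R X Y f \<Longrightarrow> chain_map R X Y g \<Longrightarrow>
    homotopic R X Y f g \<Longrightarrow> htpy X Y f g"
  by (simp add: htpy_def)

lemma htpyD: "htpy X Y f g \<Longrightarrow> homotopic R X Y f g"
  by (simp add: htpy_def)

lemma htpy_refl: "bcpx R X \<Longrightarrow> bcpx R Y \<Longrightarrow> chain_map R X Y f \<Longrightarrow> htpy X Y f f"
  by (simp add: htpy_def homotopic_refl)

lemma htpy_eqI: "bcpx R X \<Longrightarrow> bcpx R Y \<Longrightarrow> chain_map R X Y f \<Longrightarrow> chain_map R X Y g \<Longrightarrow>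
    (\<And>n x. x \<in> carrier (cobj X n) \<Longrightarrow> f n x = g n x) \<Longrightarrow> htpy X Y f g"
  by (simp add: htpy_def homotopic_eqI)

lemma htpy_sym: "htpy X Y f g \<Longrightarrow> htpy X Y g f"
  unfolding htpy_def using homotopic_sym by blast

lemma htpy_trans [trans]: "htpy X Y f g \<Longrightarrow> htpy X Y g h \<Longrightarrow> htpy X Y f h"
  unfolding htpy_def using homotopic_trans by blast

lemma htpy_trans3: "htpy X Y f g \<Longrightarrow> htpy X Y g h \<Longrightarrow> htpy X Y h k \<Longrightarrow> htpy X Y f k"
  by (rule htpy_trans[OF htpy_trans])

lemma htpy_pre: "htpy X Y f g \<Longrightarrow> bcpx R W \<Longrightarrow> chain_map R W X u \<Longrightarrow> htpy W Y (cmp f u) (cmp g u)"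
  unfolding htpy_def using homotopic_pre chain_map_cmp by blast

lemma htpy_post: "htpy X Y f g \<Longrightarrow> bcpx R Z \<Longrightarrow> chain_map R Y Z s \<Longrightarrow> htpy X Z (cmp s f) (cmp s g)"
  unfolding htpy_def using homotopic_post chain_map_cmp by blast

lemma htpy_ore:
  fixes V :: "('k fps, 'k fps) cpx"
  assumes "bcpx R V" "bcpx R V'" "bcpx R Y" "chain_map R V Y f" "quasi_iso R V' Y s"
  obtains W u h where "bcpx R W" "quasi_iso R W V u" "chain_map R W V' h" "htpy W Y (cmp f u) (cmp s h)"
proof (rule ore[OF assms])
  fix W u h assume *: "bcpx R W" "quasi_iso R W V u" "chain_map R W V' h" "homotopic R W Y (cmp f u) (cmp s h)"
  show thesis
    by (rule that[OF *(1-3)], rule htpyI)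
      (use assms * in \<open>auto intro: chain_map_cmp quasi_iso_chain_map\<close>)
qed

lemma htpy_cancel:
  fixes V :: "('k fps, 'k fps) cpx"
  assumes "chain_map R V Y f" "chain_map R V Y g" "bcpx R Y" "quasi_iso R Y Z s" "htpy V Z (cmp s f) (cmp s g)"
  obtains W u where "bcpx R W" "quasi_iso R W V u" "htpy W Y (cmp f u) (cmp g u)"
proof -
  have *: "bcpx R V" "bcpx R Z" "homotopic R V Z (cmp s f) (cmp s g)" using assms(5) by (auto simp: htpy_def)
  show thesis
  proof (rule homotopic_cancel[OF *(1) assms(3) *(2) assms(1,2,4) *(3)])
    fix W u assume w: "bcpx R W" "quasi_iso R W V u" "homotopic R W Y (cmp f u) (cmp g u)"
    show thesis by (rule that[OF w(1,2)], rule htpyI)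
      (use assms w in \<open>auto intro: chain_map_cmp quasi_iso_chain_map\<close>)
  qed
qed

lemma is_roofD:
  assumes "is_roof R \<rho>"
  shows "bcpx R (rsrc \<rho>)" "bcpx R (rtgt \<rho>)" "bcpx R (rapex \<rho>)"
    "quasi_iso R (rapex \<rho>) (rsrc \<rho>) (rleft \<rho>)" "chain_map R (rapex \<rho>) (rsrc \<rho>) (rleft \<rho>)"
    "chain_map R (rapex \<rho>) (rtgt \<rho>) (rright \<rho>)"
  using assms by (auto simp: is_roof_def quasi_iso_def)

lemma roof_eqI:
  assumes "is_roof R \<rho>" "is_roof R \<sigma>" "rsrc \<rho> = rsrc \<sigma>" "rtgt \<rho> = rtgt \<sigma>"
    and "quasi_iso R W (rapex \<rho>) u" "chain_map R W (rapex \<sigma>) v"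
    and "htpy W (rsrc \<rho>) (cmp (rleft \<rho>) u) (cmp (rleft \<sigma>) v)"
    and "htpy W (rtgt \<rho>) (cmp (rright \<rho>) u) (cmp (rright \<sigma>) v)"
  shows "roof_eq R \<rho> \<sigma>"
proof -
  have W: "bcpx R W" using assms(7) by (simp add: htpy_def)
  note D = is_roofD[OF assms(1)]
  show ?thesis unfolding roof_eq_def
    using assms W quasi_iso_cmp[OF W D(3,1) assms(5) D(4)]
    by (intro conjI exI[of _ W] exI[of _ u] exI[of _ v]) (auto simp: htpy_def quasi_iso_chain_map)
qed

text \<open>The definition of \<open>roof_eq\<close> asks only that the composite from
  \<open>W\<close> to the source be a quasi-isomorphism. By two-out-of-three both maps
  \<open>u\<close> and \<open>v\<close> to the apexes are then quasi-isomorphisms, which makes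
  further Ore squares possible.\<close>

lemma roof_eqE:
  assumes "roof_eq R \<rho> \<sigma>"
  obtains W u v where "bcpx R W" "quasi_iso R W (rapex \<rho>) u" "quasi_iso R W (rapex \<sigma>) v"
    "htpy W (rsrc \<rho>) (cmp (rleft \<rho>) u) (cmp (rleft \<sigma>) v)"
    "htpy W (rtgt \<rho>) (cmp (rright \<rho>) u) (cmp (rright \<sigma>) v)"
proof -
  have r: "is_roof R \<rho>" "is_roof R \<sigma>" "rsrc \<rho> = rsrc \<sigma>" "rtgt \<rho> = rtgt \<sigma>"
    using assms by (auto simp: roof_eq_def)
  obtain W u v where W: "bcpx R W" "chain_map R W (rapex \<rho>) u" "chain_map R W (rapex \<sigma>) v"
    "quasi_iso R W (rsrc \<rho>) (cmp (rleft \<rho>) u)"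
    "homotopic R W (rsrc \<rho>) (cmp (rleft \<rho>) u) (cmp (rleft \<sigma>) v)"
    "homotopic R W (rtgt \<rho>) (cmp (rright \<rho>) u) (cmp (rright \<sigma>) v)"
    using assms unfolding roof_eq_def by blast
  note D = is_roofD[OF r(1)] and E = is_roofD[OF r(2)]
  have l: "htpy W (rsrc \<rho>) (cmp (rleft \<rho>) u) (cmp (rleft \<sigma>) v)"
    by (rule htpyI[OF W(1) D(1) chain_map_cmp[OF W(2) D(5)] _ W(5)])
      (use chain_map_cmp[OF W(3) E(5)] r in simp)
  have rr: "htpy W (rtgt \<rho>) (cmp (rright \<rho>) u) (cmp (rright \<sigma>) v)"
    by (rule htpyI[OF W(1) D(2) chain_map_cmp[OF W(2) D(6)] _ W(6)])
      (use chain_map_cmp[OF W(3) E(6)] r in simp)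
  have u: "quasi_iso R W (rapex \<rho>) u" by (rule quasi_iso_cancel[OF W(1) D(3) D(1) W(2) D(4) W(4)])
  have "quasi_iso R W (rsrc \<sigma>) (cmp (rleft \<sigma>) v)"
    using htpy_sym[OF l] W(4) r(3) quasi_iso_homotopic[OF W(1) D(1) _ W(4), of "cmp (rleft \<sigma>) v"]
    by (auto simp: htpy_def)
  then have "quasi_iso R W (rapex \<sigma>) v" by (rule quasi_iso_cancel[OF W(1) E(3) E(1) W(3) E(4)])
  from that[OF W(1) u this l rr] show thesis .
qed

lemma roof_eq_refl:
  assumes "is_roof R \<rho>"
  shows "roof_eq R \<rho> \<rho>"
proof -
  note D = is_roofD[OF assms]
  show ?thesis
    by (rule roof_eqI[OF assms assms, where u = "\<lambda>_ x. x" and v = "\<lambda>_ x. x" and W = "rapex \<rho>"])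
      (simp_all add: htpy_refl D quasi_iso_id chain_map_id)
qed

lemma roof_eq_sym:
  assumes "roof_eq R \<rho> \<sigma>"
  shows "roof_eq R \<sigma> \<rho>"
proof -
  have r: "is_roof R \<rho>" "is_roof R \<sigma>" "rsrc \<rho> = rsrc \<sigma>" "rtgt \<rho> = rtgt \<sigma>"
    using assms by (auto simp: roof_eq_def)
  obtain W u v where W: "bcpx R W" "quasi_iso R W (rapex \<rho>) u" "quasi_iso R W (rapex \<sigma>) v"
    "htpy W (rsrc \<rho>) (cmp (rleft \<rho>) u) (cmp (rleft \<sigma>) v)"
    "htpy W (rtgt \<rho>) (cmp (rright \<rho>) u) (cmp (rright \<sigma>) v)"
    by (rule roof_eqE[OF assms])
  show ?thesis
    by (rule roof_eqI[OF r(2,1) r(3)[symmetric] r(4)[symmetric] W(3) quasi_iso_chain_map[OF W(2)]])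
      (use htpy_sym W(4,5) r(3,4) in simp_all)
qed

text \<open>Two homotopy commutative squares with the common map \<open>p2\<close> are pasted along
  a square over \<open>V\<close>. In the proof of transitivity this serves the left legs and the
  right legs alike.\<close>

lemma htpy_square:
  assumes "htpy A X (cmp p1 a1) (cmp p2 a2)" "htpy B X (cmp p2 b2) (cmp p3 b3)"
    and "htpy C V (cmp a2 c) (cmp b2 e)" "chain_map R V X p2" "chain_map R C A c" "chain_map R C B e"
  shows "htpy C X (cmp p1 (cmp a1 c)) (cmp p3 (cmp b3 e))"
proof -
  have C: "bcpx R C" and X: "bcpx R X" using assms(1,3) by (auto simp: htpy_def)
  have "htpy C X (cmp p1 (cmp a1 c)) (cmp p2 (cmp a2 c))"
    using htpy_pre[OF assms(1) C assms(5)] by (simp add: cmp_assoc)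
  also have "htpy C X (cmp p2 (cmp a2 c)) (cmp p2 (cmp b2 e))" by (rule htpy_post[OF assms(3) X assms(4)])
  also have "htpy C X (cmp p2 (cmp b2 e)) (cmp p3 (cmp b3 e))"
    using htpy_pre[OF assms(2) C assms(6)] by (simp add: cmp_assoc)
  finally show ?thesis .
qed

text \<open>The witnesses \<open>A\<close> and \<open>B\<close> both map to the apex of
  \<open>\<sigma>\<close>, and an Ore square over that apex supplies a common witness.\<close>

lemma roof_eq_trans:
  fixes \<rho> \<sigma> \<tau> :: "('k fps, 'k fps) roof"
  assumes "roof_eq R \<rho> \<sigma>" "roof_eq R \<sigma> \<tau>"
  shows "roof_eq R \<rho> \<tau>"
proof -
  have r: "is_roof R \<rho>" "is_roof R \<sigma>" "is_roof R \<tau>" "rsrc \<rho> = rsrc \<tau>" "rtgt \<rho> = rtgt \<tau>"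
    "rsrc \<sigma> = rsrc \<rho>" "rtgt \<sigma> = rtgt \<rho>"
    using assms by (auto simp: roof_eq_def)
  note D = is_roofD[OF r(1)] and E = is_roofD[OF r(2)]
  obtain A a1 a2 where A: "bcpx R A" "quasi_iso R A (rapex \<rho>) a1" "quasi_iso R A (rapex \<sigma>) a2"
    "htpy A (rsrc \<rho>) (cmp (rleft \<rho>) a1) (cmp (rleft \<sigma>) a2)"
    "htpy A (rtgt \<rho>) (cmp (rright \<rho>) a1) (cmp (rright \<sigma>) a2)"
    by (rule roof_eqE[OF assms(1)])
  obtain B b2 b3 where B: "bcpx R B" "quasi_iso R B (rapex \<sigma>) b2" "quasi_iso R B (rapex \<tau>) b3"
    "htpy B (rsrc \<sigma>) (cmp (rleft \<sigma>) b2) (cmp (rleft \<tau>) b3)"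
    "htpy B (rtgt \<sigma>) (cmp (rright \<sigma>) b2) (cmp (rright \<tau>) b3)"
    by (rule roof_eqE[OF assms(2)])
  obtain C c e where C: "bcpx R C" "quasi_iso R C A c" "chain_map R C B e"
    "htpy C (rapex \<sigma>) (cmp a2 c) (cmp b2 e)"
    by (rule htpy_ore[OF A(1) B(1) E(3) quasi_iso_chain_map[OF A(3)] B(2)])
  note cc = quasi_iso_chain_map[OF C(2)]
  show ?thesis
  proof (rule roof_eqI[OF r(1,3,4,5)])
    show "quasi_iso R C (rapex \<rho>) (cmp a1 c)" by (rule quasi_iso_cmp[OF C(1) A(1) D(3) C(2) A(2)])
    show "chain_map R C (rapex \<tau>) (cmp b3 e)" by (rule chain_map_cmp[OF C(3) quasi_iso_chain_map[OF B(3)]])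
    show "htpy C (rsrc \<rho>) (cmp (rleft \<rho>) (cmp a1 c)) (cmp (rleft \<tau>) (cmp b3 e))"
      by (rule htpy_square[OF A(4) B(4)[unfolded r(6)] C(4) E(5)[unfolded r(6)] cc C(3)])
    show "htpy C (rtgt \<rho>) (cmp (rright \<rho>) (cmp a1 c)) (cmp (rright \<tau>) (cmp b3 e))"
      by (rule htpy_square[OF A(5) B(5)[unfolded r(7)] C(4) E(6)[unfolded r(7)] cc C(3)])
  qed
qed

lemma roof_class_eqI:
  fixes \<rho> \<sigma> :: "('k fps, 'k fps) roof"
  assumes "roof_eq R \<rho> \<sigma>"
  shows "roof_class R \<rho> = roof_class R \<sigma>"
  unfolding roof_class_def
proof (intro Collect_cong iffI)
  show "roof_eq R \<sigma> \<tau>" if "roof_eq R \<rho> \<tau>" for \<tau> by (rule roof_eq_trans[OF roof_eq_sym[OF assms] that])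
  show "roof_eq R \<rho> \<tau>" if "roof_eq R \<sigma> \<tau>" for \<tau> by (rule roof_eq_trans[OF assms that])
qed

lemma roof_class_self: "is_roof R \<rho> \<Longrightarrow> \<rho> \<in> roof_class R \<rho>"
  unfolding roof_class_def by (simp add: roof_eq_refl)

lemma roof_class_eqD:
  assumes "is_roof R \<sigma>" "roof_class R \<rho> = roof_class R \<sigma>"
  shows "roof_eq R \<rho> \<sigma>"
proof -
  have "\<sigma> \<in> roof_class R \<rho>" unfolding assms(2) by (rule roof_class_self[OF assms(1)])
  then show ?thesis by (simp add: roof_class_def)
qed

section \<open>Composition of roofs\<close>

definition rcomp :: "('k fps, 'k fps) roof \<Rightarrow> ('k fps, 'k fps) roof \<Rightarrow> ('k fps, 'k fps) cpx \<Rightarrow>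
    (int \<Rightarrow> 'k fps \<Rightarrow> 'k fps) \<Rightarrow> (int \<Rightarrow> 'k fps \<Rightarrow> 'k fps) \<Rightarrow> ('k fps, 'k fps) roof" where
  "rcomp \<rho> \<sigma> W u h = \<lparr>rsrc = rsrc \<rho>, rtgt = rtgt \<sigma>, rapex = W,
       rleft = cmp (rleft \<rho>) u, rright = cmp (rright \<sigma>) h\<rparr>"

lemma is_roof_rcomp:
  assumes "is_roof R \<rho>" "is_roof R \<sigma>" "bcpx R W" "quasi_iso R W (rapex \<rho>) u" "chain_map R W (rapex \<sigma>) h"
  shows "is_roof R (rcomp \<rho> \<sigma> W u h)"
  using is_roofD[OF assms(1)] is_roofD[OF assms(2)] assms(3-5)
  by (auto simp: is_roof_def rcomp_def intro: quasi_iso_cmp chain_map_cmp)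

text \<open>All the data are pulled back to one complex. The difficulty is that the maps to the
  apexes of the second roofs are compared only after the left legs; cancelling a quasi-isomorphism
  there forces one more refinement.\<close>

lemma rcomp_well_defined:
  assumes eq1: "roof_eq R \<rho>1 \<rho>2" and eq2: "roof_eq R \<sigma>1 \<sigma>2" and m: "rtgt \<rho>1 = rsrc \<sigma>1"
    and W1: "bcpx R W1" "quasi_iso R W1 (rapex \<rho>1) w1" "chain_map R W1 (rapex \<sigma>1) h1"
      "homotopic R W1 (rtgt \<rho>1) (cmp (rright \<rho>1) w1) (cmp (rleft \<sigma>1) h1)"
    and W2: "bcpx R W2" "quasi_iso R W2 (rapex \<rho>2) w2" "chain_map R W2 (rapex \<sigma>2) h2"
      "homotopic R W2 (rtgt \<rho>2) (cmp (rright \<rho>2) w2) (cmp (rleft \<sigma>2) h2)"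
  shows "roof_eq R (rcomp \<rho>1 \<sigma>1 W1 w1 h1) (rcomp \<rho>2 \<sigma>2 W2 w2 h2)"
proof -
  have r: "is_roof R \<rho>1" "is_roof R \<rho>2" "rsrc \<rho>2 = rsrc \<rho>1" "rtgt \<rho>2 = rtgt \<rho>1"
    using eq1 by (auto simp: roof_eq_def)
  have r': "is_roof R \<sigma>1" "is_roof R \<sigma>2" "rsrc \<sigma>2 = rsrc \<sigma>1" "rtgt \<sigma>2 = rtgt \<sigma>1"
    using eq2 by (auto simp: roof_eq_def)
  note D1 = is_roofD[OF r(1)] and D2 = is_roofD[OF r(2), unfolded r(3,4)]
  note E1 = is_roofD[OF r'(1), folded m] and E2 = is_roofD[OF r'(2), unfolded r'(3,4), folded m]
  note qc = quasi_iso_chain_map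
  obtain A a1 a2 where A: "bcpx R A" "quasi_iso R A (rapex \<rho>1) a1" "quasi_iso R A (rapex \<rho>2) a2"
    "htpy A (rsrc \<rho>1) (cmp (rleft \<rho>1) a1) (cmp (rleft \<rho>2) a2)"
    "htpy A (rtgt \<rho>1) (cmp (rright \<rho>1) a1) (cmp (rright \<rho>2) a2)"
    by (rule roof_eqE[OF eq1])
  obtain B b1 b2 where B: "bcpx R B" "quasi_iso R B (rapex \<sigma>1) b1" "quasi_iso R B (rapex \<sigma>2) b2"
    "htpy B (rtgt \<rho>1) (cmp (rleft \<sigma>1) b1) (cmp (rleft \<sigma>2) b2)"
    "htpy B (rtgt \<sigma>1) (cmp (rright \<sigma>1) b1) (cmp (rright \<sigma>2) b2)"
    by (rule roof_eqE[OF eq2, folded m])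
  have H1: "htpy W1 (rtgt \<rho>1) (cmp (rright \<rho>1) w1) (cmp (rleft \<sigma>1) h1)"
    by (rule htpyI[OF W1(1) D1(2) chain_map_cmp[OF qc[OF W1(2)] D1(6)] chain_map_cmp[OF W1(3) E1(5)] W1(4)])
  have H2: "htpy W2 (rtgt \<rho>1) (cmp (rright \<rho>2) w2) (cmp (rleft \<sigma>2) h2)"
    by (rule htpyI[OF W2(1) D1(2) chain_map_cmp[OF qc[OF W2(2)] D2(6)] chain_map_cmp[OF W2(3) E2(5)] W2(4)[unfolded r(4)]])
  \<comment> \<open>Two Ore squares, over the apex of \<open>\<rho>1\<close> and then over that of
    \<open>\<rho>2\<close>, give a complex \<open>C\<close> lying over \<open>W1\<close>,
    \<open>A\<close> and \<open>W2\<close> compatibly.\<close>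
  obtain D d \<alpha>1 where D: "bcpx R D" "quasi_iso R D W1 d" "chain_map R D A \<alpha>1"
    "htpy D (rapex \<rho>1) (cmp w1 d) (cmp a1 \<alpha>1)"
    by (rule htpy_ore[OF W1(1) A(1) D1(3) qc[OF W1(2)] A(2)])
  obtain C c c2 where C: "bcpx R C" "quasi_iso R C D c" "chain_map R C W2 c2"
    "htpy C (rapex \<rho>2) (cmp (cmp a2 \<alpha>1) c) (cmp w2 c2)"
    by (rule htpy_ore[OF D(1) W2(1) D2(3) chain_map_cmp[OF D(3) qc[OF A(3)]] W2(2)])
  note cc = qc[OF C(2)]
  define c1 where "c1 = cmp d c"
  define \<alpha> where "\<alpha> = cmp \<alpha>1 c"
  have c1: "quasi_iso R C W1 c1" unfolding c1_def by (rule quasi_iso_cmp[OF C(1) D(1) W1(1) C(2) D(2)])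
  have \<alpha>: "chain_map R C A \<alpha>" unfolding \<alpha>_def by (rule chain_map_cmp[OF cc D(3)])
  have k1: "htpy C (rapex \<rho>1) (cmp w1 c1) (cmp a1 \<alpha>)"
    using htpy_pre[OF D(4) C(1) cc] by (simp add: c1_def \<alpha>_def cmp_assoc)
  have k2: "htpy C (rapex \<rho>2) (cmp a2 \<alpha>) (cmp w2 c2)" using C(4) by (simp add: \<alpha>_def cmp_assoc)
  have left: "htpy C (rsrc \<rho>1) (cmp (rleft \<rho>1) (cmp w1 c1)) (cmp (rleft \<rho>2) (cmp w2 c2))"
    using htpy_post[OF k1 D1(1,5)] htpy_pre[OF A(4) C(1) \<alpha>] htpy_post[OF k2 D2(1,5)]
    unfolding cmp_assoc by (rule htpy_trans3)
  have mid: "htpy C (rtgt \<rho>1) (cmp (rright \<rho>1) (cmp w1 c1)) (cmp (rright \<rho>2) (cmp w2 c2))"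
    using htpy_post[OF k1 D1(2,6)] htpy_pre[OF A(5) C(1) \<alpha>] htpy_post[OF k2 D2(2,6)]
    unfolding cmp_assoc by (rule htpy_trans3)
  have hc1: "chain_map R C (rapex \<sigma>1) (cmp h1 c1)" by (rule chain_map_cmp[OF qc[OF c1] W1(3)])
  have hc2: "chain_map R C (rapex \<sigma>2) (cmp h2 c2)" by (rule chain_map_cmp[OF C(3) W2(3)])
  have th: "htpy C (rtgt \<rho>1) (cmp (rleft \<sigma>1) (cmp h1 c1)) (cmp (rleft \<sigma>2) (cmp h2 c2))"
    using htpy_sym[OF htpy_pre[OF H1 C(1) qc[OF c1]]] mid htpy_pre[OF H2 C(1,3)]
    unfolding cmp_assoc by (rule htpy_trans3)
  \<comment> \<open>So far \<open>h1\<close> and \<open>h2\<close> are related only in the common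
    target. A square over the apex of \<open>\<sigma>1\<close> makes \<open>h1\<close> factor
    through \<open>B\<close> up to homotopy, where the two right legs can be compared.\<close>
  obtain C' p q where C': "bcpx R C'" "quasi_iso R C' C p" "chain_map R C' B q"
    "htpy C' (rapex \<sigma>1) (cmp (cmp h1 c1) p) (cmp b1 q)"
    by (rule htpy_ore[OF C(1) B(1) E1(3) hc1 B(2)])
  note pp = qc[OF C'(2)]
  have "htpy C' (rtgt \<rho>1) (cmp (rleft \<sigma>2) (cmp (cmp h2 c2) p)) (cmp (rleft \<sigma>2) (cmp b2 q))"
    using htpy_sym[OF htpy_pre[OF th C'(1) pp]] htpy_post[OF C'(4) E1(1,5)] htpy_pre[OF B(4) C'(1,3)]
    unfolding cmp_assoc by (rule htpy_trans3)
  \<comment> \<open>The left leg of \<open>\<sigma>2\<close> is cancelled at the cost of refining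
    \<open>C'\<close> to \<open>E\<close>; now \<open>h2\<close> factors through \<open>B\<close> as
    well.\<close>
  then obtain E r where E: "bcpx R E" "quasi_iso R E C' r"
    "htpy E (rapex \<sigma>2) (cmp (cmp (cmp h2 c2) p) r) (cmp (cmp b2 q) r)"
    by (rule htpy_cancel[OF chain_map_cmp[OF pp hc2] chain_map_cmp[OF C'(3) qc[OF B(3)]] E2(3,4)])
  note rr = qc[OF E(2)]
  have pr: "chain_map R E C (cmp p r)" by (rule chain_map_cmp[OF rr pp])
  have qr: "chain_map R E B (cmp q r)" by (rule chain_map_cmp[OF rr C'(3)])
  have right: "htpy E (rtgt \<sigma>1) (cmp (rright \<sigma>1) (cmp h1 (cmp c1 (cmp p r)))) (cmp (rright \<sigma>2) (cmp h2 (cmp c2 (cmp p r))))"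
    using htpy_post[OF htpy_pre[OF C'(4) E(1) rr] E1(2,6)] htpy_pre[OF B(5) E(1) qr]
      htpy_sym[OF htpy_post[OF E(3) E2(2,6)]]
    unfolding cmp_assoc by (rule htpy_trans3)
  show ?thesis
  proof (rule roof_eqI)
    show "is_roof R (rcomp \<rho>1 \<sigma>1 W1 w1 h1)" "is_roof R (rcomp \<rho>2 \<sigma>2 W2 w2 h2)"
      by (rule is_roof_rcomp; fact)+
    show "quasi_iso R E (rapex (rcomp \<rho>1 \<sigma>1 W1 w1 h1)) (cmp c1 (cmp p r))"
      unfolding rcomp_def roof.simps
      by (rule quasi_iso_cmp[OF E(1) C(1) W1(1) quasi_iso_cmp[OF E(1) C'(1) C(1) E(2) C'(2)] c1])
    show "chain_map R E (rapex (rcomp \<rho>2 \<sigma>2 W2 w2 h2)) (cmp c2 (cmp p r))"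
      unfolding rcomp_def roof.simps by (rule chain_map_cmp[OF pr C(3)])
    show "htpy E (rsrc (rcomp \<rho>1 \<sigma>1 W1 w1 h1)) (cmp (rleft (rcomp \<rho>1 \<sigma>1 W1 w1 h1)) (cmp c1 (cmp p r)))
     (cmp (rleft (rcomp \<rho>2 \<sigma>2 W2 w2 h2)) (cmp c2 (cmp p r)))"
      using htpy_pre[OF left E(1) pr] by (simp add: rcomp_def cmp_assoc)
  qed (use right r r' in \<open>simp_all add: rcomp_def cmp_assoc\<close>)
qed

text \<open>\<open>dcomp\<close> collects the composites over all representatives and all squares.
  Since these are one class, any single convenient square computes the composite.\<close>

lemma dcomp_class:
  assumes \<rho>: "is_roof R \<rho>" and \<sigma>: "is_roof R \<sigma>" and m: "rtgt \<rho> = rsrc \<sigma>"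
    and W: "bcpx R W" "quasi_iso R W (rapex \<rho>) u" "chain_map R W (rapex \<sigma>) h"
      "homotopic R W (rtgt \<rho>) (cmp (rright \<rho>) u) (cmp (rleft \<sigma>) h)"
  shows "dcomp R (roof_class R \<sigma>) (roof_class R \<rho>) = roof_class R (rcomp \<rho> \<sigma> W u h)"
proof
  show "roof_class R (rcomp \<rho> \<sigma> W u h) \<subseteq> dcomp R (roof_class R \<sigma>) (roof_class R \<rho>)"
  proof
    fix \<tau> assume "\<tau> \<in> roof_class R (rcomp \<rho> \<sigma> W u h)"
    then have "roof_eq R (rcomp \<rho> \<sigma> W u h) \<tau>" by (simp add: roof_class_def)
    then show "\<tau> \<in> dcomp R (roof_class R \<sigma>) (roof_class R \<rho>)"
      unfolding dcomp_def rcomp_def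
      by (intro CollectI bexI[of _ \<rho>] bexI[of _ \<sigma>] exI[of _ W] exI[of _ u] exI[of _ h] conjI m W
        roof_class_self \<rho> \<sigma>)
  qed
  show "dcomp R (roof_class R \<sigma>) (roof_class R \<rho>) \<subseteq> roof_class R (rcomp \<rho> \<sigma> W u h)"
  proof
    fix \<tau> assume "\<tau> \<in> dcomp R (roof_class R \<sigma>) (roof_class R \<rho>)"
    then obtain \<rho>' \<sigma>' W' u' h' where *: "roof_eq R \<rho> \<rho>'" "roof_eq R \<sigma> \<sigma>'" "bcpx R W'"
       "quasi_iso R W' (rapex \<rho>') u'" "chain_map R W' (rapex \<sigma>') h'"
       "homotopic R W' (rtgt \<rho>') (cmp (rright \<rho>') u') (cmp (rleft \<sigma>') h')"
       "roof_eq R (rcomp \<rho>' \<sigma>' W' u' h') \<tau>"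
      unfolding dcomp_def rcomp_def roof_class_def mem_Collect_eq by (elim bexE exE conjE) simp
    then have "roof_eq R (rcomp \<rho> \<sigma> W u h) (rcomp \<rho>' \<sigma>' W' u' h')"
      by (intro rcomp_well_defined m W) auto
    then show "\<tau> \<in> roof_class R (rcomp \<rho> \<sigma> W u h)"
      unfolding roof_class_def mem_Collect_eq by (rule roof_eq_trans[OF _ *(7)])
  qed
qed

abbreviation mk_roof :: "('k fps, 'k fps) cpx \<Rightarrow> ('k fps, 'k fps) cpx \<Rightarrow> ('k fps, 'k fps) cpx \<Rightarrow>
    (int \<Rightarrow> 'k fps \<Rightarrow> 'k fps) \<Rightarrow> (int \<Rightarrow> 'k fps \<Rightarrow> 'k fps) \<Rightarrow> ('k fps, 'k fps) roof" where
  "mk_roof X Y V s f \<equiv> \<lparr>rsrc = X, rtgt = Y, rapex = V, rleft = s, rright = f\<rparr>"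

lemma is_roof_mk: "bcpx R X \<Longrightarrow> bcpx R Y \<Longrightarrow> bcpx R V \<Longrightarrow> quasi_iso R V X s \<Longrightarrow> chain_map R V Y f \<Longrightarrow>
    is_roof R (mk_roof X Y V s f)"
  by (simp add: is_roof_def)

lemma is_roof_chain_map: "bcpx R X \<Longrightarrow> bcpx R Y \<Longrightarrow> chain_map R X Y f \<Longrightarrow>
    is_roof R (mk_roof X Y X (\<lambda>_ x. x) f)"
  by (rule is_roof_mk[OF _ _ _ quasi_iso_id])

lemma dhom_class: "is_roof R \<rho> \<Longrightarrow> rsrc \<rho> = X \<Longrightarrow> rtgt \<rho> = Y \<Longrightarrow> roof_class R \<rho> \<in> dhom R X Y"
  unfolding dhom_def by blast

lemma dmor_in_dhom:
  fixes X Y :: "('k fps, 'k fps) cpx"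
  shows "bcpx R X \<Longrightarrow> bcpx R Y \<Longrightarrow> chain_map R X Y f \<Longrightarrow> dmor R X Y f \<in> dhom R X Y"
  unfolding dmor_def by (rule dhom_class) (simp_all add: is_roof_chain_map)

lemma dcomp_dmor:
  fixes X Y Z :: "('k fps, 'k fps) cpx"
  assumes "bcpx R X" "bcpx R Y" "bcpx R Z" "chain_map R X Y f" "chain_map R Y Z g"
  shows "dcomp R (dmor R Y Z g) (dmor R X Y f) = dmor R X Z (cmp g f)"
  unfolding dmor_def
  by (subst dcomp_class[of _ _ X "\<lambda>_ x. x" f])
    (use assms in \<open>simp_all add: is_roof_chain_map quasi_iso_id homotopic_refl rcomp_def\<close>)

lemma quasi_iso_iso_mor:
  fixes X Y :: "('k fps, 'k fps) cpx"
  assumes X: "bcpx R X" and Y: "bcpx R Y" and f: "quasi_iso R X Y f"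
  shows "iso_mor (Db R) X Y (dmor R X Y f)" "isomorphic_obj (Db R) X Y" "isomorphic_obj (Db R) Y X"
proof -
  note cf = quasi_iso_chain_map[OF f]
  \<comment> \<open>The formal inverse of \<open>f\<close>: the roof with \<open>f\<close> as left
    leg and the identity as right leg.\<close>
  let ?g = "roof_class R (mk_roof Y X X f (\<lambda>_ x. x))"
  have g: "is_roof R (mk_roof Y X X f (\<lambda>_ x. x))"
    by (simp add: is_roof_mk X Y f chain_map_id)
  note fr = is_roof_chain_map[OF X Y cf]
  have 1: "dcomp R ?g (dmor R X Y f) = dmor R X X (\<lambda>_ x. x)"
    unfolding dmor_def
    by (subst dcomp_class[of _ _ X "\<lambda>_ x. x" "\<lambda>_ x. x"])
      (simp_all add: g fr X Y cf quasi_iso_id homotopic_refl rcomp_def chain_map_id)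
  have "dcomp R (dmor R X Y f) ?g = roof_class R (mk_roof Y Y X f f)"
    unfolding dmor_def
    by (subst dcomp_class[of _ _ X "\<lambda>_ x. x" "\<lambda>_ x. x"])
      (simp_all add: g fr X Y cf quasi_iso_id homotopic_refl rcomp_def chain_map_id)
  also have "\<dots> = dmor R Y Y (\<lambda>_ x. x)"
    unfolding dmor_def
    by (rule roof_class_eqI, rule roof_eqI[of _ _ X "\<lambda>_ x. x" f])
      (simp_all add: is_roof_mk quasi_iso_id X Y f cf chain_map_id htpy_refl)
  finally have 2: "dcomp R (dmor R X Y f) ?g = dmor R Y Y (\<lambda>_ x. x)" .
  have gh: "?g \<in> dhom R Y X" by (rule dhom_class[OF g]) simp_all
  show "iso_mor (Db R) X Y (dmor R X Y f)"
    unfolding iso_mor_def Db_simps by (intro conjI bexI[of _ ?g] 1 2 gh dmor_in_dhom[OF X Y cf])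
  then show "isomorphic_obj (Db R) X Y" unfolding isomorphic_obj_def by (rule exI)
  have "iso_mor (Db R) Y X ?g"
    unfolding iso_mor_def Db_simps by (intro conjI bexI[of _ "dmor R X Y f"] 1 2 gh dmor_in_dhom[OF X Y cf])
  then show "isomorphic_obj (Db R) Y X" unfolding isomorphic_obj_def by (rule exI)
qed

section \<open>Triangles\<close>

lemma quasi_iso_cshift:
  assumes X [simp]: "bcpx R X" and Y [simp]: "bcpx R Y" and f: "quasi_iso R X Y f"
  shows "quasi_iso R (cshift X) (cshift Y) (\<lambda>n. f (n + 1))"
proof -
  note cf = quasi_iso_chain_map[OF f]
  have neg: "d = \<zero>\<^bsub>cobj Z (n + 2)\<^esub>" if "bcpx R Z" "d \<in> carrier (cobj Z (n + 2))"
    "\<ominus>\<^bsub>cobj Z (n + 2)\<^esub> d = \<zero>\<^bsub>cobj Z (n + 2)\<^esub>" for Z d n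
    using minus_minus[of "cobj Z (n + 2)" d] that by simp
  show ?thesis
  proof (rule quasi_isoI)
    fix n y assume y: "y \<in> carrier (cobj (cshift Y) n)" "cdif (cshift Y) n y = \<zero>\<^bsub>cobj (cshift Y) (n + 1)\<^esub>"
    have y1: "y \<in> carrier (cobj Y (n + 1))" using y(1) by simp
    have y2: "cdif Y (n + 1) y = \<zero>\<^bsub>cobj Y (n + 1 + 1)\<^esub>" using neg[OF Y, of "cdif Y (n + 1) y" n] y by simp
    obtain x z where x: "x \<in> carrier (cobj X (n + 1))" "cdif X (n + 1) x = \<zero>\<^bsub>cobj X (n + 1 + 1)\<^esub>"
      "z \<in> carrier (cobj Y (n + 1 - 1))" "y = f (n + 1) x \<oplus>\<^bsub>cobj Y (n + 1)\<^esub> cdif Y (n + 1 - 1) z"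
      using surj_HD[OF quasi_iso_surj[OF X Y f] y1 y2] .
    show "\<exists>x\<in>carrier (cobj (cshift X) n). cdif (cshift X) n x = \<zero>\<^bsub>cobj (cshift X) (n + 1)\<^esub> \<and>
            (\<exists>z\<in>carrier (cobj (cshift Y) (n - 1)).
               y = f (n + 1) x \<oplus>\<^bsub>cobj (cshift Y) n\<^esub> cdif (cshift Y) (n - 1) z)"
      by (rule bexI[of _ x], rule conjI, use x in simp, rule bexI[of _ "\<ominus>\<^bsub>cobj Y n\<^esub> z"])
        (use x in simp_all)
  next
    fix n x z assume x: "x \<in> carrier (cobj (cshift X) n)" "cdif (cshift X) n x = \<zero>\<^bsub>cobj (cshift X) (n + 1)\<^esub>"
      "z \<in> carrier (cobj (cshift Y) (n - 1))" "f (n + 1) x = cdif (cshift Y) (n - 1) z"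
    have x1: "x \<in> carrier (cobj X (n + 1))" using x(1) by simp
    have x2: "cdif X (n + 1) x = \<zero>\<^bsub>cobj X (n + 1 + 1)\<^esub>" using neg[OF X, of "cdif X (n + 1) x" n] x by simp
    have z: "\<ominus>\<^bsub>cobj Y n\<^esub> z \<in> carrier (cobj Y (n + 1 - 1))" using x(3) by simp
    have fx: "f (n + 1) x = cdif Y (n + 1 - 1) (\<ominus>\<^bsub>cobj Y n\<^esub> z)" using x(3,4) by simp
    obtain w where w: "w \<in> carrier (cobj X (n + 1 - 1))" "x = cdif X (n + 1 - 1) w"
      using inj_HD[OF quasi_iso_inj[OF X Y f] x1 x2 z fx] .
    show "\<exists>w\<in>carrier (cobj (cshift X) (n - 1)). x = cdif (cshift X) (n - 1) w"
      by (rule bexI[of _ "\<ominus>\<^bsub>cobj X n\<^esub> w"]) (use w in simp_all)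
  qed (simp_all add: chain_map_cshift cf)
qed

lemma htpy_cshift:
  assumes "htpy X Y f g"
  shows "htpy (cshift X) (cshift Y) (\<lambda>n. f (n + 1)) (\<lambda>n. g (n + 1))"
proof -
  have X [simp]: "bcpx R X" and Y [simp]: "bcpx R Y" and f: "chain_map R X Y f" and g: "chain_map R X Y g"
    and "homotopic R X Y f g" using assms by (auto simp: htpy_def)
  then obtain h where h: "\<And>n. h n \<in> mod_hom R (cobj X n) (cobj Y (n - 1))"
    "\<And>n x. x \<in> carrier (cobj X n) \<Longrightarrow> f n x = g n x \<oplus>\<^bsub>cobj Y n\<^esub>
               (cdif Y (n - 1) (h n x) \<oplus>\<^bsub>cobj Y n\<^esub> h (n + 1) (cdif X n x))"
    unfolding homotopic_def by blast
  note [simp] = chain_map_simps[OF X Y g] homotopy_simps[OF X Y h(1)]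
  have h1: "h (n + 1) \<in> mod_hom R (cobj X (n + 1)) (cobj Y n)" for n
    using h(1)[of "n + 1"] by simp
  have hm: "h (n + 2) (\<ominus>\<^bsub>cobj X (n + 2)\<^esub> x) = \<ominus>\<^bsub>cobj Y (n + 1)\<^esub> h (n + 2) x"
    if "x \<in> carrier (cobj X (n + 2))" for n x
    using homotopy_simps(5)[OF X Y h(1) that] by simp
  have h2: "f (n + 1) x = g (n + 1) x \<oplus>\<^bsub>cobj Y (n + 1)\<^esub>
               (cdif Y n (h (n + 1) x) \<oplus>\<^bsub>cobj Y (n + 1)\<^esub> h (n + 2) (cdif X (n + 1) x))"
    if "x \<in> carrier (cobj X (n + 1))" for n x
    using h(2)[OF that] by simp
  have "homotopic R (cshift X) (cshift Y) (\<lambda>n. f (n + 1)) (\<lambda>n. g (n + 1))"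
    \<comment> \<open>The shift negates both differentials, so the homotopy changes sign
      too.\<close>
    by (rule homotopicI[of "\<lambda>n x. \<ominus>\<^bsub>cobj Y n\<^esub> h (n + 1) x"])
      (simp_all add: mod_hom_minus h1 h2 hm)
  then show ?thesis by (simp add: htpy_def chain_map_cshift f g)
qed

lemma roof_eq_shift:
  assumes "roof_eq R \<rho> \<sigma>"
  shows "roof_eq R (roof_shift \<rho>) (roof_shift \<sigma>)"
proof -
  have r: "is_roof R \<rho>" "is_roof R \<sigma>" "rsrc \<rho> = rsrc \<sigma>" "rtgt \<rho> = rtgt \<sigma>"
    using assms by (auto simp: roof_eq_def)
  have s: "is_roof R (roof_shift \<tau>)" if "is_roof R \<tau>" for \<tau>
    using is_roofD[OF that] by (simp add: is_roof_def roof_shift_def quasi_iso_cshift chain_map_cshift)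
  obtain W u v where W: "bcpx R W" "quasi_iso R W (rapex \<rho>) u" "quasi_iso R W (rapex \<sigma>) v"
    "htpy W (rsrc \<rho>) (cmp (rleft \<rho>) u) (cmp (rleft \<sigma>) v)"
    "htpy W (rtgt \<rho>) (cmp (rright \<rho>) u) (cmp (rright \<sigma>) v)"
    by (rule roof_eqE[OF assms])
  show ?thesis
    by (rule roof_eqI[OF s[OF r(1)] s[OF r(2)], of "cshift W" "\<lambda>n. u (n + 1)" "\<lambda>n. v (n + 1)"])
      (use W r is_roofD[OF r(1)] is_roofD[OF r(2)] htpy_cshift[OF W(4)] htpy_cshift[OF W(5)] in
        \<open>simp_all add: roof_shift_def quasi_iso_cshift chain_map_cshift quasi_iso_chain_map cmp_def\<close>)
qed

lemma dshift_class:
  fixes \<rho> :: "('k fps, 'k fps) roof"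
  assumes "is_roof R \<rho>"
  shows "dshift R (roof_class R \<rho>) = roof_class R (roof_shift \<rho>)"
proof -
  have eq: "roof_class R (roof_shift \<sigma>) = roof_class R (roof_shift \<rho>)" if "\<sigma> \<in> roof_class R \<rho>" for \<sigma>
  proof -
    have "roof_eq R \<rho> \<sigma>" using that by (simp add: roof_class_def)
    then show ?thesis by (rule roof_class_eqI[OF roof_eq_shift[OF roof_eq_sym]])
  qed
  show ?thesis unfolding dshift_def by (rule UN_constant_eq[OF roof_class_self[OF assms] ballI[OF eq]])
qed

lemma dshift_id:
  fixes A :: "('k fps, 'k fps) cpx"
  shows "bcpx R A \<Longrightarrow> dshift R (dmor R A A (\<lambda>_ x. x)) = dmor R (cshift A) (cshift A) (\<lambda>_ x. x)"
  unfolding dmor_def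
  by (subst dshift_class) (simp_all add: is_roof_chain_map chain_map_id roof_shift_def)

lemma iso_mor_Db_cat: "iso_mor (Db_cat R) = iso_mor (Db R)"
  by (simp add: iso_mor_def fun_eq_iff)

lemma cone_triangle:
  assumes A: "bcpx R A" and B: "bcpx R B" and f: "chain_map R A B f"
  shows "(A, B, cone A B f, dmor R A B f, dmor R B (cone A B f) (cone_inc A),
    dmor R (cone A B f) (cshift A) cone_prj) \<in> Tri (Db R)"
proof -
  note C = bcpx_cone[OF A B f]
  note i = chain_map_cone_inc[OF A B f] and p = chain_map_cone_prj[OF A B f]
  have id: "iso_mor (Db R) X X (dmor R X X (\<lambda>_ x. x))" if "bcpx R X" for X
    by (rule quasi_iso_iso_mor[OF that that quasi_iso_id[OF that]])
  show ?thesis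
    unfolding Db_simps Db_triangles_def mem_Collect_eq prod.case iso_mor_Db_cat
    by (intro conjI A B C dmor_in_dhom bcpx_cshift f i p exI[of _ A] exI[of _ B] exI[of _ f]
        exI[of _ "dmor R A A (\<lambda>_ x. x)"] exI[of _ "dmor R B B (\<lambda>_ x. x)"]
        exI[of _ "dmor R (cone A B f) (cone A B f) (\<lambda>_ x. x)"] id)
      (simp_all add: dshift_id A B C dcomp_dmor f i p chain_map_id del: bcpx_cone')
qed

section \<open>Coproducts\<close>

lemma copair_apply: "copair Z f g n p = f n (fps_fst p) \<oplus>\<^bsub>cobj Z n\<^esub> g n (fps_snd p)"
  by (simp add: copair_def)

lemma csum_map_apply: "csum_map f g n p = fps_pair (f n (fps_fst p)) (g n (fps_snd p))"
  by (simp add: csum_map_def)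

lemma inl_apply: "inl Y n x = fps_pair x \<zero>\<^bsub>cobj Y n\<^esub>"
  by (simp add: inl_def)

lemma inr_apply: "inr X n y = fps_pair \<zero>\<^bsub>cobj X n\<^esub> y"
  by (simp add: inr_def)

lemma copair_simps:
  assumes [simp]: "bcpx R X" "bcpx R Y" "bcpx R Z" and f: "chain_map R X Z f" and g: "chain_map R Y Z g"
  shows "htpy X Z (cmp (copair Z f g) (inl Y)) f" "htpy Y Z (cmp (copair Z f g) (inr X)) g"
proof -
  have XZ: "bcpx R X" "bcpx R Z" and YZ: "bcpx R Y" "bcpx R Z" by simp_all
  note [simp] = chain_map_simps[OF XZ f] chain_map_simps[OF YZ g]
  note c = chain_map_copair[OF _ _ _ f g]
  show "htpy X Z (cmp (copair Z f g) (inl Y)) f"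
    by (rule htpy_eqI) (auto intro: chain_map_cmp[OF chain_map_inl c] f simp: copair_apply inl_apply)
  show "htpy Y Z (cmp (copair Z f g) (inr X)) g"
    by (rule htpy_eqI) (auto intro: chain_map_cmp[OF chain_map_inr c] g simp: copair_apply inr_apply)
qed

lemma htpy_copair:
  assumes "htpy X Z f f'" "htpy Y Z g g'"
  shows "htpy (csum X Y) Z (copair Z f g) (copair Z f' g')"
  using assms by (auto simp: htpy_def intro: chain_map_copair homotopic_copair)

lemma cmp_copair:
  assumes X: "bcpx R X" and Y: "bcpx R Y" and W: "bcpx R W" and Z: "bcpx R Z"
    and f: "chain_map R X W f" and g: "chain_map R Y W g" and z: "chain_map R W Z z"
  shows "htpy (csum X Y) Z (cmp z (copair W f g)) (copair Z (cmp z f) (cmp z g))"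
proof -
  note [simp] = chain_map_simps[OF X W f] chain_map_simps[OF Y W g] chain_map_simps[OF W Z z]
  show ?thesis
    by (rule htpy_eqI)
      (auto simp: X Y Z copair_apply elim!: mod_sum_cases
        intro!: chain_map_cmp[OF chain_map_copair z] chain_map_copair W f g chain_map_cmp[OF _ z])
qed

lemma copair_csum_map:
  assumes X: "bcpx R X" and Y: "bcpx R Y" and X': "bcpx R X'" and Y': "bcpx R Y'" and Z: "bcpx R Z"
    and f: "chain_map R X' Z f" and g: "chain_map R Y' Z g"
    and a: "chain_map R X X' a" and b: "chain_map R Y Y' b"
  shows "htpy (csum X Y) Z (cmp (copair Z f g) (csum_map a b)) (copair Z (cmp f a) (cmp g b))"
  by (rule htpy_eqI[OF bcpx_csum[OF X Y] Z
        chain_map_cmp[OF chain_map_csum_map[OF X Y X' Y' a b] chain_map_copair[OF X' Y' Z f g]]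
        chain_map_copair[OF X Y Z chain_map_cmp[OF a f] chain_map_cmp[OF b g]]])
    (simp add: copair_apply csum_map_apply)

lemma csum_map_csum_map:
  assumes X: "bcpx R X" and Y: "bcpx R Y" and V: "bcpx R V" and U: "bcpx R U" and A: "bcpx R A" and B: "bcpx R B"
    and s: "chain_map R V X s" and t: "chain_map R U Y t"
    and a: "chain_map R A V a" and b: "chain_map R B U b"
  shows "htpy (csum A B) (csum X Y) (cmp (csum_map s t) (csum_map a b))
    (copair (csum X Y) (cmp (inl Y) (cmp s a)) (cmp (inr X) (cmp t b)))"
proof -
  note [simp] = chain_map_simps[OF V X s] chain_map_simps[OF U Y t] chain_map_simps[OF A V a] chain_map_simps[OF B U b]
  show ?thesis
    by (rule htpy_eqI[OF bcpx_csum[OF A B] bcpx_csum[OF X Y]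
          chain_map_cmp[OF chain_map_csum_map[OF A B V U a b] chain_map_csum_map[OF V U X Y s t]]
          chain_map_copair[OF A B bcpx_csum[OF X Y] chain_map_cmp[OF chain_map_cmp[OF a s] chain_map_inl[OF X Y]]
            chain_map_cmp[OF chain_map_cmp[OF b t] chain_map_inr[OF X Y]]]])
      (auto simp: X Y copair_apply csum_map_apply inl_apply inr_apply elim!: mod_sum_cases)
qed

text \<open>The rules \<open>sum\<close> and \<open>summand\<close> of \<open>generated\<close>
  refer to the universal property, which has to be checked in the localisation. Existence comes from
  summing the apexes of the two given roofs.\<close>

lemma direct_sum_csum:
  assumes X: "bcpx R X" and Y: "bcpx R Y"
  shows "direct_sum_obj (Db R) X Y (csum X Y)"
proof -
  let ?P = "csum X Y"
  note P = bcpx_csum[OF X Y] and il = chain_map_inl[OF X Y] and ir = chain_map_inr[OF X Y]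
  note qc = quasi_iso_chain_map
  have uni: "\<exists>!h. h \<in> dhom R ?P Z \<and> dcomp R h (dmor R X ?P (inl Y)) = f \<and> dcomp R h (dmor R Y ?P (inr X)) = g"
    if Z: "bcpx R Z" and f: "f \<in> dhom R X Z" and g: "g \<in> dhom R Y Z" for Z f g
  proof -
    obtain \<phi> where \<phi>: "is_roof R \<phi>" "rsrc \<phi> = X" "rtgt \<phi> = Z" "f = roof_class R \<phi>" using f unfolding dhom_def by blast
    obtain \<gamma> where \<gamma>: "is_roof R \<gamma>" "rsrc \<gamma> = Y" "rtgt \<gamma> = Z" "g = roof_class R \<gamma>" using g unfolding dhom_def by blast
    define V s p where "V = rapex \<phi>" "s = rleft \<phi>" "p = rright \<phi>"
    define U t q where "U = rapex \<gamma>" "t = rleft \<gamma>" "q = rright \<gamma>"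
    note D = is_roofD[OF \<phi>(1), unfolded \<phi>(2,3), folded V_s_p_def]
    note E = is_roofD[OF \<gamma>(1), unfolded \<gamma>(2,3), folded U_t_q_def]
    define \<eta> where "\<eta> = mk_roof ?P Z (csum V U) (csum_map s t) (copair Z p q)"
    have cp: "chain_map R (csum V U) Z (copair Z p q)" by (rule chain_map_copair[OF D(3) E(3) Z D(6) E(6)])
    have VU: "bcpx R (csum V U)" by (rule bcpx_csum[OF D(3) E(3)])
    have \<eta>: "is_roof R \<eta>" unfolding \<eta>_def
      by (rule is_roof_mk[OF P Z VU quasi_iso_csum_map[OF D(3) E(3) X Y D(4) E(4)] cp])
    note ilr = is_roof_chain_map[OF X P il] and irr = is_roof_chain_map[OF Y P ir]
    note iVl = chain_map_inl[OF D(3) E(3)] and iVr = chain_map_inr[OF D(3) E(3)]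
    have e1: "homotopic R V ?P (cmp (inl Y) s) (cmp (csum_map s t) (inl U))"
      by (rule homotopic_eqI[OF D(3) P chain_map_cmp[OF D(5) il]])
        (simp add: csum_map_apply inl_apply chain_map_simps(4)[OF E(3) Y E(5)])
    have e2: "homotopic R U ?P (cmp (inr X) t) (cmp (csum_map s t) (inr V))"
      by (rule homotopic_eqI[OF E(3) P chain_map_cmp[OF E(5) ir]])
        (simp add: csum_map_apply inr_apply chain_map_simps(4)[OF D(3) X D(5)])
    have "dcomp R (roof_class R \<eta>) (dmor R X ?P (inl Y)) = roof_class R (mk_roof X Z V s (cmp (copair Z p q) (inl U)))"
      unfolding dmor_def
      by (subst dcomp_class[OF ilr \<eta>, of V s "inl U"])
        (simp_all add: \<eta>_def rcomp_def D(3,4) iVl e1)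
    also have "\<dots> = f" unfolding \<phi>(4)
      by (rule roof_class_eqI, rule roof_eqI[of _ _ V "\<lambda>_ x. x" "\<lambda>_ x. x"])
        (use copair_simps(1)[OF D(3) E(3) Z D(6) E(6)] in \<open>simp_all add: is_roof_mk X Z D \<phi> chain_map_cmp[OF iVl cp]
          quasi_iso_id chain_map_id htpy_refl flip: V_s_p_def\<close>)
    finally have 1: "dcomp R (roof_class R \<eta>) (dmor R X ?P (inl Y)) = f" .
    have "dcomp R (roof_class R \<eta>) (dmor R Y ?P (inr X)) = roof_class R (mk_roof Y Z U t (cmp (copair Z p q) (inr V)))"
      unfolding dmor_def
      by (subst dcomp_class[OF irr \<eta>, of U t "inr V"])
        (simp_all add: \<eta>_def rcomp_def E(3,4) iVr e2)
    also have "\<dots> = g" unfolding \<gamma>(4)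
      by (rule roof_class_eqI, rule roof_eqI[of _ _ U "\<lambda>_ x. x" "\<lambda>_ x. x"])
        (use copair_simps(2)[OF D(3) E(3) Z D(6) E(6)] in \<open>simp_all add: is_roof_mk Y Z E \<gamma> chain_map_cmp[OF iVr cp]
          quasi_iso_id chain_map_id htpy_refl flip: U_t_q_def\<close>)
    finally have 2: "dcomp R (roof_class R \<eta>) (dmor R Y ?P (inr X)) = g" .
    \<comment> \<open>For uniqueness a competing roof is restricted along both inclusions by Ore
      squares. The restrictions are compared with the given roofs over \<open>A\<close> and
      \<open>B\<close>, and the two comparisons are glued over \<open>csum A B\<close>.\<close>
    have u: "h = roof_class R \<eta>" if h: "h \<in> dhom R ?P Z"
      and h1: "dcomp R h (dmor R X ?P (inl Y)) = f" and h2: "dcomp R h (dmor R Y ?P (inr X)) = g" for h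
    proof -
      obtain \<omega> where \<omega>: "is_roof R \<omega>" "rsrc \<omega> = ?P" "rtgt \<omega> = Z" "h = roof_class R \<omega>" using h unfolding dhom_def by blast
      define W w z where "W = rapex \<omega>" "w = rleft \<omega>" "z = rright \<omega>"
      note F = is_roofD[OF \<omega>(1), unfolded \<omega>(2,3), folded W_w_z_def]
      obtain V' s' a where V': "bcpx R V'" "quasi_iso R V' X s'" "chain_map R V' W a"
        "htpy V' ?P (cmp (inl Y) s') (cmp w a)"
        by (rule htpy_ore[OF X F(3) P il F(4)])
      obtain U' t' b where U': "bcpx R U'" "quasi_iso R U' Y t'" "chain_map R U' W b"
        "htpy U' ?P (cmp (inr X) t') (cmp w b)"
        by (rule htpy_ore[OF Y F(3) P ir F(4)])
      have "f = roof_class R (mk_roof X Z V' s' (cmp z a))"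
        unfolding h1[symmetric] dmor_def \<omega>(4)
        by (subst dcomp_class[OF ilr \<omega>(1), of V' s' a])
          (use V' in \<open>simp_all add: rcomp_def \<omega> htpyD flip: W_w_z_def\<close>)
      then have "roof_eq R (mk_roof X Z V' s' (cmp z a)) \<phi>"
        using \<phi>(4) by (intro roof_class_eqD[OF \<phi>(1)]) simp
      then obtain A \<alpha> \<alpha>' where A: "bcpx R A" "quasi_iso R A V' \<alpha>" "quasi_iso R A V \<alpha>'"
        "htpy A X (cmp s' \<alpha>) (cmp s \<alpha>')" "htpy A Z (cmp (cmp z a) \<alpha>) (cmp p \<alpha>')"
        by (rule roof_eqE) (simp flip: V_s_p_def)
      have "g = roof_class R (mk_roof Y Z U' t' (cmp z b))"
        unfolding h2[symmetric] dmor_def \<omega>(4)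
        by (subst dcomp_class[OF irr \<omega>(1), of U' t' b])
          (use U' in \<open>simp_all add: rcomp_def \<omega> htpyD flip: W_w_z_def\<close>)
      then have "roof_eq R (mk_roof Y Z U' t' (cmp z b)) \<gamma>"
        using \<gamma>(4) by (intro roof_class_eqD[OF \<gamma>(1)]) simp
      then obtain B \<beta> \<beta>' where B: "bcpx R B" "quasi_iso R B U' \<beta>" "quasi_iso R B U \<beta>'"
        "htpy B Y (cmp t' \<beta>) (cmp t \<beta>')" "htpy B Z (cmp (cmp z b) \<beta>) (cmp q \<beta>')"
        by (rule roof_eqE) (simp flip: U_t_q_def)
      note a\<alpha> = chain_map_cmp[OF qc[OF A(2)] V'(3)] and b\<beta> = chain_map_cmp[OF qc[OF B(2)] U'(3)]
      \<comment> \<open>The comparison map from the glued complex to the apex of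
        \<open>\<omega>\<close>. Each leg is checked on the two summands separately, since
        homotopies out of a sum can be assembled componentwise.\<close>
      let ?v = "copair W (cmp a \<alpha>) (cmp b \<beta>)"
      have wl: "htpy A ?P (cmp (inl Y) (cmp s \<alpha>')) (cmp w (cmp a \<alpha>))"
        using htpy_sym[OF htpy_post[OF A(4) P il]] htpy_pre[OF V'(4) A(1) qc[OF A(2)]]
        unfolding cmp_assoc by (rule htpy_trans)
      have wr: "htpy B ?P (cmp (inr X) (cmp t \<beta>')) (cmp w (cmp b \<beta>))"
        using htpy_sym[OF htpy_post[OF B(4) P ir]] htpy_pre[OF U'(4) B(1) qc[OF B(2)]]
        unfolding cmp_assoc by (rule htpy_trans)
      have left: "htpy (csum A B) ?P (cmp (csum_map s t) (csum_map \<alpha>' \<beta>')) (cmp w ?v)"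
        using csum_map_csum_map[OF X Y D(3) E(3) A(1) B(1) D(5) E(5) qc[OF A(3)] qc[OF B(3)]]
          htpy_copair[OF wl wr] htpy_sym[OF cmp_copair[OF A(1) B(1) F(3) P a\<alpha> b\<beta> F(5)]]
        by (rule htpy_trans3)
      have right: "htpy (csum A B) Z (cmp (copair Z p q) (csum_map \<alpha>' \<beta>')) (cmp z ?v)"
        using copair_csum_map[OF A(1) B(1) D(3) E(3) Z D(6) E(6) qc[OF A(3)] qc[OF B(3)]]
          htpy_copair[OF htpy_sym[OF A(5)[unfolded cmp_assoc]] htpy_sym[OF B(5)[unfolded cmp_assoc]]]
          htpy_sym[OF cmp_copair[OF A(1) B(1) F(3) Z a\<alpha> b\<beta> F(6)]]
        by (rule htpy_trans3)
      have "roof_eq R \<eta> \<omega>"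
        by (rule roof_eqI[OF \<eta> \<omega>(1), of "csum A B" "csum_map \<alpha>' \<beta>'" ?v])
          (use left right quasi_iso_csum_map[OF A(1) B(1) D(3) E(3) A(3) B(3)]
            chain_map_copair[OF A(1) B(1) F(3) a\<alpha> b\<beta>] in \<open>simp_all add: \<eta>_def \<omega> flip: W_w_z_def\<close>)
      then show ?thesis using \<omega>(4) roof_class_eqI by simp
    qed
    show ?thesis
      by (rule ex1I[of _ "roof_class R \<eta>"])
        (use 1 2 u dhom_class[OF \<eta>] in \<open>auto simp: \<eta>_def\<close>)
  qed
  show ?thesis
    unfolding direct_sum_obj_def Db_simps mem_Collect_eq
    by (intro conjI X Y P bexI[OF _ dmor_in_dhom[OF X P il]] bexI[OF _ dmor_in_dhom[OF Y P ir]] ballI uni)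
      simp_all
qed

end

text \<open>A finite power of \<open>D\<close>: a free module for \<open>S_mod\<close> or the ring
  itself, a vector space for \<open>k_mod\<close>. Nested pairs keep every power inside the one type
  of power series.\<close>

primrec frk :: "('r, 'k::zero fps) module \<Rightarrow> nat \<Rightarrow> ('r, 'k fps) module" where
  "frk D 0 = zero_mod"
| "frk D (Suc r) = mod_sum D (frk D r)"

definition zc :: "(int \<Rightarrow> ('r, 'u) module) \<Rightarrow> ('r, 'u) cpx" where
  "zc M = \<lparr>cobj = M, cdif = (\<lambda>n x. \<zero>\<^bsub>M (n + 1)\<^esub>)\<rparr>"

definition sub_cpx :: "('r, 'u) cpx \<Rightarrow> (int \<Rightarrow> 'u set) \<Rightarrow> ('r, 'u) cpx" where
  "sub_cpx X F = \<lparr>cobj = (\<lambda>n. (cobj X n)\<lparr>carrier := F n\<rparr>), cdif = cdif X\<rparr>"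

text \<open>
  Choosing coset representatives keeps the carrier of a quotient module in the original type, which
  \<open>Db\<close> requires.
\<close>
definition rep :: "('r, 'u) module \<Rightarrow> 'u set \<Rightarrow> 'u \<Rightarrow> 'u" where
  "rep M A x = (SOME y. y \<in> A +>\<^bsub>M\<^esub> x)"

definition mquot :: "('r, 'u) module \<Rightarrow> 'u set \<Rightarrow> ('r, 'u) module" where
  "mquot M A = \<lparr>carrier = rep M A ` carrier M, mult = (\<lambda>_ _. undefined), one = undefined,
     zero = rep M A \<zero>\<^bsub>M\<^esub>, add = (\<lambda>x y. rep M A (x \<oplus>\<^bsub>M\<^esub> y)), smult = (\<lambda>r x. rep M A (r \<odot>\<^bsub>M\<^esub> x))\<rparr>"

definition quot_cpx :: "('r, 'u) cpx \<Rightarrow> (int \<Rightarrow> 'u set) \<Rightarrow> ('r, 'u) cpx" where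
  "quot_cpx X F = \<lparr>cobj = (\<lambda>n. mquot (cobj X n) (F n)),
     cdif = (\<lambda>n x. rep (cobj X (n + 1)) (F (n + 1)) (cdif X n x))\<rparr>"

lemma cobj_zc [simp]: "cobj (zc M) n = M n" and cdif_zc [simp]: "cdif (zc M) n x = \<zero>\<^bsub>M (n + 1)\<^esub>"
  by (simp_all add: zc_def)

lemma cobj_sub_cpx [simp]: "cobj (sub_cpx X F) n = (cobj X n)\<lparr>carrier := F n\<rparr>"
  and cdif_sub_cpx [simp]: "cdif (sub_cpx X F) n x = cdif X n x"
  by (simp_all add: sub_cpx_def)

text \<open>The rule \<open>summand\<close> releases only the first summand; symmetry gives access
  to the second.\<close>

lemma direct_sum_obj_sym:
  assumes "direct_sum_obj T X Y P"
  shows "direct_sum_obj T Y X P"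
proof -
  obtain i j where ij: "i \<in> Hom T X P" "j \<in> Hom T Y P"
    and u: "\<forall>Z\<in>Ob T. \<forall>f\<in>Hom T X Z. \<forall>g\<in>Hom T Y Z. \<exists>!h. h \<in> Hom T P Z \<and> Cmp T h i = f \<and> Cmp T h j = g"
    using assms unfolding direct_sum_obj_def by (elim conjE bexE)
  have "\<forall>Z\<in>Ob T. \<forall>f\<in>Hom T Y Z. \<forall>g\<in>Hom T X Z. \<exists>!h. h \<in> Hom T P Z \<and> Cmp T h j = f \<and> Cmp T h i = g"
  proof (intro ballI)
    fix Z f g assume "Z \<in> Ob T" "f \<in> Hom T Y Z" "g \<in> Hom T X Z"
    then have "\<exists>!h. h \<in> Hom T P Z \<and> Cmp T h i = g \<and> Cmp T h j = f" using u by simp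
    then show "\<exists>!h. h \<in> Hom T P Z \<and> Cmp T h j = f \<and> Cmp T h i = g" by (simp add: conj_commute)
  qed
  with ij have "\<exists>i\<in>Hom T Y P. \<exists>j\<in>Hom T X P. \<forall>Z\<in>Ob T. \<forall>f\<in>Hom T Y Z. \<forall>g\<in>Hom T X Z.
      \<exists>!h. h \<in> Hom T P Z \<and> Cmp T h i = f \<and> Cmp T h j = g"
    by - (rule bexI[of _ j], rule bexI[of _ i])
  moreover have "X \<in> Ob T" "Y \<in> Ob T" "P \<in> Ob T" by (rule assms[unfolded direct_sum_obj_def, THEN conjunct1], rule assms[unfolded direct_sum_obj_def, THEN conjunct2, THEN conjunct1], rule assms[unfolded direct_sum_obj_def, THEN conjunct2, THEN conjunct2, THEN conjunct1])
  ultimately show ?thesis unfolding direct_sum_obj_def by (intro conjI)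
qed

text \<open>Every positive level is the closure of some class, so it inherits invariance under
  isomorphism and under shifts from \<open>generated\<close>.\<close>

lemma level_Suc_generated: "\<exists>\<Y>. level T \<X> (Suc n) = generated T \<Y>"
  by (cases n) auto

context fps_complexes
begin

section \<open>Closure properties of the levels\<close>

lemma generated_bcpx: "X \<in> generated (Db R) \<X> \<Longrightarrow> bcpx R X"
  by (induction rule: generated.induct) (simp_all add: zero_obj_def direct_sum_obj_def)

lemma generated_quasi_iso:
  fixes X Y :: "('k fps, 'k fps) cpx"
  assumes "bcpx R X" "bcpx R Y" "quasi_iso R X Y f"
  shows "X \<in> generated (Db R) \<X> \<longleftrightarrow> Y \<in> generated (Db R) \<X>"
proof
  show "Y \<in> generated (Db R) \<X>" if "X \<in> generated (Db R) \<X>"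
    by (rule generated.iso[OF that _ quasi_iso_iso_mor(2)[OF assms]]) (simp add: assms)
  show "X \<in> generated (Db R) \<X>" if "Y \<in> generated (Db R) \<X>"
    by (rule generated.iso[OF that _ quasi_iso_iso_mor(3)[OF assms]]) (simp add: assms)
qed

lemma generated_csum:
  assumes "X \<in> generated (Db R) \<X>" "Y \<in> generated (Db R) \<X>"
  shows "csum X Y \<in> generated (Db R) \<X>"
  by (rule generated.sum[OF assms direct_sum_csum]) (simp_all add: assms[THEN generated_bcpx])

lemma generated_summand:
  assumes "bcpx R X" "bcpx R Y" "csum X Y \<in> generated (Db R) \<X>"
  shows "X \<in> generated (Db R) \<X>" "Y \<in> generated (Db R) \<X>"
  by (rule generated.summand[OF assms(3) direct_sum_csum[OF assms(1,2)]],
      rule generated.summand[OF assms(3) direct_sum_obj_sym[OF direct_sum_csum[OF assms(1,2)]]])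

lemma generated_cshift:
  fixes X :: "('k fps, 'k fps) cpx"
  assumes "bcpx R X"
  shows "cshift X \<in> generated (Db R) \<X> \<longleftrightarrow> X \<in> generated (Db R) \<X>"
  using generated.shift[of X "Db R" \<X>] generated.unshift[of X "Db R" \<X>] assms by auto

lemma level_Suc_bcpx: "X \<in> level (Db R) \<X> (Suc n) \<Longrightarrow> bcpx R X"
  using level_Suc_generated[of "Db R" \<X> n] generated_bcpx by auto

lemma level_Suc_quasi_iso:
  fixes X Y :: "('k fps, 'k fps) cpx"
  assumes "bcpx R X" "bcpx R Y" "quasi_iso R X Y f"
  shows "X \<in> level (Db R) \<X> (Suc n) \<longleftrightarrow> Y \<in> level (Db R) \<X> (Suc n)"
  using level_Suc_generated[of "Db R" \<X> n] generated_quasi_iso[OF assms] by auto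

lemma level_Suc_cshift:
  fixes X :: "('k fps, 'k fps) cpx"
  assumes "bcpx R X"
  shows "cshift X \<in> level (Db R) \<X> (Suc n) \<longleftrightarrow> X \<in> level (Db R) \<X> (Suc n)"
  using level_Suc_generated[of "Db R" \<X> n] generated_cshift[OF assms] by auto

text \<open>\<open>star\<close> wants its object in the middle of a triangle, and that is the place
  of \<open>B\<close> in the triangle of the cone.\<close>

lemma level_cone:
  assumes A: "A \<in> generated (Db R) \<X>" and B: "bcpx R B" and f: "chain_map R A B f"
    and C: "cone A B f \<in> level (Db R) \<X> (Suc n)"
  shows "B \<in> level (Db R) \<X> (Suc (Suc n))"
proof -
  have "B \<in> star (Db R) (generated (Db R) \<X>) (level (Db R) \<X> (Suc n))"
    unfolding star_def mem_Collect_eq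
    by (intro bexI[OF _ A] bexI[OF _ C] exI) (rule cone_triangle[OF generated_bcpx[OF A] B f])
  then show ?thesis unfolding level.simps by (rule generated.base) (simp add: B)
qed

section \<open>Submodules and quotients\<close>

lemma submoduleD:
  assumes "module R M" "submodule A R M"
  shows "x \<in> A \<Longrightarrow> x \<in> carrier M" "\<zero>\<^bsub>M\<^esub> \<in> A" "x \<in> A \<Longrightarrow> y \<in> A \<Longrightarrow> x \<oplus>\<^bsub>M\<^esub> y \<in> A"
    "x \<in> A \<Longrightarrow> \<ominus>\<^bsub>M\<^esub> x \<in> A" "r \<in> carrier R \<Longrightarrow> x \<in> A \<Longrightarrow> r \<odot>\<^bsub>M\<^esub> x \<in> A"
proof -
  interpret M: module R M by fact
  note E = M.submoduleE[OF assms(2)]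
  show "x \<in> A \<Longrightarrow> x \<in> carrier M" "x \<in> A \<Longrightarrow> y \<in> A \<Longrightarrow> x \<oplus>\<^bsub>M\<^esub> y \<in> A"
    "x \<in> A \<Longrightarrow> \<ominus>\<^bsub>M\<^esub> x \<in> A" "r \<in> carrier R \<Longrightarrow> x \<in> A \<Longrightarrow> r \<odot>\<^bsub>M\<^esub> x \<in> A"
    using E by auto
  obtain a where a: "a \<in> A" using E(2) by blast
  have "a \<oplus>\<^bsub>M\<^esub> \<ominus>\<^bsub>M\<^esub> a \<in> A" by (rule E(5)[OF a E(3)[OF a]])
  moreover have "a \<in> carrier M" using a E(1) by blast
  ultimately show "\<zero>\<^bsub>M\<^esub> \<in> A" using assms(1) by simp
qed

lemma submoduleI:
  assumes M: "module R M" and "A \<subseteq> carrier M" "\<zero>\<^bsub>M\<^esub> \<in> A" "\<And>x y. x \<in> A \<Longrightarrow> y \<in> A \<Longrightarrow> x \<oplus>\<^bsub>M\<^esub> y \<in> A"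
    "\<And>r x. r \<in> carrier R \<Longrightarrow> x \<in> A \<Longrightarrow> r \<odot>\<^bsub>M\<^esub> x \<in> A"
  shows "submodule A R M"
proof -
  interpret M: module R M by fact
  have "\<ominus>\<^bsub>M\<^esub> x \<in> A" if "x \<in> A" for x
    using assms(5)[OF _ that, of "\<ominus>\<^bsub>R\<^esub> \<one>\<^bsub>R\<^esub>"] minus_smult[OF M, of x] that assms(2) by auto
  then show ?thesis by (rule M.submoduleI[OF assms(2,3) _ assms(4,5)])
qed

lemma submodule_module: "module R M \<Longrightarrow> submodule A R M \<Longrightarrow> module R (M\<lparr>carrier := A\<rparr>)"
  by (rule submodule.submodule_is_module)

text \<open>The inverse is determined by the whole record including its carrier, so its invariance
  under shrinking the carrier needs uniqueness of inverses.\<close>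

lemma minus_restrict:
  assumes "module R M" "submodule A R M" "x \<in> A"
  shows "\<ominus>\<^bsub>M\<lparr>carrier := A\<rparr>\<^esub> x = \<ominus>\<^bsub>M\<^esub> x"
  by (rule minus_unique[symmetric, OF submodule_module[OF assms(1,2)]])
    (use submoduleD[OF assms(1,2)] assms in simp_all)

lemma submodule_zero: "module R M \<Longrightarrow> submodule {\<zero>\<^bsub>M\<^esub>} R M"
  by (rule submoduleI) auto

lemma submodule_carrier: "module R M \<Longrightarrow> submodule (carrier M) R M"
  by (rule submoduleI) auto

lemma submodule_kernel:
  assumes "module R M" "module R N" "f \<in> mod_hom R M N"
  shows "submodule {x \<in> carrier M. f x = \<zero>\<^bsub>N\<^esub>} R M"
  by (rule submoduleI) (use assms hom_zero[OF assms] in \<open>auto simp: mod_hom_add mod_hom_smult\<close>)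

lemma submodule_vimage:
  assumes "module R M" "module R N" "f \<in> mod_hom R M N" "submodule A R M" "submodule B R N"
  shows "submodule {x \<in> A. f x \<in> B} R M"
  by (rule submoduleI) (use assms hom_zero[OF assms(1-3)] submoduleD[OF assms(1,4)] submoduleD[OF assms(2,5)] in
    \<open>auto simp: mod_hom_add[OF assms(3)] mod_hom_smult[OF assms(3)]\<close>)

lemma submodule_image:
  assumes "module R M" "module R N" "f \<in> mod_hom R M N" "submodule A R M"
  shows "submodule (f ` A) R N"
proof (rule submoduleI[OF assms(2)])
  note D = submoduleD[OF assms(1,4)]
  show "f ` A \<subseteq> carrier N" using D(1) mod_hom_closed[OF assms(3)] by auto
  show "\<zero>\<^bsub>N\<^esub> \<in> f ` A" using hom_zero[OF assms(1-3)] D(2) by (metis imageI)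
  fix x y assume "x \<in> f ` A" "y \<in> f ` A"
  then obtain a b where "a \<in> A" "b \<in> A" "x = f a" "y = f b" by blast
  then show "x \<oplus>\<^bsub>N\<^esub> y \<in> f ` A" using D by (simp flip: mod_hom_add[OF assms(3)])
next
  note D = submoduleD[OF assms(1,4)]
  fix r x assume "r \<in> carrier R" "x \<in> f ` A"
  then show "r \<odot>\<^bsub>N\<^esub> x \<in> f ` A" using D by (auto simp flip: mod_hom_smult[OF assms(3)])
qed

lemma fg_image:
  assumes M: "fg_module R M" and N: "module R N" and f: "f \<in> mod_hom R M N" and surj: "f ` carrier M = carrier N"
  shows "fg_module R N"
proof -
  have mM: "module R M" using M by (simp add: fg_module_def)
  obtain A where A: "finite A" "A \<subseteq> carrier M" "\<And>K. submodule K R M \<Longrightarrow> A \<subseteq> K \<Longrightarrow> K = carrier M"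
    using M unfolding fg_module_def by auto
  have "K = carrier N" if K: "submodule K R N" "f ` A \<subseteq> K" for K
  proof -
    have "{x \<in> carrier M. f x \<in> K} = carrier M"
      by (rule A(3)[OF submodule_vimage[OF mM N f submodule_carrier[OF mM] K(1)]]) (use A(2) K(2) in auto)
    then have "f ` carrier M \<subseteq> K" by auto
    then show ?thesis using surj submoduleD(1)[OF N K(1)] by auto
  qed
  then show ?thesis unfolding fg_module_def using A(1,2) N surj
    by (intro conjI exI[of _ "f ` A"]) auto
qed

lemma fg_iso:
  assumes M: "module R M" and N: "fg_module R N" and f: "f \<in> mod_hom R M N" "bij_betw f (carrier M) (carrier N)"
  shows "fg_module R M"
proof (rule fg_image[OF N M mod_hom_inverse[OF f M]])
  show "the_inv_into (carrier M) f ` carrier N = carrier M"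
    using bij_betw_the_inv_into[OF f(2)] by (simp add: bij_betw_def)
qed

lemma bij_betw_hom:
  assumes M: "module R M" and N: "module R N" and f: "f \<in> mod_hom R M N" and surj: "f ` carrier M = carrier N"
    and ker: "\<And>x. x \<in> carrier M \<Longrightarrow> f x = \<zero>\<^bsub>N\<^esub> \<Longrightarrow> x = \<zero>\<^bsub>M\<^esub>"
  shows "bij_betw f (carrier M) (carrier N)"
proof -
  have "x = y" if xy: "x \<in> carrier M" "y \<in> carrier M" "f x = f y" for x y
  proof (rule eq_if_diff_zero[OF M xy(1,2)], rule ker)
    show "x \<oplus>\<^bsub>M\<^esub> \<ominus>\<^bsub>M\<^esub> y \<in> carrier M" using M xy by simp
    show "f (x \<oplus>\<^bsub>M\<^esub> \<ominus>\<^bsub>M\<^esub> y) = \<zero>\<^bsub>N\<^esub>"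
      using M N xy mod_hom_closed[OF f xy(2)] by (simp add: mod_hom_add[OF f] hom_minus[OF M N f])
  qed
  then show ?thesis unfolding bij_betw_def inj_on_def using surj by blast
qed

lemma rep:
  assumes M: "module R M" and A: "submodule A R M" and x: "x \<in> carrier M"
  obtains a where "a \<in> A" "rep M A x = x \<oplus>\<^bsub>M\<^esub> a"
proof -
  note D = submoduleD[OF M A]
  have "x \<in> A +>\<^bsub>M\<^esub> x" using D(2) M x by (force simp: a_r_coset_def r_coset_def)
  then have "rep M A x \<in> A +>\<^bsub>M\<^esub> x" unfolding rep_def by (rule someI)
  then obtain a where "a \<in> A" "rep M A x = a \<oplus>\<^bsub>M\<^esub> x" by (auto simp: a_r_coset_def r_coset_def)
  then show thesis using that a_comm[OF M _ x] D(1) by metis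
qed

lemma rep_cong:
  assumes M: "module R M" and A: "submodule A R M" and x: "x \<in> carrier M" and a: "a \<in> A"
  shows "rep M A (x \<oplus>\<^bsub>M\<^esub> a) = rep M A x"
proof -
  note D = submoduleD[OF M A]
  have "A +>\<^bsub>M\<^esub> (x \<oplus>\<^bsub>M\<^esub> a) = A +>\<^bsub>M\<^esub> x"
  proof (rule Set.set_eqI)
    have "\<exists>c\<in>A. b \<oplus>\<^bsub>M\<^esub> (x \<oplus>\<^bsub>M\<^esub> a) = c \<oplus>\<^bsub>M\<^esub> x" if "b \<in> A" for b
      using M a x that D by (intro bexI[of _ "b \<oplus>\<^bsub>M\<^esub> a"]) (simp_all add: group_ac)
    moreover have "\<exists>c\<in>A. b \<oplus>\<^bsub>M\<^esub> x = c \<oplus>\<^bsub>M\<^esub> (x \<oplus>\<^bsub>M\<^esub> a)" if "b \<in> A" for b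
      using M a x that D by (intro bexI[of _ "b \<oplus>\<^bsub>M\<^esub> \<ominus>\<^bsub>M\<^esub> a"]) (simp_all add: group_ac)
    ultimately show "y \<in> A +>\<^bsub>M\<^esub> (x \<oplus>\<^bsub>M\<^esub> a) \<longleftrightarrow> y \<in> A +>\<^bsub>M\<^esub> x" for y
      unfolding a_r_coset_def r_coset_def by auto
  qed
  then show ?thesis by (simp add: rep_def)
qed

lemma rep_eq_iff:
  assumes M: "module R M" and A: "submodule A R M" and x: "x \<in> carrier M" and y: "y \<in> carrier M"
  shows "rep M A x = rep M A y \<longleftrightarrow> x \<oplus>\<^bsub>M\<^esub> \<ominus>\<^bsub>M\<^esub> y \<in> A"
proof
  note D = submoduleD[OF M A]
  {
    assume eq: "rep M A x = rep M A y"
    obtain a where a: "a \<in> A" "rep M A x = x \<oplus>\<^bsub>M\<^esub> a" by (rule rep[OF M A x])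
    obtain b where b: "b \<in> A" "rep M A y = y \<oplus>\<^bsub>M\<^esub> b" by (rule rep[OF M A y])
    have "x = (x \<oplus>\<^bsub>M\<^esub> a) \<oplus>\<^bsub>M\<^esub> \<ominus>\<^bsub>M\<^esub> a" using M x D(1)[OF a(1)] by (simp add: group_ac)
    also have "\<dots> = (y \<oplus>\<^bsub>M\<^esub> b) \<oplus>\<^bsub>M\<^esub> \<ominus>\<^bsub>M\<^esub> a" using eq a b by simp
    finally have "x \<oplus>\<^bsub>M\<^esub> \<ominus>\<^bsub>M\<^esub> y = b \<oplus>\<^bsub>M\<^esub> \<ominus>\<^bsub>M\<^esub> a" using M y D(1)[OF a(1)] D(1)[OF b(1)] by (simp add: group_ac)
    then show "x \<oplus>\<^bsub>M\<^esub> \<ominus>\<^bsub>M\<^esub> y \<in> A" using a(1) b(1) D by simp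
  }
  assume "x \<oplus>\<^bsub>M\<^esub> \<ominus>\<^bsub>M\<^esub> y \<in> A"
  from rep_cong[OF M A y this] show "rep M A x = rep M A y" using M x y by (simp add: group_ac)
qed

lemma rep_zero_iff:
  assumes M: "module R M" and A: "submodule A R M" and x: "x \<in> carrier M"
  shows "rep M A x = rep M A \<zero>\<^bsub>M\<^esub> \<longleftrightarrow> x \<in> A"
  using rep_eq_iff[OF M A x, of "\<zero>\<^bsub>M\<^esub>"] M x by simp

lemma rep_add:
  assumes M: "module R M" and A: "submodule A R M" and x: "x \<in> carrier M" and y: "y \<in> carrier M"
  shows "rep M A (rep M A x \<oplus>\<^bsub>M\<^esub> rep M A y) = rep M A (x \<oplus>\<^bsub>M\<^esub> y)"
proof -
  note D = submoduleD[OF M A]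
  obtain a where a: "a \<in> A" "rep M A x = x \<oplus>\<^bsub>M\<^esub> a" by (rule rep[OF M A x])
  obtain b where b: "b \<in> A" "rep M A y = y \<oplus>\<^bsub>M\<^esub> b" by (rule rep[OF M A y])
  have "rep M A x \<oplus>\<^bsub>M\<^esub> rep M A y = (x \<oplus>\<^bsub>M\<^esub> y) \<oplus>\<^bsub>M\<^esub> (a \<oplus>\<^bsub>M\<^esub> b)"
    using M x y D(1)[OF a(1)] D(1)[OF b(1)] by (simp add: a b group_ac)
  then show ?thesis using rep_cong[OF M A, of "x \<oplus>\<^bsub>M\<^esub> y" "a \<oplus>\<^bsub>M\<^esub> b"] M x y a(1) b(1) D by simp
qed

lemma rep_smult:
  assumes M: "module R M" and A: "submodule A R M" and x: "x \<in> carrier M" and r: "r \<in> carrier R"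
  shows "rep M A (r \<odot>\<^bsub>M\<^esub> rep M A x) = rep M A (r \<odot>\<^bsub>M\<^esub> x)"
proof -
  note D = submoduleD[OF M A]
  obtain a where a: "a \<in> A" "rep M A x = x \<oplus>\<^bsub>M\<^esub> a" by (rule rep[OF M A x])
  show ?thesis using M x r D(1)[OF a(1)] rep_cong[OF M A, of "r \<odot>\<^bsub>M\<^esub> x" "r \<odot>\<^bsub>M\<^esub> a"] D(5)[OF r a(1)]
    by (simp add: a smult_r_distr)
qed

lemma module_mquot:
  assumes M: "module R M" and A: "submodule A R M"
  shows "module R (mquot M A)"
proof -
  interpret M: module R M by fact
  have [simp]: "carrier (mquot M A) = rep M A ` carrier M" "\<zero>\<^bsub>mquot M A\<^esub> = rep M A \<zero>\<^bsub>M\<^esub>"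
    by (simp_all add: mquot_def)
  have ad [simp]: "rep M A x \<oplus>\<^bsub>mquot M A\<^esub> rep M A y = rep M A (x \<oplus>\<^bsub>M\<^esub> y)"
    if "x \<in> carrier M" "y \<in> carrier M" for x y
    using rep_add[OF M A that] by (simp add: mquot_def)
  have sm [simp]: "r \<odot>\<^bsub>mquot M A\<^esub> rep M A x = rep M A (r \<odot>\<^bsub>M\<^esub> x)"
    if "x \<in> carrier M" "r \<in> carrier R" for r x
    using rep_smult[OF M A that] by (simp add: mquot_def)
  have ab: "abelian_group (mquot M A)"
  proof (rule abelian_groupI, goal_cases)
    case (6 x)
    then obtain y where y: "y \<in> carrier M" "x = rep M A y" by auto
    then show ?case by (intro bexI[of _ "rep M A (\<ominus>\<^bsub>M\<^esub> y)"]) (simp_all add: M)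
  qed (use M in \<open>auto simp: group_ac\<close>)
  show ?thesis
    by (rule moduleI[OF cring_R ab]) (use M in \<open>auto simp: M.smult_l_distr smult_r_distr M.smult_assoc1\<close>)
qed

lemma rep_hom:
  assumes M: "module R M" and A: "submodule A R M"
  shows "rep M A \<in> mod_hom R M (mquot M A)"
  using rep_add[OF M A] rep_smult[OF M A] by (intro mod_homI) (simp_all add: mquot_def)

lemma fg_mquot:
  assumes M: "fg_module R M" and A: "submodule A R M"
  shows "fg_module R (mquot M A)"
proof -
  have m: "module R M" using M by (simp add: fg_module_def)
  show ?thesis by (rule fg_image[OF M module_mquot[OF m A] rep_hom[OF m A]]) (simp add: mquot_def)
qed

section \<open>Subcomplexes, quotient complexes and short exact sequences\<close>

text \<open>Finite generation of the pieces is left to the caller: in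
  \<open>filtration_level\<close> it comes from an isomorphism with a power of some
  \<open>D i\<close>, in \<open>bcpx_level\<close> from \<open>lattice_fg\<close>.\<close>

lemma bcpx_sub_cpx:
  assumes X: "bcpx R X" and F: "\<And>n. submodule (F n) R (cobj X n)"
    and fg: "\<And>n. fg_module R ((cobj X n)\<lparr>carrier := F n\<rparr>)"
    and d: "\<And>n x. x \<in> F n \<Longrightarrow> cdif X n x \<in> F (n + 1)"
  shows "bcpx R (sub_cpx X F)"
proof -
  obtain b where b: "\<And>n. b < \<bar>n\<bar> \<Longrightarrow> carrier (cobj X n) = {\<zero>\<^bsub>cobj X n\<^esub>}"
    by (rule bcpx_bound[OF X]) blast
  have D: "x \<in> carrier (cobj X n)" if "x \<in> F n" for x n using submoduleD(1)[OF bcpx_module[OF X] F that] .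
  have z: "\<zero>\<^bsub>cobj X n\<^esub> \<in> F n" for n using submoduleD(2)[OF bcpx_module[OF X] F] .
  show ?thesis
  proof (rule bcpxI[of _ b])
    show "cdif (sub_cpx X F) n \<in> mod_hom R (cobj (sub_cpx X F) n) (cobj (sub_cpx X F) (n + 1))" for n
      by (rule mod_homI) (simp_all add: d D X)
    show "carrier (cobj (sub_cpx X F) n) = {\<zero>\<^bsub>cobj (sub_cpx X F) n\<^esub>}" if "b < \<bar>n\<bar>" for n
    proof -
      have "F n \<subseteq> carrier (cobj X n)" using D by (rule subsetI)
      then show ?thesis using z[of n] unfolding b[OF that] by auto
    qed
  qed (simp_all add: fg D X)
qed

lemma chain_map_sub_cpx:
  assumes X: "bcpx R X" and F: "\<And>n. submodule (F n) R (cobj X n)"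
  shows "chain_map R (sub_cpx X F) X (\<lambda>_ x. x)"
  by (rule chain_mapI, rule mod_homI) (use submoduleD(1)[OF bcpx_module[OF X] F] in simp_all)

lemma bcpx_quot_cpx:
  assumes X: "bcpx R X" and F: "\<And>n. submodule (F n) R (cobj X n)"
    and d: "\<And>n x. x \<in> F n \<Longrightarrow> cdif X n x \<in> F (n + 1)"
  shows "bcpx R (quot_cpx X F)" "chain_map R X (quot_cpx X F) (\<lambda>n. rep (cobj X n) (F n))"
proof -
  obtain b where b: "\<And>n. b < \<bar>n\<bar> \<Longrightarrow> carrier (cobj X n) = {\<zero>\<^bsub>cobj X n\<^esub>}"
    by (rule bcpx_bound[OF X]) blast
  note m = bcpx_module[OF X]
  let ?rp = "\<lambda>n. rep (cobj X n) (F n)"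
  have rd: "?rp (n + 1) (cdif X n (?rp n x)) = ?rp (n + 1) (cdif X n x)" if x: "x \<in> carrier (cobj X n)" for n x
  proof -
    obtain a where a: "a \<in> F n" "?rp n x = x \<oplus>\<^bsub>cobj X n\<^esub> a" by (rule rep[OF m F x])
    show ?thesis using submoduleD(1)[OF m F a(1)] x X
      by (simp add: a rep_cong[OF m F _ d[OF a(1)]])
  qed
  have c: "cobj (quot_cpx X F) n = mquot (cobj X n) (F n)" for n by (simp add: quot_cpx_def)
  have q: "cdif (quot_cpx X F) n (?rp n x) = ?rp (n + 1) (cdif X n x)" if "x \<in> carrier (cobj X n)" for n x
    using rd[OF that] by (simp add: quot_cpx_def)
  have car: "carrier (cobj (quot_cpx X F) n) = ?rp n ` carrier (cobj X n)" for n by (simp add: c mquot_def)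
  have hom: "?rp n \<in> mod_hom R (cobj X n) (cobj (quot_cpx X F) n)" for n
    unfolding c by (rule rep_hom[OF m F])
  have z: "\<zero>\<^bsub>cobj (quot_cpx X F) n\<^esub> = ?rp n \<zero>\<^bsub>cobj X n\<^esub>" for n by (simp add: c mquot_def)
  show "bcpx R (quot_cpx X F)"
  proof (rule bcpxI[of _ b])
    show "fg_module R (cobj (quot_cpx X F) n)" for n unfolding c by (rule fg_mquot[OF bcpx_fg[OF X] F])
    show "cdif (quot_cpx X F) n \<in> mod_hom R (cobj (quot_cpx X F) n) (cobj (quot_cpx X F) (n + 1))" for n
    proof (rule mod_homI)
      fix x assume "x \<in> carrier (cobj (quot_cpx X F) n)"
      then show "cdif (quot_cpx X F) n x \<in> carrier (cobj (quot_cpx X F) (n + 1))"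
        using X by (auto simp: car q)
    next
      fix x y assume "x \<in> carrier (cobj (quot_cpx X F) n)" "y \<in> carrier (cobj (quot_cpx X F) n)"
      then obtain a b where "a \<in> carrier (cobj X n)" "b \<in> carrier (cobj X n)" "x = ?rp n a" "y = ?rp n b"
        by (auto simp: car)
      then show "cdif (quot_cpx X F) n (x \<oplus>\<^bsub>cobj (quot_cpx X F) n\<^esub> y) =
         cdif (quot_cpx X F) n x \<oplus>\<^bsub>cobj (quot_cpx X F) (n + 1)\<^esub> cdif (quot_cpx X F) n y"
        using X by (simp add: q mod_hom_add[OF hom, symmetric])
    next
      fix r x assume "r \<in> carrier R" "x \<in> carrier (cobj (quot_cpx X F) n)"
      then show "cdif (quot_cpx X F) n (r \<odot>\<^bsub>cobj (quot_cpx X F) n\<^esub> x) =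
         r \<odot>\<^bsub>cobj (quot_cpx X F) (n + 1)\<^esub> cdif (quot_cpx X F) n x"
        using X by (auto simp: q car mod_hom_smult[OF hom, symmetric])
    qed
    show "cdif (quot_cpx X F) (n + 1) (cdif (quot_cpx X F) n x) = \<zero>\<^bsub>cobj (quot_cpx X F) (n + 1 + 1)\<^esub>"
      if "x \<in> carrier (cobj (quot_cpx X F) n)" for n x
      using that X q[of _ "n + 1"] by (auto simp: car q z)
    show "carrier (cobj (quot_cpx X F) n) = {\<zero>\<^bsub>cobj (quot_cpx X F) n\<^esub>}" if "b < \<bar>n\<bar>" for n
      using b[OF that] by (simp add: car z)
  qed
  show "chain_map R X (quot_cpx X F) ?rp"
    by (rule chain_mapI[OF hom]) (simp add: q)
qed

text \<open>For a short exact sequence \<open>0 -> K -> X -> Y -> 0\<close> the cone of the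
  inclusion is a model of the quotient \<open>Y\<close>.\<close>

lemma quasi_iso_ses:
  assumes X [simp]: "bcpx R X" and Y [simp]: "bcpx R Y" and g: "chain_map R X Y g"
    and surj: "\<And>n. g n ` carrier (cobj X n) = carrier (cobj Y n)"
    and K_def: "\<And>n. K n = {x \<in> carrier (cobj X n). g n x = \<zero>\<^bsub>cobj Y n\<^esub>}"
    and K [simp]: "bcpx R (sub_cpx X K)"
  shows "quasi_iso R (cone (sub_cpx X K) X (\<lambda>_ x. x)) Y (\<lambda>n p. g n (fps_snd p))"
proof -
  have smK: "submodule (K n) R (cobj X n)" for n
    unfolding K_def by (rule submodule_kernel) (simp_all add: chain_map_hom[OF g])
  note i = chain_map_sub_cpx[OF X smK]
  have mK: "\<ominus>\<^bsub>(cobj X n)\<lparr>carrier := K n\<rparr>\<^esub> x = \<ominus>\<^bsub>cobj X n\<^esub> x" if "x \<in> K n" for n x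
    by (rule minus_restrict[OF _ smK that]) simp
  have Kc: "x \<in> carrier (cobj X n)" if "x \<in> K n" for x n using that by (simp add: K_def)
  note [simp] = chain_map_simps[OF X Y g] cdif_pred[OF X] cdif_pred[OF Y]
  have dK: "cdif X n x \<in> K (n + 1)" if "x \<in> K n" for n x
    using that by (simp add: K_def)
  let ?C = "cone (sub_cpx X K) X (\<lambda>_ x. x)"
  have C [simp]: "bcpx R ?C" by (rule bcpx_cone[OF K X i])
  have Cd: "cdif ?C n (fps_pair k x) = fps_pair (\<ominus>\<^bsub>cobj X (n + 2)\<^esub> cdif X (n + 1) k) (k \<oplus>\<^bsub>cobj X (n + 1)\<^esub> cdif X n x)"
    if "k \<in> K (n + 1)" for n k x
    using mK[of "cdif X (n + 1) k" "n + 2"] dK[OF that] by simp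
  have Cc: "fps_pair k x \<in> carrier (cobj ?C n) \<longleftrightarrow> k \<in> K (n + 1) \<and> x \<in> carrier (cobj X n)" for n k x by simp
  show ?thesis
  proof (rule quasi_isoI[OF C Y])
    show "chain_map R ?C Y (\<lambda>n p. g n (fps_snd p))"
    proof (rule chain_mapI)
      show "(\<lambda>p. g n (fps_snd p)) \<in> mod_hom R (cobj ?C n) (cobj Y n)" for n
        by (simp add: mod_hom_comp[OF mod_hom_snd chain_map_hom[OF g]])
      show "g (n + 1) (fps_snd (cdif ?C n p)) = cdif Y n (g n (fps_snd p))" if "p \<in> carrier (cobj ?C n)" for n p
        using that by (auto simp: K_def elim!: mod_sum_cases)
    qed
  next
    fix n y assume y: "y \<in> carrier (cobj Y n)" "cdif Y n y = \<zero>\<^bsub>cobj Y (n + 1)\<^esub>"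
    obtain x where x: "x \<in> carrier (cobj X n)" "y = g n x" using surj[of n] y(1) by auto
    \<comment> \<open>A lift \<open>x\<close> of a cocycle of \<open>Y\<close> is a cocycle only
      modulo \<open>K\<close>. Its boundary lies in \<open>K\<close>, and the negated boundary in
      the first component completes \<open>x\<close> to a cocycle of the cone.\<close>
    have gd: "g (n + 1) (cdif X n x) = \<zero>\<^bsub>cobj Y (n + 1)\<^esub>" using x y(2) by simp
    have k: "\<ominus>\<^bsub>cobj X (n + 1)\<^esub> cdif X n x \<in> K (n + 1)" using x(1) gd by (simp add: K_def del: chain_map_simps(6)[OF X Y g])
    show "\<exists>p\<in>carrier (cobj ?C n). cdif ?C n p = \<zero>\<^bsub>cobj ?C (n + 1)\<^esub> \<and>
         (\<exists>z\<in>carrier (cobj Y (n - 1)). y = g n (fps_snd p) \<oplus>\<^bsub>cobj Y n\<^esub> cdif Y (n - 1) z)"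
    proof (rule bexI[of _ "fps_pair (\<ominus>\<^bsub>cobj X (n + 1)\<^esub> cdif X n x) x"], rule conjI)
      show "fps_pair (\<ominus>\<^bsub>cobj X (n + 1)\<^esub> cdif X n x) x \<in> carrier (cobj ?C n)" unfolding Cc using k x by simp
      show "cdif ?C n (fps_pair (\<ominus>\<^bsub>cobj X (n + 1)\<^esub> cdif X n x) x) = \<zero>\<^bsub>cobj ?C (n + 1)\<^esub>"
        unfolding Cd[OF k] using x(1) by simp
      show "\<exists>z\<in>carrier (cobj Y (n - 1)). y = g n (fps_snd (fps_pair (\<ominus>\<^bsub>cobj X (n + 1)\<^esub> cdif X n x) x)) \<oplus>\<^bsub>cobj Y n\<^esub> cdif Y (n - 1) z"
        by (rule bexI[of _ "\<zero>\<^bsub>cobj Y (n - 1)\<^esub>"]) (simp_all add: x)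
    qed
  next
    fix n p z assume p: "p \<in> carrier (cobj ?C n)" "cdif ?C n p = \<zero>\<^bsub>cobj ?C (n + 1)\<^esub>"
      and z: "z \<in> carrier (cobj Y (n - 1))" "g n (fps_snd p) = cdif Y (n - 1) z"
    obtain k x where kx: "k \<in> K (n + 1)" "x \<in> carrier (cobj X n)" "p = fps_pair k x"
      using p(1) by (auto elim: mod_sum_cases)
    have "k \<oplus>\<^bsub>cobj X (n + 1)\<^esub> cdif X n x = \<zero>\<^bsub>cobj X (n + 1)\<^esub>"
      using p(2) unfolding kx(3) Cd[OF kx(1)] by simp
    then have k: "k = \<ominus>\<^bsub>cobj X (n + 1)\<^esub> cdif X n x"
      using minus_unique[of "cobj X (n + 1)" "cdif X n x" k] kx Kc[OF kx(1)] by (simp add: a_comm)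
    obtain x0 where x0: "x0 \<in> carrier (cobj X (n - 1))" "z = g (n - 1) x0" using surj[of "n - 1"] z(1) by auto
    let ?k0 = "x \<oplus>\<^bsub>cobj X n\<^esub> \<ominus>\<^bsub>cobj X n\<^esub> cdif X (n - 1) x0"
    have k0: "?k0 \<in> K (n - 1 + 1)"
      using kx(2,3) x0 z(2) chain_map_simps(6)[OF X Y g x0(1), of n] by (simp add: K_def)
    have "p = cdif ?C (n - 1) (fps_pair ?k0 x0)"
      unfolding Cd[OF k0] kx(3) k using kx(2) x0(1) by (simp add: group_ac)
    then show "\<exists>w\<in>carrier (cobj ?C (n - 1)). p = cdif ?C (n - 1) w"
      by (rule bexI) (unfold Cc, use k0 x0 in simp)
  qed
qed

text \<open>Collapsing the acyclic complex \<open>X\<close> leaves only the shifted \<open>K\<close>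
  of the cone. In elements: a cocycle of \<open>K\<close> is the boundary of some \<open>x\<close>
  in \<open>X\<close>, and \<open>-x\<close> completes it to a cocycle of the cone.\<close>

lemma quasi_iso_cone_acyclic:
  assumes X [simp]: "bcpx R X" and K [simp]: "bcpx R (sub_cpx X K)" and ac: "acyclic X"
    and smK: "\<And>n. submodule (K n) R (cobj X n)"
  shows "quasi_iso R (cone (sub_cpx X K) X (\<lambda>_ x. x)) (cshift (sub_cpx X K)) cone_prj"
proof -
  note i = chain_map_sub_cpx[OF X smK]
  have mK: "\<ominus>\<^bsub>(cobj X n)\<lparr>carrier := K n\<rparr>\<^esub> x = \<ominus>\<^bsub>cobj X n\<^esub> x" if "x \<in> K n" for n x
    by (rule minus_restrict[OF _ smK that]) simp
  have Kc: "x \<in> carrier (cobj X n)" if "x \<in> K n" for x n using submoduleD(1)[OF _ smK that] by simp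
  have dK: "cdif X n x \<in> K (n + 1)" if "x \<in> K n" for n x
    using cdif_closed[OF K, of x n "n + 1"] that by simp
  note [simp] = cdif_pred[OF X]
  let ?C = "cone (sub_cpx X K) X (\<lambda>_ x. x)" and ?S = "cshift (sub_cpx X K)"
  have C [simp]: "bcpx R ?C" by (rule bcpx_cone[OF K X i])
  have Cd: "cdif ?C n (fps_pair k x) = fps_pair (\<ominus>\<^bsub>cobj X (n + 2)\<^esub> cdif X (n + 1) k) (k \<oplus>\<^bsub>cobj X (n + 1)\<^esub> cdif X n x)"
    if "k \<in> K (n + 1)" for n k x
    using mK[of "cdif X (n + 1) k" "n + 2"] dK[OF that] by simp
  have Sd: "cdif ?S n k = \<ominus>\<^bsub>cobj X (n + 2)\<^esub> cdif X (n + 1) k" if "k \<in> K (n + 1)" for n k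
    using mK[of "cdif X (n + 1) k" "n + 2"] dK[OF that] by simp
  have Cc: "fps_pair k x \<in> carrier (cobj ?C n) \<longleftrightarrow> k \<in> K (n + 1) \<and> x \<in> carrier (cobj X n)" for n k x by simp
  show ?thesis
  proof (rule quasi_isoI[OF C bcpx_cshift[OF K] chain_map_cone_prj[OF K X i]])
    fix n k assume k0: "k \<in> carrier (cobj ?S n)" "cdif ?S n k = \<zero>\<^bsub>cobj ?S (n + 1)\<^esub>"
    have k: "k \<in> K (n + 1)" using k0 by simp
    have mdk: "\<ominus>\<^bsub>cobj X (n + 2)\<^esub> cdif X (n + 1) k = \<zero>\<^bsub>cobj X (n + 2)\<^esub>" using k0(2) unfolding Sd[OF k] by simp
    then have dk: "cdif X (n + 1) k = \<zero>\<^bsub>cobj X (n + 1 + 1)\<^esub>"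
      using minus_minus[of "cobj X (n + 2)" "cdif X (n + 1) k"] Kc[OF k] by simp
    obtain x where x: "x \<in> carrier (cobj X n)" "k = cdif X n x"
      using acyclicD[OF ac Kc[OF k] dk] by auto
    let ?p = "fps_pair k (\<ominus>\<^bsub>cobj X n\<^esub> x)"
    show "\<exists>p\<in>carrier (cobj ?C n). cdif ?C n p = \<zero>\<^bsub>cobj ?C (n + 1)\<^esub> \<and>
         (\<exists>z\<in>carrier (cobj ?S (n - 1)). k = cone_prj n p \<oplus>\<^bsub>cobj ?S n\<^esub> cdif ?S (n - 1) z)"
    proof (rule bexI[of _ ?p], rule conjI)
      show "?p \<in> carrier (cobj ?C n)" unfolding Cc using k x by simp
      show "cdif ?C n ?p = \<zero>\<^bsub>cobj ?C (n + 1)\<^esub>" unfolding Cd[OF k] mdk using x by simp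
      have z: "\<zero>\<^bsub>cobj X n\<^esub> \<in> K (n - 1 + 1)" using submoduleD(2)[OF _ smK[of n]] by simp
      show "\<exists>z\<in>carrier (cobj ?S (n - 1)). k = cone_prj n ?p \<oplus>\<^bsub>cobj ?S n\<^esub> cdif ?S (n - 1) z"
        by (rule bexI[of _ "\<zero>\<^bsub>cobj X n\<^esub>"], unfold Sd[OF z]) (use z Kc[OF k] in \<open>simp_all add: cone_prj_def\<close>)
    qed
  next
    fix n p z assume p: "p \<in> carrier (cobj ?C n)" "cdif ?C n p = \<zero>\<^bsub>cobj ?C (n + 1)\<^esub>"
      and z: "z \<in> carrier (cobj ?S (n - 1))" "cone_prj n p = cdif ?S (n - 1) z"
    obtain k x where kx: "k \<in> K (n + 1)" "x \<in> carrier (cobj X n)" "p = fps_pair k x"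
      using p(1) by (auto elim: mod_sum_cases)
    have z1: "z \<in> K (n - 1 + 1)" using z(1) by simp
    have kz: "k = \<ominus>\<^bsub>cobj X (n + 1)\<^esub> cdif X n z" using z(2) unfolding Sd[OF z1] kx(3) by (simp add: cone_prj_def)
    have zc: "z \<in> carrier (cobj X n)" using Kc[OF z1] by simp
    have "k \<oplus>\<^bsub>cobj X (n + 1)\<^esub> cdif X n x = \<zero>\<^bsub>cobj X (n + 1)\<^esub>"
      using p(2) unfolding kx(3) Cd[OF kx(1)] by simp
    then have "cdif X n (x \<oplus>\<^bsub>cobj X n\<^esub> \<ominus>\<^bsub>cobj X n\<^esub> z) = \<zero>\<^bsub>cobj X (n + 1)\<^esub>"
      using kx(2) zc by (simp add: kz a_comm)
    then obtain q where q: "q \<in> carrier (cobj X (n - 1))" "x \<oplus>\<^bsub>cobj X n\<^esub> \<ominus>\<^bsub>cobj X n\<^esub> z = cdif X (n - 1) q"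
      using acyclicD[OF ac, of "x \<oplus>\<^bsub>cobj X n\<^esub> \<ominus>\<^bsub>cobj X n\<^esub> z" n] kx(2) zc by auto
    have "p = cdif ?C (n - 1) (fps_pair z q)"
      unfolding Cd[OF z1] kx(3) using kx(2) zc q(1) by (simp add: kz group_ac flip: q(2))
    then show "\<exists>w\<in>carrier (cobj ?C (n - 1)). p = cdif ?C (n - 1) w"
      by (rule bexI) (unfold Cc, use z1 q in simp)
  qed
qed

text \<open>One step of a filtration: \<open>level_cone\<close> applied to the inclusion of the
  kernel, with its cone replaced by the quotient \<open>Y\<close>.\<close>

lemma level_ses:
  assumes X: "bcpx R X" and Y: "Y \<in> level (Db R) \<X> (Suc m)" and g: "chain_map R X Y g"
    and surj: "\<And>n. g n ` carrier (cobj X n) = carrier (cobj Y n)"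
    and K: "\<And>n. K n = {x \<in> carrier (cobj X n). g n x = \<zero>\<^bsub>cobj Y n\<^esub>}"
    and gen: "sub_cpx X K \<in> generated (Db R) \<X>"
  shows "X \<in> level (Db R) \<X> (Suc (Suc m))"
proof -
  note Yb = level_Suc_bcpx[OF Y] and Kb = generated_bcpx[OF gen]
  have smK: "submodule (K n) R (cobj X n)" for n
    unfolding K by (rule submodule_kernel) (simp_all add: chain_map_hom[OF g] X Yb)
  note i = chain_map_sub_cpx[OF X smK]
  note q = quasi_iso_ses[OF X Yb g surj K Kb]
  show ?thesis
    by (rule level_cone[OF gen X i]) (use level_Suc_quasi_iso[OF bcpx_cone[OF Kb X i] Yb q] Y in simp)
qed

text \<open>The dimension shift: the same cone is a model of \<open>Y\<close> by
  \<open>quasi_iso_ses\<close> and of the shift of \<open>K\<close> by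
  \<open>quasi_iso_cone_acyclic\<close>, and positive levels are closed under shifts in both
  directions.\<close>

lemma level_acyclic_cover:
  assumes X: "bcpx R X" and Y: "bcpx R Y" and g: "chain_map R X Y g"
    and surj: "\<And>n. g n ` carrier (cobj X n) = carrier (cobj Y n)"
    and K: "\<And>n. K n = {x \<in> carrier (cobj X n). g n x = \<zero>\<^bsub>cobj Y n\<^esub>}"
    and ac: "acyclic X" and lev: "sub_cpx X K \<in> level (Db R) \<X> (Suc m)"
  shows "Y \<in> level (Db R) \<X> (Suc m)"
proof -
  note Kb = level_Suc_bcpx[OF lev]
  have smK: "submodule (K n) R (cobj X n)" for n
    unfolding K by (rule submodule_kernel) (simp_all add: chain_map_hom[OF g] X Y)
  note i = chain_map_sub_cpx[OF X smK]
  note q = quasi_iso_ses[OF X Y g surj K Kb] and q' = quasi_iso_cone_acyclic[OF X Kb ac smK]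
  show ?thesis
    using lev level_Suc_cshift[OF Kb] level_Suc_quasi_iso[OF bcpx_cone[OF Kb X i] Y q]
      level_Suc_quasi_iso[OF bcpx_cone[OF Kb X i] bcpx_cshift[OF Kb] q'] by simp
qed

end

text \<open>For \<open>A\<close> inside \<open>B\<close> this says that \<open>B / A\<close> is a
  finite power of \<open>D\<close>. A surjection with kernel \<open>A\<close> stands in for the
  quotient, so no coset representatives have to be chosen.\<close>

definition free_quot :: "('r, 'a) ring_scheme \<Rightarrow> ('r, 'k::zero fps) module \<Rightarrow> ('r, 'k fps) module \<Rightarrow>
    'k fps set \<Rightarrow> 'k fps set \<Rightarrow> bool" where
  "free_quot R D M B A \<longleftrightarrow> (\<exists>r. \<exists>\<theta>\<in>mod_hom R (M\<lparr>carrier := B\<rparr>) (frk D r).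
     \<theta> ` B = carrier (frk D r) \<and> (\<forall>x\<in>B. \<theta> x = \<zero>\<^bsub>frk D r\<^esub> \<longleftrightarrow> x \<in> A))"

lemma free_quotE:
  assumes "free_quot R D M B A"
  obtains r \<theta> where "\<theta> \<in> mod_hom R (M\<lparr>carrier := B\<rparr>) (frk D r)" "\<theta> ` B = carrier (frk D r)"
    "\<forall>x\<in>B. \<theta> x = \<zero>\<^bsub>frk D r\<^esub> \<longleftrightarrow> x \<in> A"
  using assms unfolding free_quot_def by (elim exE bexE conjE) simp

lemma free_quotI:
  assumes "\<theta> \<in> mod_hom R (M\<lparr>carrier := B\<rparr>) (frk D r)" "\<theta> ` B = carrier (frk D r)"
    "\<And>x. x \<in> B \<Longrightarrow> \<theta> x = \<zero>\<^bsub>frk D r\<^esub> \<longleftrightarrow> x \<in> A"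
  shows "free_quot R D M B A"
  unfolding free_quot_def by (intro exI[of _ r] bexI[OF _ assms(1)] conjI assms(2) ballI assms(3))

context fps_complexes
begin

section \<open>Filtrations with zero differential on the subquotients\<close>

lemma fg_frk: "fg_module R D \<Longrightarrow> fg_module R (frk D r)"
  by (induction r) (simp_all add: fg_zero_mod[OF cring_R] fg_mod_sum)

lemma module_frk [simp]:
  fixes D :: "('k fps, 'k fps) module"
  shows "module R D \<Longrightarrow> module R (frk D r)"
  by (induction r) simp_all

lemma bcpx_zc:
  assumes "\<And>n. fg_module R (M n)" "\<And>n. b < \<bar>n\<bar> \<Longrightarrow> carrier (M n) = {\<zero>\<^bsub>M n\<^esub>}"
  shows "bcpx R (zc M)"
proof (rule bcpxI[of _ b])
  have m: "module R (M n)" for n using assms(1) by (simp add: fg_module_def)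
  show "cdif (zc M) n \<in> mod_hom R (cobj (zc M) n) (cobj (zc M) (n + 1))" for n
    using mod_hom_const[OF m] by (simp add: zc_def)
qed (use assms in simp_all)

lemma carrier_zero_mod [simp]: "carrier zero_mod = {0}" and zero_zero_mod [simp]: "\<zero>\<^bsub>zero_mod\<^esub> = 0"
  and add_zero_mod [simp]: "x \<oplus>\<^bsub>zero_mod\<^esub> y = 0" and smult_zero_mod [simp]: "r \<odot>\<^bsub>zero_mod\<^esub> x = 0"
  by (simp_all add: zero_mod_def)

lemma fg_zero [simp]: "fg_module R (zero_mod :: ('k fps, 'k fps) module)"
  by (rule fg_zero_mod[OF cring_R])

definition conc :: "int \<Rightarrow> ('k fps, 'k fps) module \<Rightarrow> ('k fps, 'k fps) cpx" where
  "conc i D = zc (\<lambda>n. if n = i then D else zero_mod)"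

lemma bcpx_conc [simp]: "fg_module R D \<Longrightarrow> bcpx R (conc i D)"
  unfolding conc_def by (rule bcpx_zc[of _ "\<bar>i\<bar>"]) auto

lemma conc_0: "conc 0 D = stalk D"
proof -
  have "cdif (conc 0 D) = cdif (stalk D)"
    by (intro ext) (auto simp: conc_def zc_def stalk_def)
  moreover have "cobj (conc 0 D) = cobj (stalk D)" by (simp add: conc_def zc_def stalk_def)
  ultimately show ?thesis by (simp add: conc_def zc_def stalk_def)
qed

lemma conc_shift:
  assumes D: "fg_module R D"
  shows "conc (i - 1) D \<in> generated (Db R) \<X> \<longleftrightarrow> conc i D \<in> generated (Db R) \<X>"
proof -
  have e: "n = i - 1 \<longleftrightarrow> n + 1 = i" for n :: int by auto
  have c: "cobj (cshift (conc i D)) n = cobj (conc (i - 1) D) n" for n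
    unfolding conc_def by (simp add: e)
  have m: "module R (cobj (conc i D) n)" for n using D by simp
  have "quasi_iso R (cshift (conc i D)) (conc (i - 1) D) (\<lambda>_ x. x)"
  proof (rule quasi_iso_id_like)
    show "chain_map R (cshift (conc i D)) (conc (i - 1) D) (\<lambda>_ x. x)"
    proof (rule chain_mapI)
      show "(\<lambda>x. x) \<in> mod_hom R (cobj (cshift (conc i D)) n) (cobj (conc (i - 1) D) n)" for n
        unfolding c by (rule mod_hom_id)
      fix n x
      have "cdif (cshift (conc i D)) n x = \<zero>\<^bsub>cobj (conc i D) (n + 2)\<^esub>"
        using m[of "n + 2"] by (simp add: conc_def)
      also have "\<dots> = cdif (conc (i - 1) D) n x" using c[of "n + 1"] by (simp add: conc_def)
      finally show "cdif (cshift (conc i D)) n x = cdif (conc (i - 1) D) n x" .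
    qed
  qed (use D c in simp_all)
  from generated_quasi_iso[OF _ _ this] generated_cshift[of "conc i D"] D show ?thesis by simp
qed

lemma conc_generated:
  assumes D: "fg_module R D" and "stalk D \<in> generated (Db R) \<X>"
  shows "conc i D \<in> generated (Db R) \<X>"
proof (induction i rule: int_induct[of _ 0])
  case base then show ?case using assms(2) by (simp add: conc_0)
next
  case (step1 i) then show ?case using conc_shift[OF D, of "i + 1" \<X>] by simp
next
  case (step2 i) then show ?case using conc_shift[OF D, of i \<X>] by simp
qed

text \<open>Induction on the total rank, which is finite by the bound: one copy of \<open>D\<close>
  in one degree is split off as a direct summand.\<close>

lemma zc_frk_generated:
  assumes D: "fg_module R D" and st: "stalk D \<in> generated (Db R) \<X>"
    and b: "\<And>n. b < \<bar>n\<bar> \<Longrightarrow> r n = 0"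
  shows "zc (\<lambda>n. frk D (r n)) \<in> generated (Db R) \<X>"
  using b
proof (induction "\<Sum>n\<in>{-b..b}. r n" arbitrary: r)
  case 0
  have "r n = 0" for n
  proof (cases "b < \<bar>n\<bar>")
    case False
    then have "n \<in> {-b..b}" by auto
    then show ?thesis using 0(1) by (simp add: sum_eq_0_iff)
  qed (rule 0)
  then have r: "(\<lambda>n. frk D (r n)) = (\<lambda>_. zero_mod)" by simp
  have Z: "bcpx R (zc (\<lambda>_. zero_mod :: ('k fps, 'k fps) module))" by (rule bcpx_zc[of _ 0]) simp_all
  \<comment> \<open>The zero complex is reached as a summand: adding it to \<open>conc 0 D\<close>
    gives a complex isomorphic to \<open>conc 0 D\<close>.\<close>
  let ?Z = "zc (\<lambda>_. zero_mod :: ('k fps, 'k fps) module)" and ?S = "conc 0 D"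
  have S: "bcpx R ?S" using D by simp
  have "quasi_iso R (csum ?Z ?S) ?S (\<lambda>_. fps_snd)"
  proof (rule quasi_iso_bij[OF bcpx_csum[OF Z S] S])
    show "chain_map R (csum ?Z ?S) ?S (\<lambda>_. fps_snd)"
      by (rule chain_mapI) (auto simp: mod_hom_snd elim!: mod_sum_cases)
    show "bij_betw fps_snd (carrier (cobj (csum ?Z ?S) n)) (carrier (cobj ?S n))" for n
      by (rule bij_betw_byWitness[where f' = "fps_pair 0"]) (auto elim!: mod_sum_cases)
  qed
  then have "csum ?Z ?S \<in> generated (Db R) \<X>"
    using generated_quasi_iso[OF bcpx_csum[OF Z S] S] conc_generated[OF D st, of 0] by simp
  from generated_summand(1)[OF Z S this] show ?case unfolding r .
next
  case (Suc s)
  have "\<exists>i\<in>{-b..b}. r i \<noteq> 0"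
  proof (rule ccontr)
    assume "\<not> (\<exists>i\<in>{-b..b}. r i \<noteq> 0)"
    then have "(\<Sum>n\<in>{-b..b}. r n) = 0" by simp
    then show False using Suc(2) by simp
  qed
  then obtain i m where i: "i \<in> {-b..b}" "r i = Suc m" by (metis not0_implies_Suc)
  define r' where "r' = r(i := m)"
  have "(\<Sum>n\<in>{-b..b}. r n) = r i + (\<Sum>n\<in>{-b..b} - {i}. r n)" using i(1) by (simp add: sum.remove)
  moreover have "(\<Sum>n\<in>{-b..b}. r' n) = r' i + (\<Sum>n\<in>{-b..b} - {i}. r' n)" using i(1) by (simp add: sum.remove)
  moreover have "(\<Sum>n\<in>{-b..b} - {i}. r' n) = (\<Sum>n\<in>{-b..b} - {i}. r n)" by (rule sum.cong) (auto simp: r'_def)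
  ultimately have s: "s = (\<Sum>n\<in>{-b..b}. r' n)" using Suc(2) i(2) by (simp add: r'_def)
  have b': "r' n = 0" if "b < \<bar>n\<bar>" for n using Suc(3)[OF that] i by (auto simp: r'_def)
  let ?A = "conc i D" and ?B = "zc (\<lambda>n. frk D (r' n))" and ?C = "zc (\<lambda>n. frk D (r n))"
  have B: "?B \<in> generated (Db R) \<X>" by (rule Suc(1)[OF s b'])
  have A: "bcpx R ?A" using D by simp
  have C: "bcpx R ?C" by (rule bcpx_zc[of _ b]) (use D Suc(3) in \<open>simp_all add: fg_frk\<close>)
  note AB = bcpx_csum[OF A generated_bcpx[OF B]]
  \<comment> \<open>In degree \<open>i\<close> the sum is literally \<open>frk D (Suc m)\<close>, so
    the identity works. In the other degrees a factor \<open>zero_mod\<close> has to be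
    dropped.\<close>
  define f where "f = (\<lambda>n. if n = i then (\<lambda>x. x) else (fps_snd :: 'k fps \<Rightarrow> 'k fps))"
  have Ai: "cobj (csum ?A ?B) i = cobj ?C i" by (simp add: conc_def i(2) r'_def)
  have An: "cobj (csum ?A ?B) n = mod_sum zero_mod (cobj ?C n)" if "n \<noteq> i" for n
    using that by (simp add: conc_def r'_def)
  have fb: "f n \<in> mod_hom R (cobj (csum ?A ?B) n) (cobj ?C n) \<and>
      bij_betw (f n) (carrier (cobj (csum ?A ?B) n)) (carrier (cobj ?C n))" for n
  proof (cases "n = i")
    case True
    show ?thesis unfolding True Ai by (simp add: f_def mod_hom_id bij_betw_def)
  next
    case False
    have "bij_betw fps_snd (carrier (mod_sum zero_mod (cobj ?C n))) (carrier (cobj ?C n))"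
      by (rule bij_betw_byWitness[where f' = "fps_pair 0"]) (auto elim!: mod_sum_cases)
    then show ?thesis unfolding An[OF False] using False by (simp add: f_def mod_hom_snd del: cobj_zc)
  qed
  have "quasi_iso R (csum ?A ?B) ?C f"
  proof (rule quasi_iso_bij[OF AB C chain_mapI])
    fix n x assume "x \<in> carrier (cobj (csum ?A ?B) n)"
    have "cdif (csum ?A ?B) n x = \<zero>\<^bsub>cobj (csum ?A ?B) (n + 1)\<^esub>" by (simp add: conc_def)
    then have "f (n + 1) (cdif (csum ?A ?B) n x) = f (n + 1) \<zero>\<^bsub>cobj (csum ?A ?B) (n + 1)\<^esub>" by (rule arg_cong)
    also have "\<dots> = \<zero>\<^bsub>cobj ?C (n + 1)\<^esub>"
      by (rule hom_zero[OF bcpx_module[OF AB] bcpx_module[OF C] conjunct1[OF fb]])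
    also have "\<dots> = cdif ?C n (f n x)" by simp
    finally show "f (n + 1) (cdif (csum ?A ?B) n x) = cdif ?C n (f n x)" .
  qed (rule conjunct1[OF fb] conjunct2[OF fb])+
  from generated_quasi_iso[OF AB C this, of \<X>] generated_csum[OF conc_generated[OF D st, of i] B]
  show ?case by (rule iffD1)
qed

lemma zero_differential_generated:
  assumes X: "bcpx R X" and d: "\<And>n x. x \<in> carrier (cobj X n) \<Longrightarrow> cdif X n x = \<zero>\<^bsub>cobj X (n + 1)\<^esub>"
    and D: "fg_module R D" and st: "stalk D \<in> generated (Db R) \<X>"
    and iso: "\<And>n. \<exists>r. \<exists>\<psi>\<in>mod_hom R (cobj X n) (frk D r). bij_betw \<psi> (carrier (cobj X n)) (carrier (frk D r))"
  shows "X \<in> generated (Db R) \<X>"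
proof -
  obtain b where b: "\<And>n. b < \<bar>n\<bar> \<Longrightarrow> carrier (cobj X n) = {\<zero>\<^bsub>cobj X n\<^esub>}"
    by (rule bcpx_bound[OF X]) blast
  have mD: "module R D" using D by (simp add: fg_module_def)
  \<comment> \<open>If \<open>D\<close> is the zero module, \<open>iso\<close> does not determine
    the rank. Beyond the bound rank 0 is therefore chosen explicitly, as
    \<open>zc_frk_generated\<close> demands.\<close>
  have "\<exists>r \<psi>. \<psi> \<in> mod_hom R (cobj X n) (frk D r) \<and> bij_betw \<psi> (carrier (cobj X n)) (carrier (frk D r)) \<and>
     (b < \<bar>n\<bar> \<longrightarrow> r = 0)" for n
  proof (cases "b < \<bar>n\<bar>")
    case True
    have "(\<lambda>_. 0) \<in> mod_hom R (cobj X n) (frk D 0)" by (rule mod_homI) simp_all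
    moreover have "bij_betw (\<lambda>_. 0) (carrier (cobj X n)) (carrier (frk D 0))"
      unfolding b[OF True] by (simp add: bij_betw_def)
    ultimately show ?thesis by blast
  next
    case False
    then show ?thesis using iso[of n] by blast
  qed
  then obtain r \<psi> where h: "\<And>n. \<psi> n \<in> mod_hom R (cobj X n) (frk D (r n))"
    and bij: "\<And>n. bij_betw (\<psi> n) (carrier (cobj X n)) (carrier (frk D (r n)))" and r: "\<And>n. b < \<bar>n\<bar> \<Longrightarrow> r n = 0"
    by metis
  let ?Y = "zc (\<lambda>n. frk D (r n))"
  have Y: "?Y \<in> generated (Db R) \<X>" by (rule zc_frk_generated[OF D st r])
  have "quasi_iso R X ?Y \<psi>"
    by (rule quasi_iso_bij[OF X generated_bcpx[OF Y] chain_mapI])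
      (simp_all add: h bij d hom_zero[OF bcpx_module[OF X] module_frk[OF mD] h])
  then show ?thesis using generated_quasi_iso[OF X generated_bcpx[OF Y]] Y by simp
qed

lemma free_quot_iso:
  fixes D :: "('k fps, 'k fps) module"
  assumes M: "module R M" and D: "module R D" and A: "submodule A R M" and fq: "free_quot R D M A {\<zero>\<^bsub>M\<^esub>}"
  shows "\<exists>r. \<exists>\<psi>\<in>mod_hom R (M\<lparr>carrier := A\<rparr>) (frk D r). bij_betw \<psi> A (carrier (frk D r))"
proof -
  obtain r \<theta> where t: "\<theta> \<in> mod_hom R (M\<lparr>carrier := A\<rparr>) (frk D r)" "\<theta> ` A = carrier (frk D r)"
    "\<forall>x\<in>A. \<theta> x = \<zero>\<^bsub>frk D r\<^esub> \<longleftrightarrow> x \<in> {\<zero>\<^bsub>M\<^esub>}"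
    by (rule free_quotE[OF fq])
  note t3 = t(3)[rule_format]
  have "bij_betw \<theta> (carrier (M\<lparr>carrier := A\<rparr>)) (carrier (frk D r))"
    by (rule bij_betw_hom[OF submodule_module[OF M A] _ t(1)]) (use D t(2) t3 in simp_all)
  then show ?thesis using t(1) by auto
qed

text \<open>The third isomorphism theorem. The map \<open>\<theta>\<close> kills \<open>C\<close>,
  which contains \<open>A\<close>, so it takes the same value on an element and on its
  representative and can be reused unchanged on the quotient by \<open>A\<close>.\<close>

lemma free_quot_rep:
  fixes D :: "('k fps, 'k fps) module"
  assumes M: "module R M" and D: "module R D" and A: "submodule A R M" and B: "submodule B R M"
    and C: "submodule C R M" and AC: "A \<subseteq> C" and CB: "C \<subseteq> B" and fq: "free_quot R D M B C"
  shows "free_quot R D (mquot M A) (rep M A ` B) (rep M A ` C)"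
proof -
  obtain r \<theta> where t: "\<theta> \<in> mod_hom R (M\<lparr>carrier := B\<rparr>) (frk D r)" "\<theta> ` B = carrier (frk D r)"
    "\<forall>x\<in>B. \<theta> x = \<zero>\<^bsub>frk D r\<^esub> \<longleftrightarrow> x \<in> C"
    by (rule free_quotE[OF fq])
  note t3 = t(3)[rule_format]
  note DB = submoduleD[OF M B] and F = module_frk[OF D]
  have tc: "\<theta> x \<in> carrier (frk D r)" if "x \<in> B" for x using mod_hom_closed[OF t(1)] that by simp
  have ta: "\<theta> (x \<oplus>\<^bsub>M\<^esub> y) = \<theta> x \<oplus>\<^bsub>frk D r\<^esub> \<theta> y" if "x \<in> B" "y \<in> B" for x y
    using mod_hom_add[OF t(1), of x y] that by simp
  have ts: "\<theta> (s \<odot>\<^bsub>M\<^esub> x) = s \<odot>\<^bsub>frk D r\<^esub> \<theta> x" if "x \<in> B" "s \<in> carrier R" for s x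
    using mod_hom_smult[OF t(1), of s x] that by simp
  have tr: "\<theta> (rep M A x) = \<theta> x" if x: "x \<in> B" for x
  proof -
    obtain a where a: "a \<in> A" "rep M A x = x \<oplus>\<^bsub>M\<^esub> a" by (rule rep[OF M A DB(1)[OF x]])
    have aB: "a \<in> B" "a \<in> C" using a(1) AC CB by auto
    show ?thesis using ta[OF x aB(1)] t3[OF aB(1)] aB(2) tc[OF x] F by (simp add: a(2))
  qed
  show ?thesis
  proof (rule free_quotI)
    show "\<theta> \<in> mod_hom R ((mquot M A)\<lparr>carrier := rep M A ` B\<rparr>) (frk D r)"
    proof (rule mod_homI)
      show "\<theta> x \<in> carrier (frk D r)" if "x \<in> carrier ((mquot M A)\<lparr>carrier := rep M A ` B\<rparr>)" for x
        using that by (auto simp: tr tc)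
    next
      fix x y assume "x \<in> carrier ((mquot M A)\<lparr>carrier := rep M A ` B\<rparr>)" "y \<in> carrier ((mquot M A)\<lparr>carrier := rep M A ` B\<rparr>)"
      then obtain a b where ab: "a \<in> B" "b \<in> B" "x = rep M A a" "y = rep M A b" by auto
      have "rep M A a \<oplus>\<^bsub>mquot M A\<^esub> rep M A b = rep M A (a \<oplus>\<^bsub>M\<^esub> b)"
        using mod_hom_add[OF rep_hom[OF M A] DB(1)[OF ab(1)] DB(1)[OF ab(2)]] by simp
      then show "\<theta> (x \<oplus>\<^bsub>(mquot M A)\<lparr>carrier := rep M A ` B\<rparr>\<^esub> y) = \<theta> x \<oplus>\<^bsub>frk D r\<^esub> \<theta> y"
        using ab(1,2) by (simp add: ab(3,4) tr ta DB(3))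
    next
      fix s x assume s: "s \<in> carrier R" and "x \<in> carrier ((mquot M A)\<lparr>carrier := rep M A ` B\<rparr>)"
      then obtain a where a: "a \<in> B" "x = rep M A a" by auto
      have "s \<odot>\<^bsub>mquot M A\<^esub> rep M A a = rep M A (s \<odot>\<^bsub>M\<^esub> a)"
        using mod_hom_smult[OF rep_hom[OF M A] s DB(1)[OF a(1)]] by simp
      then show "\<theta> (s \<odot>\<^bsub>(mquot M A)\<lparr>carrier := rep M A ` B\<rparr>\<^esub> x) = s \<odot>\<^bsub>frk D r\<^esub> \<theta> x"
        using a(1) s by (simp add: a(2) tr ts DB(5))
    qed
    show "\<theta> ` rep M A ` B = carrier (frk D r)"
      unfolding image_image t(2)[symmetric] by (rule image_cong[OF refl]) (rule tr)
    fix x assume "x \<in> rep M A ` B"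
    then obtain a where a: "a \<in> B" "x = rep M A a" by auto
    have "rep M A a \<in> rep M A ` C \<longleftrightarrow> a \<in> C"
    proof
      assume "rep M A a \<in> rep M A ` C"
      then obtain c where c: "c \<in> C" "rep M A a = rep M A c" by auto
      have "\<theta> a = \<theta> c" using tr[OF a(1)] tr[of c] c CB by auto
      then show "a \<in> C" using t3[OF a(1)] t3[of c] c(1) CB by auto
    qed (rule imageI)
    then show "\<theta> x = \<zero>\<^bsub>frk D r\<^esub> \<longleftrightarrow> x \<in> rep M A ` C"
      unfolding a(2) tr[OF a(1)] using t3[OF a(1)] by simp
  qed
qed

text \<open>
  The condition on the differential makes it vanish on every subquotient, so that each step of the
  filtration contributes a finite sum of shifts of a single module.
\<close>
lemma filtration_level:
  assumes "bcpx R X" and "\<And>i n. submodule (F i n) R (cobj X n)"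
    and "\<And>n. F 0 n = {\<zero>\<^bsub>cobj X n\<^esub>}" and "\<And>n. F (Suc m) n = carrier (cobj X n)"
    and "\<And>i n. F i n \<subseteq> F (Suc i) n" and "\<And>i n x. i \<le> m \<Longrightarrow> x \<in> F (Suc i) n \<Longrightarrow> cdif X n x \<in> F i (n + 1)"
    and "\<And>i. fg_module R (D i)" and "\<And>i. stalk (D i) \<in> generated (Db R) \<X>"
    and "\<And>i n. i \<le> m \<Longrightarrow> free_quot R (D i) (cobj X n) (F (Suc i) n) (F i n)"
  shows "X \<in> level (Db R) \<X> (Suc m)"
  using assms
proof (induction m arbitrary: X F D)
  case 0
  note X = 0(1) and F = 0(2) and F0 = 0(3) and F1 = 0(4) and Fd = 0(6) and D = 0(7) and st = 0(8) and fq = 0(9)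
  have "X \<in> generated (Db R) \<X>"
  proof (rule zero_differential_generated[OF X _ D st])
    show "cdif X n x = \<zero>\<^bsub>cobj X (n + 1)\<^esub>" if "x \<in> carrier (cobj X n)" for n x
      using Fd[of 0 x n] that F1[of n] F0[of "n + 1"] by simp
    have mD: "module R (D 0)" using D[of 0] by (simp add: fg_module_def)
    show "\<exists>r. \<exists>\<psi>\<in>mod_hom R (cobj X n) (frk (D 0) r). bij_betw \<psi> (carrier (cobj X n)) (carrier (frk (D 0) r))" for n
      using free_quot_iso[OF bcpx_module[OF X, of n] mD submodule_carrier[OF bcpx_module[OF X, of n]]] fq[of 0 n]
      by (simp add: F0 F1)
  qed
  then show ?case by simp
next
  case (Suc m)
  note X = Suc(2) and F = Suc(3) and F0 = Suc(4) and Fm = Suc(5) and FF = Suc(6) and Fd = Suc(7)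
    and D = Suc(8) and st = Suc(9) and fq = Suc(10)
  have mD: "module R (D i)" for i using D[of i] by (simp add: fg_module_def)
  note mX = bcpx_module[OF X]
  \<comment> \<open>The bottom step is divided out. It is a subcomplex with zero differential, hence
    generated, and the quotient carries the images of the remaining steps with all indices lowered
    by one.\<close>
  let ?A = "F (Suc 0)"
  have A: "submodule (?A n) R (cobj X n)" for n by (rule F)
  have dA: "cdif X n x = \<zero>\<^bsub>cobj X (n + 1)\<^esub>" if "x \<in> ?A n" for n x
    using Fd[of 0 x n] that F0[of "n + 1"] by simp
  have dA': "cdif X n x \<in> ?A (n + 1)" if "x \<in> ?A n" for n x
    unfolding dA[OF that] by (rule submoduleD(2)[OF mX A])
  have isoA: "\<exists>r. \<exists>\<psi>\<in>mod_hom R ((cobj X n)\<lparr>carrier := ?A n\<rparr>) (frk (D 0) r). bij_betw \<psi> (?A n) (carrier (frk (D 0) r))" for n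
    using free_quot_iso[OF mX[of n] mD[of 0] A[of n]] fq[of 0 n] by (simp add: F0)
  \<comment> \<open>Finite generation is transported from a power of \<open>D 0\<close>.\<close>
  have fgA: "fg_module R ((cobj X n)\<lparr>carrier := ?A n\<rparr>)" for n
  proof -
    obtain r \<psi> where "\<psi> \<in> mod_hom R ((cobj X n)\<lparr>carrier := ?A n\<rparr>) (frk (D 0) r)" "bij_betw \<psi> (?A n) (carrier (frk (D 0) r))"
      using isoA[of n] by blast
    then show ?thesis by (intro fg_iso[OF submodule_module[OF mX A] fg_frk[OF D]]) simp_all
  qed
  have sA: "bcpx R (sub_cpx X ?A)" by (rule bcpx_sub_cpx[OF X A fgA dA'])
  have gen: "sub_cpx X ?A \<in> generated (Db R) \<X>"
    by (rule zero_differential_generated[OF sA _ D st]) (use dA isoA in simp_all)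
  let ?q = "\<lambda>n. rep (cobj X n) (?A n)" and ?Q = "quot_cpx X ?A"
  note Q = bcpx_quot_cpx[OF X A dA']
  have Qc: "cobj ?Q n = mquot (cobj X n) (?A n)" for n by (simp add: quot_cpx_def)
  note qh = chain_map_hom[OF Q(2)]
  have A_le: "?A n \<subseteq> F (Suc i) n" for i n
    by (induction i) (use FF in auto)
  have "?Q \<in> level (Db R) \<X> (Suc m)"
  proof (rule Suc(1)[of ?Q "\<lambda>i n. ?q n ` F (Suc i) n" "\<lambda>i. D (Suc i)"])
    show "bcpx R ?Q" by (rule Q)
    show "submodule (?q n ` F (Suc i) n) R (cobj ?Q n)" for i n
      by (rule submodule_image[OF mX bcpx_module[OF Q(1)] qh F])
    show "?q n ` F (Suc 0) n = {\<zero>\<^bsub>cobj ?Q n\<^esub>}" for n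
    proof -
      have eq: "?q n x = ?q n \<zero>\<^bsub>cobj X n\<^esub>" if "x \<in> ?A n" for x
        using rep_zero_iff[OF mX A submoduleD(1)[OF mX A that]] that by simp
      have "?q n ` ?A n = (\<lambda>_. ?q n \<zero>\<^bsub>cobj X n\<^esub>) ` ?A n" by (rule image_cong[OF refl eq])
      moreover have "?A n \<noteq> {}" using submoduleD(2)[OF mX A, of n] by blast
      moreover have "\<zero>\<^bsub>cobj ?Q n\<^esub> = ?q n \<zero>\<^bsub>cobj X n\<^esub>" by (simp add: Qc mquot_def)
      ultimately show ?thesis by (simp only: image_constant_conv if_False)
    qed
    show "?q n ` F (Suc (Suc m)) n = carrier (cobj ?Q n)" for n
      unfolding Fm by (simp add: Qc mquot_def)
    show "?q n ` F (Suc i) n \<subseteq> ?q n ` F (Suc (Suc i)) n" for i n by (rule image_mono[OF FF])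
    show "cdif ?Q n x \<in> ?q (n + 1) ` F (Suc i) (n + 1)" if im: "i \<le> m" and x: "x \<in> ?q n ` F (Suc (Suc i)) n" for i n x
    proof -
      obtain a where a: "a \<in> F (Suc (Suc i)) n" "x = ?q n a" using x by auto
      have "cdif ?Q n x = ?q (n + 1) (cdif X n a)"
        using chain_map_simps(6)[OF X Q, of a n "n + 1"] submoduleD(1)[OF mX F a(1)] by (simp add: a(2))
      then show ?thesis using Fd[of "Suc i" a n] im a(1) by simp
    qed
    show "fg_module R (D (Suc i))" "stalk (D (Suc i)) \<in> generated (Db R) \<X>" for i by (rule D, rule st)
    show "free_quot R (D (Suc i)) (cobj ?Q n) (?q n ` F (Suc (Suc i)) n) (?q n ` F (Suc i) n)" if "i \<le> m" for i n
      unfolding Qc by (rule free_quot_rep[OF mX mD A F F A_le FF fq]) (use that in simp)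
  qed
  then show ?case
  proof (rule level_ses[OF X _ Q(2) _ _ gen])
    show "?q n ` carrier (cobj X n) = carrier (cobj ?Q n)" for n by (simp add: Qc mquot_def)
    show "?A n = {x \<in> carrier (cobj X n). ?q n x = \<zero>\<^bsub>cobj ?Q n\<^esub>}" for n
      using rep_zero_iff[OF mX A, of _ n] submoduleD(1)[OF mX A, of _ n] by (auto simp: Qc mquot_def)
  qed
qed

end

section \<open>The two coefficient rings: the semigroup ring and \<open>k[[t]]\<close>\<close>

locale semigroup_complexes =
  fixes R :: "'k::field fps ring" and H :: "nat set"
  assumes H: "numerical_semigroup H" and R_eq: "R = semigroup_ring H"

lemma numerical_semigroup_UNIV: "numerical_semigroup UNIV"
  by (simp add: numerical_semigroup_def)

sublocale semigroup_complexes \<subseteq> fps_complexes R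
  by (rule fps_complexes.intro) (simp add: R_eq cring_semigroup_ring[OF H])

text \<open>The semigroup of all naturals gives the ring \<open>S = k[[t]]\<close>. Under the
  qualifier \<open>S\<close> all module lemmas are thus available for \<open>S\<close>-linear maps
  and \<open>S\<close>-submodules too.\<close>

sublocale semigroup_complexes \<subseteq> S: fps_complexes "semigroup_ring UNIV :: 'k fps ring"
  by (rule fps_complexes.intro) (simp add: cring_semigroup_ring[OF numerical_semigroup_UNIV])

lemma S_mod_simps [simp]: "carrier S_mod = UNIV" "x \<oplus>\<^bsub>S_mod\<^esub> y = x + y" "r \<odot>\<^bsub>S_mod\<^esub> x = r * x" "\<zero>\<^bsub>S_mod\<^esub> = 0"
  by (simp_all add: S_mod_def)

lemma k_mod_simps [simp]: "carrier k_mod = range fps_const" "x \<oplus>\<^bsub>k_mod\<^esub> y = x + y"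
    "r \<odot>\<^bsub>k_mod\<^esub> x = fps_const (r $ 0) * x" "\<zero>\<^bsub>k_mod\<^esub> = 0"
  by (simp_all add: k_mod_def)

context semigroup_complexes
begin

abbreviation FS :: "nat \<Rightarrow> ('k fps, 'k fps) module" where "FS \<equiv> frk S_mod"

abbreviation FK :: "nat \<Rightarrow> ('k fps, 'k fps) module" where "FK \<equiv> frk k_mod"

abbreviation Sr :: "'k fps ring" where "Sr \<equiv> semigroup_ring UNIV"

lemma Sr_simps [simp]: "carrier Sr = UNIV" "x \<oplus>\<^bsub>Sr\<^esub> y = x + y" "x \<otimes>\<^bsub>Sr\<^esub> y = x * y" "\<one>\<^bsub>Sr\<^esub> = 1" "\<zero>\<^bsub>Sr\<^esub> = 0"
  by (simp_all add: semigroup_ring_def)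

lemma R_simps: "f \<in> carrier R \<longleftrightarrow> (\<forall>n. f $ n \<noteq> 0 \<longrightarrow> n \<in> H)" "x \<oplus>\<^bsub>R\<^esub> y = x + y" "x \<otimes>\<^bsub>R\<^esub> y = x * y"
    "\<one>\<^bsub>R\<^esub> = 1" "\<zero>\<^bsub>R\<^esub> = 0"
  by (simp_all add: R_eq semigroup_ring_def)

lemma zero_in_H: "0 \<in> H"
  using H by (simp add: numerical_semigroup_def)

lemma const_in_R [simp]: "fps_const c \<in> carrier R"
  using zero_in_H by (simp add: R_simps)

lemma smult_l:
  assumes "module R M" "x \<in> carrier M" "a \<in> carrier R" "b \<in> carrier R"
  shows "(a + b) \<odot>\<^bsub>M\<^esub> x = a \<odot>\<^bsub>M\<^esub> x \<oplus>\<^bsub>M\<^esub> b \<odot>\<^bsub>M\<^esub> x" "(a * b) \<odot>\<^bsub>M\<^esub> x = a \<odot>\<^bsub>M\<^esub> (b \<odot>\<^bsub>M\<^esub> x)"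
    "1 \<odot>\<^bsub>M\<^esub> x = x" "0 \<odot>\<^bsub>M\<^esub> x = \<zero>\<^bsub>M\<^esub>"
proof -
  interpret M: module R M by fact
  show "(a + b) \<odot>\<^bsub>M\<^esub> x = a \<odot>\<^bsub>M\<^esub> x \<oplus>\<^bsub>M\<^esub> b \<odot>\<^bsub>M\<^esub> x" "(a * b) \<odot>\<^bsub>M\<^esub> x = a \<odot>\<^bsub>M\<^esub> (b \<odot>\<^bsub>M\<^esub> x)"
    "1 \<odot>\<^bsub>M\<^esub> x = x" "0 \<odot>\<^bsub>M\<^esub> x = \<zero>\<^bsub>M\<^esub>"
    using M.smult_l_distr[of a b x] M.smult_assoc1[of a b x] M.smult_one[of x] M.smult_l_null[of x] assms
    by (simp_all add: R_simps)
qed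

lemma smult_l_S:
  assumes "module Sr M" "x \<in> carrier M"
  shows "(a + b) \<odot>\<^bsub>M\<^esub> x = a \<odot>\<^bsub>M\<^esub> x \<oplus>\<^bsub>M\<^esub> b \<odot>\<^bsub>M\<^esub> x" "(a * b) \<odot>\<^bsub>M\<^esub> x = a \<odot>\<^bsub>M\<^esub> (b \<odot>\<^bsub>M\<^esub> x)"
    "1 \<odot>\<^bsub>M\<^esub> x = x" "0 \<odot>\<^bsub>M\<^esub> x = \<zero>\<^bsub>M\<^esub>"
proof -
  interpret M: module Sr M by fact
  show "(a + b) \<odot>\<^bsub>M\<^esub> x = a \<odot>\<^bsub>M\<^esub> x \<oplus>\<^bsub>M\<^esub> b \<odot>\<^bsub>M\<^esub> x" "(a * b) \<odot>\<^bsub>M\<^esub> x = a \<odot>\<^bsub>M\<^esub> (b \<odot>\<^bsub>M\<^esub> x)"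
    "1 \<odot>\<^bsub>M\<^esub> x = x" "0 \<odot>\<^bsub>M\<^esub> x = \<zero>\<^bsub>M\<^esub>"
    using M.smult_l_distr[of a b x] M.smult_assoc1[of a b x] M.smult_one[of x] M.smult_l_null[of x] assms
    by simp_all
qed

lemma restrict_scalars:
  assumes "module Sr M"
  shows "module R M"
proof (rule moduleI[OF cring_R])
  show "abelian_group M" using assms by (rule module.axioms(2))
qed (use assms in \<open>simp_all add: R_simps smult_l_S S.smult_r_distr\<close>)

lemma mod_hom_restrict: "f \<in> mod_hom Sr M N \<Longrightarrow> f \<in> mod_hom R M N"
  by (auto simp: mod_hom_def)

lemma submodule_restrict:
  assumes "module Sr M" "submodule A Sr M"
  shows "submodule A R M"
  using S.submoduleD[OF assms] by (intro submoduleI[OF restrict_scalars[OF assms(1)]]) auto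

lemma module_S_mod [simp]: "module Sr (S_mod :: ('k fps, 'k fps) module)" "module R (S_mod :: ('k fps, 'k fps) module)"
  using fg_S_mod[OF numerical_semigroup_UNIV, where 'a = 'k] fg_S_mod[OF H, where 'a = 'k]
  by (simp_all add: fg_module_def R_eq)

lemma module_k_mod [simp]: "module R (k_mod :: ('k fps, 'k fps) module)"
  using fg_k_mod[OF H, where 'a = 'k] by (simp add: fg_module_def R_eq)

section \<open>Lattices\<close>

text \<open>Submodules of free modules over the discrete valuation ring \<open>k[[t]]\<close> are
  free. The first coordinates of \<open>L\<close> form an ideal generated by the first coordinate of
  some \<open>q\<close> in \<open>L\<close>, and \<open>L\<close> is the direct sum of the multiples
  of \<open>q\<close> and the part with first coordinate 0.\<close>

lemma submodule_frk_S:
  fixes L :: "'k fps set"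
  assumes "submodule L Sr (FS m)"
  shows "\<exists>r. \<exists>\<psi>\<in>mod_hom Sr (FS r) (FS m).
    inj_on \<psi> (carrier (FS r)) \<and> \<psi> ` carrier (FS r) = L"
  using assms
proof (induction m arbitrary: L)
  case 0
  have "L = {0}" using S.submoduleD(1,2)[OF S.module_frk[OF module_S_mod(1)] 0] by auto
  then show ?case by (intro exI[of _ 0] bexI[of _ "\<lambda>_. 0"]) (auto intro!: mod_homI)
next
  case (Suc m)
  let ?F = "FS m :: ('k fps, 'k fps) module" and ?F' = "FS (Suc m) :: ('k fps, 'k fps) module"
  have F: "module Sr ?F" and F': "module Sr ?F'" by (simp_all del: frk.simps)
  note L = S.submoduleD[OF F' Suc(2)]
  have "submodule {v \<in> carrier ?F. fps_pair 0 v \<in> L} Sr ?F"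
  proof (rule S.submodule_vimage[OF F F' _ S.submodule_carrier[OF F] Suc(2)])
    show "fps_pair 0 \<in> mod_hom Sr ?F ?F'" by (rule mod_homI) simp_all
  qed
  from Suc(1)[OF this] obtain r \<psi> where \<psi>: "\<psi> \<in> mod_hom Sr (FS r) ?F"
    and inj: "inj_on \<psi> (carrier (FS r))"
    and im: "\<psi> ` carrier (FS r) = {v \<in> carrier ?F. fps_pair 0 v \<in> L}" by blast
  note \<psi>c = mod_hom_closed[OF \<psi>] and \<psi>a = mod_hom_add[OF \<psi>] and \<psi>s = mod_hom_smult[OF \<psi>]
  have \<psi>L: "fps_pair 0 (\<psi> v) \<in> L" if "v \<in> carrier (FS r)" for v
    using im that by blast
  have split: "p = fps_pair (fps_fst p) (fps_snd p)" if "p \<in> carrier ?F'" for p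
    using that by (auto elim: mod_sum_cases)
  show ?case
  proof (cases "\<forall>p\<in>L. fps_fst p = 0")
    case True
    have "(\<lambda>v. fps_pair 0 (\<psi> v)) ` carrier (FS r) = L"
    proof
      show "L \<subseteq> (\<lambda>v. fps_pair 0 (\<psi> v)) ` carrier (FS r)"
      proof
        fix p assume p: "p \<in> L"
        have p': "p = fps_pair 0 (fps_snd p)" using split[OF L(1)[OF p]] True p by simp
        then have "fps_snd p \<in> {v \<in> carrier ?F. fps_pair 0 v \<in> L}" using p L(1)[OF p] by auto
        then obtain v where "v \<in> carrier (FS r)" "fps_snd p = \<psi> v" unfolding im[symmetric] by blast
        then show "p \<in> (\<lambda>v. fps_pair 0 (\<psi> v)) ` carrier (FS r)" using p' by auto
      qed
    qed (use \<psi>L in auto)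
    moreover have "inj_on (\<lambda>v. fps_pair 0 (\<psi> v)) (carrier (FS r))"
      using inj by (simp add: inj_on_def)
    moreover have "(\<lambda>v. fps_pair 0 (\<psi> v)) \<in> mod_hom Sr (FS r) ?F'"
      by (rule mod_homI) (simp_all add: \<psi>c \<psi>a \<psi>s)
    ultimately show ?thesis by blast
  next
    case False
    \<comment> \<open>In \<open>k[[t]]\<close> an element divides every element of at least the same
      order, so one of least order generates the ideal.\<close>
    define d where "d = (LEAST d. \<exists>p\<in>L. fps_fst p \<noteq> 0 \<and> subdegree (fps_fst p) = d)"
    have "\<exists>p\<in>L. fps_fst p \<noteq> 0 \<and> subdegree (fps_fst p) = d"
      unfolding d_def by (rule LeastI_ex) (use False in blast)
    then obtain q where q: "q \<in> L" "fps_fst q \<noteq> 0" "subdegree (fps_fst q) = d" by blast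
    have qc: "fps_snd q \<in> carrier ?F" using L(1)[OF q(1)] by simp
    have dv: "fps_fst q dvd fps_fst p" if "p \<in> L" for p
    proof (cases "fps_fst p = 0")
      case False
      then have "d \<le> subdegree (fps_fst p)" unfolding d_def using that by (intro Least_le) blast
      then show ?thesis using q False by (simp add: fps_dvd_iff)
    qed simp
    \<comment> \<open>The new basis vector goes to \<open>q\<close>, the old ones go to the part of
      \<open>L\<close> with first coordinate 0.\<close>
    define \<Psi> where "\<Psi> = (\<lambda>a. fps_pair (fps_fst a * fps_fst q) (fps_fst a \<odot>\<^bsub>?F\<^esub> fps_snd q \<oplus>\<^bsub>?F\<^esub> \<psi> (fps_snd a)))"
    have hom: "\<Psi> \<in> mod_hom Sr (FS (Suc r)) ?F'"
    proof (rule mod_homI)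
      show "\<Psi> x \<in> carrier ?F'" if "x \<in> carrier (FS (Suc r))" for x
        using that qc F by (simp add: \<Psi>_def \<psi>c)
      show "\<Psi> (x \<oplus>\<^bsub>FS (Suc r)\<^esub> y) = \<Psi> x \<oplus>\<^bsub>?F'\<^esub> \<Psi> y"
        if "x \<in> carrier (FS (Suc r))" "y \<in> carrier (FS (Suc r))" for x y
        using that qc F by (simp add: \<Psi>_def \<psi>c \<psi>a smult_l_S S.group_ac distrib_right)
      show "\<Psi> (s \<odot>\<^bsub>FS (Suc r)\<^esub> x) = s \<odot>\<^bsub>?F'\<^esub> \<Psi> x"
        if "s \<in> carrier Sr" "x \<in> carrier (FS (Suc r))" for s x
        using that qc F by (simp add: \<Psi>_def \<psi>c \<psi>s smult_l_S S.smult_r_distr mult.assoc)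
    qed
    have im\<Psi>: "\<Psi> ` carrier (FS (Suc r)) = L"
    proof
      show "\<Psi> ` carrier (FS (Suc r)) \<subseteq> L"
      proof (rule image_subsetI)
        fix x assume x: "x \<in> carrier (FS (Suc r))"
        then have sx: "fps_snd x \<in> carrier (FS r)" by simp
        have "fps_fst x \<odot>\<^bsub>?F'\<^esub> q \<oplus>\<^bsub>?F'\<^esub> fps_pair 0 (\<psi> (fps_snd x)) \<in> L"
          by (rule L(3)[OF L(5)[OF _ q(1)] \<psi>L[OF sx]]) simp
        then show "\<Psi> x \<in> L" by (simp add: \<Psi>_def)
      qed
      show "L \<subseteq> \<Psi> ` carrier (FS (Suc r))"
      proof
        fix p assume p: "p \<in> L"
        obtain s where s: "fps_fst p = fps_fst q * s" using dv[OF p] by (rule dvdE)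
        have pc: "fps_snd p \<in> carrier ?F" using L(1)[OF p] by simp
        let ?v = "fps_snd p \<oplus>\<^bsub>?F\<^esub> (- s) \<odot>\<^bsub>?F\<^esub> fps_snd q"
        have "p \<oplus>\<^bsub>?F'\<^esub> (- s) \<odot>\<^bsub>?F'\<^esub> q \<in> L" by (rule L(3)[OF p L(5)[OF _ q(1)]]) simp
        then have "fps_pair 0 ?v \<in> L" by (simp add: s)
        then have "?v \<in> {v \<in> carrier ?F. fps_pair 0 v \<in> L}" using pc qc F by simp
        then obtain v where v: "v \<in> carrier (FS r)" "?v = \<psi> v" unfolding im[symmetric] by blast
        have "s \<odot>\<^bsub>?F\<^esub> fps_snd q \<oplus>\<^bsub>?F\<^esub> (- s) \<odot>\<^bsub>?F\<^esub> fps_snd q = \<zero>\<^bsub>?F\<^esub>"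
          using smult_l_S(1)[OF F qc, of s "- s"] smult_l_S(4)[OF F qc] by simp
        then have "s \<odot>\<^bsub>?F\<^esub> fps_snd q \<oplus>\<^bsub>?F\<^esub> ?v = fps_snd p"
          using F qc pc by (simp add: S.a_lcomm[OF F, of "s \<odot>\<^bsub>?F\<^esub> fps_snd q"])
        then have "p = \<Psi> (fps_pair s v)"
          using split[OF L(1)[OF p]] by (simp add: \<Psi>_def s mult.commute flip: v(2))
        then show "p \<in> \<Psi> ` carrier (FS (Suc r))" using v(1) by auto
      qed
    qed
    have "inj_on \<Psi> (carrier (FS (Suc r)))"
    proof (rule inj_onI)
      fix x y assume xy: "x \<in> carrier (FS (Suc r))" "y \<in> carrier (FS (Suc r))" "\<Psi> x = \<Psi> y"
      then obtain a b c d where ab: "x = fps_pair a b" "y = fps_pair c d" "b \<in> carrier (FS r)" "d \<in> carrier (FS r)"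
        by (auto elim!: mod_sum_cases)
      have ac: "a = c" using xy(3) q(2) by (simp add: \<Psi>_def ab)
      have "a \<odot>\<^bsub>?F\<^esub> fps_snd q \<oplus>\<^bsub>?F\<^esub> \<psi> b = a \<odot>\<^bsub>?F\<^esub> fps_snd q \<oplus>\<^bsub>?F\<^esub> \<psi> d" using xy(3) by (simp add: \<Psi>_def ab ac)
      then have "\<ominus>\<^bsub>?F\<^esub> (a \<odot>\<^bsub>?F\<^esub> fps_snd q) \<oplus>\<^bsub>?F\<^esub> (a \<odot>\<^bsub>?F\<^esub> fps_snd q \<oplus>\<^bsub>?F\<^esub> \<psi> b) =
          \<ominus>\<^bsub>?F\<^esub> (a \<odot>\<^bsub>?F\<^esub> fps_snd q) \<oplus>\<^bsub>?F\<^esub> (a \<odot>\<^bsub>?F\<^esub> fps_snd q \<oplus>\<^bsub>?F\<^esub> \<psi> d)" by simp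
      then have "\<psi> b = \<psi> d" using F qc ab(3,4) by (simp add: \<psi>c)
      then show "x = y" using inj ab ac by (simp add: inj_on_def)
    qed
    with hom im\<Psi> show ?thesis by blast
  qed
qed

text \<open>The test modules \<open>N\<close> range over submodules of the ambient module instead of
  submodules of \<open>L\<close>. Inductions can thus avoid records with a restricted carrier;
  \<open>fg_restrict\<close> converts to \<open>fg_module\<close>.\<close>

definition fin_gen_sub :: "('k fps, 'k fps) module \<Rightarrow> 'k fps set \<Rightarrow> bool" where
  "fin_gen_sub M L \<longleftrightarrow> (\<exists>A. finite A \<and> A \<subseteq> L \<and> (\<forall>N. submodule N R M \<and> A \<subseteq> N \<longrightarrow> L \<subseteq> N))"

lemma fin_gen_subE:
  assumes "fin_gen_sub M L"
  obtains A where "finite A" "A \<subseteq> L" "\<forall>N. submodule N R M \<longrightarrow> A \<subseteq> N \<longrightarrow> L \<subseteq> N"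
  using assms unfolding fin_gen_sub_def by (elim exE conjE) simp

lemma R_contains: "\<exists>c. \<forall>n\<ge>c. n \<in> H"
proof -
  have "finite (UNIV - H)" using H by (simp add: numerical_semigroup_def)
  then obtain m where "\<forall>n\<in>UNIV - H. n < m" using finite_nat_set_iff_bounded by auto
  then show ?thesis by (intro exI[of _ m]) (metis DiffI UNIV_I leD)
qed

text \<open>Fix a nonzero \<open>f\<close> in \<open>I\<close>. All of \<open>H\<close> beyond some
  \<open>c\<close> is present, so every series of order at least \<open>subdegree f + c\<close> is a
  multiple of \<open>f\<close> by an element of \<open>R\<close>. Below that bound one element of
  \<open>I\<close> for each order that occurs suffices.\<close>

lemma fin_gen_sub_S:
  assumes I: "submodule I R S_mod"
  shows "fin_gen_sub S_mod I"
proof (cases "I \<subseteq> {0}")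
  case True
  have "I \<subseteq> N" if "submodule N R (S_mod :: ('k fps, 'k fps) module)" for N
    using True submoduleD(2)[OF module_S_mod(2) that] by auto
  then show ?thesis unfolding fin_gen_sub_def by (intro exI[of _ "{}"]) auto
next
  case False
  note D = submoduleD[OF module_S_mod(2) I]
  obtain f where f: "f \<in> I" "f \<noteq> 0" using False by auto
  obtain c where c: "\<forall>n\<ge>c. n \<in> H" using R_contains by blast
  define b where "b = subdegree f + c"
  define P where "P j g \<longleftrightarrow> g \<in> I \<and> (\<forall>i<j. g $ i = 0) \<and> g $ j \<noteq> 0" for j g
  define h where "h j = (SOME g. P j g)" for j
  have h: "P j (h j)" if "P j g" for j g unfolding h_def by (rule someI[of _ g]) (rule that)
  define A where "A = insert f (h ` {j. j < b \<and> (\<exists>g. P j g)})"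
  have "I \<subseteq> N" if N: "submodule N R S_mod" "A \<subseteq> N" for N
  proof -
    note E = submoduleD[OF module_S_mod(2) N(1)]
    \<comment> \<open>The induction lowers the assumed order of \<open>g\<close> from
      \<open>b\<close> down to 0.\<close>
    have step: "\<forall>g\<in>I. (\<forall>i<b - d. g $ i = 0) \<longrightarrow> g \<in> N" for d
    proof (induction d)
      case 0
      show ?case
      proof (intro ballI impI)
        fix g assume g: "g \<in> I" "\<forall>i<b - 0. g $ i = 0"
        show "g \<in> N"
        proof (cases "g = 0")
          case False
          then have le: "b \<le> subdegree g" using g(2) by (intro subdegree_geI) auto
          then have "f dvd g" using f(2) False by (simp add: fps_dvd_iff b_def)
          then obtain q where q: "g = f * q" by (rule dvdE)
          have "q \<noteq> 0" using q False by auto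
          then have "subdegree g = subdegree f + subdegree q" using q f(2) by simp
          then have "c \<le> subdegree q" using le by (simp add: b_def)
          have "q \<in> carrier R" unfolding R_simps
          proof (intro allI impI)
            fix n assume "q $ n \<noteq> 0"
            then have "subdegree q \<le> n" by (rule subdegree_leI)
            then show "n \<in> H" using \<open>c \<le> subdegree q\<close> c by simp
          qed
          then show ?thesis using E(5)[of q f] N(2) by (simp add: A_def q mult.commute)
        qed (use E(2) in simp)
      qed
    next
      case (Suc d)
      show ?case
      proof (intro ballI impI)
        fix g assume g: "g \<in> I" "\<forall>i<b - Suc d. g $ i = 0"
        let ?j = "b - Suc d"
        show "g \<in> N"
        \<comment> \<open>For \<open>b \<le> d\<close> the subtraction is truncated and both order
          bounds are 0, so nothing is gained in this step.\<close>
        proof (cases "b \<le> d \<or> g $ ?j = 0")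
          case True
          then have "\<forall>i<b - d. g $ i = 0" using g(2) less_SucE[of _ ?j] by (metis Suc_diff_Suc diff_is_0_eq less_zeroE not_le)
          then show ?thesis using Suc g(1) by blast
        next
          case False
          then have P: "P ?j g" using g by (simp add: P_def)
          note h = h[OF P, unfolded P_def]
          have "?j < b" using False by simp
          then have "h ?j \<in> A" unfolding A_def using P by (intro insertI2 imageI CollectI conjI exI)
          then have hA: "h ?j \<in> N" using N(2) by blast
          \<comment> \<open>The constant that cancels the leading coefficient of \<open>g\<close>
            against the chosen element of the same order.\<close>
          let ?a = "g $ ?j / h ?j $ ?j"
          let ?g = "g + fps_const (- ?a) * h ?j"
          have g': "?g \<in> I" using D(3)[OF g(1) D(5)[OF const_in_R conjunct1[OF h], of "- ?a"]] by simp
          have "\<forall>i<b - d. ?g $ i = 0"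
          proof (intro allI impI)
            fix i assume "i < b - d"
            then consider "i < ?j" | "i = ?j" by linarith
            then show "?g $ i = 0" using h g(2) by cases auto
          qed
          then have "?g \<in> N" using Suc g' by blast
          moreover have "fps_const ?a * h ?j \<in> N" using E(5)[OF const_in_R hA, of ?a] by simp
          ultimately have "?g + fps_const ?a * h ?j \<in> N" using E(3) by simp
          moreover have "?g + fps_const ?a * h ?j = g" by (simp flip: fps_const_neg)
          ultimately show ?thesis by simp
        qed
      qed
    qed
    show ?thesis using step[of b] by auto
  qed
  moreover have "A \<subseteq> I" using f(1) h by (auto simp: A_def P_def)
  ultimately show ?thesis unfolding fin_gen_sub_def by (intro exI[of _ A]) (auto simp: A_def)
qed

text \<open>Induction along \<open>0 -> S^m -> S^(m+1) -> S -> 0\<close>: generators of the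
  projection of \<open>L\<close> are lifted to \<open>L\<close> and joined with generators of the
  part of \<open>L\<close> in the kernel.\<close>

lemma fin_gen_sub_frk_S:
  assumes "submodule L R (FS m)"
  shows "fin_gen_sub (FS m) L"
  using assms
proof (induction m arbitrary: L)
  case 0
  have "L \<subseteq> N" if "submodule N R (FS 0 :: ('k fps, 'k fps) module)" for N
    using submoduleD(1)[OF _ 0] submoduleD(2)[OF _ that] by auto
  then show ?case unfolding fin_gen_sub_def by (intro exI[of _ "{}"]) auto
next
  case (Suc m)
  let ?F = "FS m :: ('k fps, 'k fps) module" and ?F' = "FS (Suc m) :: ('k fps, 'k fps) module"
  have F: "module R ?F" and F': "module R ?F'" by (simp_all add: module_frk del: frk.simps)
  note L = submoduleD[OF F' Suc(2)]
  have pr: "fps_fst \<in> mod_hom R ?F' S_mod" by (simp add: mod_hom_fst)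
  have ih: "fps_pair 0 \<in> mod_hom R ?F ?F'" by (rule mod_homI) simp_all
  let ?L' = "\<lambda>L. {v \<in> carrier ?F. fps_pair 0 v \<in> L}"
  have sub: "submodule (?L' N) R ?F" if "submodule N R ?F'" for N
    by (rule submodule_vimage[OF F F' ih submodule_carrier[OF F] that])
  obtain A0 where A0: "finite A0" "A0 \<subseteq> fps_fst ` L"
    "\<forall>N. submodule N R S_mod \<longrightarrow> A0 \<subseteq> N \<longrightarrow> fps_fst ` L \<subseteq> N"
    by (rule fin_gen_subE[OF fin_gen_sub_S[OF submodule_image[OF F' module_S_mod(2) pr Suc(2)]]])
  obtain A1 where A1: "finite A1" "A1 \<subseteq> L" "A0 = fps_fst ` A1" using finite_subset_image[OF A0(1,2)] by blast
  obtain A2 where A2: "finite A2" "A2 \<subseteq> ?L' L" "\<forall>N. submodule N R ?F \<longrightarrow> A2 \<subseteq> N \<longrightarrow> ?L' L \<subseteq> N"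
    by (rule fin_gen_subE[OF Suc(1)[OF sub[OF Suc(2)]]])
  have "L \<subseteq> N" if N: "submodule N R ?F'" "A1 \<union> fps_pair 0 ` A2 \<subseteq> N" for N
  proof
    fix p assume p: "p \<in> L"
    note E = submoduleD[OF F' N(1)]
    \<comment> \<open>Using the intersection of \<open>N\<close> and \<open>L\<close> instead of
      \<open>N\<close> alone yields a \<open>q\<close> in \<open>L\<close>, so that
      \<open>p - q\<close> stays in \<open>L\<close> and falls under the kernel part.\<close>
    have NL: "submodule {x \<in> N. x \<in> L} R ?F'"
      by (rule submodule_vimage[OF F' F' mod_hom_id N(1) Suc(2)])
    have "fps_fst ` L \<subseteq> fps_fst ` {x \<in> N. x \<in> L}"
      by (rule A0(3)[rule_format, OF submodule_image[OF F' module_S_mod(2) pr NL]]) (use A1 N(2) in auto)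
    then obtain q where q: "q \<in> N" "q \<in> L" "fps_fst p = fps_fst q" using p by blast
    let ?d = "p \<oplus>\<^bsub>?F'\<^esub> \<ominus>\<^bsub>?F'\<^esub> q"
    have dL: "?d \<in> L" by (rule L(3)[OF p L(4)[OF q(2)]])
    obtain a v b w where pq: "p = fps_pair a v" "q = fps_pair b w" "v \<in> carrier ?F" "w \<in> carrier ?F"
      using L(1)[OF p] L(1)[OF q(2)] by (auto elim!: mod_sum_cases)
    have ab: "b = a" using q(3) by (simp add: pq)
    have "a \<oplus>\<^bsub>S_mod\<^esub> \<ominus>\<^bsub>S_mod\<^esub> a = \<zero>\<^bsub>S_mod\<^esub>" by (rule r_neg) simp_all
    then have d: "?d = fps_pair 0 (v \<oplus>\<^bsub>?F\<^esub> \<ominus>\<^bsub>?F\<^esub> w)" using F pq(3,4) by (simp add: pq(1,2) ab)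
    have "?L' L \<subseteq> ?L' N" by (rule A2(3)[rule_format, OF sub[OF N(1)]]) (use A2(2) N(2) in auto)
    moreover have "v \<oplus>\<^bsub>?F\<^esub> \<ominus>\<^bsub>?F\<^esub> w \<in> ?L' L" using dL F pq(3,4) by (simp only: d) simp
    ultimately have "?d \<in> N" unfolding d by blast
    then have "?d \<oplus>\<^bsub>?F'\<^esub> q \<in> N" using q(1) by (rule E(3))
    moreover have "?d \<oplus>\<^bsub>?F'\<^esub> q = p" using F' L(1)[OF p] L(1)[OF q(2)] by (simp add: a_assoc del: frk.simps)
    ultimately show "p \<in> N" by simp
  qed
  moreover have "A1 \<union> fps_pair 0 ` A2 \<subseteq> L" using A1(2) A2(2) by auto
  ultimately show ?case unfolding fin_gen_sub_def using A1(1) A2(1)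
    by (intro exI[of _ "A1 \<union> fps_pair 0 ` A2"]) auto
qed

lemma submodule_of_restrict:
  assumes M: "module R M" and L: "submodule L R M" and N: "submodule N R (M\<lparr>carrier := L\<rparr>)"
  shows "submodule N R M"
proof -
  note D = submoduleD[OF submodule_module[OF M L] N]
  show ?thesis
  proof (rule submoduleI[OF M])
    show "N \<subseteq> carrier M" using D(1) submoduleD(1)[OF M L] by (intro subsetI) simp
  qed (use D(2,3,5) in simp_all)
qed

lemma submodule_in_restrict:
  assumes M: "module R M" and L: "submodule L R M" and N: "submodule N R M" and "N \<subseteq> L"
  shows "submodule N R (M\<lparr>carrier := L\<rparr>)"
proof (rule submoduleI[OF submodule_module[OF M L]])
  show "N \<subseteq> carrier (M\<lparr>carrier := L\<rparr>)" using assms(4) by simp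
qed (use submoduleD(2,3,5)[OF M N] in simp_all)

lemma fg_restrict:
  assumes M: "module R M" and L: "submodule L R M" and "fin_gen_sub M L"
  shows "fg_module R (M\<lparr>carrier := L\<rparr>)"
proof -
  obtain A where A: "finite A" "A \<subseteq> L" "\<forall>N. submodule N R M \<longrightarrow> A \<subseteq> N \<longrightarrow> L \<subseteq> N"
    by (rule fin_gen_subE[OF assms(3)])
  have "N = L" if N: "submodule N R (M\<lparr>carrier := L\<rparr>)" "A \<subseteq> N" for N
    using A(3)[rule_format, OF submodule_of_restrict[OF M L N(1)] N(2)] submoduleD(1)[OF submodule_module[OF M L] N(1)] by auto
  then show ?thesis unfolding fg_module_def using submodule_module[OF M L] A(1,2)
    by (intro conjI exI[of _ A]) auto
qed

text \<open>These are the finitely generated torsion-free \<open>S\<close>-modules. The embedding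
  form also covers sums of two powers of \<open>S_mod\<close>, which are not literally of the form
  \<open>frk\<close>.\<close>

definition lattice :: "('k fps, 'k fps) module \<Rightarrow> bool" where
  "lattice M \<longleftrightarrow> module Sr M \<and> (\<exists>m. \<exists>j\<in>mod_hom Sr M (FS m). inj_on j (carrier M))"

lemma latticeE:
  assumes "lattice M"
  obtains m j where "module Sr M" "j \<in> mod_hom Sr M (FS m)" "inj_on j (carrier M)"
  using assms unfolding lattice_def by blast

text \<open>Here \<open>L\<close> is only an \<open>R\<close>-submodule, so its image need not be
  free; finite generation comes from \<open>S\<close> being a Noetherian
  \<open>R\<close>-module.\<close>

lemma lattice_fg:
  assumes "lattice M" and L: "submodule L R M"
  shows "fg_module R (M\<lparr>carrier := L\<rparr>)"
proof -
  obtain m j where mM: "module Sr M" and j: "j \<in> mod_hom Sr M (FS m)" and inj: "inj_on j (carrier M)"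
    by (rule latticeE[OF assms(1)])
  note M = restrict_scalars[OF mM] and jR = mod_hom_restrict[OF j]
  have F: "module R (FS m)" by simp
  note jL = submodule_image[OF M F jR L]
  have D: "x \<in> carrier M" if "x \<in> L" for x by (rule submoduleD(1)[OF M L that])
  show ?thesis
  proof (rule fg_iso[OF submodule_module[OF M L] fg_restrict[OF F jL fin_gen_sub_frk_S[OF jL]]])
    show "j \<in> mod_hom R (M\<lparr>carrier := L\<rparr>) ((FS m)\<lparr>carrier := j ` L\<rparr>)"
      by (rule mod_homI) (simp_all add: D mod_hom_add[OF jR] mod_hom_smult[OF jR])
    show "bij_betw j (carrier (M\<lparr>carrier := L\<rparr>)) (carrier ((FS m)\<lparr>carrier := j ` L\<rparr>))"
      unfolding bij_betw_def using inj_on_subset[OF inj, of L] D by auto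
  qed
qed

text \<open>An \<open>S\<close>-submodule is carried by the embedding to a submodule of a free
  module, and \<open>submodule_frk_S\<close> provides a basis there.\<close>

lemma lattice_free:
  assumes "lattice M" and L: "submodule L Sr M"
  shows "\<exists>r. \<exists>\<theta>\<in>mod_hom R (M\<lparr>carrier := L\<rparr>) (FS r). bij_betw \<theta> L (carrier (FS r))"
proof -
  obtain m j where mM: "module Sr M" and j: "j \<in> mod_hom Sr M (FS m)" and inj: "inj_on j (carrier M)"
    by (rule latticeE[OF assms(1)])
  have F: "module Sr (FS m)" by simp
  obtain r \<psi> where \<psi>: "\<psi> \<in> mod_hom Sr (FS r) (FS m)"
    "inj_on \<psi> (carrier (FS r))" "\<psi> ` carrier (FS r) = j ` L"
    using submodule_frk_S[OF S.submodule_image[OF mM F j L]] by blast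
  have D: "x \<in> carrier M" if "x \<in> L" for x by (rule S.submoduleD(1)[OF mM L that])
  have G: "module Sr (FS r)" by simp
  let ?N = "(FS m)\<lparr>carrier := j ` L\<rparr>"
  have \<psi>N: "\<psi> \<in> mod_hom Sr (FS r) ?N"
    by (rule mod_homI) (use \<psi>(3) in \<open>auto simp: mod_hom_add[OF \<psi>(1)] mod_hom_smult[OF \<psi>(1)]\<close>)
  have b1: "bij_betw \<psi> (carrier (FS r)) (carrier ?N)" using \<psi>(2,3) by (simp add: bij_betw_def)
  have jN: "j \<in> mod_hom Sr (M\<lparr>carrier := L\<rparr>) ?N"
    by (rule mod_homI) (simp_all add: D mod_hom_add[OF j] mod_hom_smult[OF j])
  have b2: "bij_betw j L (carrier ?N)"
    unfolding bij_betw_def using inj_on_subset[OF inj, of L] D by auto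
  let ?\<theta> = "\<lambda>x. the_inv_into (carrier (FS r)) \<psi> (j x)"
  have "?\<theta> \<in> mod_hom Sr (M\<lparr>carrier := L\<rparr>) (FS r)"
    by (rule mod_hom_comp[OF jN mod_hom_inverse[OF \<psi>N b1 G]])
  moreover have "bij_betw ?\<theta> L (carrier (FS r))"
    using bij_betw_trans[OF b2 bij_betw_the_inv_into[OF b1]] by (simp add: o_def)
  ultimately show ?thesis using mod_hom_restrict by blast
qed

text \<open>The embedding merely rebrackets nested pairs.\<close>

lemma lattice_sum_frk: "lattice (mod_sum (FS a) (FS b))"
proof -
  have "\<exists>j\<in>mod_hom Sr (mod_sum (FS a) (FS b)) (FS (a + b)).
      inj_on j (carrier (mod_sum (FS a) (FS b)))"
  proof (induction a)
    case 0
    have "inj_on fps_snd (carrier (mod_sum (FS 0) (FS b)))"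
      by (rule inj_onI) (auto elim!: mod_sum_cases)
    then show ?case by (intro bexI[of _ fps_snd]) (simp_all add: S.mod_hom_snd)
  next
    case (Suc a)
    then obtain j where j: "j \<in> mod_hom Sr (mod_sum (FS a) (FS b)) (FS (a + b))"
      and inj: "inj_on j (carrier (mod_sum (FS a) (FS b)))" by blast
    let ?J = "\<lambda>p. fps_pair (fps_fst (fps_fst p)) (j (fps_pair (fps_snd (fps_fst p)) (fps_snd p)))"
    have c: "j (fps_pair v w) \<in> carrier (FS (a + b))"
      if "v \<in> carrier (FS a)" "w \<in> carrier (FS b)" for v w
      using mod_hom_closed[OF j, of "fps_pair v w"] that by simp
    have ad: "j (fps_pair (v \<oplus>\<^bsub>FS a\<^esub> v') (w \<oplus>\<^bsub>FS b\<^esub> w')) = j (fps_pair v w) \<oplus>\<^bsub>FS (a + b)\<^esub> j (fps_pair v' w')"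
      if "v \<in> carrier (FS a)" "w \<in> carrier (FS b)" "v' \<in> carrier (FS a)" "w' \<in> carrier (FS b)" for v w v' w'
      using mod_hom_add[OF j, of "fps_pair v w" "fps_pair v' w'"] that by simp
    have sm: "j (fps_pair (s \<odot>\<^bsub>FS a\<^esub> v) (s \<odot>\<^bsub>FS b\<^esub> w)) = s \<odot>\<^bsub>FS (a + b)\<^esub> j (fps_pair v w)"
      if "v \<in> carrier (FS a)" "w \<in> carrier (FS b)" for s v w
      using mod_hom_smult[OF j, of s "fps_pair v w"] that by simp
    have ii: "v = v' \<and> w = w'" if "j (fps_pair v w) = j (fps_pair v' w')"
      "v \<in> carrier (FS a)" "w \<in> carrier (FS b)" "v' \<in> carrier (FS a)" "w' \<in> carrier (FS b)" for v w v' w'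
      using inj_onD[OF inj that(1)] that(2-) by simp
    have "?J \<in> mod_hom Sr (mod_sum (FS (Suc a)) (FS b)) (FS (Suc a + b))"
      by (rule mod_homI) (auto simp: c ad sm elim!: mod_sum_cases)
    moreover have "inj_on ?J (carrier (mod_sum (FS (Suc a)) (FS b)))"
      by (rule inj_onI) (auto dest: ii elim!: mod_sum_cases)
    ultimately show ?case by (intro bexI[of _ ?J])
  qed
  then show ?thesis unfolding lattice_def by auto
qed

section \<open>Vector spaces\<close>

text \<open>A module killed by the maximal ideal is a vector space over \<open>k\<close>, and a
  basis is built greedily: the injection is extended by \<open>x\<close> only if \<open>x\<close> is
  not yet in its image.\<close>

lemma killed_free:
  assumes Q: "module R Q" and kill: "\<And>r x. r \<in> carrier R \<Longrightarrow> r $ 0 = 0 \<Longrightarrow> x \<in> carrier Q \<Longrightarrow> r \<odot>\<^bsub>Q\<^esub> x = \<zero>\<^bsub>Q\<^esub>"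
    and "finite A" "A \<subseteq> carrier Q"
  shows "\<exists>r. \<exists>\<psi>\<in>mod_hom R (FK r) Q. inj_on \<psi> (carrier (FK r)) \<and> A \<subseteq> \<psi> ` carrier (FK r)"
  using assms(3,4)
proof (induction A)
  case empty
  have "(\<lambda>_. \<zero>\<^bsub>Q\<^esub>) \<in> mod_hom R (FK 0) Q" by (rule mod_hom_const[OF Q])
  then show ?case by (intro exI[of _ 0] bexI) auto
next
  case (insert x A)
  then obtain r \<psi> where \<psi>: "\<psi> \<in> mod_hom R (FK r) Q" and inj: "inj_on \<psi> (carrier (FK r))"
    and A: "A \<subseteq> \<psi> ` carrier (FK r)" by blast
  have x: "x \<in> carrier Q" using insert by simp
  show ?case
  proof (cases "x \<in> \<psi> ` carrier (FK r)")
    case True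
    then show ?thesis using \<psi> inj A by blast
  next
    case False
    have F: "module R (FK r)" and F': "module R (FK (Suc r))" by (simp_all del: frk.simps)
    note \<psi>c = mod_hom_closed[OF \<psi>] and \<psi>a = mod_hom_add[OF \<psi>] and \<psi>s = mod_hom_smult[OF \<psi>]
    let ?P = "\<lambda>p. fps_fst p \<odot>\<^bsub>Q\<^esub> x \<oplus>\<^bsub>Q\<^esub> \<psi> (fps_snd p)"
    \<comment> \<open>The series \<open>s\<close> acts through its constant coefficient, because the
      difference \<open>s - fps_const (s $ 0)\<close> lies in the maximal ideal. This is the scalar
      action on \<open>k_mod\<close>.\<close>
    have sm: "(fps_const (s $ 0) * fps_const c) \<odot>\<^bsub>Q\<^esub> x = s \<odot>\<^bsub>Q\<^esub> (fps_const c \<odot>\<^bsub>Q\<^esub> x)" if s: "s \<in> carrier R" for s c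
    proof -
      let ?t = "s - fps_const (s $ 0)"
      have t: "?t \<in> carrier R" using s zero_in_H by (auto simp: R_simps)
      have cx: "fps_const c \<odot>\<^bsub>Q\<^esub> x \<in> carrier Q" using Q x by simp
      have "s \<odot>\<^bsub>Q\<^esub> (fps_const c \<odot>\<^bsub>Q\<^esub> x) = (fps_const (s $ 0) + ?t) \<odot>\<^bsub>Q\<^esub> (fps_const c \<odot>\<^bsub>Q\<^esub> x)" by simp
      also have "\<dots> = fps_const (s $ 0) \<odot>\<^bsub>Q\<^esub> (fps_const c \<odot>\<^bsub>Q\<^esub> x) \<oplus>\<^bsub>Q\<^esub> ?t \<odot>\<^bsub>Q\<^esub> (fps_const c \<odot>\<^bsub>Q\<^esub> x)"
        by (rule smult_l(1)[OF Q cx const_in_R t])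
      also have "?t \<odot>\<^bsub>Q\<^esub> (fps_const c \<odot>\<^bsub>Q\<^esub> x) = \<zero>\<^bsub>Q\<^esub>" by (rule kill[OF t _ cx]) simp
      finally show ?thesis using smult_l(2)[OF Q x const_in_R const_in_R] cx Q by simp
    qed
    have hom: "?P \<in> mod_hom R (FK (Suc r)) Q"
    proof (rule mod_homI)
      show "?P p \<in> carrier Q" if "p \<in> carrier (FK (Suc r))" for p
        using that Q x by (auto simp: \<psi>c elim!: mod_sum_cases)
      show "?P (p \<oplus>\<^bsub>FK (Suc r)\<^esub> q) = ?P p \<oplus>\<^bsub>Q\<^esub> ?P q"
        if pq: "p \<in> carrier (FK (Suc r))" "q \<in> carrier (FK (Suc r))" for p q
      proof -
        obtain a v b w where e: "p = fps_pair (fps_const a) v" "q = fps_pair (fps_const b) w"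
          "v \<in> carrier (FK r)" "w \<in> carrier (FK r)"
          using pq by (auto elim!: mod_sum_cases)
        show ?thesis using Q x e(3,4) by (simp add: e(1,2) \<psi>c \<psi>a smult_l(1)[OF Q x] group_ac del: fps_const_add)
      qed
      show "?P (s \<odot>\<^bsub>FK (Suc r)\<^esub> p) = s \<odot>\<^bsub>Q\<^esub> ?P p"
        if s: "s \<in> carrier R" and p: "p \<in> carrier (FK (Suc r))" for s p
      proof -
        obtain a v where e: "p = fps_pair (fps_const a) v" "v \<in> carrier (FK r)"
          using p by (auto elim!: mod_sum_cases)
        show ?thesis using Q x s e(2) by (simp add: e(1) \<psi>c \<psi>s sm smult_r_distr del: fps_const_mult)
      qed
    qed
    have ker: "p = \<zero>\<^bsub>FK (Suc r)\<^esub>" if p: "p \<in> carrier (FK (Suc r))" and z: "?P p = \<zero>\<^bsub>Q\<^esub>" for p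
    proof -
      obtain c v where e: "p = fps_pair (fps_const c) v" "v \<in> carrier (FK r)"
        using p by (auto elim!: mod_sum_cases)
      have cx: "fps_const c \<odot>\<^bsub>Q\<^esub> x \<in> carrier Q" using Q x by simp
      have z': "fps_const c \<odot>\<^bsub>Q\<^esub> x \<oplus>\<^bsub>Q\<^esub> \<psi> v = \<zero>\<^bsub>Q\<^esub>" using z by (simp add: e(1))
      have pv: "\<psi> v = \<ominus>\<^bsub>Q\<^esub> (fps_const c \<odot>\<^bsub>Q\<^esub> x)" by (rule minus_unique[OF Q cx \<psi>c[OF e(2)] z'])
      \<comment> \<open>Otherwise dividing by \<open>c\<close> would put \<open>x\<close> into the
        image of \<open>\<psi>\<close>.\<close>
      have c0: "c = 0"
      proof (rule ccontr)
        assume c: "c \<noteq> 0"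
        have "x = (fps_const (inverse c) * fps_const c) \<odot>\<^bsub>Q\<^esub> x" using c smult_l(3)[OF Q x const_in_R const_in_R] by simp
        also have "\<dots> = fps_const (inverse c) \<odot>\<^bsub>Q\<^esub> (fps_const c \<odot>\<^bsub>Q\<^esub> x)"
          by (rule smult_l(2)[OF Q x const_in_R const_in_R])
        also have "fps_const c \<odot>\<^bsub>Q\<^esub> x = \<psi> (\<ominus>\<^bsub>FK r\<^esub> v)"
          using hom_minus[OF F Q \<psi> e(2)] pv cx Q by simp
        also have "fps_const (inverse c) \<odot>\<^bsub>Q\<^esub> \<psi> (\<ominus>\<^bsub>FK r\<^esub> v) = \<psi> (fps_const (inverse c) \<odot>\<^bsub>FK r\<^esub> (\<ominus>\<^bsub>FK r\<^esub> v))"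
          by (rule \<psi>s[symmetric]) (use F e(2) in simp_all)
        finally have "x \<in> \<psi> ` carrier (FK r)"
          using F e(2) by (metis (no_types, lifting) image_eqI minus_closed smult_closed const_in_R)
        then show False using False by simp
      qed
      have "\<psi> v = \<psi> \<zero>\<^bsub>FK r\<^esub>" using pv smult_l(4)[OF Q x const_in_R const_in_R] hom_zero[OF F Q \<psi>] Q by (simp add: c0)
      then have "v = \<zero>\<^bsub>FK r\<^esub>" using inj_onD[OF inj _ e(2)] F by simp
      then show ?thesis by (simp add: e(1) c0)
    qed
    have "inj_on ?P (carrier (FK (Suc r)))"
    proof (rule inj_onI)
      fix p q assume pq: "p \<in> carrier (FK (Suc r))" "q \<in> carrier (FK (Suc r))" "?P p = ?P q"
      have "p \<oplus>\<^bsub>FK (Suc r)\<^esub> \<ominus>\<^bsub>FK (Suc r)\<^esub> q = \<zero>\<^bsub>FK (Suc r)\<^esub>"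
      proof (rule ker)
        show c: "p \<oplus>\<^bsub>FK (Suc r)\<^esub> \<ominus>\<^bsub>FK (Suc r)\<^esub> q \<in> carrier (FK (Suc r))"
          using F' pq(1,2) by (simp del: frk.simps)
        show "?P (p \<oplus>\<^bsub>FK (Suc r)\<^esub> \<ominus>\<^bsub>FK (Suc r)\<^esub> q) = \<zero>\<^bsub>Q\<^esub>"
          using mod_hom_add[OF hom pq(1), of "\<ominus>\<^bsub>FK (Suc r)\<^esub> q"] hom_minus[OF F' Q hom pq(2)]
            mod_hom_closed[OF hom pq(2)] pq F' Q by (simp del: frk.simps)
      qed
      then show "p = q" by (rule eq_if_diff_zero[OF F' pq(1,2)])
    qed
    moreover have "insert x A \<subseteq> ?P ` carrier (FK (Suc r))"
    proof -
      have "?P (fps_pair (fps_const 1) \<zero>\<^bsub>FK r\<^esub>) = x"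
        using hom_zero[OF F Q \<psi>] smult_l(3)[OF Q x const_in_R const_in_R] Q x by simp
      moreover have "fps_pair (fps_const 1) \<zero>\<^bsub>FK r\<^esub> \<in> carrier (FK (Suc r))" using F by simp
      ultimately have 1: "x \<in> ?P ` carrier (FK (Suc r))" by (metis (no_types, lifting) image_eqI)
      have "?P (fps_pair (fps_const 0) v) = \<psi> v" if "v \<in> carrier (FK r)" for v
        using smult_l(4)[OF Q x const_in_R const_in_R] Q x \<psi>c[OF that] by simp
      moreover have "fps_pair (fps_const 0) v \<in> carrier (FK (Suc r))" if "v \<in> carrier (FK r)" for v
        using that by simp
      ultimately have "\<psi> ` carrier (FK r) \<subseteq> ?P ` carrier (FK (Suc r))"
        by (metis (no_types, lifting) image_eqI image_subsetI)
      then show ?thesis using 1 A by blast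
    qed
    ultimately show ?thesis using hom by blast
  qed
qed

text \<open>The quotient \<open>B / A\<close> is finitely generated and killed by the maximal ideal,
  so its basis map is bijective. The required surjection is the projection followed by the inverse
  of that map.\<close>

lemma free_quot_k:
  assumes M: "module R M" and A: "submodule A R M" and B: "submodule B R M" and AB: "A \<subseteq> B"
    and fg: "fg_module R (M\<lparr>carrier := B\<rparr>)"
    and kill: "\<And>r x. r \<in> carrier R \<Longrightarrow> r $ 0 = 0 \<Longrightarrow> x \<in> B \<Longrightarrow> r \<odot>\<^bsub>M\<^esub> x \<in> A"
  shows "free_quot R k_mod M B A"
proof -
  let ?B = "M\<lparr>carrier := B\<rparr>"
  note mB = submodule_module[OF M B] and A' = submodule_in_restrict[OF M B A AB]
  let ?Q = "mquot ?B A"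
  have Q: "module R ?Q" by (rule module_mquot[OF mB A'])
  note rh = rep_hom[OF mB A']
  have Qc: "carrier ?Q = rep ?B A ` B" "\<zero>\<^bsub>?Q\<^esub> = rep ?B A \<zero>\<^bsub>?B\<^esub>" by (simp_all add: mquot_def)
  have killQ: "r \<odot>\<^bsub>?Q\<^esub> x = \<zero>\<^bsub>?Q\<^esub>" if r: "r \<in> carrier R" "r $ 0 = 0" and x: "x \<in> carrier ?Q" for r x
  proof -
    obtain b where b: "b \<in> B" "x = rep ?B A b" using x by (auto simp: Qc)
    have "r \<odot>\<^bsub>?Q\<^esub> x = rep ?B A (r \<odot>\<^bsub>?B\<^esub> b)" using mod_hom_smult[OF rh r(1), of b] b by simp
    also have "\<dots> = rep ?B A \<zero>\<^bsub>?B\<^esub>"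
      using rep_zero_iff[OF mB A', of "r \<odot>\<^bsub>?B\<^esub> b"] kill[OF r b(1)] AB by auto
    finally show ?thesis by (simp add: Qc)
  qed
  obtain G where G: "finite G" "G \<subseteq> carrier ?Q" "\<And>N. submodule N R ?Q \<Longrightarrow> G \<subseteq> N \<Longrightarrow> N = carrier ?Q"
    using fg_mquot[OF fg A'] unfolding fg_module_def by auto
  obtain r \<psi> where \<psi>: "\<psi> \<in> mod_hom R (FK r) ?Q" "inj_on \<psi> (carrier (FK r))"
    "G \<subseteq> \<psi> ` carrier (FK r)"
    using killed_free[OF Q killQ G(1,2)] by blast
  have F: "module R (FK r)" by simp
  have "\<psi> ` carrier (FK r) = carrier ?Q"
    by (rule G(3)[OF submodule_image[OF F Q \<psi>(1) submodule_carrier[OF F]] \<psi>(3)])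
  then have bij: "bij_betw \<psi> (carrier (FK r)) (carrier ?Q)" using \<psi>(2) by (simp add: bij_betw_def)
  let ?i = "the_inv_into (carrier (FK r)) \<psi>"
  note ih = mod_hom_inverse[OF \<psi>(1) bij F] and ib = bij_betw_the_inv_into[OF bij]
  show ?thesis
  proof (rule free_quotI[of "\<lambda>x. ?i (rep ?B A x)" _ _ _ _ r])
    show "(\<lambda>x. ?i (rep ?B A x)) \<in> mod_hom R ?B (FK r)" by (rule mod_hom_comp[OF rh ih])
    show "(\<lambda>x. ?i (rep ?B A x)) ` B = carrier (FK r)"
      using ib unfolding bij_betw_def Qc image_image by simp
    fix x assume x: "x \<in> B"
    have xQ: "rep ?B A x \<in> carrier ?Q" using x by (simp add: Qc)
    have "?i (rep ?B A x) = \<zero>\<^bsub>FK r\<^esub> \<longleftrightarrow> ?i (rep ?B A x) = ?i \<zero>\<^bsub>?Q\<^esub>"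
      using hom_zero[OF Q F ih] by simp
    also have "\<dots> \<longleftrightarrow> rep ?B A x = \<zero>\<^bsub>?Q\<^esub>"
      using bij_betw_imp_inj_on[OF ib] xQ zero_closed[OF Q] by (auto simp: inj_on_def)
    also have "\<dots> \<longleftrightarrow> x \<in> A" unfolding Qc using rep_zero_iff[OF mB A', of x] x by simp
    finally show "?i (rep ?B A x) = \<zero>\<^bsub>FK r\<^esub> \<longleftrightarrow> x \<in> A" .
  qed
qed

section \<open>Filtrations of complexes of lattices\<close>

text \<open>
  In the proof, \<open>L'\<close> is \<open>L\<close> shifted by one with the zero module in front, \<open>Z j\<close> lies between
  \<open>L' j\<close> and \<open>L j\<close>, and \<open>F\<close> runs through \<open>L' 0, Z 0, L' 1, Z 1, \<dots>\<close>; the subquotients with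
  index below 2 are free over \<open>S\<close>, the others are vector spaces over \<open>k\<close>.
\<close>
lemma lattice_level:
  fixes SP :: "int \<Rightarrow> ('k fps, 'k fps) module"
  assumes Y: "bcpx R Y" and Yc: "\<And>n. cobj Y n = (SP n)\<lparr>carrier := K n\<rparr>"
    and lat: "\<And>n. lattice (SP n)" and K: "\<And>n. submodule (K n) R (SP n)"
    and d: "\<And>n. d n \<in> mod_hom Sr (SP n) (SP (n + 1))"
    and Yd: "\<And>n x. x \<in> K n \<Longrightarrow> cdif Y n x = d n x"
    and e: "\<And>h. h \<in> H \<Longrightarrow> h \<noteq> 0 \<Longrightarrow> e \<le> h" and N: "\<And>h. N * e \<le> h \<Longrightarrow> h \<in> H"
    and stS: "stalk S_mod \<in> generated (Db R) \<X>" and stk: "stalk k_mod \<in> generated (Db R) \<X>"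
  shows "Y \<in> level (Db R) \<X> (2 * N + 2)"
proof -
  have mS: "module Sr (SP n)" for n using lat[of n] by (simp add: lattice_def)
  note mR = restrict_scalars[OF mS] and dR = mod_hom_restrict[OF d]
  note KD = submoduleD[OF mR K]
  have dK: "d n x \<in> K (n + 1)" if "x \<in> K n" for n x
    using cdif_closed[OF Y, of x n "n + 1"] that by (simp add: Yc Yd)
  have dd: "d (n + 1) (d n x) = \<zero>\<^bsub>SP (n + 1 + 1)\<^esub>" if "x \<in> K n" for n x
    using cdif_cdif[OF Y, of x n "n + 1"] that dK[OF that] by (simp add: Yc Yd)
  define ord where "ord j s \<longleftrightarrow> (\<forall>i<j * e. s $ i = 0)" for j and s :: "'k fps"
  define L where "L j n = {x \<in> K n. \<forall>s. ord j s \<longrightarrow> s \<odot>\<^bsub>SP n\<^esub> x \<in> K n}" for j n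
  define L' where "L' j n = (case j of 0 \<Rightarrow> {\<zero>\<^bsub>SP n\<^esub>} | Suc j \<Rightarrow> L j n)" for j n
  define Z where "Z j n = {x \<in> L j n. d n x \<in> L' j (n + 1)}" for j n
  define F where "F i n = (if even i then L' (i div 2) n else Z (i div 2) n)" for i n
  have [simp]: "L' 0 n = {\<zero>\<^bsub>SP n\<^esub>}" "L' (Suc j) n = L j n" for j n by (simp_all add: L'_def)
  have ord_mono: "ord (Suc j) s \<Longrightarrow> ord j s" for j s unfolding ord_def by auto
  have ord_mult: "ord j (r * s)" if "ord j s" for j r s
    using that unfolding ord_def by (simp add: fps_mult_nth)
  have LK: "x \<in> K n" if "x \<in> L j n" for x j n using that by (simp add: L_def)
  have Ls: "s \<odot>\<^bsub>SP n\<^esub> x \<in> K n" if "x \<in> L j n" "ord j s" for s x j n using that by (simp add: L_def)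
  have LI: "x \<in> L j n" if "x \<in> K n" "\<And>s. ord j s \<Longrightarrow> s \<odot>\<^bsub>SP n\<^esub> x \<in> K n" for x j n using that by (simp add: L_def)
  have subL: "submodule (L j n) R (SP n)" for j n
  proof (rule submoduleI[OF mR])
    show "L j n \<subseteq> carrier (SP n)" by (rule subsetI) (rule KD(1)[OF LK])
    show "\<zero>\<^bsub>SP n\<^esub> \<in> L j n" by (rule LI) (simp_all add: KD(2) S.smult_r_zero[OF mS])
    show "x \<oplus>\<^bsub>SP n\<^esub> y \<in> L j n" if x: "x \<in> L j n" and y: "y \<in> L j n" for x y
    proof (rule LI[OF KD(3)[OF LK[OF x] LK[OF y]]])
      fix s assume s: "ord j s"
      show "s \<odot>\<^bsub>SP n\<^esub> (x \<oplus>\<^bsub>SP n\<^esub> y) \<in> K n"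
        using KD(3)[OF Ls[OF x s] Ls[OF y s]] KD(1)[OF LK[OF x]] KD(1)[OF LK[OF y]]
        by (simp add: S.smult_r_distr[OF mS])
    qed
    show "r \<odot>\<^bsub>SP n\<^esub> x \<in> L j n" if r: "r \<in> carrier R" and x: "x \<in> L j n" for r x
    proof (rule LI[OF KD(5)[OF r LK[OF x]]])
      fix s assume s: "ord j s"
      show "s \<odot>\<^bsub>SP n\<^esub> (r \<odot>\<^bsub>SP n\<^esub> x) \<in> K n"
        using Ls[OF x ord_mult[OF s, of r]] smult_l_S(2)[OF mS KD(1)[OF LK[OF x]], of s r] by (simp add: mult.commute)
    qed
  qed
  have zL: "\<zero>\<^bsub>SP n\<^esub> \<in> L j n" for j n by (rule submoduleD(2)[OF mR subL])
  have subL': "submodule (L' j n) R (SP n)" for j n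
    by (cases j) (simp_all add: subL submodule_zero[OF mR])
  have zL': "\<zero>\<^bsub>SP n\<^esub> \<in> L' j n" for j n by (rule submoduleD(2)[OF mR subL'])
  have subZ: "submodule (Z j n) R (SP n)" for j n
    unfolding Z_def by (rule submodule_vimage[OF mR mR dR subL subL'])
  have L_mono: "L j n \<subseteq> L (Suc j) n" for j n unfolding L_def using ord_mono by auto
  have L'_mono: "L' j n \<subseteq> L j n" for j n by (cases j) (simp_all add: zL L_mono)
  \<comment> \<open>This is where the \<open>S\<close>-linear extension of the differential is used:
    \<open>s (d x) = d (s x)\<close> for every \<open>s\<close> in \<open>S\<close>.\<close>
  have dL: "d n x \<in> L j (n + 1)" if x: "x \<in> L j n" for x j n
  proof (rule LI[OF dK[OF LK[OF x]]])
    fix s assume s: "ord j s"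
    have "s \<odot>\<^bsub>SP (n + 1)\<^esub> d n x = d n (s \<odot>\<^bsub>SP n\<^esub> x)"
      by (rule mod_hom_smult[OF d, symmetric]) (simp_all add: KD(1)[OF LK[OF x]])
    then show "s \<odot>\<^bsub>SP (n + 1)\<^esub> d n x \<in> K (n + 1)" using dK[OF Ls[OF x s]] by simp
  qed
  have dL': "d n x \<in> L' j (n + 1)" if "x \<in> L' j n" for x j n
    using that by (cases j) (simp_all add: dL hom_zero[OF mR mR dR])
  have L'Z: "L' j n \<subseteq> Z j n" for j n unfolding Z_def using L'_mono dL' by blast
  have ZL: "Z j n \<subseteq> L j n" for j n unfolding Z_def by blast
  \<comment> \<open>The support of \<open>r\<close> lies in \<open>H\<close> without 0, so
    \<open>r\<close> has order at least \<open>e\<close>. Multiplication by \<open>r\<close>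
    therefore raises order \<open>j e\<close> to \<open>(j + 1) e\<close>.\<close>
  have rad: "r \<odot>\<^bsub>SP n\<^esub> x \<in> L j n" if r: "r \<in> carrier R" "r $ 0 = 0" and x: "x \<in> L (Suc j) n" for r x j n
  proof (rule LI[OF KD(5)[OF r(1) LK[OF x]]])
    fix s assume s: "ord j s"
    have r0: "r $ i = 0" if "i < e" for i
    proof (rule ccontr)
      assume ri: "r $ i \<noteq> 0"
      then have "i \<in> H" using r(1) by (simp add: R_simps)
      moreover have "i \<noteq> 0" using ri r(2) by metis
      ultimately have "e \<le> i" by (rule e)
      then show False using that by simp
    qed
    have "ord (Suc j) (s * r)" unfolding ord_def
    proof (intro allI impI)
      fix i assume i: "i < Suc j * e"
      have "s $ k * r $ (i - k) = 0" if "k \<le> i" for k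
      proof (cases "k < j * e")
        case True then show ?thesis using s by (simp add: ord_def)
      next
        case False
        then have "i - k < e" using i that by auto
        then show ?thesis by (simp add: r0)
      qed
      then show "(s * r) $ i = 0" unfolding fps_mult_nth by (intro sum.neutral ballI) simp
    qed
    then have "(s * r) \<odot>\<^bsub>SP n\<^esub> x \<in> K n" by (rule Ls[OF x])
    then show "s \<odot>\<^bsub>SP n\<^esub> (r \<odot>\<^bsub>SP n\<^esub> x) \<in> K n" by (simp add: smult_l_S(2)[OF mS KD(1)[OF LK[OF x]]])
  qed
  \<comment> \<open>A series of order at least \<open>N e\<close> has its support in
    \<open>H\<close>, so it belongs to \<open>R\<close> and preserves \<open>K n\<close>.\<close>
  have LN: "L N n = K n" for n
  proof -
    have "x \<in> L N n" if x: "x \<in> K n" for x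
    proof (rule LI[OF x KD(5)[OF _ x]])
      fix s assume s: "ord N s"
      show "s \<in> carrier R" unfolding R_simps
      proof (intro allI impI N)
        fix i assume "s $ i \<noteq> 0"
        then show "N * e \<le> i" using s unfolding ord_def by (metis not_le)
      qed
    qed
    then show ?thesis using LK by (intro subset_antisym subsetI)
  qed
  \<comment> \<open>For \<open>j = 0\<close> the order condition is empty, so \<open>L 0 n\<close>
    is the largest \<open>S\<close>-submodule contained in \<open>K n\<close>.\<close>
  have ord0: "ord 0 s" for s by (simp add: ord_def)
  have subL0: "submodule (L 0 n) Sr (SP n)" for n
  proof (rule S.submoduleI[OF mS])
    note D = submoduleD[OF mR subL]
    show "L 0 n \<subseteq> carrier (SP n)" "\<zero>\<^bsub>SP n\<^esub> \<in> L 0 n" using D(1,2) by (intro subsetI, simp_all)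
    show "x \<oplus>\<^bsub>SP n\<^esub> y \<in> L 0 n" if "x \<in> L 0 n" "y \<in> L 0 n" for x y by (rule D(3)[OF that])
    show "r \<odot>\<^bsub>SP n\<^esub> x \<in> L 0 n" if x: "x \<in> L 0 n" for r x
    proof (rule LI[OF Ls[OF x ord0]])
      fix s :: "'k fps"
      show "s \<odot>\<^bsub>SP n\<^esub> (r \<odot>\<^bsub>SP n\<^esub> x) \<in> K n"
        using Ls[OF x ord0, of "s * r"] by (simp add: smult_l_S(2)[OF mS KD(1)[OF LK[OF x]]])
    qed
  qed
  have subZ0: "submodule (Z 0 n) Sr (SP n)" for n
    unfolding Z_def by (rule S.submodule_vimage[OF mS mS d subL0]) (simp add: S.submodule_zero[OF mS])
  have FK: "F i n \<subseteq> K n" for i n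
  proof -
    have "L' j n \<subseteq> K n" "Z j n \<subseteq> K n" for j using L'_mono ZL LK by blast+
    then show ?thesis by (simp add: F_def)
  qed
  have subF: "submodule (F i n) R (SP n)" for i n by (simp add: F_def subL' subZ)
  have even_Suc: "F (Suc (2 * j)) n = Z j n" "F (2 * j) n = L' j n" "F (Suc (Suc (2 * j))) n = L j n" for j n
    by (simp_all add: F_def)
  let ?D = "\<lambda>i::nat. if i < 2 then S_mod else (k_mod :: ('k fps, 'k fps) module)"
  have parity: "(\<And>j. P (2 * j)) \<Longrightarrow> (\<And>j. P (Suc (2 * j))) \<Longrightarrow> P i" for P and i :: nat
    by (cases "even i") (auto elim!: evenE oddE)
  have "Y \<in> level (Db R) \<X> (Suc (2 * N + 1))"
  proof (rule filtration_level[OF Y, of F "2 * N + 1" ?D])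
    show "submodule (F i n) R (cobj Y n)" for i n
      unfolding Yc by (rule submodule_in_restrict[OF mR K subF FK])
    show "F 0 n = {\<zero>\<^bsub>cobj Y n\<^esub>}" for n by (simp add: F_def Yc)
    show "F (Suc (2 * N + 1)) n = carrier (cobj Y n)" for n using even_Suc(3)[of N n] by (simp add: Yc LN)
    show "F i n \<subseteq> F (Suc i) n" for i n
      by (rule parity[of "\<lambda>i. F i n \<subseteq> F (Suc i) n"]) (unfold even_Suc, rule L'Z, rule ZL)
    show "cdif Y n x \<in> F i (n + 1)" if x: "x \<in> F (Suc i) n" for i n x
    proof -
      have "\<forall>x\<in>F (Suc i) n. d n x \<in> F i (n + 1)"
      proof (rule parity[of "\<lambda>i. \<forall>x\<in>F (Suc i) n. d n x \<in> F i (n + 1)"])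
        show "\<forall>x\<in>F (Suc (2 * j)) n. d n x \<in> F (2 * j) (n + 1)" for j
          unfolding even_Suc by (simp add: Z_def)
        \<comment> \<open>The image \<open>d x\<close> lies in \<open>Z j\<close> because it lies in
          \<open>L j\<close> and \<open>d (d x) = 0\<close> lies in every \<open>L'\<close>.\<close>
        show "\<forall>x\<in>F (Suc (Suc (2 * j))) n. d n x \<in> F (Suc (2 * j)) (n + 1)" for j
          unfolding even_Suc Z_def using dL dd[OF LK] zL' by auto
      qed
      then show ?thesis using x FK Yd by (metis subsetD)
    qed
    show "fg_module R (?D i)" for i using fg_S_mod[OF H, where 'a = 'k] fg_k_mod[OF H, where 'a = 'k] by (simp add: R_eq)
    show "stalk (?D i) \<in> generated (Db R) \<X>" for i using stS stk by simp
    show "free_quot R (?D i) (cobj Y n) (F (Suc i) n) (F i n)" for i n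
    proof -
      have k: "free_quot R k_mod (SP n) (F (Suc i) n) (F i n)" if i: "2 \<le> i"
      proof (rule free_quot_k[OF mR subF subF _ lattice_fg[OF lat subF]])
        have "2 \<le> i \<longrightarrow> F i n \<subseteq> F (Suc i) n \<and> (\<forall>x\<in>F (Suc i) n. \<forall>r\<in>carrier R. r $ 0 = 0 \<longrightarrow> r \<odot>\<^bsub>SP n\<^esub> x \<in> F i n)"
        proof (rule parity[of "\<lambda>i. 2 \<le> i \<longrightarrow> F i n \<subseteq> F (Suc i) n \<and> (\<forall>x\<in>F (Suc i) n. \<forall>r\<in>carrier R. r $ 0 = 0 \<longrightarrow> r \<odot>\<^bsub>SP n\<^esub> x \<in> F i n)"])
          show "2 \<le> 2 * j \<longrightarrow> F (2 * j) n \<subseteq> F (Suc (2 * j)) n \<and>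
              (\<forall>x\<in>F (Suc (2 * j)) n. \<forall>r\<in>carrier R. r $ 0 = 0 \<longrightarrow> r \<odot>\<^bsub>SP n\<^esub> x \<in> F (2 * j) n)" for j
          proof (cases j)
            case (Suc l)
            have "r \<odot>\<^bsub>SP n\<^esub> x \<in> L' j n" if "x \<in> Z j n" "r \<in> carrier R" "r $ 0 = 0" for r x
              using rad[OF that(2,3), of x l n] subsetD[OF ZL that(1)] by (simp add: Suc)
            then show ?thesis unfolding even_Suc using L'Z[of j n] by simp
          qed simp
          show "2 \<le> Suc (2 * j) \<longrightarrow> F (Suc (2 * j)) n \<subseteq> F (Suc (Suc (2 * j))) n \<and>
              (\<forall>x\<in>F (Suc (Suc (2 * j))) n. \<forall>r\<in>carrier R. r $ 0 = 0 \<longrightarrow> r \<odot>\<^bsub>SP n\<^esub> x \<in> F (Suc (2 * j)) n)" for j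
          proof (cases j)
            case (Suc l)
            \<comment> \<open>The product already lies in \<open>L' j\<close>, which is contained in
              \<open>Z j\<close>.\<close>
            have "r \<odot>\<^bsub>SP n\<^esub> x \<in> Z j n" if "x \<in> L j n" "r \<in> carrier R" "r $ 0 = 0" for r x
              using rad[OF that(2,3), of x l n] that(1) L'Z[of j n] by (auto simp: Suc)
            then show ?thesis unfolding even_Suc using ZL by simp
          qed simp
        qed
        with i show "F i n \<subseteq> F (Suc i) n"
          and "\<And>r x. r \<in> carrier R \<Longrightarrow> r $ 0 = 0 \<Longrightarrow> x \<in> F (Suc i) n \<Longrightarrow> r \<odot>\<^bsub>SP n\<^esub> x \<in> F i n" by simp_all
      qed
      \<comment> \<open>As \<open>L' 0\<close> is zero, \<open>Z 0 n\<close> is the kernel of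
        \<open>d\<close> on \<open>L 0 n\<close>, an \<open>S\<close>-submodule of a
        lattice.\<close>
      have s0: "free_quot R S_mod (SP n) (Z 0 n) {\<zero>\<^bsub>SP n\<^esub>}"
      proof -
        obtain r \<theta> where \<theta>: "\<theta> \<in> mod_hom R ((SP n)\<lparr>carrier := Z 0 n\<rparr>) (FS r)" "bij_betw \<theta> (Z 0 n) (carrier (FS r))"
          using lattice_free[OF lat subZ0] by blast
        show ?thesis
        proof (rule free_quotI[OF \<theta>(1)])
          show "\<theta> ` Z 0 n = carrier (FS r)" using \<theta>(2) by (simp add: bij_betw_def)
          have z: "\<theta> \<zero>\<^bsub>SP n\<^esub> = \<zero>\<^bsub>FS r\<^esub>"
            using hom_zero[OF submodule_module[OF mR subZ] _ \<theta>(1)] by (simp add: module_frk)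
          fix x assume x: "x \<in> Z 0 n"
          have "\<theta> x = \<theta> \<zero>\<^bsub>SP n\<^esub> \<longleftrightarrow> x = \<zero>\<^bsub>SP n\<^esub>"
            by (rule inj_on_eq_iff[OF bij_betw_imp_inj_on[OF \<theta>(2)] x submoduleD(2)[OF mR subZ]])
          then show "\<theta> x = \<zero>\<^bsub>FS r\<^esub> \<longleftrightarrow> x \<in> {\<zero>\<^bsub>SP n\<^esub>}" by (simp add: z)
        qed
      qed
      \<comment> \<open>The quotient \<open>L 0 / Z 0\<close> is isomorphic to the image of
        \<open>d\<close>. That image is an \<open>S\<close>-submodule of the lattice in the next
        degree, hence free.\<close>
      have s1: "free_quot R S_mod (SP n) (L 0 n) (Z 0 n)"
      proof -
        have sub: "submodule (d n ` L 0 n) Sr (SP (n + 1))" by (rule S.submodule_image[OF mS mS d subL0])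
        obtain r \<theta> where \<theta>: "\<theta> \<in> mod_hom R ((SP (n + 1))\<lparr>carrier := d n ` L 0 n\<rparr>) (FS r)"
          "bij_betw \<theta> (d n ` L 0 n) (carrier (FS r))"
          using lattice_free[OF lat sub] by blast
        note subR = submodule_restrict[OF mS sub]
        have dh: "d n \<in> mod_hom R ((SP n)\<lparr>carrier := L 0 n\<rparr>) ((SP (n + 1))\<lparr>carrier := d n ` L 0 n\<rparr>)"
          by (rule mod_homI) (use KD(1)[OF LK] in \<open>simp_all add: mod_hom_add[OF dR] mod_hom_smult[OF dR]\<close>)
        show ?thesis
        proof (rule free_quotI[OF mod_hom_comp[OF dh \<theta>(1)]])
          show "(\<lambda>x. \<theta> (d n x)) ` L 0 n = carrier (FS r)" using \<theta>(2) by (simp add: bij_betw_def image_image)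
          have z: "\<theta> \<zero>\<^bsub>SP (n + 1)\<^esub> = \<zero>\<^bsub>FS r\<^esub>"
            using hom_zero[OF submodule_module[OF mR subR] _ \<theta>(1)] by (simp add: module_frk)
          fix x assume x: "x \<in> L 0 n"
          have "\<theta> (d n x) = \<theta> \<zero>\<^bsub>SP (n + 1)\<^esub> \<longleftrightarrow> d n x = \<zero>\<^bsub>SP (n + 1)\<^esub>"
            by (rule inj_on_eq_iff[OF bij_betw_imp_inj_on[OF \<theta>(2)] imageI[OF x] submoduleD(2)[OF mR subR]])
          then show "\<theta> (d n x) = \<zero>\<^bsub>FS r\<^esub> \<longleftrightarrow> x \<in> Z 0 n" using x by (simp add: z Z_def)
        qed
      qed
      consider "i = 0" | "i = 1" | "2 \<le> i" by linarith
      then have "free_quot R (?D i) (SP n) (F (Suc i) n) (F i n)"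
      proof cases
        case 1 then show ?thesis using s0 by (simp add: F_def)
      next
        case 2 then show ?thesis using s1 by (simp add: F_def)
      next
        case 3 then show ?thesis using k by simp
      qed
      then show ?thesis by (simp add: free_quot_def Yc)
    qed
  qed
  then show ?thesis by simp
qed

section \<open>Covering by a contractible complex of free modules\<close>

definition R_mod :: "('k fps, 'k fps) module" where
  "R_mod = S_mod\<lparr>carrier := carrier R\<rparr>"

abbreviation FR :: "nat \<Rightarrow> ('k fps, 'k fps) module" where "FR \<equiv> frk R_mod"

lemma R_mod_simps [simp]: "carrier R_mod = carrier R" "x \<oplus>\<^bsub>R_mod\<^esub> y = x + y" "r \<odot>\<^bsub>R_mod\<^esub> x = r * x" "\<zero>\<^bsub>R_mod\<^esub> = 0"
  by (simp_all add: R_mod_def)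

lemma R_closed [simp]: "0 \<in> carrier R" "1 \<in> carrier R" "x \<in> carrier R \<Longrightarrow> y \<in> carrier R \<Longrightarrow> x + y \<in> carrier R"
  "x \<in> carrier R \<Longrightarrow> y \<in> carrier R \<Longrightarrow> x * y \<in> carrier R"
proof -
  interpret R: cring R by (rule cring_R)
  show "0 \<in> carrier R" "1 \<in> carrier R" "x \<in> carrier R \<Longrightarrow> y \<in> carrier R \<Longrightarrow> x + y \<in> carrier R"
  "x \<in> carrier R \<Longrightarrow> y \<in> carrier R \<Longrightarrow> x * y \<in> carrier R"
    using R.zero_closed R.one_closed R.a_closed[of x y] R.m_closed[of x y] by (simp_all add: R_simps(2-5))
qed

lemma submodule_R: "submodule (carrier R) R S_mod"
  by (rule submoduleI) simp_all

lemma fg_R_mod: "fg_module R R_mod"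
proof -
  have m: "module R R_mod" unfolding R_mod_def by (rule submodule_module[OF module_S_mod(2) submodule_R])
  have "N = carrier R" if N: "submodule N R R_mod" "{1} \<subseteq> N" for N
  proof -
    have "r \<in> N" if "r \<in> carrier R" for r using submoduleD(5)[OF m N(1) that, of 1] N(2) by simp
    then show ?thesis using submoduleD(1)[OF m N(1)] by auto
  qed
  then show ?thesis unfolding fg_module_def using m by (intro conjI exI[of _ "{1}"]) auto
qed

lemma module_FR [simp]: "module R (FR a)"
  using fg_R_mod by (intro module_frk) (simp add: fg_module_def)

text \<open>A free \<open>R\<close>-module shares its operations with the free
  \<open>S\<close>-module of the same rank and differs only in its carrier, so its submodules are
  literally \<open>R\<close>-submodules of a lattice.\<close>

lemma FR_FS: "FR a = (FS a)\<lparr>carrier := carrier (FR a)\<rparr>"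
proof (induction a)
  case (Suc a)
  then have "mod_sum R_mod (FR a) = mod_sum (S_mod\<lparr>carrier := carrier R\<rparr>) ((FS a)\<lparr>carrier := carrier (FR a)\<rparr>)"
    by (simp add: R_mod_def)
  then show ?case by (simp add: mod_sum_def)
qed simp

lemma FR_sub: "carrier (FR a) \<subseteq> carrier (FS a)"
  by (induction a) (auto elim!: mod_sum_cases)

lemma free_cover:
  assumes M: "fg_module R M"
  shows "\<exists>a. \<exists>\<phi>\<in>mod_hom R (FR a) M. \<phi> ` carrier (FR a) = carrier M"
proof -
  have m: "module R M" using M by (simp add: fg_module_def)
  obtain A where A: "finite A" "A \<subseteq> carrier M" "\<forall>K. submodule K R M \<and> A \<subseteq> K \<longrightarrow> K = carrier M"
    using M unfolding fg_module_def by (elim conjE exE)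
  have "\<exists>a. \<exists>\<phi>\<in>mod_hom R (FR a) M. A \<subseteq> \<phi> ` carrier (FR a)"
    using A(1,2)
  proof (induction A)
    case empty
    show ?case by (intro exI[of _ 0] bexI[OF _ mod_hom_const[OF m]]) simp
  next
    case (insert x A)
    then obtain a \<phi> where \<phi>: "\<phi> \<in> mod_hom R (FR a) M" "A \<subseteq> \<phi> ` carrier (FR a)" by blast
    have x: "x \<in> carrier M" using insert by simp
    note c = mod_hom_closed[OF \<phi>(1)]
    let ?P = "\<lambda>p. fps_fst p \<odot>\<^bsub>M\<^esub> x \<oplus>\<^bsub>M\<^esub> \<phi> (fps_snd p)"
    have "?P \<in> mod_hom R (FR (Suc a)) M"
      by (rule mod_homI) (use m x in \<open>auto simp: c mod_hom_add[OF \<phi>(1)] mod_hom_smult[OF \<phi>(1)] smult_l[OF m x]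
        smult_r_distr group_ac elim!: mod_sum_cases\<close>)
    moreover have "insert x A \<subseteq> ?P ` carrier (FR (Suc a))"
    proof -
      have "?P (fps_pair 1 \<zero>\<^bsub>FR a\<^esub>) = x" using smult_l(3)[OF m x R_closed(1,1)] hom_zero[OF module_FR m \<phi>(1)] m x by simp
      moreover have "fps_pair 1 \<zero>\<^bsub>FR a\<^esub> \<in> carrier (FR (Suc a))" by (simp add: zero_closed[OF module_FR])
      ultimately have 1: "x \<in> ?P ` carrier (FR (Suc a))" by (metis (no_types, lifting) image_eqI)
      have "?P (fps_pair 0 v) = \<phi> v" if "v \<in> carrier (FR a)" for v
        using smult_l(4)[OF m x R_closed(1,1)] m x c[OF that] by simp
      moreover have "fps_pair 0 v \<in> carrier (FR (Suc a))" if "v \<in> carrier (FR a)" for v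
        using that by simp
      ultimately have "\<phi> ` carrier (FR a) \<subseteq> ?P ` carrier (FR (Suc a))"
        by (metis (no_types, lifting) image_eqI image_subsetI)
      then show ?thesis using 1 \<phi>(2) by blast
    qed
    ultimately show ?case by blast
  qed
  then obtain a \<phi> where \<phi>: "\<phi> \<in> mod_hom R (FR a) M" "A \<subseteq> \<phi> ` carrier (FR a)" by blast
  have "\<phi> ` carrier (FR a) = carrier M"
    using A(3) submodule_image[OF module_FR m \<phi>(1) submodule_carrier[OF module_FR]] \<phi>(2) by blast
  then show ?thesis using \<phi>(1) by blast
qed

text \<open>A free cover of each \<open>cobj X n\<close> is spread over the degrees \<open>n\<close>
  and \<open>n + 1\<close>. This makes the covering complex contractible and its kernel degreewise a
  submodule of a free module.\<close>

lemma bcpx_level: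
  assumes X: "bcpx R X"
    and e: "\<And>h. h \<in> H \<Longrightarrow> h \<noteq> 0 \<Longrightarrow> e \<le> h" and N: "\<And>h. N * e \<le> h \<Longrightarrow> h \<in> H"
    and stS: "stalk S_mod \<in> generated (Db R) \<X>" and stk: "stalk k_mod \<in> generated (Db R) \<X>"
  shows "X \<in> level (Db R) \<X> (2 * N + 2)"
proof -
  note mX = bcpx_module[OF X]
  obtain b where b: "\<And>n. b < \<bar>n\<bar> \<Longrightarrow> carrier (cobj X n) = {\<zero>\<^bsub>cobj X n\<^esub>}"
    by (rule bcpx_bound[OF X]) blast
  have "\<exists>a \<phi>. \<phi> \<in> mod_hom R (FR a) (cobj X n) \<and> \<phi> ` carrier (FR a) = carrier (cobj X n) \<and> (b < \<bar>n\<bar> \<longrightarrow> a = 0)" for n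
  proof (cases "b < \<bar>n\<bar>")
    case True
    then show ?thesis
      by (intro exI[of _ 0] exI[of _ "\<lambda>_. \<zero>\<^bsub>cobj X n\<^esub>"]) (simp add: b[OF True] mod_hom_const[OF mX])
  next
    case False
    then show ?thesis using free_cover[OF bcpx_fg[OF X, of n]] by blast
  qed
  then obtain a \<phi> where \<phi>: "\<And>n. \<phi> n \<in> mod_hom R (FR (a n)) (cobj X n)"
    and surj: "\<And>n. \<phi> n ` carrier (FR (a n)) = carrier (cobj X n)" and a0: "\<And>n. b < \<bar>n\<bar> \<Longrightarrow> a n = 0"
    by metis
  \<comment> \<open>The sum of the complexes with an identity map from degree \<open>n\<close> to
    degree \<open>n + 1\<close> of \<open>FR (a n)\<close>. No coefficients of \<open>X\<close>
    enter the differential, so the same formula works over \<open>S\<close>.\<close>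
  define P where "P = \<lparr>cobj = (\<lambda>n. mod_sum (FR (a n)) (FR (a (n - 1)))),
    cdif = (\<lambda>n p. fps_pair \<zero>\<^bsub>FR (a (n + 1))\<^esub> (fps_fst p))\<rparr>"
  have Pc [simp]: "cobj P n = mod_sum (FR (a n)) (FR (a (n - 1)))"
    and Pd [simp]: "cdif P n p = fps_pair \<zero>\<^bsub>FR (a (n + 1))\<^esub> (fps_fst p)" for n p by (simp_all add: P_def)
  have P: "bcpx R P"
  \<comment> \<open>Degree \<open>n\<close> also involves the rank \<open>a (n - 1)\<close>, which
    enlarges the bound by one.\<close>
  proof (rule bcpxI[of _ "b + 1"])
    show "fg_module R (cobj P n)" for n by (simp add: fg_mod_sum fg_frk fg_R_mod)
    show "cdif P n \<in> mod_hom R (cobj P n) (cobj P (n + 1))" for n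
      by (rule mod_homI) (simp_all add: zero_closed[OF module_FR] l_zero[OF module_FR] smult_r_zero[OF module_FR])
    show "cdif P (n + 1) (cdif P n x) = \<zero>\<^bsub>cobj P (n + 1 + 1)\<^esub>" for n x by simp
    show "carrier (cobj P n) = {\<zero>\<^bsub>cobj P n\<^esub>}" if "b + 1 < \<bar>n\<bar>" for n
      using a0[of n] a0[of "n - 1"] that by (auto elim!: mod_sum_cases)
  qed
  have ac: "acyclic P"
    unfolding acyclic_def
  proof (intro allI ballI impI)
    fix n p assume p: "p \<in> carrier (cobj P n)" "cdif P n p = \<zero>\<^bsub>cobj P (n + 1)\<^esub>"
    obtain x y where xy: "x \<in> carrier (FR (a n))" "y \<in> carrier (FR (a (n - 1)))" "p = fps_pair x y"
      using p(1) by (auto elim: mod_sum_cases)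
    have "x = \<zero>\<^bsub>FR (a n)\<^esub>" using p(2) by (simp add: xy(3))
    then show "\<exists>w\<in>carrier (cobj P (n - 1)). p = cdif P (n - 1) w"
      using xy by (intro bexI[of _ "fps_pair y \<zero>\<^bsub>FR (a (n - 1 - 1))\<^esub>"]) (simp_all add: zero_closed[OF module_FR])
  qed
  \<comment> \<open>A map out of such an identity complex is determined by its value in the lower
    degree; the copy in the upper degree must then go to \<open>X\<close> by \<open>cdif\<close>
    after \<open>\<phi>\<close>.\<close>
  define g where "g = (\<lambda>n p. \<phi> n (fps_fst p) \<oplus>\<^bsub>cobj X n\<^esub> cdif X (n - 1) (\<phi> (n - 1) (fps_snd p)))"
  have dX: "cdif X (n - 1) \<in> mod_hom R (cobj X (n - 1)) (cobj X n)" for n using cdif_hom[OF X, of "n - 1"] by simp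
  note \<phi>c = mod_hom_closed[OF \<phi>] and \<phi>0 = hom_zero[OF module_FR mX \<phi>]
  have g: "chain_map R P X g"
  proof (rule chain_mapI)
    show "g n \<in> mod_hom R (cobj P n) (cobj X n)" for n
      unfolding g_def Pc
      by (intro mod_hom_plus[OF mX] mod_hom_comp[OF mod_hom_fst \<phi>] mod_hom_comp[OF mod_hom_comp[OF mod_hom_snd \<phi>] dX])
    show "g (n + 1) (cdif P n p) = cdif X n (g n p)" if p: "p \<in> carrier (cobj P n)" for n p
    proof -
      obtain x y where xy: "x \<in> carrier (FR (a n))" "y \<in> carrier (FR (a (n - 1)))" "p = fps_pair x y"
        using p by (auto elim: mod_sum_cases)
      have "cdif X (n - 1) (\<phi> (n - 1) y) \<in> carrier (cobj X n)" using mod_hom_closed[OF dX \<phi>c[OF xy(2)]] .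
      then show ?thesis using X cdif_pred(4)[OF X \<phi>c[OF xy(2)]] \<phi>c[OF xy(1)] by (simp add: g_def xy(3) \<phi>0)
    qed
  qed
  have gs: "g n ` carrier (cobj P n) = carrier (cobj X n)" for n
  proof
    show "g n ` carrier (cobj P n) \<subseteq> carrier (cobj X n)" using mod_hom_closed[OF chain_map_hom[OF g]] by blast
    show "carrier (cobj X n) \<subseteq> g n ` carrier (cobj P n)"
    proof
      fix x assume "x \<in> carrier (cobj X n)"
      then obtain v where v: "v \<in> carrier (FR (a n))" "x = \<phi> n v" using surj[of n] by blast
      have "x = g n (fps_pair v \<zero>\<^bsub>FR (a (n - 1))\<^esub>)"
        using hom_zero[OF mX mX dX] X \<phi>c[OF v(1)] by (simp add: g_def v(2) \<phi>0)
      moreover have "fps_pair v \<zero>\<^bsub>FR (a (n - 1))\<^esub> \<in> carrier (cobj P n)" using v(1) by (simp add: zero_closed[OF module_FR])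
      ultimately show "x \<in> g n ` carrier (cobj P n)" by (rule image_eqI)
    qed
  qed
  define K where "K n = {p \<in> carrier (cobj P n). g n p = \<zero>\<^bsub>cobj X n\<^esub>}" for n
  have subK: "submodule (K n) R (cobj P n)" for n
    unfolding K_def by (rule submodule_kernel[OF bcpx_module[OF P] mX chain_map_hom[OF g]])
  define SP where "SP n = mod_sum (FS (a n)) (FS (a (n - 1)))" for n
  have lat: "lattice (SP n)" for n unfolding SP_def by (rule lattice_sum_frk)
  have mSP: "module Sr (SP n)" for n using lat[of n] by (simp add: lattice_def)
  have PSP: "cobj P n = (SP n)\<lparr>carrier := carrier (cobj P n)\<rparr>" for n
  proof -
    have "cobj P n = mod_sum ((FS (a n))\<lparr>carrier := carrier (FR (a n))\<rparr>) ((FS (a (n - 1)))\<lparr>carrier := carrier (FR (a (n - 1)))\<rparr>)"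
      by (simp flip: FR_FS)
    then show ?thesis by (simp add: mod_sum_def SP_def)
  qed
  have Pin: "carrier (cobj P n) \<subseteq> carrier (SP n)" for n
    using FR_sub[of "a n"] FR_sub[of "a (n - 1)"] by (auto simp: SP_def elim!: mod_sum_cases)
  have subP: "submodule (carrier (cobj P n)) R (SP n)" for n
  proof (rule submoduleI[OF restrict_scalars[OF mSP] Pin])
    note m = bcpx_module[OF P, of n]
    show "\<zero>\<^bsub>SP n\<^esub> \<in> carrier (cobj P n)" using zero_closed[OF m] by (subst (asm) (1) PSP) simp
    show "x \<oplus>\<^bsub>SP n\<^esub> y \<in> carrier (cobj P n)" if "x \<in> carrier (cobj P n)" "y \<in> carrier (cobj P n)" for x y
      using add_closed[OF m that] by (subst (asm) (1) PSP) simp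
    show "r \<odot>\<^bsub>SP n\<^esub> x \<in> carrier (cobj P n)" if "r \<in> carrier R" "x \<in> carrier (cobj P n)" for r x
      using smult_closed[OF m that] by (subst (asm) (1) PSP) simp
  qed
  have subKS: "submodule (K n) R (SP n)" for n
    using subK[of n] by (subst (asm) PSP) (rule submodule_of_restrict[OF restrict_scalars[OF mSP] subP])
  have c: "(cobj P n)\<lparr>carrier := K n\<rparr> = (SP n)\<lparr>carrier := K n\<rparr>" for n
    by (subst PSP) simp
  \<comment> \<open>The \<open>S\<close>-linear extension of \<open>cdif P\<close>: the zero of
    \<open>FS\<close> is that of \<open>FR\<close>, so both formulas agree on
    \<open>P\<close>.\<close>
  define d where "d n p = fps_pair \<zero>\<^bsub>FS (a (n + 1))\<^esub> (fps_fst p)" for n and p :: "'k fps"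
  have FSm: "module Sr (FS r)" for r by simp
  have dh: "d n \<in> mod_hom Sr (SP n) (SP (n + 1))" for n
    unfolding d_def[abs_def] SP_def
    by (rule mod_homI) (simp_all add: S.zero_closed[OF FSm] S.l_zero[OF FSm] S.smult_r_zero[OF FSm])
  have zFR: "\<zero>\<^bsub>FR r\<^esub> = \<zero>\<^bsub>FS r\<^esub>" for r by (subst FR_FS) simp
  have dK: "cdif P n x \<in> K (n + 1)" if x: "x \<in> K n" for n x
  proof -
    have xc: "x \<in> carrier (cobj P n)" using x by (simp add: K_def)
    have "g (n + 1) (cdif P n x) = cdif X n (g n x)" by (rule chain_map_simps(6)[OF P X g xc refl])
    also have "\<dots> = \<zero>\<^bsub>cobj X (n + 1)\<^esub>" using x cdif_zero[OF X] by (simp add: K_def)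
    finally show ?thesis using cdif_closed[OF P xc refl] unfolding K_def by (intro CollectI conjI)
  qed
  have Yb: "bcpx R (sub_cpx P K)"
    by (rule bcpx_sub_cpx[OF P subK _ dK]) (simp only: c lattice_fg[OF lat subKS])
  have "sub_cpx P K \<in> level (Db R) \<X> (2 * N + 2)"
  proof (rule lattice_level[where SP = SP and K = K and d = d and e = e and N = N, OF Yb _ lat subKS dh _ e N stS stk])
    show "cobj (sub_cpx P K) n = (SP n)\<lparr>carrier := K n\<rparr>" for n unfolding cobj_sub_cpx by (rule c)
    show "cdif (sub_cpx P K) n x = d n x" for n x by (simp add: d_def zFR)
  qed
  then have "sub_cpx P K \<in> level (Db R) \<X> (Suc (2 * N + 1))" by simp
  from level_acyclic_cover[OF P X g gs K_def ac this] show ?thesis by simp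
qed

lemma Db_eq_level:
  assumes e: "\<And>h. h \<in> H \<Longrightarrow> h \<noteq> 0 \<Longrightarrow> e \<le> h" and N: "\<And>h. N * e \<le> h \<Longrightarrow> h \<in> H"
  shows "Ob (Db R) = level (Db R) {stalk (mod_sum S_mod k_mod)} (2 * N + 2)"
proof
  let ?\<X> = "{stalk (mod_sum S_mod k_mod :: ('k fps, 'k fps) module)}"
  have fS: "fg_module R (S_mod :: ('k fps, 'k fps) module)" and fk: "fg_module R (k_mod :: ('k fps, 'k fps) module)"
    using fg_S_mod[OF H, where 'a = 'k] fg_k_mod[OF H, where 'a = 'k] by (simp_all add: R_eq)
  note Sb = bcpx_conc[OF fS, of 0] and kb = bcpx_conc[OF fk, of 0] and Gb = bcpx_conc[OF fg_mod_sum[OF fS fk], of 0]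
  have gG: "conc 0 (mod_sum S_mod k_mod) \<in> generated (Db R) ?\<X>"
    unfolding conc_0 by (rule generated.base) (use Gb in \<open>simp_all add: conc_0\<close>)
  \<comment> \<open>Degree 0 agrees literally. In the other degrees both modules have one element,
    but \<open>mod_sum zero_mod zero_mod\<close> and \<open>zero_mod\<close> are different records,
    so an isomorphism is needed.\<close>
  let ?f = "\<lambda>n x. if n = 0 then x else (0 :: 'k fps)"
  have "quasi_iso R (csum (conc 0 S_mod) (conc 0 k_mod)) (conc 0 (mod_sum S_mod k_mod)) ?f"
  proof (rule quasi_iso_bij[OF bcpx_csum[OF Sb kb] Gb])
    show "chain_map R (csum (conc 0 S_mod) (conc 0 k_mod)) (conc 0 (mod_sum S_mod k_mod)) ?f"
    proof (rule chain_mapI)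
      show "?f n \<in> mod_hom R (cobj (csum (conc 0 S_mod) (conc 0 k_mod)) n) (cobj (conc 0 (mod_sum S_mod k_mod)) n)" for n
        by (cases "n = 0") (auto simp: conc_def intro!: mod_homI)
    qed (auto simp: conc_def)
    show "bij_betw (?f n) (carrier (cobj (csum (conc 0 S_mod) (conc 0 k_mod)) n)) (carrier (cobj (conc 0 (mod_sum S_mod k_mod)) n))" for n
      by (cases "n = 0") (auto simp: conc_def bij_betw_def inj_on_def image_iff elim!: mod_sum_cases intro!: exI[of _ "fps_pair 0 0"])
  qed
  then have "csum (conc 0 S_mod) (conc 0 k_mod) \<in> generated (Db R) ?\<X>"
    using generated_quasi_iso[OF bcpx_csum[OF Sb kb] Gb] gG by blast
  \<comment> \<open>Both \<open>S\<close> and \<open>k\<close> are direct summands of the generator,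
    so a filtration with mixed subquotients is allowed.\<close>
  from generated_summand[OF Sb kb this]
  have st: "stalk S_mod \<in> generated (Db R) ?\<X>" "stalk k_mod \<in> generated (Db R) ?\<X>" by (simp_all add: conc_0)
  show "Ob (Db R) \<subseteq> level (Db R) ?\<X> (2 * N + 2)"
    using bcpx_level[OF _ e N st] by auto
  show "level (Db R) ?\<X> (2 * N + 2) \<subseteq> Ob (Db R)"
    using level_Suc_bcpx[of _ ?\<X> "2 * N + 1"] by auto
qed

section \<open>Ideals of the semigroup ring\<close>

definition ordge :: "nat \<Rightarrow> 'k fps \<Rightarrow> bool" where
  "ordge n f \<longleftrightarrow> (\<forall>i<n. f $ i = 0)"

text \<open>The unique maximal ideal of \<open>R\<close>, as shown in
  \<open>maximalideal_mid\<close> and \<open>local_ideal_R\<close>.\<close>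

definition mid :: "'k fps set" where
  "mid = {f \<in> carrier R. f $ 0 = 0}"

lemma ordge_add: "ordge n f \<Longrightarrow> ordge n g \<Longrightarrow> ordge n (f + g)"
  by (simp add: ordge_def)

lemma ordge_mult: "ordge m f \<Longrightarrow> ordge n g \<Longrightarrow> ordge (m + n) (f * g)"
  unfolding ordge_def
proof (intro allI impI)
  fix i assume f: "\<forall>i<m. f $ i = 0" and g: "\<forall>i<n. g $ i = 0" and i: "i < m + n"
  have "f $ k * g $ (i - k) = 0" if "k \<le> i" for k
  proof (cases "k < m")
    case False
    then have "i - k < n" using i that by auto
    then show ?thesis using g by simp
  qed (use f in simp)
  then show "(f * g) $ i = 0" unfolding fps_mult_nth by (intro sum.neutral ballI) simp
qed

lemma ordge_0 [simp]: "ordge 0 f" and ordge_zero [simp]: "ordge n 0"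
  by (simp_all add: ordge_def)

lemma ordge_mono: "ordge n f \<Longrightarrow> m \<le> n \<Longrightarrow> ordge m f"
  by (simp add: ordge_def)

lemma ordge_const_mult: "ordge n f \<Longrightarrow> ordge n (g * f)"
  using ordge_mult[of 0 g n f] by simp

lemma mem_ordge: "(\<And>n. c \<le> n \<Longrightarrow> n \<in> H) \<Longrightarrow> ordge c f \<Longrightarrow> f \<in> carrier R"
  unfolding R_simps ordge_def by (metis not_le)

lemma minus_R [simp]: "x \<in> carrier R \<Longrightarrow> - x \<in> carrier R"
  by (simp add: R_simps)

lemma a_inv_R: "x \<in> carrier R \<Longrightarrow> \<ominus>\<^bsub>R\<^esub> x = - x"
proof -
  interpret R: cring R by (rule cring_R)
  assume "x \<in> carrier R"
  then show ?thesis by (intro R.minus_equality) (simp_all add: R_simps(2,5))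
qed

lemma ideal_R_I:
  assumes "I \<subseteq> carrier R" "0 \<in> I" "\<And>x y. x \<in> I \<Longrightarrow> y \<in> I \<Longrightarrow> x + y \<in> I"
    "\<And>r x. r \<in> carrier R \<Longrightarrow> x \<in> I \<Longrightarrow> r * x \<in> I"
  shows "ideal I R"
proof -
  interpret R: cring R by (rule cring_R)
  have neg: "- x \<in> I" if "x \<in> I" for x using assms(4)[OF minus_R[OF R_closed(2)] that] by simp
  show ?thesis
  proof (rule idealI[OF R.ring_axioms])
    show "subgroup I (add_monoid R)"
    proof (rule R.add.subgroupI)
      show "\<ominus>\<^bsub>R\<^esub> a \<in> I" if "a \<in> I" for a using neg[OF that] a_inv_R[of a] assms(1) that by auto
    qed (use assms(1-3) in \<open>auto simp: R_simps(2)\<close>)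
    show "x \<otimes>\<^bsub>R\<^esub> a \<in> I" "a \<otimes>\<^bsub>R\<^esub> x \<in> I" if "a \<in> I" "x \<in> carrier R" for a x
      using assms(4)[OF that(2,1)] by (simp_all add: R_simps(3) mult.commute)
  qed
qed

lemma ideal_RD:
  assumes "ideal I R"
  shows "x \<in> I \<Longrightarrow> x \<in> carrier R" "0 \<in> I" "x \<in> I \<Longrightarrow> y \<in> I \<Longrightarrow> x + y \<in> I"
    "r \<in> carrier R \<Longrightarrow> x \<in> I \<Longrightarrow> r * x \<in> I"
proof -
  interpret I: ideal I R by fact
  show "x \<in> I \<Longrightarrow> x \<in> carrier R" "0 \<in> I" "x \<in> I \<Longrightarrow> y \<in> I \<Longrightarrow> x + y \<in> I"
    "r \<in> carrier R \<Longrightarrow> x \<in> I \<Longrightarrow> r * x \<in> I"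
    using I.Icarr[of x] additive_subgroup.zero_closed[OF ideal.axioms(1)[OF assms]]
      additive_subgroup.a_closed[OF ideal.axioms(1)[OF assms], of x y] I.I_l_closed[of x r]
    by (simp_all add: R_simps(2-5))
qed

lemma ideal_mid: "ideal mid R"
  by (rule ideal_R_I) (auto simp: mid_def)

text \<open>Comparing coefficients in \<open>f * inverse f = 1\<close> writes the
  \<open>n\<close>-th coefficient of the inverse through products of \<open>f $ i\<close> with
  earlier coefficients at \<open>n - i\<close>. If it is nonzero, some such \<open>i\<close> and
  \<open>n - i\<close> both lie in \<open>H\<close>, hence so does \<open>n\<close>.\<close>

lemma inverse_in_R:
  assumes f: "f \<in> carrier R" "f $ 0 \<noteq> 0"
  shows "inverse f \<in> carrier R"
proof -
  let ?g = "inverse f"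
  have fg: "f * ?g = 1" using f(2) by (simp add: inverse_mult_eq_1')
  have "?g $ n \<noteq> 0 \<longrightarrow> n \<in> H" for n
  proof (induction n rule: less_induct)
    case (less n)
    show ?case
    proof
      assume gn: "?g $ n \<noteq> 0"
      show "n \<in> H"
      proof (cases "n = 0")
        case False
        have "0 = (f * ?g) $ n" using False by (simp add: fg)
        also have "\<dots> = f $ 0 * ?g $ n + (\<Sum>i\<in>{1..n}. f $ i * ?g $ (n - i))"
          by (simp add: fps_mult_nth sum.atLeast_Suc_atMost)
        finally have "(\<Sum>i\<in>{1..n}. f $ i * ?g $ (n - i)) \<noteq> 0" using gn f(2) by auto
        then obtain i where i: "i \<in> {1..n}" "f $ i * ?g $ (n - i) \<noteq> 0"
          by (meson sum.not_neutral_contains_not_neutral)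
        then have "i \<in> H" "n - i \<in> H" using less[of "n - i"] f(1) by (auto simp: R_simps(1))
        moreover have "n = i + (n - i)" using i(1) by simp
        ultimately show ?thesis using H unfolding numerical_semigroup_def by metis
      qed (use zero_in_H in simp)
    qed
  qed
  then show ?thesis by (simp add: R_simps(1))
qed

text \<open>An element of \<open>R\<close> outside \<open>mid\<close> is a unit of
  \<open>R\<close>.\<close>

lemma proper_ideal_le_mid:
  assumes "ideal J R" "J \<noteq> carrier R"
  shows "J \<subseteq> mid"
proof
  fix f assume f: "f \<in> J"
  show "f \<in> mid"
  proof (rule ccontr)
    assume "f \<notin> mid"
    then have nz: "f \<in> carrier R" "f $ 0 \<noteq> 0" using ideal_RD(1)[OF assms(1) f] by (auto simp: mid_def)
    have "inverse f * f \<in> J" by (rule ideal_RD(4)[OF assms(1) inverse_in_R[OF nz] f])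
    then have "\<one>\<^bsub>R\<^esub> \<in> J" using nz(2) by (simp add: inverse_mult_eq_1 R_simps)
    then show False using ideal.one_imp_carrier[OF assms(1)] assms(2) by blast
  qed
qed

lemma mid_proper: "mid \<noteq> carrier R"
proof
  assume "mid = carrier R"
  then have "1 \<in> mid" by simp
  then show False by (simp add: mid_def)
qed

lemma maximalideal_mid: "maximalideal mid R"
proof (rule maximalidealI[OF ideal_mid])
  show "carrier R \<noteq> mid" using mid_proper by simp
  show "J = mid \<or> J = carrier R" if "ideal J R" "mid \<subseteq> J" "J \<subseteq> carrier R" for J
    using proper_ideal_le_mid[OF that(1)] that(2) by blast
qed

lemma local_ideal_R: "local_ideal R = mid"
  unfolding local_ideal_def
proof (rule the_equality)
  show "maximalideal mid R" by (rule maximalideal_mid)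
  fix J assume "maximalideal J R"
  then interpret J: maximalideal J R .
  have "J \<subseteq> mid" using proper_ideal_le_mid[OF J.is_ideal] J.I_notcarr by blast
  moreover have "mid \<subseteq> carrier R" by (auto simp: mid_def)
  ultimately show "J = mid" using J.I_maximal[OF ideal_mid] mid_proper by blast
qed

text \<open>Every series of order at least \<open>subdegree f + c\<close> is a multiple of
  \<open>f\<close> in \<open>R\<close>. A high power of any element of \<open>mid\<close> has such
  an order, so it lies in \<open>P\<close>, and primality brings the element itself into
  \<open>P\<close>.\<close>

lemma nonzero_prime_eq_mid:
  assumes P: "primeideal P R" and f: "f \<in> P" "f \<noteq> 0"
  shows "P = mid"
proof -
  interpret P: primeideal P R by fact
  obtain c where c: "\<forall>n\<ge>c. n \<in> H" using R_contains by blast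
  have big: "h \<in> P" if h: "ordge (subdegree f + c) h" for h
  proof (cases "h = 0")
    case False
    then have le: "subdegree f + c \<le> subdegree h" using h by (intro subdegree_geI) (auto simp: ordge_def)
    then have "f dvd h" using f(2) False by (simp add: fps_dvd_iff)
    then obtain q where q: "h = f * q" by (rule dvdE)
    have "q \<noteq> 0" using q False by auto
    then have "c \<le> subdegree q" using le q f(2) by simp
    then have "ordge c q" unfolding ordge_def by (auto intro: nth_less_subdegree_zero)
    then have "q \<in> carrier R" using c by (intro mem_ordge[of c]) auto
    then show ?thesis using ideal_RD(4)[OF P.is_ideal _ f(1), of q] by (simp add: q mult.commute)
  qed (use ideal_RD(2)[OF P.is_ideal] in simp)
  have "x \<in> P" if x: "x \<in> mid" for x
  proof -
    have xR: "x \<in> carrier R" using x by (simp add: mid_def)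
    have o: "ordge k (x ^ k)" for k
    proof (induction k)
      case (Suc k)
      have "ordge 1 x" using x by (simp add: mid_def ordge_def)
      from ordge_mult[OF this Suc] show ?case by simp
    qed simp
    have pw: "x ^ k \<in> carrier R" for k by (induction k) (simp_all add: xR)
    have "x ^ k \<in> P \<Longrightarrow> x \<in> P" for k
    proof (induction k)
      case 0
      then show ?case using P.one_imp_carrier P.I_notcarr by (simp add: R_simps)
    next
      case (Suc k)
      then show ?case using P.I_prime[OF xR pw, of k] by (auto simp: R_simps(3))
    qed
    then show ?thesis using big[OF o] by blast
  qed
  moreover have "P \<subseteq> mid" using proper_ideal_le_mid[OF P.is_ideal] P.I_notcarr by blast
  ultimately show ?thesis by blast
qed

lemma krull_dim_R: "krull_dim R = 1"
proof -
  interpret R: cring R by (rule cring_R)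
  have "domain R"
    by (intro domain.intro cring_R domain_axioms.intro) (auto simp: R_simps(3-5))
  then have "primeideal {\<zero>\<^bsub>R\<^esub>} R" by (rule domain.zeroprimeideal)
  then have z': "primeideal {0} R" by (simp add: R_simps)
  obtain c where c: "\<forall>n\<ge>c. n \<in> H" using R_contains by blast
  \<comment> \<open>The exponent is \<open>Suc c\<close> because \<open>c\<close> may be 0, and a
    constant 1 would not lie in \<open>mid\<close>.\<close>
  have "fps_X ^ Suc c \<in> mid" using c by (auto simp: mid_def R_simps(1) fps_X_power_nth split: if_splits)
  moreover have "fps_X ^ Suc c \<noteq> (0 :: 'k fps)" by simp
  ultimately have ne: "{0} \<subset> mid" using ideal_RD(2)[OF ideal_mid] by blast
  let ?S = "{enat n | n. \<exists>P. (\<forall>i\<le>n. primeideal (P i) R) \<and> (\<forall>i<n. P i \<subset> P (Suc i))}"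
  have "enat 1 \<in> ?S"
    using z' ne R.maximalideal_prime[OF maximalideal_mid]
    by (intro CollectI exI[of _ 1] conjI refl exI[of _ "\<lambda>i. if i = 0 then {0} else mid"]) auto
  then have 1: "1 \<le> krull_dim R" unfolding krull_dim_def one_enat_def by (rule Sup_upper)
  have "x \<le> 1" if "x \<in> ?S" for x
  proof -
    obtain n P where x: "x = enat n" and P: "\<forall>i\<le>n. primeideal (P i) R" "\<forall>i<n. P i \<subset> P (Suc i)"
      using \<open>x \<in> ?S\<close> by blast
    have "n \<le> 1"
    proof (rule ccontr)
      assume n: "\<not> n \<le> 1"
      \<comment> \<open>Every member of a chain above the first is a nonzero prime, so a chain with
        two strict inclusions would repeat \<open>mid\<close>.\<close>
      have nz: "P (Suc i) = mid" if "i < n" for i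
      proof -
        have i: "primeideal (P i) R" "primeideal (P (Suc i)) R" "P i \<subset> P (Suc i)" using P that by auto
        obtain f where "f \<in> P (Suc i)" "f \<notin> P i" using i(3) by blast
        moreover have "0 \<in> P i" using ideal_RD(2) i(1) primeideal.axioms(1) by blast
        ultimately show ?thesis by (intro nonzero_prime_eq_mid[OF i(2), of f]) auto
      qed
      have "P 1 = mid" "P 2 = mid" "P 1 \<subset> P 2"
        using nz[of 0] nz[of 1] P(2)[rule_format, of 1] n by (simp_all add: numeral_2_eq_2)
      then show False by blast
    qed
    then show ?thesis by (simp add: x one_enat_def)
  qed
  then have "krull_dim R \<le> 1" unfolding krull_dim_def by (rule Sup_least)
  with 1 show ?thesis by (rule antisym[rotated])
qed

lemma ideal_power_mid: "ideal (ideal_power R mid n) R"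
proof -
  interpret R: cring R by (rule cring_R)
  show ?thesis
    by (induction n) (simp_all add: R.oneideal R.ideal_prod_is_ideal ideal_mid)
qed

text \<open>Elements of \<open>mid\<close> have order at least \<open>e\<close>, and orders add
  under multiplication.\<close>

lemma ideal_power_upper:
  assumes e: "\<And>h. h \<in> H \<Longrightarrow> h \<noteq> 0 \<Longrightarrow> e \<le> h" and f: "f \<in> ideal_power R mid n"
  shows "ordge (n * e) f"
  using f
proof (induction n arbitrary: f)
  case (Suc n)
  have m: "ordge e g" if "g \<in> mid" for g
    unfolding ordge_def
  proof (intro allI impI, rule ccontr)
    fix i assume i: "i < e" "g $ i \<noteq> 0"
    then have "i \<in> H" "i \<noteq> 0" using \<open>g \<in> mid\<close> by (auto simp: mid_def R_simps(1) intro: ccontr)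
    then show False using e[of i] i(1) by simp
  qed
  from Suc(2) show ?case unfolding ideal_power.simps
  proof (induction f rule: ideal_prod.induct)
    case (prod i j)
    then show ?case using ordge_mult[OF m[OF prod(1)] Suc(1)[OF prod(2)]] by (simp add: R_simps(3))
  next
    case (sum s1 s2)
    then show ?case using ordge_add[OF sum(3,4)] by (simp add: R_simps(2))
  qed
qed simp

text \<open>The factor \<open>fps_X ^ e\<close>, an element of \<open>mid\<close>, is split off
  \<open>n\<close> times; the remaining series has order at least \<open>c\<close> and so lies in
  \<open>R\<close>.\<close>

lemma ideal_power_lower:
  assumes e: "e \<in> H" "e \<noteq> 0" and c: "\<And>n. c \<le> n \<Longrightarrow> n \<in> H" and f: "ordge (n * e + c) f"
  shows "f \<in> ideal_power R mid n"
  using f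
proof (induction n arbitrary: f)
  case 0
  then show ?case using mem_ordge[of c f] c by simp
next
  case (Suc n)
  define g where "g = Abs_fps (\<lambda>i. f $ (i + e))"
  have fe: "f = fps_X ^ e * g"
    by (rule fps_ext) (use Suc(2) in \<open>simp add: fps_X_power_mult_nth g_def ordge_def\<close>)
  have "ordge (n * e + c) g" using Suc(2) by (simp add: ordge_def g_def)
  then have "g \<in> ideal_power R mid n" by (rule Suc(1))
  moreover have "fps_X ^ e \<in> mid" using e by (simp add: mid_def R_simps(1) fps_X_power_nth)
  ultimately have "fps_X ^ e \<otimes>\<^bsub>R\<^esub> g \<in> ideal_power R mid (Suc n)"
    unfolding ideal_power.simps by (intro ideal_prod.prod)
  then show ?case by (simp add: R_simps(3) flip: fe)
qed

section \<open>Lengths and multiplicity\<close>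

text \<open>
  A strictly larger space of power series realises strictly more orders below \<open>b\<close>.
\<close>

lemma chain_bound:
  fixes B :: "nat \<Rightarrow> 'k fps set"
  assumes add: "\<And>i x y. i \<le> l \<Longrightarrow> x \<in> B i \<Longrightarrow> y \<in> B i \<Longrightarrow> x + y \<in> B i"
    and smult: "\<And>i a x. i \<le> l \<Longrightarrow> x \<in> B i \<Longrightarrow> fps_const a * x \<in> B i"
    and big: "\<And>i x. i \<le> l \<Longrightarrow> ordge b x \<Longrightarrow> x \<in> B i"
    and strict: "\<And>i. i < l \<Longrightarrow> B i \<subset> B (Suc i)"
  shows "l \<le> b"
proof -
  define v where "v i = {j. j < b \<and> (\<exists>f\<in>B i. ordge j f \<and> f $ j \<noteq> 0)}" for i
  have fin: "finite (v i)" for i unfolding v_def by simp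
  have sub: "v i \<subset> v (Suc i)" if i: "i < l" for i
  proof
    show "v i \<subseteq> v (Suc i)" using strict[OF i] unfolding v_def by blast
    show "v i \<noteq> v (Suc i)"
    proof
      assume eq: "v i = v (Suc i)"
      \<comment> \<open>If no new order occurs, leading coefficients can be cancelled by elements of
        \<open>B i\<close> until the order reaches \<open>b\<close>, which contradicts the strict
        inclusion.\<close>
      have "\<forall>f\<in>B (Suc i). ordge (b - d) f \<longrightarrow> f \<in> B i" for d
      proof (induction d)
        case 0
        then show ?case using big[of i] i by simp
      next
        case (Suc d)
        show ?case
        proof (intro ballI impI)
          fix f assume f: "f \<in> B (Suc i)" "ordge (b - Suc d) f"
          let ?j = "b - Suc d"
          show "f \<in> B i"
          proof (cases "b \<le> d \<or> f $ ?j = 0")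
            case True
            have "ordge (b - d) f" unfolding ordge_def
            proof (intro allI impI)
              fix k assume "k < b - d"
              then consider "k < ?j" | "k = ?j" by linarith
              then show "f $ k = 0" using f(2) True \<open>k < b - d\<close> by cases (auto simp: ordge_def)
            qed
            then show ?thesis using Suc f(1) by blast
          next
            case False
            then have "?j \<in> v (Suc i)" unfolding v_def using f by auto
            then have "?j \<in> v i" by (simp only: eq)
            then obtain h where h: "h \<in> B i" "ordge ?j h" "h $ ?j \<noteq> 0" unfolding v_def by blast
            let ?a = "f $ ?j / h $ ?j"
            have hS: "h \<in> B (Suc i)" using h(1) strict[OF i] by blast
            have "f + fps_const (- ?a) * h \<in> B (Suc i)"
              using i by (intro add smult f(1) hS) auto
            moreover have "ordge (b - d) (f + fps_const (- ?a) * h)" unfolding ordge_def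
            proof (intro allI impI)
              fix k assume "k < b - d"
              then consider "k < ?j" | "k = ?j" by linarith
              then show "(f + fps_const (- ?a) * h) $ k = 0" using f(2) h(2,3) by cases (auto simp: ordge_def)
            qed
            ultimately have diff: "f + fps_const (- ?a) * h \<in> B i" using Suc by blast
            have "i \<le> l" using i by simp
            then have "f + fps_const (- ?a) * h + fps_const ?a * h \<in> B i"
              using add[OF _ diff smult[OF _ h(1)]] by blast
            moreover have "f + fps_const (- ?a) * h + fps_const ?a * h = f" by (simp flip: fps_const_neg)
            ultimately show ?thesis by simp
          qed
        qed
      qed
      from this[of b] have "B (Suc i) \<subseteq> B i" by auto
      then show False using strict[OF i] by blast
    qed
  qed
  have "i \<le> l \<Longrightarrow> i \<le> card (v i)" for i
  proof (induction i)
    case (Suc i)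
    then have "card (v i) < card (v (Suc i))" by (intro psubset_card_mono fin sub) simp
    then show ?case using Suc by simp
  qed simp
  then have "l \<le> card (v l)" by simp
  also have "\<dots> \<le> card {..<b}" by (rule card_mono) (auto simp: v_def)
  finally show ?thesis by simp
qed

text \<open>Above, chains of submodules pull back to chains of \<open>k\<close>-spaces of series,
  bounded by \<open>chain_bound\<close>. Below, the order filtration gives an explicit chain, strict
  as long as the relevant power of \<open>t\<close> lies in \<open>R\<close>.\<close>

lemma quotient_length:
  assumes I: "ideal I R" and up: "\<And>f. f \<in> I \<Longrightarrow> ordge a f" and low: "\<And>f. ordge b f \<Longrightarrow> f \<in> I"
    and c: "\<And>n. c \<le> n \<Longrightarrow> n \<in> H"
  shows "\<exists>l. module_length R (quotient_module R I) = enat l \<and> a - c \<le> l \<and> l \<le> b"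
proof -
  interpret R: cring R by (rule cring_R)
  interpret I: ideal I R by fact
  interpret Q: ring "R Quot I" by (rule I.quotient_is_ring)
  let ?M = "quotient_module R I" and ?p = "\<lambda>f. I +>\<^bsub>R\<^esub> f"
  note hom = I.rcos_ring_hom
  have pa: "?p (f + g) = ?p f \<oplus>\<^bsub>?M\<^esub> ?p g" if "f \<in> carrier R" "g \<in> carrier R" for f g
    using ring_hom_add[OF hom that] by (simp add: quotient_module_def R_simps(2))
  have ps: "?p (f * g) = f \<odot>\<^bsub>?M\<^esub> ?p g" if "f \<in> carrier R" "g \<in> carrier R" for f g
    using ring_hom_mult[OF hom that] by (simp add: quotient_module_def R_simps(3))
  have pe: "?p f = ?p g \<longleftrightarrow> f - g \<in> I" if "f \<in> carrier R" "g \<in> carrier R" for f g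
    using R.quotient_eq_iff_same_a_r_cos[OF I that] that by (simp add: a_minus_def a_inv_R R_simps(2))
  have pz: "?p 0 = \<zero>\<^bsub>?M\<^esub>"
    using ring_hom_zero[OF hom R.ring_axioms Q.ring_axioms] by (simp add: quotient_module_def R_simps(5))
  have Mc: "carrier ?M = ?p ` carrier R"
    by (auto simp: quotient_module_def FactRing_def A_RCOSETS_def' image_iff)
  have M: "module R ?M"
  proof (rule moduleI[OF cring_R])
    show "abelian_group ?M"
    proof (rule abelian_groupI, goal_cases)
      case (6 x)
      then obtain f where f: "f \<in> carrier R" "x = ?p f" by (auto simp: Mc)
      show ?case
        by (rule bexI[of _ "?p (- f)"]) (use f in \<open>simp_all add: Mc flip: pa pz\<close>)
    qed (auto simp: Mc pz[symmetric] add_ac simp flip: pa)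
  next
    fix x y r assume r: "r \<in> carrier R" "x \<in> carrier ?M" "y \<in> carrier ?M"
    then show "r \<odot>\<^bsub>?M\<^esub> (x \<oplus>\<^bsub>?M\<^esub> y) = r \<odot>\<^bsub>?M\<^esub> x \<oplus>\<^bsub>?M\<^esub> r \<odot>\<^bsub>?M\<^esub> y"
      by (auto simp: Mc distrib_left simp flip: pa ps)
  next
    fix x r s assume r: "r \<in> carrier R" "s \<in> carrier R" "x \<in> carrier ?M"
    then show "(r \<oplus>\<^bsub>R\<^esub> s) \<odot>\<^bsub>?M\<^esub> x = r \<odot>\<^bsub>?M\<^esub> x \<oplus>\<^bsub>?M\<^esub> s \<odot>\<^bsub>?M\<^esub> x"
      by (auto simp: Mc R_simps(2) distrib_right simp flip: pa ps)
    show "(r \<otimes>\<^bsub>R\<^esub> s) \<odot>\<^bsub>?M\<^esub> x = r \<odot>\<^bsub>?M\<^esub> (s \<odot>\<^bsub>?M\<^esub> x)"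
      using r by (auto simp: Mc R_simps(3) mult.assoc simp flip: ps)
  next
    fix x r assume "r \<in> carrier R" "x \<in> carrier ?M"
    then show "r \<odot>\<^bsub>?M\<^esub> x \<in> carrier ?M" by (auto simp: Mc simp flip: ps)
  next
    fix x assume "x \<in> carrier ?M"
    then show "\<one>\<^bsub>R\<^esub> \<odot>\<^bsub>?M\<^esub> x = x" by (auto simp: Mc R_simps(4) simp flip: ps)
  qed
  let ?S = "{enat n | n. \<exists>N. (\<forall>i\<le>n. submodule (N i) R ?M) \<and> (\<forall>i<n. N i \<subset> N (Suc i))}"
  have bound: "n \<le> b" if N: "\<forall>i\<le>n. submodule (N i) R ?M" "\<forall>i<n. N i \<subset> N (Suc i)" for n N
  proof (rule chain_bound)
    define B where "B i = {f \<in> carrier R. ?p f \<in> N i}" for i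
    have bR: "x \<in> carrier R" if "ordge b x" for x using ideal_RD(1)[OF I low[OF that]] .
    show "x + y \<in> B i" if "i \<le> n" "x \<in> B i" "y \<in> B i" for i x y
      using that submoduleD(3)[OF M N(1)[rule_format, OF that(1)]] by (simp add: B_def pa)
    show "fps_const a * x \<in> B i" if "i \<le> n" "x \<in> B i" for i a x
      using that submoduleD(5)[OF M N(1)[rule_format, OF that(1)]] by (simp add: B_def ps)
    show "x \<in> B i" if i: "i \<le> n" and x: "ordge b x" for i x
    proof -
      have "?p x = \<zero>\<^bsub>?M\<^esub>" using pe[OF bR[OF x] R_closed(1)] low[OF x] by (simp add: pz)
      then show ?thesis using submoduleD(2)[OF M N(1)[rule_format, OF i]] bR[OF x] by (simp add: B_def)
    qed
    show "B i \<subset> B (Suc i)" if i: "i < n" for i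
    proof
      have s: "N i \<subset> N (Suc i)" using N(2) i by simp
      show "B i \<subseteq> B (Suc i)" using s by (auto simp: B_def)
      obtain x where x: "x \<in> N (Suc i)" "x \<notin> N i" using s by blast
      have "x \<in> carrier ?M" using submoduleD(1)[OF M N(1)[rule_format, of "Suc i"] x(1)] i by simp
      then obtain f where "f \<in> carrier R" "x = ?p f" by (auto simp: Mc)
      then show "B i \<noteq> B (Suc i)" using x by (auto simp: B_def)
    qed
  qed
  have "enat (a - c) \<in> ?S"
  proof -
    \<comment> \<open>Lowering the order bound from \<open>a - i\<close> to \<open>a - i - 1\<close>
      adds the class of \<open>t\<close> to the power \<open>a - i - 1\<close>. For
      \<open>i < a - c\<close> this exponent is at least \<open>c\<close>, hence in
      \<open>H\<close>, and elements of \<open>I\<close> have order at least \<open>a\<close>, so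
      the class is new.\<close>
    define N where "N i = ?p ` {f \<in> carrier R. ordge (a - i) f}" for i
    have "submodule (N i) R ?M" for i
    proof (rule submoduleI[OF M])
      show "N i \<subseteq> carrier ?M" by (auto simp: N_def Mc)
      show "\<zero>\<^bsub>?M\<^esub> \<in> N i" unfolding N_def by (rule image_eqI[of _ _ 0]) (simp_all add: pz)
      show "x \<oplus>\<^bsub>?M\<^esub> y \<in> N i" if xy: "x \<in> N i" "y \<in> N i" for x y
      proof -
        obtain f g where "f \<in> carrier R" "ordge (a - i) f" "x = ?p f" "g \<in> carrier R" "ordge (a - i) g" "y = ?p g"
          using xy by (auto simp: N_def)
        then show ?thesis unfolding N_def by (intro image_eqI[of _ _ "f + g"]) (simp_all add: pa ordge_add)
      qed
      show "r \<odot>\<^bsub>?M\<^esub> x \<in> N i" if r: "r \<in> carrier R" and "x \<in> N i" for r x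
      proof -
        obtain f where "f \<in> carrier R" "ordge (a - i) f" "x = ?p f" using \<open>x \<in> N i\<close> by (auto simp: N_def)
        then show ?thesis unfolding N_def using r by (intro image_eqI[of _ _ "r * f"]) (simp_all add: ps ordge_const_mult)
      qed
    qed
    moreover have "N i \<subset> N (Suc i)" if i: "i < a - c" for i
    proof
      show "N i \<subseteq> N (Suc i)" unfolding N_def by (rule image_mono) (auto intro: ordge_mono)
      let ?j = "a - Suc i"
      let ?f = "fps_X ^ ?j :: 'k fps"
      have fR: "?f \<in> carrier R" using c[of ?j] i by (simp add: R_simps(1) fps_X_power_nth)
      have "?p ?f \<in> N (Suc i)" unfolding N_def using fR by (intro imageI) (simp add: ordge_def fps_X_power_nth)
      moreover have "?p ?f \<notin> N i"
      proof
        assume "?p ?f \<in> N i"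
        then obtain g where g: "g \<in> carrier R" "ordge (a - i) g" "?p ?f = ?p g" by (auto simp: N_def)
        have d: "ordge a (?f - g)" using pe[OF fR g(1)] up g(3) by blast
        have "?j < a" "?j < a - i" using i by auto
        then have "(?f - g) $ ?j = 0" "g $ ?j = 0" using d g(2) unfolding ordge_def by blast+
        then show False by (simp add: fps_X_power_nth)
      qed
      ultimately show "N i \<noteq> N (Suc i)" by blast
    qed
    ultimately show ?thesis by blast
  qed
  then have lo: "enat (a - c) \<le> module_length R ?M" unfolding module_length_def by (rule Sup_upper)
  have hi: "module_length R ?M \<le> enat b" unfolding module_length_def
    by (rule Sup_least) (use bound in auto)
  then obtain l where l: "module_length R ?M = enat l" by (cases "module_length R ?M") auto
  then show ?thesis using lo hi by auto
qed

text \<open>The length of the quotient by the power \<open>n + 1\<close> of \<open>mid\<close>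
  differs from \<open>(n + 1) e\<close> by at most the constant \<open>c\<close>, which disappears
  on division by \<open>n\<close>. The Krull dimension is 1, so the normalising factor is
  \<open>1 / n\<close>.\<close>

lemma ring_multiplicity_R:
  assumes e: "e \<in> H" "e \<noteq> 0" and min: "\<And>h. h \<in> H \<Longrightarrow> h \<noteq> 0 \<Longrightarrow> e \<le> h"
  shows "ring_multiplicity R = real e"
proof -
  obtain c where c: "\<forall>n\<ge>c. n \<in> H" using R_contains by blast
  define L where "L n = module_length R (quotient_module R (ideal_power R mid (n + 1)))" for n
  have "\<exists>l. L n = enat l \<and> (n + 1) * e - c \<le> l \<and> l \<le> (n + 1) * e + c" for n
    unfolding L_def
  proof (rule quotient_length[OF ideal_power_mid])
    show "ordge ((n + 1) * e) f" if "f \<in> ideal_power R mid (n + 1)" for f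
      by (rule ideal_power_upper[OF _ that]) (rule min)
    show "f \<in> ideal_power R mid (n + 1)" if "ordge ((n + 1) * e + c) f" for f
      by (rule ideal_power_lower[OF e _ that]) (simp add: c)
  qed (simp add: c)
  then obtain l where l: "\<And>n. L n = enat (l n)" "\<And>n. (n + 1) * e - c \<le> l n" "\<And>n. l n \<le> (n + 1) * e + c"
    by metis
  have lim: "(\<lambda>n. fact 1 / real n ^ 1 * real (the_enat (L n))) \<longlonglongrightarrow> real e"
  proof (rule tendsto_sandwich)
    have b: "real n * real e + (real e - real c) \<le> real (l n)" "real (l n) \<le> real n * real e + (real e + real c)" for n
    proof -
      have "(n + 1) * e \<le> l n + c" using l(2)[of n] by simp
      then have "real ((n + 1) * e) \<le> real (l n + c)" by (rule of_nat_mono)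
      then show "real n * real e + (real e - real c) \<le> real (l n)" by (simp add: algebra_simps)
      have "real (l n) \<le> real ((n + 1) * e + c)" using l(3)[of n] by (rule of_nat_mono)
      then show "real (l n) \<le> real n * real e + (real e + real c)" by (simp add: algebra_simps)
    qed
    have q: "real e + x * (1 / real n) = (real n * real e + x) / real n" if "0 < n" for n x
      using that by (simp add: field_simps)
    \<comment> \<open>The estimates are claimed only eventually, which excludes division by
      \<open>n = 0\<close>.\<close>
    show "\<forall>\<^sub>F n in sequentially. real e + (real e - real c) * (1 / real n) \<le> fact 1 / real n ^ 1 * real (the_enat (L n))"
      using eventually_gt_at_top[of 0]
      by eventually_elim (use b(1) in \<open>simp only: q; simp add: l(1) divide_right_mono\<close>)
    show "\<forall>\<^sub>F n in sequentially. fact 1 / real n ^ 1 * real (the_enat (L n)) \<le> real e + (real e + real c) * (1 / real n)"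
      using eventually_gt_at_top[of 0]
      by eventually_elim (use b(2) in \<open>simp only: q; simp add: l(1) divide_right_mono\<close>)
    have t: "(\<lambda>n. real e + x * (1 / real n)) \<longlonglongrightarrow> real e" for x
      using tendsto_add[OF tendsto_const tendsto_mult[OF tendsto_const lim_1_over_n[where 'a = real]], of "real e" x] by simp
    show "(\<lambda>n. real e + (real e - real c) * (1 / real n)) \<longlonglongrightarrow> real e"
      "(\<lambda>n. real e + (real e + real c) * (1 / real n)) \<longlonglongrightarrow> real e" by (rule t)+
  qed
  have "the_enat 1 = 1" by (simp add: one_enat_def)
  then show ?thesis
    unfolding ring_multiplicity_def Let_def krull_dim_R local_ideal_R using limI[OF lim] by (simp add: L_def)
qed

end

text \<open>The finitely many gaps make the set under \<open>Max\<close> finite. A gap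
  \<open>h\<close> puts \<open>Suc h\<close> into that set, because the set tests the
  predecessor.\<close>

lemma conductor_le:
  assumes "numerical_semigroup H" "conductor H \<le> h"
  shows "h \<in> H"
proof (rule ccontr)
  assume h: "h \<notin> H"
  let ?A = "{i. int i - 1 \<notin> int ` H}"
  have "?A \<subseteq> insert 0 (Suc ` (UNIV - H))"
  proof
    fix i assume i: "i \<in> ?A"
    show "i \<in> insert 0 (Suc ` (UNIV - H))"
      using i by (cases i) auto
  qed
  moreover have "finite (UNIV - H)" using assms(1) by (simp add: numerical_semigroup_def)
  ultimately have fin: "finite ?A" by (meson finite_imageI finite_insert finite_subset)
  have "Suc h \<in> ?A" using h by auto
  then have "Suc h \<le> conductor H" unfolding conductor_def by (rule Max_ge[OF fin])
  then show False using assms(2) by simp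
qed

theorem corollary3p13:
  fixes H :: "nat set" and R :: "'k::field fps ring"
  assumes "numerical_semigroup H" and "R = semigroup_ring H"
  shows "Ob (Db R) =
           level (Db R) {stalk (mod_sum S_mod k_mod)}
             (nat (2 * \<lceil>real (conductor H) / ring_multiplicity R\<rceil> + 2)) \<and>
         tri_dim (Db R) \<le>
           ereal (real_of_int (2 * \<lceil>real (conductor H) / ring_multiplicity R\<rceil> + 1))"
proof -
  interpret semigroup_complexes R H by (rule semigroup_complexes.intro) fact+
  obtain c where "\<forall>n\<ge>c. n \<in> H" using R_contains by blast
  then have ex: "\<exists>h. h \<in> H \<and> h \<noteq> 0" by (intro exI[of _ "Suc c"]) simp
  define e where "e = (LEAST h. h \<in> H \<and> h \<noteq> 0)"
  have e: "e \<in> H" "e \<noteq> 0" using LeastI_ex[OF ex] by (simp_all add: e_def)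
  have min: "e \<le> h" if "h \<in> H" "h \<noteq> 0" for h unfolding e_def using that by (intro Least_le) simp
  have mult: "ring_multiplicity R = real e" by (rule ring_multiplicity_R[OF e]) (rule min)
  define x where "x = \<lceil>real (conductor H) / ring_multiplicity R\<rceil>"
  define N where "N = nat x"
  have "0 \<le> real (conductor H) / real e" by simp
  \<comment> \<open>Non-negativity makes the passage from the integer ceiling to a natural number
    harmless.\<close>
  then have x0: "0 \<le> x" unfolding x_def mult zero_le_ceiling by linarith
  then have xN: "x = int N" by (simp add: N_def)
  \<comment> \<open>The ceiling is used through \<open>conductor H \<le> N * e\<close>: every
    \<open>h\<close> from \<open>N * e\<close> on lies in \<open>H\<close>.\<close>
  have "real (conductor H) / real e \<le> real N"
    using le_of_int_ceiling[of "real (conductor H) / real e"] xN unfolding x_def mult by simp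
  then have "real (conductor H) \<le> real (N * e)" using e(2) by (simp add: divide_le_eq)
  then have cN: "conductor H \<le> N * e" by (simp only: of_nat_le_iff)
  have "Ob (Db R) = level (Db R) {stalk (mod_sum S_mod k_mod)} (2 * N + 2)"
    by (rule Db_eq_level[OF min]) (use cN conductor_le[OF assms(1)] in simp_all)
  moreover have n: "nat (2 * x + 2) = 2 * N + 2" using xN by simp
  ultimately have 1: "Ob (Db R) = level (Db R) {stalk (mod_sum S_mod k_mod)} (nat (2 * x + 2))" by simp
  have "stalk (mod_sum S_mod k_mod) \<in> Ob (Db R)"
    unfolding assms(2) by (rule generator_in_Db[OF assms(1)])
  \<comment> \<open>Dimension \<open>d\<close> is witnessed by level \<open>d + 1\<close>, so level
    \<open>2 x + 2\<close> corresponds to \<open>d = 2 x + 1\<close>.\<close>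
  moreover have "nat ((2 * x + 1) + 1) = nat (2 * x + 2)" by simp
  ultimately have "ereal (real_of_int (2 * x + 1)) \<in>
      {ereal (real_of_int d) | d. d \<ge> -1 \<and> (\<exists>M\<in>Ob (Db R). Ob (Db R) = level (Db R) {M} (nat (d + 1)))}"
    using 1 x0 by (intro CollectI exI[of _ "2 * x + 1"] conjI refl bexI[of _ "stalk (mod_sum S_mod k_mod)"]) auto
  then have "tri_dim (Db R) \<le> ereal (real_of_int (2 * x + 1))" unfolding tri_dim_def by (rule Inf_lower)
  with 1 show ?thesis by (simp add: x_def)
qed

end
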